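(* Let $X$ be a compact complex manifold with $\dim_{\mathbb{C}}X=n\geq 2$. (i) If $\omega$ is a balanced metric on $X$, the linear map $$\{\omega_{n-1}\}_{DR}\wedge\cdot : H^1_{DR}(X,\mathbb{C})\longrightarrow H^{2n-1}_{DR}(X,\mathbb{C}),\qquad \{u\}_{DR}\longmapsto\{\omega_{n-1}\wedge u\}_{DR},$$ is well defined and depends only on the cohomology class $\{\omega_{n-1}\}_{DR}\in H^{2n-2}_{DR}(X,\mathbb{C})$. (ii) If, moreover, $X$ has the following additional property: for every smooth $\mathbb{C}$-valued $(1,1)$-form $v$ on $X$ such that $dv=0$, the implication $$v\in\operatorname{Im}\partial\ \Longrightarrow\ v\in\operatorname{Im}(\partial\bar\partial)$$ holds, then the map in (i) is an isomorphism.
   Context: A Hermitian metric on a complex manifold is identified with its associated smooth positive definite $(1,1)$-form $\omega$. A Hermitian metric $\omega$ on an $n$-dimensional complex manifold is balanced if $d\omega^{n-1}=0$. Notation: $\omega_p:=\omega^p/p!$. $\{\cdot\}_{DR}$ denotes De Rham cohomology classes. Images $\operatorname{Im}\partial$, $\operatorname{Im}(\partial\bar\partial)$ are images on smooth $\mathbb{C}$-valued forms. *)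

theory Defs
  imports "HOL-Analysis.Analysis" "HOL-Combinatorics.Permutations" "HOL-Library.Function_Algebras"
begin

section \<open>Complex manifolds\<close>

text \<open>A chart is an open set together with a coordinate map; the values of the coordinate map
  outside the open set are irrelevant.\<close>

type_synonym ('a, 'n) chart = "'a set \<times> ('a \<Rightarrow> (complex, 'n) vec)"

definition chart_image :: "('a, 'n::finite) chart \<Rightarrow> (complex ^ 'n) set" where
  "chart_image c = snd c ` fst c"

definition is_chart :: "'a topology \<Rightarrow> ('a, 'n::finite) chart \<Rightarrow> bool" where
  "is_chart X c \<longleftrightarrow>
     openin X (fst c) \<and> open (chart_image c) \<and>
     homeomorphic_map (subtopology X (fst c)) (top_of_set (chart_image c)) (snd c)"

definition transition ::
    "('a, 'n::finite) chart \<Rightarrow> ('a, 'n) chart \<Rightarrow> complex ^ 'n \<Rightarrow> complex ^ 'n" where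
  "transition c c' = snd c' \<circ> the_inv_into (fst c) (snd c)"

definition holomorphic_map_on ::
    "(complex ^ 'n::finite) set \<Rightarrow> (complex ^ 'n \<Rightarrow> complex ^ 'n) \<Rightarrow> bool" where
  "holomorphic_map_on V f \<longleftrightarrow>
     (\<forall>z\<in>V. \<exists>L. (f has_derivative L) (at z) \<and> (\<forall>a v. L (a *s v) = a *s L v))"

text \<open>\<open>X\<close> is a complex manifold of complex dimension \<open>CARD('n)\<close>, with complex structure given by
  the (not necessarily maximal) holomorphic atlas \<open>A\<close>.\<close>

definition complex_manifold :: "'a topology \<Rightarrow> ('a, 'n::finite) chart set \<Rightarrow> bool" where
  "complex_manifold X A \<longleftrightarrow>
     Hausdorff_space X \<and> second_countable X \<and>
     (\<forall>c\<in>A. is_chart X c) \<and> topspace X = (\<Union>c\<in>A. fst c) \<and>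
     (\<forall>c\<in>A. \<forall>c'\<in>A. holomorphic_map_on (snd c ` (fst c \<inter> fst c')) (transition c c'))"


section \<open>Smooth complex-valued differential forms\<close>

text \<open>The \<open>k\<close>-times continuously differentiable functions on an open set, in the real sense.\<close>

primrec Ck_on ::
    "nat \<Rightarrow> 'b::real_normed_vector set \<Rightarrow> ('b \<Rightarrow> 'c::real_normed_vector) \<Rightarrow> bool" where
  "Ck_on 0 V f \<longleftrightarrow> continuous_on V f"
| "Ck_on (Suc k) V f \<longleftrightarrow>
     (\<forall>z\<in>V. f differentiable (at z)) \<and> (\<forall>v. Ck_on k V (\<lambda>z. frechet_derivative f (at z) v))"

definition smooth_on ::
    "'b::real_normed_vector set \<Rightarrow> ('b \<Rightarrow> 'c::real_normed_vector) \<Rightarrow> bool" where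
  "smooth_on V f \<longleftrightarrow> (\<forall>k. Ck_on k V f)"

text \<open>An alternating real-multilinear \<open>k\<close>-form on \<open>\<complex>\<^sup>n\<close> with complex values is represented as a
  function of a sequence of vectors that depends only on the entries \<open>0, \<dots>, k - 1\<close>.\<close>

type_synonym 'n altform = "(nat \<Rightarrow> (complex, 'n) vec) \<Rightarrow> complex"

definition alternating :: "nat \<Rightarrow> 'n::finite altform \<Rightarrow> bool" where
  "alternating k f \<longleftrightarrow>
     (\<forall>v w. (\<forall>i<k. v i = w i) \<longrightarrow> f v = f w) \<and>
     (\<forall>v. \<forall>i<k. linear (\<lambda>x. f (v(i := x)))) \<and>
     (\<forall>v i j. i < k \<and> j < k \<and> i \<noteq> j \<and> v i = v j \<longrightarrow> f v = 0)"

definition alt_wedge :: "nat \<Rightarrow> nat \<Rightarrow> 'n::finite altform \<Rightarrow> 'n altform \<Rightarrow> 'n altform" where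
  "alt_wedge p q f g v =
     (\<Sum>\<sigma> | \<sigma> permutes {..<p + q}.
        of_int (sign \<sigma>) * f (\<lambda>i. v (\<sigma> i)) * g (\<lambda>i. v (\<sigma> (p + i)))) / (fact p * fact q)"

definition dz :: "'n \<Rightarrow> 'n::finite altform" where
  "dz j v = v 0 $ j"

definition dzbar :: "'n \<Rightarrow> 'n::finite altform" where
  "dzbar j v = cnj (v 0 $ j)"

text \<open>A differential form on a manifold with atlas \<open>A\<close> is the family of its local expressions: a
  form on \<open>chart_image c\<close> for each chart \<open>c\<close> in \<open>A\<close>, any two of which are related by pull-back
  along the transition map. Local expressions vanish outside their domain, so that equality of
  forms is equality of functions.\<close>

type_synonym ('a, 'n) form = "('a, 'n) chart \<Rightarrow> (complex, 'n) vec \<Rightarrow> 'n altform"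

definition forms :: "('a, 'n::finite) chart set \<Rightarrow> nat \<Rightarrow> ('a, 'n) form set" where
  "forms A k = {u.
     (\<forall>c z v. c \<notin> A \<or> z \<notin> chart_image c \<longrightarrow> u c z v = 0) \<and>
     (\<forall>c\<in>A. \<forall>z\<in>chart_image c. alternating k (u c z)) \<and>
     (\<forall>c\<in>A. \<forall>v. smooth_on (chart_image c) (\<lambda>z. u c z v)) \<and>
     (\<forall>c\<in>A. \<forall>c'\<in>A. \<forall>x\<in>fst c \<inter> fst c'. \<forall>v.
        u c (snd c x) v =
        u c' (snd c' x) (\<lambda>i. frechet_derivative (transition c c') (at (snd c x)) (v i)))}"

definition scale_form :: "complex \<Rightarrow> ('a, 'n::finite) form \<Rightarrow> ('a, 'n) form" where
  "scale_form a u = (\<lambda>c z v. a * u c z v)"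

definition wedge ::
    "nat \<Rightarrow> nat \<Rightarrow> ('a, 'n::finite) form \<Rightarrow> ('a, 'n) form \<Rightarrow> ('a, 'n) form" where
  "wedge p q u w = (\<lambda>c z. alt_wedge p q (u c z) (w c z))"

definition unit_form :: "('a, 'n::finite) chart set \<Rightarrow> ('a, 'n) form" where
  "unit_form A = (\<lambda>c z v. if c \<in> A \<and> z \<in> chart_image c then 1 else 0)"

primrec wedge_power2 ::
    "('a, 'n::finite) chart set \<Rightarrow> ('a, 'n) form \<Rightarrow> nat \<Rightarrow> ('a, 'n) form" where
  "wedge_power2 A \<omega> 0 = unit_form A"
| "wedge_power2 A \<omega> (Suc k) = wedge 2 (2 * k) \<omega> (wedge_power2 A \<omega> k)"

definition divided_power ::
    "('a, 'n::finite) chart set \<Rightarrow> ('a, 'n) form \<Rightarrow> nat \<Rightarrow> ('a, 'n) form" where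
  "divided_power A \<omega> p = scale_form (1 / fact p) (wedge_power2 A \<omega> p)"


section \<open>The operators $d$, $\partial$ and $\bar\partial$\<close>

text \<open>The exterior derivative of a \<open>k\<close>-form is
  \<open>(du)\<^sub>z(v\<^sub>0, \<dots>, v\<^sub>k) = (\<Sum>i\<le>k. (-1)^i * D[u(v\<^sub>0, \<dots>, omit v\<^sub>i, \<dots>, v\<^sub>k)]\<^sub>z(v\<^sub>i))\<close> for constant
  vector fields \<open>v\<^sub>i\<close>. Replacing the differential \<open>D\<close> of the coefficient functions by its
  complex-linear part \<open>\<Sum>j. (\<partial>/\<partial>z\<^sub>j) dz\<^sub>j\<close> or by its antilinear part \<open>\<Sum>j. (\<partial>/\<partial>zbar\<^sub>j) dzbar\<^sub>j\<close>
  gives the operators \<open>del\<close> and \<open>delbar\<close>.\<close>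

definition ext_with ::
    "((complex ^ 'n \<Rightarrow> complex) \<Rightarrow> (complex ^ 'n \<Rightarrow> complex)) \<Rightarrow> nat \<Rightarrow>
     ('a, 'n::finite) form \<Rightarrow> ('a, 'n) form" where
  "ext_with P k u = (\<lambda>c z v.
     if z \<in> chart_image c then
       (\<Sum>i\<le>k. (- 1) ^ i *
          P (frechet_derivative (\<lambda>y. u c y (\<lambda>j. if j < i then v j else v (Suc j))) (at z)) (v i))
     else 0)"

definition linear_part :: "(complex ^ 'n::finite \<Rightarrow> complex) \<Rightarrow> complex ^ 'n \<Rightarrow> complex" where
  "linear_part L v = (L v - \<i> * L (\<i> *s v)) / 2"

definition antilinear_part :: "(complex ^ 'n::finite \<Rightarrow> complex) \<Rightarrow> complex ^ 'n \<Rightarrow> complex" where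
  "antilinear_part L v = (L v + \<i> * L (\<i> *s v)) / 2"

definition ext_d :: "nat \<Rightarrow> ('a, 'n::finite) form \<Rightarrow> ('a, 'n) form" where
  "ext_d = ext_with (\<lambda>L. L)"

definition del :: "nat \<Rightarrow> ('a, 'n::finite) form \<Rightarrow> ('a, 'n) form" where
  "del = ext_with linear_part"

definition delbar :: "nat \<Rightarrow> ('a, 'n::finite) form \<Rightarrow> ('a, 'n) form" where
  "delbar = ext_with antilinear_part"

definition forms_1_1 :: "('a, 'n::finite) chart set \<Rightarrow> ('a, 'n) form set" where
  "forms_1_1 A = {u \<in> forms A 2. \<forall>c\<in>A. \<forall>z\<in>chart_image c. \<exists>a. \<forall>v.
     u c z v = (\<Sum>j\<in>UNIV. \<Sum>k\<in>UNIV. a j k * alt_wedge 1 1 (dz j) (dzbar k) v)}"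

definition im_del :: "('a, 'n::finite) chart set \<Rightarrow> nat \<Rightarrow> ('a, 'n) form set" where
  "im_del A k = del k ` forms A k"

definition im_del_delbar :: "('a, 'n::finite) chart set \<Rightarrow> nat \<Rightarrow> ('a, 'n) form set" where
  "im_del_delbar A k = (\<lambda>u. del (Suc k) (delbar k u)) ` forms A k"


section \<open>Hermitian and balanced metrics\<close>

text \<open>Locally \<open>\<omega> = \<i> * (\<Sum>j k. h\<^sub>j\<^sub>k dz\<^sub>j \<and> dzbar\<^sub>k)\<close> with \<open>(h\<^sub>j\<^sub>k)\<close> Hermitian and positive
  definite.\<close>

definition hermitian_metric :: "('a, 'n::finite) chart set \<Rightarrow> ('a, 'n) form \<Rightarrow> bool" where
  "hermitian_metric A \<omega> \<longleftrightarrow> \<omega> \<in> forms A 2 \<and>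
     (\<forall>c\<in>A. \<forall>z\<in>chart_image c. \<exists>h.
        (\<forall>v. \<omega> c z v =
           \<i> * (\<Sum>j\<in>UNIV. \<Sum>k\<in>UNIV. h j k * alt_wedge 1 1 (dz j) (dzbar k) v)) \<and>
        (\<forall>j k. h k j = cnj (h j k)) \<and>
        (\<forall>w. w \<noteq> 0 \<longrightarrow> 0 < Re (\<Sum>j\<in>UNIV. \<Sum>k\<in>UNIV. h j k * w $ j * cnj (w $ k))))"

definition balanced_metric :: "('a, 'n::finite) chart set \<Rightarrow> ('a, 'n) form \<Rightarrow> bool" where
  "balanced_metric A \<omega> \<longleftrightarrow> hermitian_metric A \<omega> \<and>
     ext_d (2 * (CARD('n) - 1)) (wedge_power2 A \<omega> (CARD('n) - 1)) = 0"


section \<open>De Rham cohomology\<close>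

definition closed_forms :: "('a, 'n::finite) chart set \<Rightarrow> nat \<Rightarrow> ('a, 'n) form set" where
  "closed_forms A k = {u \<in> forms A k. ext_d k u = 0}"

definition exact_forms :: "('a, 'n::finite) chart set \<Rightarrow> nat \<Rightarrow> ('a, 'n) form set" where
  "exact_forms A k = (case k of 0 \<Rightarrow> {0} | Suc l \<Rightarrow> ext_d l ` forms A l)"

definition dR_rel ::
    "('a, 'n::finite) chart set \<Rightarrow> nat \<Rightarrow> (('a, 'n) form \<times> ('a, 'n) form) set" where
  "dR_rel A k =
     {(u, w). u \<in> closed_forms A k \<and> w \<in> closed_forms A k \<and> u - w \<in> exact_forms A k}"

definition dR_class ::
    "('a, 'n::finite) chart set \<Rightarrow> nat \<Rightarrow> ('a, 'n) form \<Rightarrow> ('a, 'n) form set" where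
  "dR_class A k u = dR_rel A k `` {u}"

definition dR :: "('a, 'n::finite) chart set \<Rightarrow> nat \<Rightarrow> ('a, 'n) form set set" where
  "dR A k = closed_forms A k // dR_rel A k"

definition dR_add :: "('a, 'n::finite) chart set \<Rightarrow> nat \<Rightarrow>
    ('a, 'n) form set \<Rightarrow> ('a, 'n) form set \<Rightarrow> ('a, 'n) form set" where
  "dR_add A k a b = (\<Union>u\<in>a. \<Union>w\<in>b. dR_class A k (u + w))"

definition dR_scale :: "('a, 'n::finite) chart set \<Rightarrow> nat \<Rightarrow>
    complex \<Rightarrow> ('a, 'n) form set \<Rightarrow> ('a, 'n) form set" where
  "dR_scale A k r a = (\<Union>u\<in>a. dR_class A k (scale_form r u))"

definition dR_linear :: "('a, 'n::finite) chart set \<Rightarrow> nat \<Rightarrow> nat \<Rightarrow>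
    (('a, 'n) form set \<Rightarrow> ('a, 'n) form set) \<Rightarrow> bool" where
  "dR_linear A k l F \<longleftrightarrow> F \<in> dR A k \<rightarrow> dR A l \<and>
     (\<forall>a\<in>dR A k. \<forall>b\<in>dR A k. F (dR_add A k a b) = dR_add A l (F a) (F b)) \<and>
     (\<forall>r. \<forall>a\<in>dR A k. F (dR_scale A k r a) = dR_scale A l r (F a))"

definition dR_isomorphism :: "('a, 'n::finite) chart set \<Rightarrow> nat \<Rightarrow> nat \<Rightarrow>
    (('a, 'n) form set \<Rightarrow> ('a, 'n) form set) \<Rightarrow> bool" where
  "dR_isomorphism A k l F \<longleftrightarrow> dR_linear A k l F \<and> bij_betw F (dR A k) (dR A l)"

text \<open>The map \<open>{u} \<mapsto> {\<theta> \<and> u}\<close> from \<open>H\<^sup>q\<close> to \<open>H\<^sup>p\<^sup>+\<^sup>q\<close> for a \<open>p\<close>-form \<open>\<theta>\<close>. It is meaningful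
  only when \<open>wedge_well_defined A p q \<theta>\<close> holds: the union is then over equal classes.\<close>

definition dR_wedge :: "('a, 'n::finite) chart set \<Rightarrow> nat \<Rightarrow> nat \<Rightarrow>
    ('a, 'n) form \<Rightarrow> ('a, 'n) form set \<Rightarrow> ('a, 'n) form set" where
  "dR_wedge A p q \<theta> a = (\<Union>u\<in>a. dR_class A (p + q) (wedge p q \<theta> u))"

definition wedge_well_defined ::
    "('a, 'n::finite) chart set \<Rightarrow> nat \<Rightarrow> nat \<Rightarrow> ('a, 'n) form \<Rightarrow> bool" where
  "wedge_well_defined A p q \<theta> \<longleftrightarrow>
     (\<forall>u\<in>closed_forms A q. wedge p q \<theta> u \<in> closed_forms A (p + q)) \<and>
     (\<lambda>u. dR_class A (p + q) (wedge p q \<theta> u)) respects dR_rel A q"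

end

(* Let theta = omega_{n-1} and, for closed 1-forms u and w, let B(u, w) be the integral of
   theta ^ u ^ w over X. This pairing is antisymmetric and vanishes when one argument is exact.

   It is nondegenerate on H^1: suppose B(u, w) = 0 for all closed w. As u is closed,
   d(u^{0,1}) = del(u^{0,1}) is a closed form of type (1,1), so the hypothesis of (ii) gives a function f
   with u - df = a + b, where a of type (1,0) and b of type (0,1) are both closed. For reasons of
   type B(a + b, conj a) = B(a, conj a), the integral of a definite form since omega is positive.
   Hence a = 0, likewise b = 0, and u = df. Injectivity follows: if theta ^ u is exact, B(u, .) = 0.

   Surjectivity needs neither finite dimensionality nor Poincare duality: there are finitely many 1-forms
   xi_s such that a closed (2n-1)-form gamma is exact as soon as all integrals of gamma ^ xi_s vanish.
   If gamma were not of the form theta ^ w + d eta, a linear combination xi of the xi_s would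
   annihilate all forms theta ^ w + d eta but not gamma. Then xi is closed by Stokes, hence exact by
   nondegeneracy, hence annihilates gamma: a contradiction. *)

theory Submission
  imports Defs "HOL-Complex_Analysis.Complex_Analysis"
begin

section \<open>Smooth functions\<close>

text \<open>Two pointwise facts carry the positivity. Multiplication by i preserves (1,1)-forms,
  multiplies a product of two 1-forms of the same type by -1, and has positive determinant on the
  underlying real space; so products of theta with two 1-forms of the same type vanish. For a of
  type (1,0), a basis that is orthogonal for omega and whose first n - 1 vectors are killed by a
  turns theta ^ a ^ conj a into a product of positive numbers times -2i |a(f)|^2, where f is the
  last basis vector. The finite family xi_s takes the place of finite dimensionality. It is built
  from two partitions of unity, and its only analytic input is the Poincare lemma for forms with
  compact support in a cube. Because only the values of theta ^ w + d eta on this family matter, the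
  separating combination is linear algebra in finitely many complex coordinates. That it is closed,
  and not merely annihilating exact forms, comes from testing against bump forms. Of the integral
  nothing is used but linearity, its value on forms supported in one chart, Stokes, and definiteness
  on nonnegative top forms.\<close>

lemma frechet_derivative_eqI: "(f has_derivative f') (at x) \<Longrightarrow> frechet_derivative f (at x) = f'"
  using frechet_derivative_at by metis

lemma Ck_on_SucD: "Ck_on (Suc k) V f \<Longrightarrow> z \<in> V \<Longrightarrow> (f has_derivative frechet_derivative f (at z)) (at z)"
  by (simp add: frechet_derivative_works)

lemma Ck_on_cong:
  assumes "open V" "\<And>z. z \<in> V \<Longrightarrow> f z = g z" "Ck_on k V f"
  shows "Ck_on k V g"
  using assms(2,3)
proof (induction k arbitrary: f g)
  case 0
  then show ?case by (simp cong: continuous_on_cong)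
next
  case (Suc k)
  have "g differentiable (at z)" if "z \<in> V" for z
    using has_derivative_transform_within_open[OF Ck_on_SucD[OF Suc.prems(2) that] assms(1) that Suc.prems(1)]
    by (auto simp: differentiable_def)
  moreover have "Ck_on k V (\<lambda>z. frechet_derivative g (at z) v)" for v
  proof (rule Suc.IH)
    show "Ck_on k V (\<lambda>z. frechet_derivative f (at z) v)" using Suc.prems by simp
    show "frechet_derivative f (at z) v = frechet_derivative g (at z) v" if "z \<in> V" for z
      using frechet_derivative_transform_within_open[of f z V g] Suc.prems that assms(1) by auto
  qed
  ultimately show ?case by simp
qed

text \<open>Any explicit derivative may be supplied; uniqueness of derivatives identifies it with
  the \<open>frechet_derivative\<close> in the definition.\<close>

lemma Ck_on_SucI:
  assumes "open V" "\<And>z. z \<in> V \<Longrightarrow> (f has_derivative f' z) (at z)" "\<And>v. Ck_on k V (\<lambda>z. f' z v)"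
  shows "Ck_on (Suc k) V f"
proof -
  have "Ck_on k V (\<lambda>z. frechet_derivative f (at z) v)" for v
    by (rule Ck_on_cong[OF assms(1) _ assms(3)]) (simp add: frechet_derivative_eqI[OF assms(2)])
  then show ?thesis using assms(2) by (auto simp: differentiable_def)
qed

lemma Ck_on_Suc_imp: "Ck_on (Suc k) V f \<Longrightarrow> Ck_on k V f"
proof (induction k arbitrary: f)
  case 0
  then show ?case
    by (auto intro!: continuous_at_imp_continuous_on dest: differentiable_imp_continuous_within)
next
  case (Suc k)
  then show ?case
    using Suc.prems[unfolded Ck_on.simps(2)[of "Suc k"]] unfolding Ck_on.simps(2)[of k] by blast
qed

lemma Ck_on_subset: "Ck_on k V f \<Longrightarrow> U \<subseteq> V \<Longrightarrow> Ck_on k U f"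
  by (induction k arbitrary: f) (auto intro: continuous_on_subset)

lemma Ck_on_local:
  assumes "\<And>x. x \<in> V \<Longrightarrow> \<exists>U. open U \<and> x \<in> U \<and> Ck_on k U f"
  shows "Ck_on k V f"
  using assms
proof (induction k arbitrary: f)
  case 0
  have "continuous (at x) f" if "x \<in> V" for x
    using 0[OF that] continuous_on_eq_continuous_at by auto
  then show ?case by (simp add: continuous_at_imp_continuous_on)
next
  case (Suc k)
  have "f differentiable (at z)" if "z \<in> V" for z
    using Suc.prems[OF that] by auto
  moreover have "Ck_on k V (\<lambda>z. frechet_derivative f (at z) v)" for v
    by (rule Suc.IH) (use Suc.prems in \<open>unfold Ck_on.simps, blast\<close>)
  ultimately show ?case by simp
qed

lemma Ck_on_const: "Ck_on k V (\<lambda>z. c)"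
  by (induction k arbitrary: c) (auto simp: frechet_derivative_const)

lemma Ck_on_bounded_linear:
  assumes "bounded_linear L" "open V" "Ck_on k V f"
  shows "Ck_on k V (\<lambda>z. L (f z))"
  using assms(3)
proof (induction k arbitrary: f)
  case 0
  then show ?case using assms(1) by (simp add: linear_continuous_on_compose
     bounded_linear.continuous_on)
next
  case (Suc k)
  show ?case
    by (rule Ck_on_SucI[OF assms(2) bounded_linear.has_derivative[OF assms(1) Ck_on_SucD[OF Suc.prems]]])
      (use Suc in auto)
qed

lemma Ck_on_id: "open V \<Longrightarrow> Ck_on k V (\<lambda>z. z)"
proof (cases k)
  case (Suc l)
  assume "open V"
  then show ?thesis unfolding Suc by (intro Ck_on_SucI[where f'="\<lambda>z v. v"]) (auto intro: Ck_on_const)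
qed simp

lemma Ck_on_add:
  assumes "open V" "Ck_on k V f" "Ck_on k V g"
  shows "Ck_on k V (\<lambda>z. f z + g z)"
  using assms(2,3)
proof (induction k arbitrary: f g)
  case 0
  then show ?case by (simp add: continuous_on_add)
next
  case (Suc k)
  show ?case
    by (rule Ck_on_SucI[OF assms(1) has_derivative_add[OF Ck_on_SucD[OF Suc.prems(1)] Ck_on_SucD[OF Suc.prems(2)]]])
      (use Suc in auto)
qed

lemma Ck_on_bilinear:
  assumes "bounded_bilinear h" "open V" "Ck_on k V f" "Ck_on k V g"
  shows "Ck_on k V (\<lambda>z. h (f z) (g z))"
  using assms(3,4)
proof (induction k arbitrary: f g)
  case 0
  then show ?case using assms(1) by (simp add: bounded_bilinear.continuous_on)
next
  case (Suc k)
  show ?case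
    by (rule Ck_on_SucI[OF assms(2) bounded_bilinear.FDERIV[OF assms(1) Ck_on_SucD[OF Suc.prems(1)] Ck_on_SucD[OF Suc.prems(2)]]])
      (use Suc Ck_on_Suc_imp[OF Suc.prems(1)] Ck_on_Suc_imp[OF Suc.prems(2)]
        in \<open>auto intro!: Ck_on_add assms(2)\<close>)
qed

lemma Ck_on_sum:
  assumes "open V" "\<And>i. i \<in> S \<Longrightarrow> Ck_on k V (f i)"
  shows "Ck_on k V (\<lambda>z. \<Sum>i\<in>S. f i z)"
  using assms(2)
  by (induction S rule: infinite_finite_induct) (auto intro!: Ck_on_add assms(1) Ck_on_const)

text \<open>\<open>Ck_on\<close> controls a derivative in fixed directions only, while in the chain
  rule the direction \<open>?f' z v\<close> moves with z. It is therefore expanded in a basis of the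
  middle space, which turns the derivative into a finite sum of products.\<close>

lemma Ck_on_compose:
  fixes f :: "'b::real_normed_vector \<Rightarrow> 'c::euclidean_space"
  assumes "open V" "open W" "\<And>z. z \<in> V \<Longrightarrow> f z \<in> W" "Ck_on k V f" "Ck_on k W g"
  shows "Ck_on k V (\<lambda>z. g (f z))"
  using assms(4,5)
proof (induction k arbitrary: g)
  case 0
  then show ?case using assms(3) by (auto intro: continuous_on_compose2)
next
  case (Suc k)
  let ?f' = "\<lambda>z. frechet_derivative f (at z)" and ?g' = "\<lambda>z. frechet_derivative g (at z)"
  have eq: "?g' (f z) (?f' z v) = (\<Sum>b\<in>Basis. (?f' z v \<bullet> b) *\<^sub>R ?g' (f z) b)" if "z \<in> V" for z v
  proof -
    have "linear (?g' (f z))"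
      using Suc.prems(2) assms(3)[OF that] by (simp add: linear_frechet_derivative)
    from linear_sum[OF this, of "\<lambda>b. (?f' z v \<bullet> b) *\<^sub>R b" Basis] show ?thesis
      by (simp add: euclidean_representation linear_scale[OF \<open>linear (?g' (f z))\<close>])
  qed
  show ?case
  proof (rule Ck_on_SucI[OF assms(1)])
    show "((\<lambda>z. g (f z)) has_derivative (\<lambda>v. \<Sum>b\<in>Basis. (?f' z v \<bullet> b) *\<^sub>R ?g' (f z) b)) (at z)"
      if "z \<in> V" for z
      using diff_chain_at[OF Ck_on_SucD[OF Suc.prems(1) that] Ck_on_SucD[OF Suc.prems(2) assms(3)[OF that]]]
      by (simp add: o_def eq[OF that])
    show "Ck_on k V (\<lambda>z. \<Sum>b\<in>Basis. (?f' z v \<bullet> b) *\<^sub>R ?g' (f z) b)" for v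
    proof (intro Ck_on_sum[OF assms(1)] Ck_on_bilinear[OF bounded_bilinear_scaleR assms(1)])
      fix b :: 'c
      show "Ck_on k V (\<lambda>z. ?f' z v \<bullet> b)"
        using Suc.prems(1) by (intro Ck_on_bounded_linear[OF bounded_linear_inner_left assms(1)]) simp
      show "Ck_on k V (\<lambda>z. ?g' (f z) b)"
        using Suc.prems Ck_on_Suc_imp[OF Suc.prems(1)] by (intro Suc.IH) auto
    qed
  qed
qed

lemma smooth_onI:
  assumes "open V" "\<And>z. z \<in> V \<Longrightarrow> (f has_derivative f' z) (at z)" "\<And>v. smooth_on V (\<lambda>z. f' z v)"
  shows "smooth_on V f"
  unfolding smooth_on_def
proof
  show "Ck_on k V f" for k
    using Ck_on_Suc_imp[OF Ck_on_SucI[OF assms(1,2)]] assms(3) unfolding smooth_on_def by blast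
qed

lemma smooth_on_deriv: "smooth_on V f \<Longrightarrow> smooth_on V (\<lambda>z. frechet_derivative f (at z) v)"
  unfolding smooth_on_def
proof
  assume "\<forall>k. Ck_on k V f"
  then have "Ck_on (Suc k) V f" for k by blast
  then show "Ck_on k V (\<lambda>z. frechet_derivative f (at z) v)" for k by simp
qed

lemma smooth_on_has_derivative:
  "smooth_on V f \<Longrightarrow> z \<in> V \<Longrightarrow> (f has_derivative frechet_derivative f (at z)) (at z)"
  unfolding smooth_on_def using Ck_on_SucD by blast

lemma smooth_on_differentiable: "smooth_on V f \<Longrightarrow> z \<in> V \<Longrightarrow> f differentiable (at z)"
  using smooth_on_has_derivative by (auto simp: differentiable_def)

lemma smooth_on_continuous: "smooth_on V f \<Longrightarrow> continuous_on V f"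
  unfolding smooth_on_def using Ck_on.simps(1)[of V f] by blast

lemma smooth_on_cong: "open V \<Longrightarrow> (\<And>z. z \<in> V \<Longrightarrow> f z = g z) \<Longrightarrow> smooth_on V f \<Longrightarrow> smooth_on V g"
  unfolding smooth_on_def using Ck_on_cong by blast

lemma smooth_on_subset: "smooth_on V f \<Longrightarrow> U \<subseteq> V \<Longrightarrow> smooth_on U f"
  unfolding smooth_on_def using Ck_on_subset by blast

lemma smooth_on_local:
  assumes "\<And>x. x \<in> V \<Longrightarrow> \<exists>U. open U \<and> x \<in> U \<and> smooth_on U f"
  shows "smooth_on V f"
  unfolding smooth_on_def
proof
  show "Ck_on k V f" for k
    by (rule Ck_on_local) (use assms smooth_on_def in blast)
qed

lemma smooth_on_Un: "open U \<Longrightarrow> open V \<Longrightarrow> smooth_on U f \<Longrightarrow> smooth_on V f \<Longrightarrow> smooth_on (U \<union> V) f"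
  by (rule smooth_on_local) blast

lemma smooth_on_const [intro, simp]: "smooth_on V (\<lambda>z. c)"
  by (simp add: smooth_on_def Ck_on_const)

lemma smooth_on_id: "open V \<Longrightarrow> smooth_on V (\<lambda>z. z)"
  by (simp add: smooth_on_def Ck_on_id)

lemma smooth_on_add: "open V \<Longrightarrow> smooth_on V f \<Longrightarrow> smooth_on V g \<Longrightarrow> smooth_on V (\<lambda>z. f z + g z)"
  by (simp add: smooth_on_def Ck_on_add)

lemma smooth_on_bounded_linear:
  "bounded_linear L \<Longrightarrow> open V \<Longrightarrow> smooth_on V f \<Longrightarrow> smooth_on V (\<lambda>z. L (f z))"
  by (simp add: smooth_on_def Ck_on_bounded_linear)

lemma smooth_on_bilinear:
  "bounded_bilinear h \<Longrightarrow> open V \<Longrightarrow> smooth_on V f \<Longrightarrow> smooth_on V g \<Longrightarrow> smooth_on V (\<lambda>z. h (f z) (g z))"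
  by (simp add: smooth_on_def Ck_on_bilinear)

lemma smooth_on_sum:
  "open V \<Longrightarrow> (\<And>i. i \<in> S \<Longrightarrow> smooth_on V (f i)) \<Longrightarrow> smooth_on V (\<lambda>z. \<Sum>i\<in>S. f i z)"
  by (simp add: smooth_on_def Ck_on_sum)

lemma smooth_on_mult:
  fixes f g :: "'b::real_normed_vector \<Rightarrow> 'c::real_normed_algebra"
  shows "open V \<Longrightarrow> smooth_on V f \<Longrightarrow> smooth_on V g \<Longrightarrow> smooth_on V (\<lambda>z. f z * g z)"
  by (rule smooth_on_bilinear[OF bounded_bilinear_mult])

lemma smooth_on_uminus: "open V \<Longrightarrow> smooth_on V f \<Longrightarrow> smooth_on V (\<lambda>z. - f z)"
  by (rule smooth_on_bounded_linear[OF bounded_linear_minus[OF bounded_linear_ident]])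

lemma smooth_on_diff: "open V \<Longrightarrow> smooth_on V f \<Longrightarrow> smooth_on V g \<Longrightarrow> smooth_on V (\<lambda>z. f z - g z)"
  using smooth_on_add[of V f "\<lambda>z. - g z"] smooth_on_uminus[of V g] by simp

lemma smooth_on_prod:
  fixes f :: "'i \<Rightarrow> 'b::real_normed_vector \<Rightarrow> 'c::{real_normed_algebra,comm_ring_1}"
  assumes "open V" "\<And>i. i \<in> S \<Longrightarrow> smooth_on V (f i)"
  shows "smooth_on V (\<lambda>z. \<Prod>i\<in>S. f i z)"
  using assms(2)
  by (induction S rule: infinite_finite_induct) (auto intro!: smooth_on_mult assms(1))

lemma smooth_on_compose:
  fixes f :: "'b::real_normed_vector \<Rightarrow> 'c::euclidean_space"
  assumes "open V" "open W" "\<And>z. z \<in> V \<Longrightarrow> f z \<in> W" "smooth_on V f" "smooth_on W g"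
  shows "smooth_on V (\<lambda>z. g (f z))"
  using assms Ck_on_compose unfolding smooth_on_def by blast

section \<open>Rules of calculus for the Frechet derivative\<close>

lemma frechet_derivative_linear_comp:
  assumes "bounded_linear L" "f differentiable (at z)"
  shows "frechet_derivative (\<lambda>y. L (f y)) (at z) = (\<lambda>v. L (frechet_derivative f (at z) v))"
  by (rule frechet_derivative_eqI[OF bounded_linear.has_derivative[OF assms(1) assms(2)[unfolded frechet_derivative_works]]])

lemma frechet_derivative_cmult:
  fixes c :: complex
  shows "f differentiable (at z) \<Longrightarrow> frechet_derivative (\<lambda>y. c * f y) (at z) v = c * frechet_derivative f (at z) v"
  using frechet_derivative_linear_comp[OF bounded_linear_mult_right[of c], of f z] by simp

lemma frechet_derivative_add:
  assumes "f differentiable (at z)" "g differentiable (at z)"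
  shows "frechet_derivative (\<lambda>y. f y + g y) (at z) v = frechet_derivative f (at z) v + frechet_derivative g (at z) v"
  using frechet_derivative_eqI[OF has_derivative_add[OF assms[unfolded frechet_derivative_works]]] by simp

lemma frechet_derivative_diff:
  assumes "f differentiable (at z)" "g differentiable (at z)"
  shows "frechet_derivative (\<lambda>y. f y - g y) (at z) v = frechet_derivative f (at z) v - frechet_derivative g (at z) v"
  using frechet_derivative_eqI[OF has_derivative_diff[OF assms[unfolded frechet_derivative_works]]] by simp

lemma frechet_derivative_mult:
  fixes f g :: "'b::real_normed_vector \<Rightarrow> complex"
  assumes "f differentiable (at z)" "g differentiable (at z)"
  shows "frechet_derivative (\<lambda>y. f y * g y) (at z) v = f z * frechet_derivative g (at z) v + frechet_derivative f (at z) v * g z"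
  using frechet_derivative_eqI[OF has_derivative_mult[OF assms[unfolded frechet_derivative_works]]] by simp

lemma frechet_derivative_sum:
  assumes "\<And>i. i \<in> S \<Longrightarrow> f i differentiable (at z)"
  shows "frechet_derivative (\<lambda>y. \<Sum>i\<in>S. f i y) (at z) v = (\<Sum>i\<in>S. frechet_derivative (f i) (at z) v)"
  by (rule fun_cong[OF frechet_derivative_eqI[OF has_derivative_sum]])
    (use assms frechet_derivative_works in blast)

text \<open>The two functions have the same derivatives at z, so the choice behind
  \<open>frechet_derivative\<close> agrees, even where no derivative exists.\<close>

lemma frechet_derivative_cong:
  assumes "open V" "z \<in> V" "\<And>y. y \<in> V \<Longrightarrow> f y = g y"
  shows "frechet_derivative f (at z) = frechet_derivative g (at z)"
proof -
  have "(f has_derivative D) (at z) \<longleftrightarrow> (g has_derivative D) (at z)" for D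
    by (intro iffI; erule has_derivative_transform_within_open[OF _ assms(1,2)]) (simp_all add: assms(3))
  then show ?thesis unfolding frechet_derivative_def by presburger
qed

lemma frechet_derivative_zero_on:
  assumes "open V" "z \<in> V" "\<And>y. y \<in> V \<Longrightarrow> f y = 0"
  shows "frechet_derivative f (at z) v = 0"
proof -
  have "frechet_derivative f (at z) = frechet_derivative (\<lambda>_. 0) (at z)"
    by (rule frechet_derivative_cong[OF assms(1,2)]) (rule assms(3))
  then show ?thesis by (simp add: frechet_derivative_const)
qed

lemma frechet_derivative_chain:
  assumes "f differentiable (at z)" "g differentiable (at (f z))"
  shows "frechet_derivative (\<lambda>y. g (f y)) (at z) v = frechet_derivative g (at (f z)) (frechet_derivative f (at z) v)"
  using fun_cong[OF frechet_derivative_eqI[OF diff_chain_at[OF assms[unfolded frechet_derivative_works]]], of v]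
  unfolding o_def .

section \<open>Symmetry of second derivatives\<close>

lemma vector_differentiable_bound:
  fixes g :: "real \<Rightarrow> complex"
  assumes "\<And>x. x \<in> S \<Longrightarrow> (g has_vector_derivative g' x) (at x within S)"
    "\<And>x. x \<in> S \<Longrightarrow> norm (g' x) \<le> B" "convex S" "x \<in> S" "y \<in> S"
  shows "norm (g x - g y) \<le> B * norm (x - y)"
proof (rule differentiable_bound[where f'="\<lambda>x k. k *\<^sub>R g' x" and S=S])
  show "onorm (\<lambda>k. k *\<^sub>R g' x) \<le> B" if "x \<in> S" for x
    using mult_left_mono[OF assms(2)[OF that] abs_ge_zero] by (intro onorm_le) (simp add: mult.commute)
qed (use assms in \<open>auto simp: has_vector_derivative_def\<close>)

text \<open>The mean value inequality is applied twice: in direction v to the derivative along u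
  (\<open>inner\<close>), then in direction u to the first difference in v. Continuity of the mixed
  derivative at z supplies the factor e.\<close>

lemma second_difference_bound:
  fixes f :: "'b::real_normed_vector \<Rightarrow> complex"
  assumes V: "open V" "z \<in> V" and f: "smooth_on V f" and "e > 0"
  shows "\<exists>d>0. \<forall>h. 0 < h \<and> h < d \<longrightarrow>
    norm (f (z + h *\<^sub>R u + h *\<^sub>R v) - f (z + h *\<^sub>R u) - f (z + h *\<^sub>R v) + f z
      - (h * h) *\<^sub>R frechet_derivative (\<lambda>y. frechet_derivative f (at y) u) (at z) v) \<le> e * (h * h)"
proof -
  let ?Du = "\<lambda>y. frechet_derivative f (at y) u"
  let ?D = "\<lambda>y. frechet_derivative ?Du (at y) v"
  have sD: "smooth_on V ?Du" "smooth_on V ?D" using f by (simp_all add: smooth_on_deriv)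
  have "continuous (at z) ?D"
    using smooth_on_continuous[OF sD(2)] V continuous_on_eq_continuous_at by blast
  then obtain r where r: "r > 0" "\<And>y. dist y z < r \<Longrightarrow> dist (?D y) (?D z) < e"
    using \<open>e > 0\<close> unfolding continuous_at_eps_delta by metis
  obtain r' where r': "r' > 0" "ball z r' \<subseteq> V" using V openE by blast
  define R where "R = min r r'"
  \<comment> \<open>With s, t \<le> h < d the displacement s u + t v has norm below R, so the whole
    parallelogram stays in V and where the mixed derivative is within e of its value at z.\<close>
  define d where "d = R / (norm u + norm v + 1)"
  have pos: "norm u + norm v + 1 > 0" by (simp add: add_nonneg_pos)
  have R: "R > 0" using r r' by (simp add: R_def)
  have d: "d > 0" using R pos by (simp add: d_def)
  have inR: "z + s *\<^sub>R u + t *\<^sub>R v \<in> V \<and> dist (z + s *\<^sub>R u + t *\<^sub>R v) z < r"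
    if "0 \<le> s" "s \<le> h" "0 \<le> t" "t \<le> h" "h < d" for s t h
  proof -
    have "norm (s *\<^sub>R u + t *\<^sub>R v) \<le> s * norm u + t * norm v"
      using that norm_triangle_ineq[of "s *\<^sub>R u" "t *\<^sub>R v"] by simp
    also have "\<dots> \<le> h * norm u + h * norm v" using that by (intro add_mono mult_right_mono) auto
    also have "\<dots> \<le> h * (norm u + norm v + 1)" using that by (simp add: algebra_simps)
    also have "\<dots> < R" using that pos by (simp add: d_def pos_less_divide_eq)
    finally have "dist (z + s *\<^sub>R u + t *\<^sub>R v) z < R" by (simp add: dist_norm add.assoc)
    then show ?thesis using r'(2) by (auto simp: R_def dist_commute)
  qed
  have inner: "norm (?Du (z + s *\<^sub>R u + h *\<^sub>R v) - ?Du (z + s *\<^sub>R u) - h *\<^sub>R ?D z) \<le> e * h"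
    if "0 \<le> s" "s \<le> h" "0 < h" "h < d" for s h
  proof -
    let ?G = "\<lambda>t. ?Du (z + s *\<^sub>R u + t *\<^sub>R v) - t *\<^sub>R ?D z"
    have "norm (?G h - ?G 0) \<le> e * norm (h - 0)"
    proof (rule vector_differentiable_bound[where S="{0..h}" and g'="\<lambda>t. ?D (z + s *\<^sub>R u + t *\<^sub>R v) - ?D z"])
      fix t assume t: "t \<in> {0..h}"
      have iv: "z + s *\<^sub>R u + t *\<^sub>R v \<in> V" and dt: "dist (z + s *\<^sub>R u + t *\<^sub>R v) z < r"
        using inR[of s h t] that t by auto
      have lin: "linear (frechet_derivative ?Du (at (z + s *\<^sub>R u + t *\<^sub>R v)))"
        using smooth_on_has_derivative[OF sD(1) iv] has_derivative_linear by blast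
      have "((\<lambda>t. z + s *\<^sub>R u + t *\<^sub>R v) has_derivative (\<lambda>k. k *\<^sub>R v)) (at t)"
        by (auto intro!: derivative_eq_intros)
      from diff_chain_at[OF this smooth_on_has_derivative[OF sD(1) iv]]
      have "((\<lambda>t. ?Du (z + s *\<^sub>R u + t *\<^sub>R v)) has_vector_derivative ?D (z + s *\<^sub>R u + t *\<^sub>R v)) (at t)"
        by (simp add: has_vector_derivative_def o_def linear_scale[OF lin])
      then have "((\<lambda>t. ?Du (z + s *\<^sub>R u + t *\<^sub>R v)) has_vector_derivative ?D (z + s *\<^sub>R u + t *\<^sub>R v)) (at t within {0..h})"
        by (rule has_vector_derivative_at_within)
      moreover have "((\<lambda>t. t *\<^sub>R ?D z) has_vector_derivative ?D z) (at t within {0..h})"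
        unfolding has_vector_derivative_def by (rule bounded_linear_imp_has_derivative) (rule bounded_linear_scaleR_left)
      ultimately show "(?G has_vector_derivative ?D (z + s *\<^sub>R u + t *\<^sub>R v) - ?D z) (at t within {0..h})"
        by (rule has_vector_derivative_diff)
      show "norm (?D (z + s *\<^sub>R u + t *\<^sub>R v) - ?D z) \<le> e"
        using r(2)[OF dt] by (simp add: dist_norm)
    qed (use that in auto)
    then show ?thesis using that by (simp add: algebra_simps)
  qed
  show ?thesis
  proof (intro exI conjI allI impI)
    fix h assume h: "0 < h \<and> h < d"
    let ?G = "\<lambda>s. f (z + s *\<^sub>R u + h *\<^sub>R v) - f (z + s *\<^sub>R u) - s *\<^sub>R h *\<^sub>R ?D z"
    have "norm (?G h - ?G 0) \<le> (e * h) * norm (h - 0)"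
    proof (rule vector_differentiable_bound[where S="{0..h}" and
          g'="\<lambda>s. ?Du (z + s *\<^sub>R u + h *\<^sub>R v) - ?Du (z + s *\<^sub>R u) - h *\<^sub>R ?D z"])
      fix s assume s: "s \<in> {0..h}"
      have vd: "((\<lambda>s. f (z + s *\<^sub>R u + t *\<^sub>R v)) has_vector_derivative ?Du (z + s *\<^sub>R u + t *\<^sub>R v)) (at s within {0..h})"
        if "0 \<le> t" "t \<le> h" for t
      proof -
        have iv: "z + s *\<^sub>R u + t *\<^sub>R v \<in> V" using inR[of s h t] that s h by auto
        have lin: "linear (frechet_derivative f (at (z + s *\<^sub>R u + t *\<^sub>R v)))"
          using smooth_on_has_derivative[OF f iv] has_derivative_linear by blast
        have "((\<lambda>s. z + s *\<^sub>R u + t *\<^sub>R v) has_derivative (\<lambda>k. k *\<^sub>R u)) (at s)"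
          by (auto intro!: derivative_eq_intros)
        from diff_chain_at[OF this smooth_on_has_derivative[OF f iv]]
        have "((\<lambda>s. f (z + s *\<^sub>R u + t *\<^sub>R v)) has_vector_derivative ?Du (z + s *\<^sub>R u + t *\<^sub>R v)) (at s)"
          by (simp add: has_vector_derivative_def o_def linear_scale[OF lin])
        then show ?thesis by (rule has_vector_derivative_at_within)
      qed
      have "((\<lambda>s. s *\<^sub>R h *\<^sub>R ?D z) has_vector_derivative h *\<^sub>R ?D z) (at s within {0..h})"
        unfolding has_vector_derivative_def by (rule bounded_linear_imp_has_derivative) (rule bounded_linear_scaleR_left)
      from has_vector_derivative_diff[OF has_vector_derivative_diff[OF vd[of h] vd[of 0]] this] h
      show "(?G has_vector_derivative ?Du (z + s *\<^sub>R u + h *\<^sub>R v) - ?Du (z + s *\<^sub>R u) - h *\<^sub>R ?D z) (at s within {0..h})"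
        by simp
      show "norm (?Du (z + s *\<^sub>R u + h *\<^sub>R v) - ?Du (z + s *\<^sub>R u) - h *\<^sub>R ?D z) \<le> e * h"
        using inner[of s h] s h by auto
    qed (use h in auto)
    moreover have "?G h - ?G 0 = f (z + h *\<^sub>R u + h *\<^sub>R v) - f (z + h *\<^sub>R u) - f (z + h *\<^sub>R v) + f z
        - (h * h) *\<^sub>R ?D z"
    proof -
      have alg: "p - q - m - (r - s - n) = p - q - r + s - m" if "n = 0" for p q r s m n :: complex
        using that by (simp add: algebra_simps)
      show ?thesis unfolding scaleR_scaleR scaleR_zero_left add_0_right by (rule alg) simp
    qed
    moreover have "norm (h - 0) = h" using h by (simp only: diff_zero real_norm_def abs_of_pos)
    then have "(e * h) * norm (h - 0) = e * (h * h)" by (simp only: mult.assoc)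
    ultimately show "norm (f (z + h *\<^sub>R u + h *\<^sub>R v) - f (z + h *\<^sub>R u) - f (z + h *\<^sub>R v) + f z
        - (h * h) *\<^sub>R ?D z) \<le> e * (h * h)"
      by (simp only:)
  qed (rule d)
qed

text \<open>The second difference is unchanged when u and v are exchanged, and both mixed
  derivatives are its limit after division by h^2.\<close>

lemma frechet_derivative_symmetric:
  fixes f :: "'b::real_normed_vector \<Rightarrow> complex"
  assumes V: "open V" "z \<in> V" and f: "smooth_on V f"
  shows "frechet_derivative (\<lambda>y. frechet_derivative f (at y) u) (at z) v =
    frechet_derivative (\<lambda>y. frechet_derivative f (at y) v) (at z) u" (is "?a = ?b")
proof -
  have "norm (?a - ?b) \<le> e" if "e > 0" for e :: real
  proof -
    have e: "e / 2 > 0" using that by simp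
    obtain d where d: "d > 0" "\<And>h. 0 < h \<Longrightarrow> h < d \<Longrightarrow>
        norm (f (z + h *\<^sub>R u + h *\<^sub>R v) - f (z + h *\<^sub>R u) - f (z + h *\<^sub>R v) + f z - (h * h) *\<^sub>R ?a) \<le> e / 2 * (h * h)"
      using second_difference_bound[OF V f e, of u v] by blast
    obtain d' where d': "d' > 0" "\<And>h. 0 < h \<Longrightarrow> h < d' \<Longrightarrow>
        norm (f (z + h *\<^sub>R v + h *\<^sub>R u) - f (z + h *\<^sub>R v) - f (z + h *\<^sub>R u) + f z - (h * h) *\<^sub>R ?b) \<le> e / 2 * (h * h)"
      using second_difference_bound[OF V f e, of v u] by blast
    define h where "h = min d d' / 2"
    have h: "0 < h" "h < d" "h < d'" using d(1) d'(1) by (auto simp: h_def)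
    define X where "X = f (z + h *\<^sub>R u + h *\<^sub>R v) - f (z + h *\<^sub>R u) - f (z + h *\<^sub>R v) + f z"
    have 1: "norm (X - (h * h) *\<^sub>R ?a) \<le> e / 2 * (h * h)" using d(2)[OF h(1,2)] by (simp add: X_def)
    have 2: "norm (X - (h * h) *\<^sub>R ?b) \<le> e / 2 * (h * h)"
      using d'(2)[OF h(1,3)] by (simp add: X_def algebra_simps)
    have "norm ((h * h) *\<^sub>R (?a - ?b)) = norm ((X - (h * h) *\<^sub>R ?b) - (X - (h * h) *\<^sub>R ?a))"
      by (simp add: algebra_simps)
    also have "\<dots> \<le> e * (h * h)"
      using norm_triangle_ineq4[of "X - (h * h) *\<^sub>R ?b" "X - (h * h) *\<^sub>R ?a"] 1 2 by linarith
    finally have "(h * h) * norm (?a - ?b) \<le> (h * h) * e" using h by (simp add: mult.commute)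
    then show ?thesis using h by simp
  qed
  then have "norm (?a - ?b) \<le> 0" using field_le_epsilon[of "norm (?a - ?b)" 0] by simp
  then show ?thesis by simp
qed

section \<open>Alternating forms and the interior product\<close>

abbreviation swp :: "nat \<Rightarrow> nat \<Rightarrow> nat \<Rightarrow> nat" where
  "swp \<equiv> Transposition.transpose"

definition vcons :: "'b \<Rightarrow> (nat \<Rightarrow> 'b) \<Rightarrow> nat \<Rightarrow> 'b" (infixr "##" 65) where
  "x ## v = (\<lambda>i. case i of 0 \<Rightarrow> x | Suc j \<Rightarrow> v j)"

text \<open>The interior product with x. It drives the inductions on the degree, since a form of
  positive degree is determined by its contractions.\<close>

definition contr :: "'b \<Rightarrow> ((nat \<Rightarrow> 'b) \<Rightarrow> 'c) \<Rightarrow> (nat \<Rightarrow> 'b) \<Rightarrow> 'c" where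
  "contr x f = (\<lambda>v. f (x ## v))"

lemma vcons_simps [simp]: "(x ## v) 0 = x" "(x ## v) (Suc i) = v i"
  by (simp_all add: vcons_def)

lemma vcons_eta: "v 0 ## (\<lambda>i. v (Suc i)) = v"
  by (rule ext) (simp add: vcons_def split: nat.split)

lemma contr_apply: "contr x f v = f (x ## v)"
  by (simp add: contr_def)

lemma alternating_cong: "alternating k f \<Longrightarrow> (\<And>i. i < k \<Longrightarrow> v i = w i) \<Longrightarrow> f v = f w"
  unfolding alternating_def by blast

lemma alternating_linear: "alternating k f \<Longrightarrow> i < k \<Longrightarrow> linear (\<lambda>x. f (v(i := x)))"
  unfolding alternating_def by blast

lemma alternating_eq: "alternating k f \<Longrightarrow> i < k \<Longrightarrow> j < k \<Longrightarrow> i \<noteq> j \<Longrightarrow> v i = v j \<Longrightarrow> f v = 0"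
  unfolding alternating_def by blast

lemma alternating_0: "alternating 0 f \<longleftrightarrow> (\<forall>v w. f v = f w)"
  by (simp add: alternating_def)

lemma alternating_transpose:
  assumes f: "alternating k f" and ij: "i < k" "j < k" "i \<noteq> j"
  shows "f (v \<circ> swp i j) = - f v"
proof -
  define G where "G x y = f (v(i := x, j := y))" for x y
  have lx: "linear (\<lambda>x. G x y)" for y
  proof -
    have "(\<lambda>x. G x y) = (\<lambda>x. f ((v(j := y))(i := x)))"
      using ij by (simp add: G_def fun_upd_twist)
    then show ?thesis using alternating_linear[OF f ij(1), of "v(j := y)"] by simp
  qed
  have ly: "linear (\<lambda>y. G x y)" for x
    using alternating_linear[OF f ij(2), of "v(i := x)"] by (simp add: G_def)
  have z: "G x x = 0" for x
    unfolding G_def by (rule alternating_eq[OF f ij]) (use ij in simp)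
  have "0 = G (v i + v j) (v i + v j)" by (simp add: z)
  also have "\<dots> = G (v i) (v j) + G (v j) (v i)"
    unfolding linear_add[OF lx] linear_add[OF ly] by (simp only: z add_0_left add_0_right add.commute)
  finally have "G (v i) (v j) + G (v j) (v i) = 0" by (rule sym)
  then have "G (v j) (v i) = - G (v i) (v j)" by (simp only: eq_neg_iff_add_eq_0 add.commute)
  moreover have "v(i := v j, j := v i) = v \<circ> swp i j"
    using ij by (auto simp: Transposition.transpose_def)
  ultimately show ?thesis by (simp add: G_def)
qed

lemma alternating_permutes:
  assumes f: "alternating k f" and s: "\<sigma> permutes {..<k}"
  shows "f (v \<circ> \<sigma>) = of_int (sign \<sigma>) * f v"
  using finite_lessThan s
proof (induction rule: permutes_rev_induct)
  case (swap a b p)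
  have "permutation p" "permutation (swp a b)"
    using \<open>p permutes {..<k}\<close> finite_lessThan[of k] permutation_swap_id[of a b]
    unfolding permutation_permutes by blast+
  then have sg: "sign (p \<circ> swp a b) = - sign p"
    using swap by (simp add: sign_compose sign_swap_id)
  have "f (v \<circ> (p \<circ> swp a b)) = - f (v \<circ> p)"
    unfolding o_assoc by (rule alternating_transpose[OF f]) (use swap(1,2,3) in auto)
  then show ?case unfolding sg swap.IH by (simp only: of_int_minus mult_minus_left)
qed simp

lemma vcons_update: "(x ## v)(Suc i := y) = x ## v(i := y)" "(x ## v)(0 := y) = y ## v"
  by (auto simp: vcons_def split: nat.split)

lemma alternating_contr: "alternating (Suc k) f \<Longrightarrow> alternating k (contr x f)"
  unfolding alternating_def[of k]
proof (intro conjI allI impI)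
  assume f: "alternating (Suc k) f"
  show "contr x f v = contr x f w" if "\<forall>i<k. v i = w i" for v w
    unfolding contr_def by (rule alternating_cong[OF f]) (use that in \<open>auto simp: vcons_def split: nat.split\<close>)
  show "linear (\<lambda>y. contr x f (v(i := y)))" if "i < k" for v i
    using alternating_linear[OF f, of "Suc i" "x ## v"] that by (simp add: contr_def vcons_update)
  show "contr x f v = 0" if "i < k \<and> j < k \<and> i \<noteq> j \<and> v i = v j" for v i j
    unfolding contr_def using alternating_eq[OF f, of "Suc i" "Suc j" "x ## v"] that by simp
qed

lemma alternating_vcons_linear: "alternating (Suc k) f \<Longrightarrow> linear (\<lambda>x. f (x ## v))"
  using alternating_linear[of "Suc k" f 0 "0 ## v"] by (simp add: vcons_update)

lemma alternating_vcons_twice: "alternating (Suc (Suc k)) f \<Longrightarrow> f (x ## x ## v) = 0"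
  by (rule alternating_eq[of _ _ 0 "Suc 0"]) auto

text \<open>A converse to \<open>alternating_contr\<close>. A repetition among the later slots is
  excluded by the contraction; one that involves the first slot is moved to the first two slots by a
  transposition inside the contraction.\<close>

lemma alternating_SucI:
  assumes c: "\<And>x. alternating k (contr x f)" and lin: "\<And>v. linear (\<lambda>x. f (x ## v))"
    and eq: "\<And>x v. 0 < k \<Longrightarrow> f (x ## x ## v) = 0"
  shows "alternating (Suc k) f"
  unfolding alternating_def
proof (intro conjI allI impI)
  have e: "f v = contr (v 0) f (\<lambda>i. v (Suc i))" for v by (simp add: contr_def vcons_eta)
  show "f v = f w" if "\<forall>i<Suc k. v i = w i" for v w
  proof -
    have "v 0 = w 0" using that by simp
    then show ?thesis unfolding e[of v] e[of w] by (simp only:) (rule alternating_cong[OF c], use that in simp)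
  qed
  show "linear (\<lambda>x. f (v(i := x)))" if "i < Suc k" for v i
  proof (cases i)
    case 0
    have "v(0 := x) = x ## (\<lambda>i. v (Suc i))" for x
      by (rule ext) (simp add: vcons_def split: nat.split)
    then show ?thesis unfolding 0 using lin by (simp only:)
  next
    case (Suc j)
    have "v(i := x) = v 0 ## (\<lambda>i. v (Suc i))(j := x)" for x
      unfolding Suc by (rule ext) (simp add: vcons_def split: nat.split)
    moreover have "linear (\<lambda>x. contr (v 0) f ((\<lambda>i. v (Suc i))(j := x)))"
      using alternating_linear[OF c, of j "v 0"] that Suc by simp
    ultimately show ?thesis unfolding contr_def by (simp only:)
  qed
  have zero: "f v = 0" if v: "v 0 = v (Suc j)" and j: "j < k" for v j
  proof (cases j)
    case 0
    have "v = v 0 ## v 0 ## (\<lambda>i. v (Suc (Suc i)))"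
      using v 0 vcons_eta[of v] vcons_eta[of "\<lambda>i. v (Suc i)"] by simp
    then have "f v = f (v 0 ## v 0 ## (\<lambda>i. v (Suc (Suc i))))" by (rule arg_cong)
    also have "\<dots> = 0" using eq j by simp
    finally show ?thesis .
  next
    case (Suc l)
    have "f v = - contr (v 0) f ((\<lambda>i. v (Suc i)) \<circ> swp 0 j)"
      unfolding e[of v] using alternating_transpose[OF c, of 0 j "v 0" "\<lambda>i. v (Suc i)"] j Suc by simp
    also have "v 0 ## ((\<lambda>i. v (Suc i)) \<circ> swp 0 j) = v 0 ## v 0 ## (\<lambda>i. ((\<lambda>i. v (Suc i)) \<circ> swp 0 j) (Suc i))"
      by (rule ext) (auto simp: vcons_def v split: nat.split)
    then have "contr (v 0) f ((\<lambda>i. v (Suc i)) \<circ> swp 0 j) = 0"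
      unfolding contr_def using eq j by simp
    finally show ?thesis by simp
  qed
  show "f v = 0" if ij: "i < Suc k \<and> j < Suc k \<and> i \<noteq> j \<and> v i = v j" for v i j
  proof -
    consider a where "i = 0" "j = Suc a" | a where "j = 0" "i = Suc a" | a b where "i = Suc a" "j = Suc b"
      using ij by (cases i; cases j) auto
    then show ?thesis
    proof cases
      case (3 a b)
      then show ?thesis unfolding e[of v] using alternating_eq[OF c, of a b] ij by auto
    next
      case (1 a)
      then show ?thesis using zero[of v a] ij by simp
    next
      case (2 a)
      then show ?thesis using zero[of v a] ij by simp
    qed
  qed
qed

definition vinsert :: "nat \<Rightarrow> 'b \<Rightarrow> (nat \<Rightarrow> 'b) \<Rightarrow> nat \<Rightarrow> 'b" where
  "vinsert i x v = (\<lambda>j. if j < i then v j else if j = i then x else v (j - 1))"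

text \<open>x travels from position i to the front by i adjacent transpositions.\<close>

lemma alternating_vinsert:
  assumes f: "alternating (Suc k) f" "i \<le> k"
  shows "f (vinsert i x v) = (- 1) ^ i * f (x ## v)"
  using f(2)
proof (induction i)
  case 0
  have "vinsert 0 x v = x ## v" by (rule ext) (auto simp: vinsert_def vcons_def split: nat.split)
  then show ?case by simp
next
  case (Suc i)
  have "vinsert (Suc i) x v = vinsert i x v \<circ> swp i (Suc i)"
    by (rule ext) (auto simp: vinsert_def Transposition.transpose_def)
  then have "f (vinsert (Suc i) x v) = - f (vinsert i x v)"
    using alternating_transpose[OF f(1), of i "Suc i"] Suc.prems by simp
  then show ?case using Suc by simp
qed

section \<open>The wedge product of alternating forms\<close>

text \<open>Permutations are sorted by the position b that they send to 0; undoing the transposition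
  of 0 and b leaves a permutation of the other N entries. The inverses appear because
  \<open>sum_over_permutations_insert\<close> puts the transposition on the left.\<close>

lemma sum_permutes_Suc:
  fixes h :: "(nat \<Rightarrow> nat) \<Rightarrow> complex"
  shows "(\<Sum>\<sigma> | \<sigma> permutes {..<Suc N}. h \<sigma>) =
    (\<Sum>b<Suc N. \<Sum>\<tau> | \<tau> permutes {..<N}. h (map_permutation {..<N} Suc \<tau> \<circ> swp 0 b))"
proof -
  have ins: "{..<Suc N} = insert 0 {1..<Suc N}" by auto
  have bij: "bij_betw Suc {..<N} {1..<Suc N}"
    by (rule bij_betwI[where g="\<lambda>i. i - 1"]) auto
  have bij': "bij_betw (\<lambda>i. i - 1) {1..<Suc N} {..<N}"
    by (rule bij_betwI[where g=Suc]) auto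
  have inv: "inv (swp 0 b \<circ> q) = inv q \<circ> swp 0 b" if "q permutes {1..<Suc N}" for b q
    using o_inv_distrib[of "swp 0 b" q] permutes_bij[OF that] by simp
  have "(\<Sum>\<sigma> | \<sigma> permutes {..<Suc N}. h \<sigma>) = (\<Sum>\<sigma> | \<sigma> permutes {..<Suc N}. h (inv \<sigma>))"
    by (rule sum_permutations_inverse)
  also have "\<dots> = (\<Sum>b<Suc N. \<Sum>q | q permutes {1..<Suc N}. h (inv (swp 0 b \<circ> q)))"
    unfolding ins by (rule sum_over_permutations_insert) auto
  also have "\<dots> = (\<Sum>b<Suc N. \<Sum>q | q permutes {1..<Suc N}. h (inv q \<circ> swp 0 b))"
    by (intro sum.cong refl) (simp only: mem_Collect_eq inv)
  also have "\<dots> = (\<Sum>b<Suc N. \<Sum>q | q permutes {1..<Suc N}. h (q \<circ> swp 0 b))"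
    by (rule sum.cong[OF refl]) (rule sum_permutations_inverse[symmetric])
  also have "\<dots> = (\<Sum>b<Suc N. \<Sum>\<tau> | \<tau> permutes {..<N}. h (map_permutation {..<N} Suc \<tau> \<circ> swp 0 b))"
  proof (rule sum.cong[OF refl])
    fix b
    show "(\<Sum>q | q permutes {1..<Suc N}. h (q \<circ> swp 0 b)) =
      (\<Sum>\<tau> | \<tau> permutes {..<N}. h (map_permutation {..<N} Suc \<tau> \<circ> swp 0 b))"
    proof (rule sum.reindex_bij_witness[where i="map_permutation {..<N} Suc"
          and j="map_permutation {1..<Suc N} (\<lambda>i. i - 1)"])
      fix q assume q: "q \<in> {q. q permutes {1..<Suc N}}"
      then show q': "map_permutation {..<N} Suc (map_permutation {1..<Suc N} (\<lambda>i. i - 1) q) = q"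
        using map_permutation_compose_inv[OF bij', of q Suc] by auto
      show "map_permutation {1..<Suc N} (\<lambda>i. i - 1) q \<in> {q. q permutes {..<N}}"
        using map_permutation_permutes[OF bij'] q by auto
      show "h (map_permutation {..<N} Suc (map_permutation {1..<Suc N} (\<lambda>i. i - 1) q) \<circ> swp 0 b) = h (q \<circ> swp 0 b)"
        by (simp only: q')
    next
      fix \<tau> assume t: "\<tau> \<in> {q. q permutes {..<N}}"
      then show "map_permutation {1..<Suc N} (\<lambda>i. i - 1) (map_permutation {..<N} Suc \<tau>) = \<tau>"
        using map_permutation_compose_inv[OF bij, of \<tau> "\<lambda>i. i - 1"] by auto
      show "map_permutation {..<N} Suc \<tau> \<in> {q. q permutes {1..<Suc N}}"
        using map_permutation_permutes[OF bij] t by auto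
    qed
  qed
  finally show ?thesis .
qed

lemma sum_permutes_vcons:
  fixes F :: "(nat \<Rightarrow> 'b) \<Rightarrow> complex"
  shows "(\<Sum>\<sigma> | \<sigma> permutes {..<Suc N}. of_int (sign \<sigma>) * F ((x ## v) \<circ> \<sigma>)) =
    (\<Sum>b<Suc N. (if b = 0 then 1 else - 1) *
      (\<Sum>\<tau> | \<tau> permutes {..<N}. of_int (sign \<tau>) * F ((x ## (v \<circ> \<tau>)) \<circ> swp 0 b)))"
  unfolding sum_permutes_Suc sum_distrib_left
proof (intro sum.cong refl)
  fix b \<tau> assume t: "\<tau> \<in> {\<tau>. \<tau> permutes {..<N}}"
  let ?l = "map_permutation {..<N} Suc \<tau>"
  have l: "?l permutes Suc ` {..<N}"
    by (rule map_permutation_permutes[OF inj_on_imp_bij_betw]) (use t in simp_all)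
  then have "permutation ?l" unfolding permutation_permutes using finite_imageI[OF finite_lessThan] by blast
  moreover have "sign ?l = sign \<tau>" by (rule sign_map_permutation) (use t in simp_all)
  ultimately have sg: "sign (?l \<circ> swp 0 b) = (if b = 0 then 1 else - 1) * sign \<tau>"
    by (simp only: sign_compose permutation_swap_id sign_swap_id) simp
  have "(x ## v) (?l i) = (x ## (v \<circ> \<tau>)) i" for i
  proof (cases i)
    case 0
    have "?l 0 = 0" by (rule permutes_not_in[OF l]) auto
    then show ?thesis unfolding 0 by simp
  next
    case (Suc j)
    show ?thesis
    proof (cases "j < N")
      case True
      then have "?l (Suc j) = Suc (\<tau> j)" by (intro map_permutation_apply) auto
      then show ?thesis unfolding Suc by simp
    next
      case False
      have "\<tau> j = j" by (rule permutes_not_in[of _ "{..<N}"]) (use t False in auto)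
      moreover have "?l (Suc j) = Suc j" by (rule permutes_not_in[OF l]) (use False in auto)
      ultimately show ?thesis unfolding Suc by simp
    qed
  qed
  then have "(x ## v) \<circ> ?l = x ## (v \<circ> \<tau>)" unfolding o_def by (rule ext)
  then have "(x ## v) \<circ> (?l \<circ> swp 0 b) = (x ## (v \<circ> \<tau>)) \<circ> swp 0 b" by (simp only: o_assoc)
  then show "of_int (sign (?l \<circ> swp 0 b)) * F ((x ## v) \<circ> (?l \<circ> swp 0 b)) =
    (if b = 0 then 1 else - 1) * (of_int (sign \<tau>) * F ((x ## (v \<circ> \<tau>)) \<circ> swp 0 b))"
    by (simp only: sg of_int_mult) simp
qed

text \<open>The interior product is an antiderivation. In the sum over permutations x lands in a
  slot of f or in a slot of g; within each group all positions contribute equally because f and g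
  alternate, which turns (p - 1)! into p! and (q - 1)! into q!. Most later facts on wedge products
  are inductions through this formula.\<close>

lemma alt_wedge_contr:
  assumes f: "alternating p f" and g: "alternating q g" and N: "p + q = Suc N"
  shows "alt_wedge p q f g (x ## v) =
    (if p = 0 then 0 else alt_wedge (p - 1) q (contr x f) g v) +
    (if q = 0 then 0 else (- 1) ^ p * alt_wedge p (q - 1) f (contr x g) v)"
proof -
  define F where "F w = f w * g (\<lambda>i. w (p + i))" for w
  define P where "P b = (if b = 0 then 1 else - 1) *
      (\<Sum>\<tau> | \<tau> permutes {..<N}. of_int (sign \<tau>) * F ((x ## (v \<circ> \<tau>)) \<circ> swp 0 b))" for b
  have W: "alt_wedge p q f g (x ## v) = (\<Sum>b<p + q. P b) / (fact p * fact q)"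
  proof -
    have "(\<Sum>\<sigma> | \<sigma> permutes {..<p + q}. of_int (sign \<sigma>) * f (\<lambda>i. (x ## v) (\<sigma> i)) * g (\<lambda>i. (x ## v) (\<sigma> (p + i)))) =
      (\<Sum>\<sigma> | \<sigma> permutes {..<Suc N}. of_int (sign \<sigma>) * F ((x ## v) \<circ> \<sigma>))"
      by (simp only: F_def o_def mult.assoc N)
    also have "\<dots> = (\<Sum>b<p + q. P b)" unfolding sum_permutes_vcons P_def N ..
    finally show ?thesis by (simp only: alt_wedge_def)
  qed
  have low: "P b = fact (p - 1) * fact q * alt_wedge (p - 1) q (contr x f) g v" if b: "b < p" for b
  proof -
    have N': "p - 1 + q = N" using N b by simp
    have eq: "F ((x ## (v \<circ> \<tau>)) \<circ> swp 0 b) =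
      (if b = 0 then 1 else - 1) * (contr x f (\<lambda>i. v (\<tau> i)) * g (\<lambda>i. v (\<tau> (p - 1 + i))))" for \<tau>
    proof -
      have 1: "f ((x ## (v \<circ> \<tau>)) \<circ> swp 0 b) = (if b = 0 then 1 else - 1) * f (x ## (v \<circ> \<tau>))"
      proof (cases "b = 0")
        case False
        then show ?thesis using alternating_transpose[OF f, of 0 b "x ## (v \<circ> \<tau>)"] b by simp
      qed simp
      have 2: "(\<lambda>i. ((x ## (v \<circ> \<tau>)) \<circ> swp 0 b) (p + i)) = (\<lambda>i. v (\<tau> (p - 1 + i)))"
      proof
        fix i
        have "swp 0 b (p + i) = Suc (p - 1 + i)" using b by (simp add: Transposition.transpose_def)
        then show "((x ## (v \<circ> \<tau>)) \<circ> swp 0 b) (p + i) = v (\<tau> (p - 1 + i))" by simp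
      qed
      show ?thesis unfolding F_def 1 2 contr_def by (simp add: o_def)
    qed
    have "P b = (\<Sum>\<tau> | \<tau> permutes {..<N}. of_int (sign \<tau>) * (contr x f (\<lambda>i. v (\<tau> i)) * g (\<lambda>i. v (\<tau> (p - 1 + i)))))"
      unfolding P_def eq sum_distrib_left by (intro sum.cong refl) simp
    also have "\<dots> = fact (p - 1) * fact q * alt_wedge (p - 1) q (contr x f) g v"
      unfolding alt_wedge_def N' by (simp add: mult.assoc)
    finally show ?thesis .
  qed
  have high: "P (p + j) = (- 1) ^ p * (fact p * fact (q - 1) * alt_wedge p (q - 1) f (contr x g) v)" if j: "j < q" for j
  proof -
    have N': "p + (q - 1) = N" using N j by simp
    obtain q' where q': "q = Suc q'" using j by (cases q) auto
    define R where "R = (\<Sum>\<tau> | \<tau> permutes {..<N}. of_int (sign \<tau>) * (f (\<lambda>i. v (\<tau> i)) * contr x g (\<lambda>i. v (\<tau> (p + i)))))"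
    have sj: "g (w \<circ> swp 0 j) = (if j = 0 then 1 else - 1) * g w" for w
      using alternating_transpose[OF g, of 0 j w] j by (cases "j = 0") auto
    have R: "R = fact p * fact (q - 1) * alt_wedge p (q - 1) f (contr x g) v"
      unfolding alt_wedge_def N' R_def by (simp add: mult.assoc)
    have "P (p + j) = (- 1) ^ p * R"
    proof (cases p)
      case 0
      have "F ((x ## (v \<circ> \<tau>)) \<circ> swp 0 j) = (if j = 0 then 1 else - 1) * (f (\<lambda>i. v (\<tau> i)) * contr x g (\<lambda>i. v (\<tau> (p + i))))" for \<tau>
      proof -
        have 1: "f ((x ## (v \<circ> \<tau>)) \<circ> swp 0 j) = f (\<lambda>i. v (\<tau> i))"
          by (rule alternating_cong[OF f]) (simp add: 0)
        have 2: "(\<lambda>i. ((x ## (v \<circ> \<tau>)) \<circ> swp 0 j) (p + i)) = (x ## (v \<circ> \<tau>)) \<circ> swp 0 j"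
          using 0 by (simp add: o_def)
        show ?thesis unfolding F_def 1 2 sj contr_def using 0 by (simp add: o_def)
      qed
      then show ?thesis unfolding P_def R_def sum_distrib_left using 0
        by (intro sum.cong refl) simp_all
    next
      case (Suc p')
      \<comment> \<open>The swap of 0 with p + j brings the entry of index p' + j into the first
        slot of f. Composing with \<open>\<rho>\<close> puts the entry of index p' there instead, so
        f sees a cyclic shift of its own p arguments, with sign (-1)^p'. The sign of
        \<open>\<rho>\<close> cancels the one from moving x to the front inside g.\<close>
      define \<rho> where "\<rho> = swp p' (p' + j)"
      have \<rho>: "\<rho> permutes {..<N}" unfolding \<rho>_def by (rule permutes_swap_id) (use N j Suc in auto)
      have sr: "sign (\<tau> \<circ> \<rho>) = (if j = 0 then 1 else - 1) * sign \<tau>" if "\<tau> permutes {..<N}" for \<tau>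
      proof -
        have "permutation \<tau>" using that finite_lessThan unfolding permutation_permutes by blast
        then have "sign (\<tau> \<circ> \<rho>) = sign \<tau> * sign \<rho>" unfolding \<rho>_def by (rule sign_compose) (rule permutation_swap_id)
        then show ?thesis by (simp add: \<rho>_def sign_swap_id)
      qed
      have eq: "F ((x ## (v \<circ> (\<tau> \<circ> \<rho>))) \<circ> swp 0 (p + j)) =
         (if j = 0 then 1 else - 1) * ((- 1) ^ p' * (f (\<lambda>i. v (\<tau> i)) * contr x g (\<lambda>i. v (\<tau> (p + i)))))" for \<tau>
      proof -
        let ?w = "(x ## (v \<circ> (\<tau> \<circ> \<rho>))) \<circ> swp 0 (p + j)"
        have wf: "?w i = ((v \<circ> \<tau>) p' ## (v \<circ> \<tau>)) i" if "i < p" for i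
        proof (cases i)
          case 0
          have "swp 0 (p + j) 0 = Suc (p' + j)" using Suc by simp
          then show ?thesis using 0 by (simp add: \<rho>_def)
        next
          case (Suc l)
          then have "swp 0 (p + j) i = Suc l" using that by (simp add: Transposition.transpose_def)
          moreover have "\<rho> l = l" using that Suc \<open>p = Suc p'\<close> by (simp add: \<rho>_def Transposition.transpose_def)
          ultimately show ?thesis using Suc by simp
        qed
        have vi: "vinsert p' ((v \<circ> \<tau>) p') (v \<circ> \<tau>) i = (v \<circ> \<tau>) i" if "i < p" for i
          using that Suc by (auto simp: vinsert_def less_Suc_eq)
        have "f ?w = f ((v \<circ> \<tau>) p' ## (v \<circ> \<tau>))" by (rule alternating_cong[OF f wf])
        moreover have "f (vinsert p' ((v \<circ> \<tau>) p') (v \<circ> \<tau>)) = (- 1) ^ p' * f ((v \<circ> \<tau>) p' ## (v \<circ> \<tau>))"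
          by (rule alternating_vinsert) (use f Suc in auto)
        moreover have "f (vinsert p' ((v \<circ> \<tau>) p') (v \<circ> \<tau>)) = f (v \<circ> \<tau>)"
          by (rule alternating_cong[OF f vi])
        ultimately have "f (v \<circ> \<tau>) = (- 1) ^ p' * f ?w" by (simp only:)
        then have "(- 1) ^ p' * f (v \<circ> \<tau>) = f ?w" by (simp flip: mult.assoc power_mult_distrib)
        then have 1: "f ?w = (- 1) ^ p' * f (\<lambda>i. v (\<tau> i))"
          by (simp add: o_def)
        have 2: "(\<lambda>i. ?w (p + i)) = (x ## (\<lambda>i. v (\<tau> (p + i)))) \<circ> swp 0 j"
        proof
          fix i
          consider "i = j" | "i \<noteq> j" "i = 0" | "i \<noteq> j" "i \<noteq> 0" by blast
          then show "?w (p + i) = ((x ## (\<lambda>i. v (\<tau> (p + i)))) \<circ> swp 0 j) i"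
          proof cases
            case 1
            then show ?thesis by simp
          next
            case 2
            obtain j' where j': "j = Suc j'" using 2 by (cases j) auto
            have "swp 0 (p + j) (p + i) = Suc p'" using 2 Suc j' by (simp add: Transposition.transpose_def)
            then show ?thesis using 2 Suc j' by (simp add: \<rho>_def)
          next
            case 3
            obtain i' where i': "i = Suc i'" using 3 by (cases i) auto
            have "swp 0 (p + j) (p + i) = Suc (p' + i)" using 3 Suc by (simp add: Transposition.transpose_def)
            moreover have "\<rho> (p' + i) = p' + i" using 3 by (simp add: \<rho>_def Transposition.transpose_def)
            moreover have "swp 0 j i = Suc i'" using 3 i' by (simp add: Transposition.transpose_def)
            ultimately show ?thesis using i' Suc by simp
          qed
        qed
        show ?thesis unfolding F_def 1 2 sj contr_def by simp
      qed
      have "P (p + j) = - (\<Sum>\<tau> | \<tau> permutes {..<N}. of_int (sign \<tau>) * F ((x ## (v \<circ> \<tau>)) \<circ> swp 0 (p + j)))"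
        using Suc by (simp add: P_def)
      also have "\<dots> = - (\<Sum>\<tau> | \<tau> permutes {..<N}. of_int (sign (\<tau> \<circ> \<rho>)) * F ((x ## (v \<circ> (\<tau> \<circ> \<rho>))) \<circ> swp 0 (p + j)))"
        by (subst sum_permutations_compose_right[OF \<rho>]) (rule refl)
      also have "\<dots> = - (\<Sum>\<tau> | \<tau> permutes {..<N}. of_int (sign \<tau>) * ((- 1) ^ p' * (f (\<lambda>i. v (\<tau> i)) * contr x g (\<lambda>i. v (\<tau> (p + i))))))"
        by (rule arg_cong[where f=uminus], intro sum.cong refl) (simp add: eq sr)
      also have "\<dots> = (- 1) ^ p * R"
        unfolding R_def sum_distrib_left Suc by (simp add: sum_negf mult.left_commute)
      finally show ?thesis .
    qed
    then show ?thesis unfolding R .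
  qed
  have "(\<Sum>b<p + q. P b) = (\<Sum>b<p. P b) + (\<Sum>j<q. P (p + j))"
    by (induction q) (simp_all add: add.assoc)
  also have "(\<Sum>b<p. P b) = of_nat p * (fact (p - 1) * fact q * alt_wedge (p - 1) q (contr x f) g v)"
    using low by simp
  also have "of_nat p * (fact (p - 1) * fact q * alt_wedge (p - 1) q (contr x f) g v)
      = fact p * fact q * (if p = 0 then 0 else alt_wedge (p - 1) q (contr x f) g v)"
    by (cases p) simp_all
  also have "(\<Sum>j<q. P (p + j)) = of_nat q * ((- 1) ^ p * (fact p * fact (q - 1) * alt_wedge p (q - 1) f (contr x g) v))"
    using high by simp
  also have "of_nat q * ((- 1) ^ p * (fact p * fact (q - 1) * alt_wedge p (q - 1) f (contr x g) v))
      = fact p * fact q * (if q = 0 then 0 else (- 1) ^ p * alt_wedge p (q - 1) f (contr x g) v)"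
    by (cases q) simp_all
  finally show ?thesis unfolding W by (simp add: field_simps)
qed

lemma alt_wedge_0_left:
  assumes f: "alternating 0 f" and g: "alternating q g"
  shows "alt_wedge 0 q f g v = f v * g v"
proof -
  have "of_int (sign \<sigma>) * f (\<lambda>i. v (\<sigma> i)) * g (\<lambda>i. v (\<sigma> (0 + i))) = f v * g v" if "\<sigma> permutes {..<q}" for \<sigma>
  proof -
    have "f (\<lambda>i. v (\<sigma> i)) = f v" using f unfolding alternating_0 by blast
    moreover have "g (\<lambda>i. v (\<sigma> i)) = of_int (sign \<sigma>) * g v"
      using alternating_permutes[OF g that, of v] by (simp add: o_def)
    moreover have "(of_int (sign \<sigma>) :: complex) * of_int (sign \<sigma>) = 1"
      by (simp flip: of_int_mult)
    ultimately show ?thesis by (simp add: mult.left_commute mult.commute)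
  qed
  then have "(\<Sum>\<sigma> | \<sigma> permutes {..<0 + q}. of_int (sign \<sigma>) * f (\<lambda>i. v (\<sigma> i)) * g (\<lambda>i. v (\<sigma> (0 + i)))) = of_nat (fact q) * (f v * g v)"
    by (simp add: card_permutations)
  then show ?thesis by (simp add: alt_wedge_def)
qed

lemma alt_wedge_0_right:
  assumes f: "alternating p f" and g: "alternating 0 g"
  shows "alt_wedge p 0 f g v = f v * g v"
proof -
  have "of_int (sign \<sigma>) * f (\<lambda>i. v (\<sigma> i)) * g (\<lambda>i. v (\<sigma> (p + i))) = f v * g v" if "\<sigma> permutes {..<p}" for \<sigma>
  proof -
    have "g (\<lambda>i. v (\<sigma> (p + i))) = g v" using g unfolding alternating_0 by blast
    moreover have "f (\<lambda>i. v (\<sigma> i)) = of_int (sign \<sigma>) * f v"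
      using alternating_permutes[OF f that, of v] by (simp add: o_def)
    moreover have "(of_int (sign \<sigma>) :: complex) * of_int (sign \<sigma>) = 1"
      by (simp flip: of_int_mult)
    ultimately show ?thesis by (simp add: mult.left_commute mult.commute)
  qed
  then have "(\<Sum>\<sigma> | \<sigma> permutes {..<p + 0}. of_int (sign \<sigma>) * f (\<lambda>i. v (\<sigma> i)) * g (\<lambda>i. v (\<sigma> (p + i)))) = of_nat (fact p) * (f v * g v)"
    by (simp add: card_permutations)
  then show ?thesis by (simp add: alt_wedge_def)
qed

lemma alternatingI:
  assumes "\<And>v w. (\<And>i. i < k \<Longrightarrow> v i = w i) \<Longrightarrow> f v = f w"
    "\<And>v i. i < k \<Longrightarrow> linear (\<lambda>x. f (v(i := x)))"
    "\<And>v i j. i < k \<Longrightarrow> j < k \<Longrightarrow> i \<noteq> j \<Longrightarrow> v i = v j \<Longrightarrow> f v = 0"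
  shows "alternating k f"
  unfolding alternating_def using assms by blast

lemma alternating_zero: "alternating k (\<lambda>v. 0)"
  by (rule alternatingI) (simp_all add: linear_iff)

lemma alternating_add:
  assumes f: "alternating k f" and g: "alternating k g"
  shows "alternating k (\<lambda>v. f v + g v)"
proof (rule alternatingI)
  show "f v + g v = f w + g w" if "\<And>i. i < k \<Longrightarrow> v i = w i" for v w
    by (rule arg_cong2[where f="(+)", OF alternating_cong[OF f] alternating_cong[OF g]]) (rule that; assumption)+
  show "linear (\<lambda>x. f (v(i := x)) + g (v(i := x)))" if "i < k" for v i
    by (rule linear_compose_add[OF alternating_linear[OF f that] alternating_linear[OF g that]])
qed (simp add: alternating_eq[OF f] alternating_eq[OF g])

lemma linear_cmult: "linear f \<Longrightarrow> linear (\<lambda>x. (c::complex) * f x)"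
  by (simp add: linear_iff distrib_left)

lemma alternating_cmult:
  assumes f: "alternating k f"
  shows "alternating k (\<lambda>v. c * f v)"
proof (rule alternatingI)
  show "c * f v = c * f w" if "\<And>i. i < k \<Longrightarrow> v i = w i" for v w
    by (rule arg_cong[OF alternating_cong[OF f]]) (rule that)
  show "linear (\<lambda>x. c * f (v(i := x)))" if "i < k" for v i
    by (rule linear_cmult[OF alternating_linear[OF f that]])
qed (simp add: alternating_eq[OF f])

lemma alternating_diff: "alternating k f \<Longrightarrow> alternating k g \<Longrightarrow> alternating k (\<lambda>v. f v - g v)"
  using alternating_add[of k f "\<lambda>v. (-1) * g v"] alternating_cmult[of k g "-1"] by simp

lemma alternating_sum:
  "(\<And>i. i \<in> S \<Longrightarrow> alternating k (f i)) \<Longrightarrow> alternating k (\<lambda>v. \<Sum>i\<in>S. f i v)"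
  by (induction S rule: infinite_finite_induct) (simp_all add: alternating_zero alternating_add)

lemma alt_wedge_add_left: "alt_wedge p q (\<lambda>v. f v + f' v) g v = alt_wedge p q f g v + alt_wedge p q f' g v"
  unfolding alt_wedge_def by (simp only: distrib_left distrib_right sum.distrib add_divide_distrib)

lemma alt_wedge_add_right: "alt_wedge p q f (\<lambda>v. g v + g' v) v = alt_wedge p q f g v + alt_wedge p q f g' v"
  unfolding alt_wedge_def by (simp only: distrib_left distrib_right sum.distrib add_divide_distrib)

lemma alt_wedge_diff_left: "alt_wedge p q (\<lambda>v. f v - f' v) g v = alt_wedge p q f g v - alt_wedge p q f' g v"
  unfolding alt_wedge_def by (simp only: left_diff_distrib right_diff_distrib sum_subtractf diff_divide_distrib)

lemma alt_wedge_diff_right: "alt_wedge p q f (\<lambda>v. g v - g' v) v = alt_wedge p q f g v - alt_wedge p q f g' v"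
  unfolding alt_wedge_def by (simp only: left_diff_distrib right_diff_distrib sum_subtractf diff_divide_distrib)

lemma alt_wedge_cmult_left: "alt_wedge p q (\<lambda>v. c * f v) g v = c * alt_wedge p q f g v"
  unfolding alt_wedge_def times_divide_eq_right sum_distrib_left by (simp only: mult.assoc mult.left_commute[of c])

lemma alt_wedge_cmult_right: "alt_wedge p q f (\<lambda>v. c * g v) v = c * alt_wedge p q f g v"
  unfolding alt_wedge_def times_divide_eq_right sum_distrib_left by (simp only: mult.assoc mult.left_commute[of c])

lemma alt_wedge_zero_left: "alt_wedge p q (\<lambda>v. 0) g v = 0"
  by (simp add: alt_wedge_def)

lemma alt_wedge_zero_right: "alt_wedge p q f (\<lambda>v. 0) v = 0"
  by (simp add: alt_wedge_def)

lemma contr_twice: "alternating (Suc (Suc k)) f \<Longrightarrow> contr x (contr x f) = (\<lambda>v. 0)"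
  by (simp add: contr_def alternating_vcons_twice)

text \<open>Induction on p + q through \<open>alternating_SucI\<close> and the antiderivation rule.
  When the same x is inserted twice, the pure terms vanish by \<open>contr_twice\<close> and the two
  mixed terms cancel.\<close>

lemma alternating_alt_wedge:
  assumes "alternating p f" "alternating q g"
  shows "alternating (p + q) (alt_wedge p q f g)"
  using assms
proof (induction "p + q" arbitrary: p q f g)
  case 0
  then have pq: "p = 0" "q = 0" by auto
  have "f v = f w \<and> g v = g w" for v w
    using 0 pq alternating_cong[of 0 f v w] alternating_cong[of 0 g v w] by simp
  then show ?case unfolding pq add_0_right alternating_0 using alt_wedge_0_left[of f 0 g] 0 pq by metis
next
  case (Suc N)
  note rule = alt_wedge_contr[OF Suc.prems Suc.hyps(2)[symmetric]]
  have "alternating (Suc N) (alt_wedge p q f g)"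
  proof (rule alternating_SucI)
    have A: "alternating N (\<lambda>v. if p = 0 then 0 else alt_wedge (p - 1) q (contr x f) g v)" for x
    proof (cases p)
      case (Suc p')
      then show ?thesis
        using Suc.hyps(1)[of p' q "contr x f" g] Suc.hyps(2) Suc.prems alternating_contr[of p' f x] by simp
    qed (simp add: alternating_zero)
    have B: "alternating N (\<lambda>v. if q = 0 then 0 else (- 1) ^ p * alt_wedge p (q - 1) f (contr x g) v)" for x
    proof (cases q)
      case (Suc q')
      then show ?thesis
        using Suc.hyps(1)[of p q' f "contr x g"] Suc.hyps(2) Suc.prems alternating_contr[of q' g x]
        by (simp add: alternating_cmult)
    qed (simp add: alternating_zero)
    show "alternating N (contr x (alt_wedge p q f g))" for x
      using alternating_add[OF A B, of x x] unfolding rule[symmetric] contr_apply[symmetric] .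
    show "linear (\<lambda>x. alt_wedge p q f g (x ## v))" for v
    proof -
      have "linear (\<lambda>x. if p = 0 then 0 else alt_wedge (p - 1) q (contr x f) g v)"
      proof (cases p)
        case (Suc p')
        have l: "linear (\<lambda>x. contr x f w)" for w
          unfolding contr_def using alternating_vcons_linear Suc.prems(1) Suc by blast
        have "linear (\<lambda>x. alt_wedge p' q (contr x f) g v)"
        proof (rule linearI)
          show "alt_wedge p' q (contr (x + y) f) g v = alt_wedge p' q (contr x f) g v + alt_wedge p' q (contr y f) g v" for x y
          proof -
            have "contr (x + y) f = (\<lambda>w. contr x f w + contr y f w)" by (rule ext) (rule linear_add[OF l])
            then show ?thesis by (simp only: alt_wedge_add_left)
          qed
          show "alt_wedge p' q (contr (r *\<^sub>R x) f) g v = r *\<^sub>R alt_wedge p' q (contr x f) g v" for r x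
          proof -
            have "contr (r *\<^sub>R x) f = (\<lambda>w. of_real r * contr x f w)"
              by (rule ext) (subst linear_scale[OF l], rule scaleR_conv_of_real)
            then show ?thesis by (simp only: alt_wedge_cmult_left scaleR_conv_of_real[where x="alt_wedge _ _ _ _ _"])
          qed
        qed
        then show ?thesis using Suc by simp
      qed (simp add: linear_iff)
      moreover have "linear (\<lambda>x. if q = 0 then 0 else (- 1) ^ p * alt_wedge p (q - 1) f (contr x g) v)"
      proof (cases q)
        case (Suc q')
        have l: "linear (\<lambda>x. contr x g w)" for w
          unfolding contr_def using alternating_vcons_linear Suc.prems(2) Suc by blast
        have "linear (\<lambda>x. alt_wedge p q' f (contr x g) v)"
        proof (rule linearI)
          show "alt_wedge p q' f (contr (x + y) g) v = alt_wedge p q' f (contr x g) v + alt_wedge p q' f (contr y g) v" for x y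
          proof -
            have "contr (x + y) g = (\<lambda>w. contr x g w + contr y g w)" by (rule ext) (rule linear_add[OF l])
            then show ?thesis by (simp only: alt_wedge_add_right)
          qed
          show "alt_wedge p q' f (contr (r *\<^sub>R x) g) v = r *\<^sub>R alt_wedge p q' f (contr x g) v" for r x
          proof -
            have "contr (r *\<^sub>R x) g = (\<lambda>w. of_real r * contr x g w)"
              by (rule ext) (subst linear_scale[OF l], rule scaleR_conv_of_real)
            then show ?thesis by (simp only: alt_wedge_cmult_right scaleR_conv_of_real[where x="alt_wedge _ _ _ _ _"])
          qed
        qed
        then show ?thesis using Suc by (simp add: linear_cmult)
      qed (simp add: linear_iff)
      ultimately show ?thesis unfolding rule by (rule linear_compose_add)
    qed
    show "alt_wedge p q f g (x ## x ## v) = 0" if N: "0 < N" for x v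
    proof -
      obtain M where M: "N = Suc M" using N by (cases N) auto
      show ?thesis
      proof (cases p)
        case 0
        then have q: "q = Suc (Suc M)" using Suc.hyps(2) M by simp
        have "alt_wedge p q f g (x ## x ## v) = alt_wedge 0 (Suc M) f (contr x g) (x ## v)"
          unfolding rule by (simp add: 0 q)
        also have "\<dots> = alt_wedge 0 M f (contr x (contr x g)) v"
          using alt_wedge_contr[of 0 f "Suc M" "contr x g" M x v] Suc.prems 0 q alternating_contr[of "Suc M" g x] by simp
        finally show ?thesis using Suc.prems q by (simp add: contr_twice alt_wedge_zero_right)
      next
        case p: (Suc p')
        show ?thesis
        proof (cases q)
          case 0
          then have q: "p' = Suc M" using Suc.hyps(2) M p by simp
          have "alt_wedge p q f g (x ## x ## v) = alt_wedge (Suc M) 0 (contr x f) g (x ## v)"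
            unfolding rule by (simp add: 0 p q)
          also have "\<dots> = alt_wedge M 0 (contr x (contr x f)) g v"
            using alt_wedge_contr[of "Suc M" "contr x f" 0 g M x v] Suc.prems 0 q p alternating_contr[of "Suc M" f x] by simp
          finally show ?thesis using Suc.prems q p by (simp add: contr_twice alt_wedge_zero_left)
        next
          case q: (Suc q')
          have sum: "p' + Suc q' = Suc M" "Suc p' + q' = Suc M" using Suc.hyps(2) M p q by auto
          have cf: "alternating p' (contr x f)" and cg: "alternating q' (contr x g)"
            using Suc.prems p q alternating_contr by auto
          have 1: "alt_wedge p' (Suc q') (contr x f) g (x ## v) = (- 1) ^ p' * alt_wedge p' q' (contr x f) (contr x g) v"
          proof -
            have "p' = Suc r \<Longrightarrow> contr x (contr x f) = (\<lambda>v. 0)" for r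
              using contr_twice[of r f x] Suc.prems p by simp
            then show ?thesis using alt_wedge_contr[OF cf Suc.prems(2)[unfolded q] sum(1), of x v]
              by (cases p') (simp_all add: alt_wedge_zero_left)
          qed
          have 2: "alt_wedge (Suc p') q' f (contr x g) (x ## v) = alt_wedge p' q' (contr x f) (contr x g) v"
          proof -
            have "q' = Suc r \<Longrightarrow> contr x (contr x g) = (\<lambda>v. 0)" for r
              using contr_twice[of r g x] Suc.prems q by simp
            then show ?thesis using alt_wedge_contr[OF Suc.prems(1)[unfolded p] cg sum(2), of x v]
              by (cases q') (simp_all add: alt_wedge_zero_right)
          qed
          show ?thesis unfolding rule by (simp add: p q 1 2)
        qed
      qed
    qed
  qed
  then show ?case using Suc.hyps(2) by simp
qed

lemma alt_wedge_1_1: "alternating 1 f \<Longrightarrow> alternating 1 g \<Longrightarrow>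
    alt_wedge 1 1 f g (x ## y ## v) = f (x ## v) * g (y ## v) - g (x ## v) * f (y ## v)"
proof -
  assume f: "alternating 1 f" and g: "alternating 1 g"
  have c: "alternating 0 (contr x f)" "alternating 0 (contr x g)"
    using f g alternating_contr[of 0] by auto
  have "alt_wedge 1 1 f g (x ## y ## v) =
      alt_wedge 0 1 (contr x f) g (y ## v) - alt_wedge 1 0 f (contr x g) (y ## v)"
    using alt_wedge_contr[OF f g, of 1 x "y ## v"] by simp
  also have "\<dots> = f (x ## y ## v) * g (y ## v) - f (y ## v) * g (x ## y ## v)"
    using alt_wedge_0_left[OF c(1) g] alt_wedge_0_right[OF f c(2)] by (simp add: contr_def)
  also have "f (x ## y ## v) = f (x ## v)" by (rule alternating_cong[OF f]) simp
  also have "g (x ## y ## v) = g (x ## v)" by (rule alternating_cong[OF g]) simp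
  finally show ?thesis by (simp add: mult.commute)
qed

text \<open>Antisymmetry in the last two factors by induction on the degree of t. Working with the
  nested product directly avoids associativity and graded commutativity of the wedge
  product.\<close>

lemma alt_wedge_swap_1_forms:
  assumes t: "alternating p t" and u: "alternating 1 u" and w: "alternating 1 w"
  shows "alt_wedge (Suc p) 1 (alt_wedge p 1 t u) w v = - alt_wedge (Suc p) 1 (alt_wedge p 1 t w) u v"
  using t
proof (induction p arbitrary: t v)
  case 0
  have cu: "alternating 0 (contr x u)" "alternating 0 (contr x w)" for x using u w alternating_contr[of 0] by auto
  have a: "alternating 1 (alt_wedge 0 1 t u)" "alternating 1 (alt_wedge 0 1 t w)"
    using alternating_alt_wedge[OF 0 u] alternating_alt_wedge[OF 0 w] by simp_all
  have t: "t v = t w" for v w using 0 unfolding alternating_0 by blast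
  have "alt_wedge 1 1 (alt_wedge 0 1 t u) w (x ## y ## v) = - alt_wedge 1 1 (alt_wedge 0 1 t w) u (x ## y ## v)" for x y v
    unfolding alt_wedge_1_1[OF a(1) w] alt_wedge_1_1[OF a(2) u] alt_wedge_0_left[OF 0 u] alt_wedge_0_left[OF 0 w]
    using t[of "x ## v" "y ## v"] by (simp add: algebra_simps)
  from this[of "v 0" "v 1" "\<lambda>i. v (Suc (Suc i))"] show ?case
    using vcons_eta[of v] vcons_eta[of "\<lambda>i. v (Suc i)"] by simp
next
  case (Suc p)
  have a: "alternating (Suc (Suc p)) (alt_wedge (Suc p) 1 t u')" if "alternating 1 u'" for u'
    using alternating_alt_wedge[OF Suc.prems that] by simp
  have c: "alternating 0 (contr x u)" "alternating 0 (contr x w)" for x using u w alternating_contr[of 0] by auto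
  have e: "alt_wedge (Suc (Suc p)) 1 (alt_wedge (Suc p) 1 t u') w' (x ## v) =
     alt_wedge (Suc p) 1 (alt_wedge p 1 (contr x t) u') w' v
      + (- 1) ^ Suc p * (contr x u' v * alt_wedge (Suc p) 1 t w' v - contr x w' v * alt_wedge (Suc p) 1 t u' v)"
    if u': "alternating 1 u'" and w': "alternating 1 w'" for u' w' x v
  proof -
    have c: "alternating 0 (contr x u')" "alternating 0 (contr x w')" using u' w' alternating_contr[of 0] by auto
    have k: "contr x u' w = contr x u' v" for w using c(1) unfolding alternating_0 by blast
    have "contr x (alt_wedge (Suc p) 1 t u') = (\<lambda>v. alt_wedge p 1 (contr x t) u' v + (- 1) ^ Suc p * (contr x u' v * t v))"
      unfolding contr_def[of x "alt_wedge (Suc p) 1 t u'"]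
      using alt_wedge_contr[OF Suc.prems u', of "Suc p" x] alt_wedge_0_right[OF Suc.prems c(1)]
      by (simp add: fun_eq_iff mult.commute)
    also have "\<dots> = (\<lambda>w. alt_wedge p 1 (contr x t) u' w + (- 1) ^ Suc p * contr x u' v * t w)"
      by (intro ext arg_cong2[where f="(+)"] refl) (subst k, simp only: mult.assoc)
    finally have 1: "contr x (alt_wedge (Suc p) 1 t u') = (\<lambda>w. alt_wedge p 1 (contr x t) u' w + (- 1) ^ Suc p * contr x u' v * t w)" .
    have 2: "alt_wedge (Suc p) 1 (contr x (alt_wedge (Suc p) 1 t u')) w' v =
        alt_wedge (Suc p) 1 (alt_wedge p 1 (contr x t) u') w' v + (- 1) ^ Suc p * contr x u' v * alt_wedge (Suc p) 1 t w' v"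
      unfolding 1 alt_wedge_add_left alt_wedge_cmult_left ..
    have "alt_wedge (Suc (Suc p)) 1 (alt_wedge (Suc p) 1 t u') w' (x ## v) =
        alt_wedge (Suc p) 1 (contr x (alt_wedge (Suc p) 1 t u')) w' v + (- 1) ^ Suc (Suc p) * (alt_wedge (Suc p) 1 t u' v * contr x w' v)"
      using alt_wedge_contr[OF a[OF u'] w', of "Suc (Suc p)" x v] alt_wedge_0_right[OF a[OF u'] c(2), of v] by simp
    then show ?thesis unfolding 2 by (simp add: right_diff_distrib mult_ac)
  qed
  have "alt_wedge (Suc (Suc p)) 1 (alt_wedge (Suc p) 1 t u) w (x ## v) = - alt_wedge (Suc (Suc p)) 1 (alt_wedge (Suc p) 1 t w) u (x ## v)" for x v
    unfolding e[OF u w] e[OF w u] unfolding Suc.IH[OF alternating_contr[OF Suc.prems], of x v] by (simp add: algebra_simps)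
  from this[of "v 0" "\<lambda>i. v (Suc i)"] show ?case unfolding vcons_eta .
qed

section \<open>The exterior derivative in local coordinates\<close>

text \<open>The formula of \<open>ext_d\<close> for one local expression, without charts, so that it
  applies to pull-backs and to forms on the whole coordinate space.\<close>

definition dloc :: "nat \<Rightarrow> (complex ^ 'n \<Rightarrow> 'n::finite altform) \<Rightarrow> complex ^ 'n \<Rightarrow> 'n altform" where
  "dloc k u z v = (\<Sum>i\<le>k. (- 1) ^ i *
     frechet_derivative (\<lambda>y. u y (\<lambda>j. if j < i then v j else v (Suc j))) (at z) (v i))"

text \<open>The Lie derivative along the constant vector field x.\<close>

definition dirv :: "complex ^ 'n \<Rightarrow> (complex ^ 'n \<Rightarrow> 'n::finite altform) \<Rightarrow> complex ^ 'n \<Rightarrow> 'n altform" where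
  "dirv x u z v = frechet_derivative (\<lambda>y. u y v) (at z) x"

definition sform :: "nat \<Rightarrow> (complex ^ 'n) set \<Rightarrow> (complex ^ 'n \<Rightarrow> 'n::finite altform) \<Rightarrow> bool" where
  "sform k V u \<longleftrightarrow> (\<forall>z\<in>V. alternating k (u z)) \<and> (\<forall>v. smooth_on V (\<lambda>z. u z v))"

lemma sform_alternating: "sform k V u \<Longrightarrow> z \<in> V \<Longrightarrow> alternating k (u z)"
  by (simp add: sform_def)

lemma sform_smooth: "sform k V u \<Longrightarrow> smooth_on V (\<lambda>z. u z v)"
  by (simp add: sform_def)

lemma sform_differentiable: "sform k V u \<Longrightarrow> z \<in> V \<Longrightarrow> (\<lambda>y. u y v) differentiable (at z)"
  using sform_smooth smooth_on_differentiable by blast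

lemma sform_subset: "sform k V u \<Longrightarrow> U \<subseteq> V \<Longrightarrow> sform k U u"
  unfolding sform_def using smooth_on_subset by blast

lemma sform_cong:
  assumes "open V" "\<And>z. z \<in> V \<Longrightarrow> u z = w z" "sform k V u"
  shows "sform k V w"
  unfolding sform_def
proof (intro conjI allI ballI)
  show "alternating k (w z)" if "z \<in> V" for z
    using sform_alternating[OF assms(3) that] assms(2)[OF that] by simp
  show "smooth_on V (\<lambda>z. w z v)" for v
    by (rule smooth_on_cong[OF assms(1) _ sform_smooth[OF assms(3), of v]]) (simp add: assms(2))
qed

lemma sform_contr: "sform (Suc k) V u \<Longrightarrow> sform k V (\<lambda>y. contr x (u y))"
  unfolding sform_def by (simp add: alternating_contr) (simp add: contr_def)

lemma sform_zero: "sform k V (\<lambda>z v. 0)"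
  by (simp add: sform_def alternating_zero)

lemma sform_add: "open V \<Longrightarrow> sform k V u \<Longrightarrow> sform k V w \<Longrightarrow> sform k V (\<lambda>z v. u z v + w z v)"
  by (simp add: sform_def alternating_add smooth_on_add)

lemma sform_diff: "open V \<Longrightarrow> sform k V u \<Longrightarrow> sform k V w \<Longrightarrow> sform k V (\<lambda>z v. u z v - w z v)"
  by (simp add: sform_def alternating_diff smooth_on_diff)

lemma sform_mult: "open V \<Longrightarrow> smooth_on V f \<Longrightarrow> sform k V w \<Longrightarrow> sform k V (\<lambda>z v. f z * w z v)"
  by (simp add: sform_def alternating_cmult smooth_on_mult)

lemma sform_cmult: "open V \<Longrightarrow> sform k V w \<Longrightarrow> sform k V (\<lambda>z v. c * w z v)"
  by (rule sform_mult) auto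

lemma sform_sum:
  "open V \<Longrightarrow> (\<And>i. i \<in> S \<Longrightarrow> sform k V (u i)) \<Longrightarrow> sform k V (\<lambda>z v. \<Sum>i\<in>S. u i z v)"
  by (simp add: sform_def alternating_sum smooth_on_sum)

lemma sform_wedge:
  assumes "open V" "sform p V u" "sform q V w"
  shows "sform (p + q) V (\<lambda>z. alt_wedge p q (u z) (w z))"
  unfolding sform_def
proof (intro conjI allI ballI)
  show "alternating (p + q) (alt_wedge p q (u z) (w z))" if "z \<in> V" for z
    by (rule alternating_alt_wedge[OF sform_alternating[OF assms(2) that] sform_alternating[OF assms(3) that]])
  show "smooth_on V (\<lambda>z. alt_wedge p q (u z) (w z) v)" for v
    unfolding alt_wedge_def divide_inverse
    by (intro smooth_on_mult smooth_on_sum smooth_on_const sform_smooth[OF assms(2)] sform_smooth[OF assms(3)] assms(1))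
qed

lemma sform_dirv:
  assumes V: "open V" and u: "sform k V u"
  shows "sform k V (dirv x u)"
  unfolding sform_def
proof (intro conjI allI ballI)
  show "smooth_on V (\<lambda>z. dirv x u z v)" for v
    unfolding dirv_def using sform_smooth[OF u] by (rule smooth_on_deriv)
  fix z assume z: "z \<in> V"
  note alt = sform_alternating[OF u]
  note diff = sform_differentiable[OF u z]
  show "alternating k (dirv x u z)"
  proof (rule alternatingI)
    show "dirv x u z v = dirv x u z w" if "\<And>i. i < k \<Longrightarrow> v i = w i" for v w
      unfolding dirv_def
      by (rule fun_cong[OF frechet_derivative_cong[OF V z alternating_cong[OF alt]]]) (use that in auto)
    show "dirv x u z v = 0" if "i < k" "j < k" "i \<noteq> j" "v i = v j" for v i j
      unfolding dirv_def
      by (rule frechet_derivative_zero_on[OF V z alternating_eq[OF alt that]])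
    show "linear (\<lambda>y. dirv x u z (v(i := y)))" if i: "i < k" for v i
    proof (rule linearI)
      fix a b :: "complex ^ 'a" and r
      have "dirv x u z (v(i := a + b)) = frechet_derivative (\<lambda>y. u y (v(i := a)) + u y (v(i := b))) (at z) x"
        unfolding dirv_def
        by (rule fun_cong[OF frechet_derivative_cong[OF V z linear_add[OF alternating_linear[OF alt i]]]])
      then show "dirv x u z (v(i := a + b)) = dirv x u z (v(i := a)) + dirv x u z (v(i := b))"
        by (simp only: frechet_derivative_add[OF diff diff] dirv_def)
      have "dirv x u z (v(i := r *\<^sub>R a)) = frechet_derivative (\<lambda>y. r *\<^sub>R u y (v(i := a))) (at z) x"
        unfolding dirv_def
        by (rule fun_cong[OF frechet_derivative_cong[OF V z linear_scale[OF alternating_linear[OF alt i]]]])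
      then show "dirv x u z (v(i := r *\<^sub>R a)) = r *\<^sub>R dirv x u z (v(i := a))"
        by (simp only: frechet_derivative_linear_comp[OF bounded_linear_scaleR_right diff] dirv_def)
    qed
  qed
qed

lemma dirv_contr: "dirv x (\<lambda>y. contr a (u y)) z v = dirv x u z (a ## v)"
  by (simp add: dirv_def contr_def)

lemma dloc_0: "dloc 0 u z (x ## v) = dirv x u z v"
  by (simp add: dloc_def dirv_def)

text \<open>Cartan's formula for a constant field: i_x d = L_x - d i_x. This recursion on the degree
  yields the basic properties of d.\<close>

lemma dloc_Suc: "dloc (Suc k) u z (x ## v) = dirv x u z v - dloc k (\<lambda>y. contr x (u y)) z v"
proof -
  have e: "(\<lambda>j. if j < Suc i then (x ## v) j else (x ## v) (Suc j)) = x ## (\<lambda>j. if j < i then v j else v (Suc j))" for i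
    by (rule ext) (auto simp: vcons_def split: nat.split)
  show ?thesis
    unfolding dloc_def sum.atMost_Suc_shift
    by (simp add: dirv_def e contr_def sum_negf[symmetric])
qed

lemma dloc_cong:
  assumes "open V" "z \<in> V" "\<And>y. y \<in> V \<Longrightarrow> u y = w y"
  shows "dloc k u z v = dloc k w z v"
  unfolding dloc_def
  by (intro sum.cong refl arg_cong2[where f="(*)"] fun_cong[OF frechet_derivative_cong[OF assms(1,2)]])
    (simp add: assms(3))

lemma dloc_add:
  assumes "sform p V u" "sform q V w" "z \<in> V"
  shows "dloc k (\<lambda>y v. u y v + w y v) z v = dloc k u z v + dloc k w z v"
  unfolding dloc_def sum.distrib[symmetric] distrib_left[symmetric]
  by (intro sum.cong refl arg_cong2[where f="(*)"] frechet_derivative_add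
      sform_differentiable[OF assms(1,3)] sform_differentiable[OF assms(2,3)])

lemma dloc_diff:
  assumes "sform p V u" "sform q V w" "z \<in> V"
  shows "dloc k (\<lambda>y v. u y v - w y v) z v = dloc k u z v - dloc k w z v"
  unfolding dloc_def sum_subtractf[symmetric] right_diff_distrib[symmetric]
  by (intro sum.cong refl arg_cong2[where f="(*)"] frechet_derivative_diff
      sform_differentiable[OF assms(1,3)] sform_differentiable[OF assms(2,3)])

lemma dloc_cmult:
  assumes "sform p V u" "z \<in> V"
  shows "dloc k (\<lambda>y v. c * u y v) z v = c * dloc k u z v"
proof -
  have "frechet_derivative (\<lambda>y. c * u y w) (at z) x = c * frechet_derivative (\<lambda>y. u y w) (at z) x" for w x
    by (intro frechet_derivative_cmult sform_differentiable[OF assms])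
  then show ?thesis by (simp only: dloc_def sum_distrib_left mult.left_commute)
qed

lemma dloc_zero: "dloc k (\<lambda>y v. 0) z v = 0"
  by (simp add: dloc_def frechet_derivative_const)

lemma dloc_sum:
  assumes "\<And>i. i \<in> S \<Longrightarrow> sform p V (u i)" "z \<in> V"
  shows "dloc k (\<lambda>y v. \<Sum>i\<in>S. u i y v) z v = (\<Sum>i\<in>S. dloc k (u i) z v)"
proof -
  have "frechet_derivative (\<lambda>y. \<Sum>i\<in>S. u i y w) (at z) x = (\<Sum>i\<in>S. frechet_derivative (\<lambda>y. u i y w) (at z) x)" for w x
    by (rule frechet_derivative_sum) (use sform_differentiable assms in blast)
  then show ?thesis by (simp only: dloc_def sum_distrib_left sum.swap[of _ S])
qed

lemma dirv_linear: "sform k V u \<Longrightarrow> z \<in> V \<Longrightarrow> linear (\<lambda>x. dirv x u z v)"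
  unfolding dirv_def using sform_differentiable linear_frechet_derivative by blast

text \<open>By Cartan's formula the contractions of du alternate by induction. On x, x, v the two
  directional derivatives cancel, and what remains is d of a double contraction with x, which is
  0.\<close>

lemma sform_dloc:
  assumes V: "open V" and u: "sform k V u"
  shows "sform (Suc k) V (dloc k u)"
  unfolding sform_def
proof (intro conjI allI ballI)
  show "smooth_on V (\<lambda>z. dloc k u z v)" for v
    unfolding dloc_def
    by (intro smooth_on_sum V smooth_on_mult smooth_on_const smooth_on_deriv sform_smooth[OF u])
  fix z assume z: "z \<in> V"
  show "alternating (Suc k) (dloc k u z)"
    using u
  proof (induction k arbitrary: u)
    case 0
    have "contr x (dloc 0 u z) = dirv x u z" for x by (rule ext) (simp add: contr_def dloc_0)
    then show ?case using sform_alternating[OF sform_dirv[OF V 0] z] dirv_linear[OF 0 z]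
      by (intro alternating_SucI) (simp_all add: dloc_0)
  next
    case (Suc k)
    have "contr x (dloc (Suc k) u z) = (\<lambda>v. dirv x u z v - dloc k (\<lambda>y. contr x (u y)) z v)" for x
      by (rule ext) (simp add: contr_def dloc_Suc)
    then have "alternating (Suc k) (contr x (dloc (Suc k) u z))" for x
      using alternating_diff[OF sform_alternating[OF sform_dirv[OF V Suc.prems] z] Suc.IH[OF sform_contr[OF Suc.prems]]]
      by (simp only:)
    moreover have "linear (\<lambda>x. dloc (Suc k) u z (x ## v))" for v
    proof -
      have l: "linear (\<lambda>x. u y (x ## w))" if "y \<in> V" for y w
        by (rule alternating_vcons_linear[OF sform_alternating[OF Suc.prems that]])
      have c: "sform k V (\<lambda>y. contr x (u y))" for x by (rule sform_contr[OF Suc.prems])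
      have "linear (\<lambda>x. dloc k (\<lambda>y. contr x (u y)) z v)"
      proof (rule linearI)
        fix a b :: "complex ^ 'a" and r
        have "dloc k (\<lambda>y. contr (a + b) (u y)) z v = dloc k (\<lambda>y v. contr a (u y) v + contr b (u y) v) z v"
          by (rule dloc_cong[OF V z]) (simp add: contr_def linear_add[OF l])
        then show "dloc k (\<lambda>y. contr (a + b) (u y)) z v = dloc k (\<lambda>y. contr a (u y)) z v + dloc k (\<lambda>y. contr b (u y)) z v"
          by (simp only: dloc_add[OF c c z])
        have "dloc k (\<lambda>y. contr (r *\<^sub>R a) (u y)) z v = dloc k (\<lambda>y v. of_real r * contr a (u y) v) z v"
          by (rule dloc_cong[OF V z], unfold contr_def, rule ext, subst linear_scale[OF l], assumption, rule scaleR_conv_of_real)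
        then show "dloc k (\<lambda>y. contr (r *\<^sub>R a) (u y)) z v = r *\<^sub>R dloc k (\<lambda>y. contr a (u y)) z v"
          by (simp only: dloc_cmult[OF c z] scaleR_conv_of_real[where x="dloc _ _ _ _"])
      qed
      then show ?thesis unfolding dloc_Suc by (rule linear_compose_sub[OF dirv_linear[OF Suc.prems z]])
    qed
    moreover have "dloc (Suc k) u z (x ## x ## v) = 0" for x v
    proof (cases k)
      case 0
      then show ?thesis by (simp add: dloc_Suc dloc_0 dirv_contr)
    next
      case (Suc k')
      have "dloc k' (\<lambda>y. contr x (contr x (u y))) z v = dloc k' (\<lambda>y v. 0) z v"
        by (rule dloc_cong[OF V z]) (rule contr_twice, use Suc.prems Suc sform_alternating in blast)
      then show ?thesis unfolding Suc by (simp add: dloc_Suc dirv_contr dloc_zero)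
    qed
    ultimately show ?case by (rule alternating_SucI)
  qed
qed

lemma dirv_wedge:
  assumes "sform p V u" "sform q V w" "z \<in> V"
  shows "dirv x (\<lambda>y. alt_wedge p q (u y) (w y)) z v =
    alt_wedge p q (dirv x u z) (w z) v + alt_wedge p q (u z) (dirv x w z) v"
proof -
  note du = sform_differentiable[OF assms(1,3)] and dw = sform_differentiable[OF assms(2,3)]
  have "((\<lambda>y. alt_wedge p q (u y) (w y) v) has_derivative
    (\<lambda>x. \<Sum>\<sigma> | \<sigma> permutes {..<p + q}.
       (of_int (sign \<sigma>) * u z (\<lambda>i. v (\<sigma> i)) * frechet_derivative (\<lambda>y. w y (\<lambda>i. v (\<sigma> (p + i)))) (at z) x
        + (of_int (sign \<sigma>) * frechet_derivative (\<lambda>y. u y (\<lambda>i. v (\<sigma> i))) (at z) x) * w z (\<lambda>i. v (\<sigma> (p + i))))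
         * inverse (fact p * fact q))) (at z)"
    unfolding alt_wedge_def divide_inverse sum_distrib_right
    by (intro has_derivative_sum has_derivative_mult_left has_derivative_mult has_derivative_mult_right
        du[unfolded frechet_derivative_works] dw[unfolded frechet_derivative_works])
  from frechet_derivative_eqI[OF this] show ?thesis
    unfolding dirv_def alt_wedge_def divide_inverse sum_distrib_right
    by (simp add: sum.distrib[symmetric] algebra_simps)
qed

lemma dirv_dloc_commute:
  assumes V: "open V" "z \<in> V" and u: "sform k V u"
  shows "dirv x (dloc k u) z v = dloc k (dirv x u) z v"
proof -
  have "dirv x (dloc k u) z v = (\<Sum>i\<le>k. frechet_derivative (\<lambda>y. (- 1) ^ i *
     frechet_derivative (\<lambda>y. u y (\<lambda>j. if j < i then v j else v (Suc j))) (at y) (v i)) (at z) x)"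
    unfolding dirv_def dloc_def
    by (intro frechet_derivative_sum smooth_on_differentiable[OF _ V(2)] smooth_on_mult V smooth_on_const
       smooth_on_deriv sform_smooth[OF u])
  also have "\<dots> = (\<Sum>i\<le>k. (- 1) ^ i * frechet_derivative (\<lambda>y.
     frechet_derivative (\<lambda>y. u y (\<lambda>j. if j < i then v j else v (Suc j))) (at y) (v i)) (at z) x)"
    by (intro sum.cong refl frechet_derivative_cmult smooth_on_differentiable[OF _ V(2)]
       smooth_on_deriv sform_smooth[OF u])
  also have "\<dots> = dloc k (dirv x u) z v"
    unfolding dloc_def dirv_def
    by (intro sum.cong refl arg_cong2[where f="(*)"] frechet_derivative_symmetric[OF V] sform_smooth[OF u])
  finally show ?thesis .
qed

text \<open>By Cartan's formula the contraction of ddu with x is L_x du - d(L_x u - d i_x u). The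
  first two terms cancel because L_x commutes with d, and the last one is the induction
  hypothesis.\<close>

lemma dloc_dloc:
  assumes V: "open V" "z \<in> V" and u: "sform k V u"
  shows "dloc (Suc k) (dloc k u) z v = 0"
  using u
proof (induction k arbitrary: u v)
  case 0
  have "dloc (Suc 0) (dloc 0 u) z (x ## y ## w) = 0" for x y w
  proof -
    have "dloc 0 (\<lambda>y. contr x (dloc 0 u y)) z (y ## w) = dloc 0 (dirv x u) z (y ## w)"
      by (rule dloc_cong[OF V]) (simp add: contr_def dloc_0)
    then show ?thesis unfolding dloc_Suc dirv_dloc_commute[OF V 0] by simp
  qed
  from this[of "v 0" "v 1" "\<lambda>i. v (Suc (Suc i))"] show ?case
    using vcons_eta[of v] vcons_eta[of "\<lambda>i. v (Suc i)"] by simp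
next
  case (Suc k)
  have c: "sform k V (\<lambda>y. contr x (u y))" for x by (rule sform_contr[OF Suc.prems])
  have "dloc (Suc (Suc k)) (dloc (Suc k) u) z (x ## w) = 0" for x w
  proof -
    have "dloc (Suc k) (\<lambda>y. contr x (dloc (Suc k) u y)) z w = dloc (Suc k) (\<lambda>y v. dirv x u y v - dloc k (\<lambda>y. contr x (u y)) y v) z w"
      by (rule dloc_cong[OF V], rule ext) (simp add: contr_apply dloc_Suc)
    also have "\<dots> = dloc (Suc k) (dirv x u) z w"
      unfolding dloc_diff[OF sform_dirv[OF V(1) Suc.prems] sform_dloc[OF V(1) c] V(2)] Suc.IH[OF c] by simp
    finally show ?thesis unfolding dloc_Suc[of "Suc k"] dirv_dloc_commute[OF V Suc.prems] by simp
  qed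
  from this[of "v 0" "\<lambda>i. v (Suc i)"] show ?case unfolding vcons_eta .
qed

text \<open>Both sides have the same contraction with every x: the left side by Cartan's formula and
  the product rule for \<open>dirv\<close>, the right side by the antiderivation rule; the terms of
  lower degree agree by induction on p + q.\<close>

lemma dloc_wedge:
  assumes V: "open V" "z \<in> V" and u: "sform p V u" and w: "sform q V w"
  shows "dloc (p + q) (\<lambda>y. alt_wedge p q (u y) (w y)) z v =
    alt_wedge (Suc p) q (dloc p u z) (w z) v + (- 1) ^ p * alt_wedge p (Suc q) (u z) (dloc q w z) v"
  using u w
proof (induction "p + q" arbitrary: p q u w v)
  case 0
  then have pq: "p = 0" "q = 0" by auto
  have u: "sform 0 V u" and w: "sform 0 V w" using 0 pq by auto
  have alt: "alternating 0 (u y)" "alternating 0 (w y)" if "y \<in> V" for y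
    using u w that by (simp_all add: sform_alternating)
  have du: "alternating 1 (dloc 0 u z)" and dw: "alternating 1 (dloc 0 w z)"
    using sform_alternating[OF sform_dloc[OF V(1) u] V(2)] sform_alternating[OF sform_dloc[OF V(1) w] V(2)] by simp_all
  have "dloc 0 (\<lambda>y. alt_wedge 0 0 (u y) (w y)) z (x ## v) =
      alt_wedge (Suc 0) 0 (dloc 0 u z) (w z) (x ## v) + alt_wedge 0 (Suc 0) (u z) (dloc 0 w z) (x ## v)" for x v
  proof -
    have k: "u z (x ## v) = u z v" "w z (x ## v) = w z v"
      using alt[OF V(2)] unfolding alternating_0 by blast+
    have "dloc 0 (\<lambda>y. alt_wedge 0 0 (u y) (w y)) z (x ## v) = alt_wedge 0 0 (dirv x u z) (w z) v + alt_wedge 0 0 (u z) (dirv x w z) v"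
      unfolding dloc_0 by (rule dirv_wedge[OF u w V(2)])
    also have "\<dots> = dirv x u z v * w z v + u z v * dirv x w z v"
      using alt_wedge_0_left[OF sform_alternating[OF sform_dirv[OF V(1) u, of x] V(2)] alt(2)[OF V(2)]]
        alt_wedge_0_left[OF alt(1)[OF V(2)] sform_alternating[OF sform_dirv[OF V(1) w, of x] V(2)]] by simp
    finally show ?thesis
      using alt_wedge_0_right[OF du alt(2)[OF V(2)]] alt_wedge_0_left[OF alt(1)[OF V(2)] dw] by (simp add: dloc_0 k)
  qed
  from this[of "v 0" "\<lambda>i. v (Suc i)"] show ?case unfolding vcons_eta pq by simp
next
  case (Suc N)
  note u = Suc.prems(1) and w = Suc.prems(2)
  note zu = sform_alternating[OF u V(2)] and zw = sform_alternating[OF w V(2)]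
  have du: "alternating (Suc p) (dloc p u z)" and dw: "alternating (Suc q) (dloc q w z)"
    using sform_alternating[OF sform_dloc[OF V(1) u] V(2)] sform_alternating[OF sform_dloc[OF V(1) w] V(2)] by simp_all
  have "dloc (p + q) (\<lambda>y. alt_wedge p q (u y) (w y)) z (x ## v) =
    alt_wedge (Suc p) q (dloc p u z) (w z) (x ## v) + (- 1) ^ p * alt_wedge p (Suc q) (u z) (dloc q w z) (x ## v)" for x v
  proof -
    define cu where "cu = (\<lambda>y. contr x (u y))"
    define cw where "cw = (\<lambda>y. contr x (w y))"
    define a where "a = (\<lambda>y v. if p = 0 then 0 else alt_wedge (p - 1) q (cu y) (w y) v)"
    define b where "b = (\<lambda>y v. if q = 0 then 0 else (- 1) ^ p * alt_wedge p (q - 1) (u y) (cw y) v)"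
    have cu: "sform (p - 1) V cu" if "p \<noteq> 0" using sform_contr[of "p - 1" V u x] u that by (simp add: cu_def)
    have cw: "sform (q - 1) V cw" if "q \<noteq> 0" using sform_contr[of "q - 1" V w x] w that by (simp add: cw_def)
    have sa: "sform N V a"
    proof (cases "p = 0")
      case False
      then have "p - 1 + q = N" using Suc.hyps(2) by simp
      then show ?thesis using sform_wedge[OF V(1) cu w] False by (simp add: a_def)
    qed (simp add: a_def sform_zero)
    have sb: "sform N V b"
    proof (cases "q = 0")
      case False
      then have "p + (q - 1) = N" using Suc.hyps(2) by simp
      then show ?thesis using sform_cmult[OF V(1) sform_wedge[OF V(1) u cw], of "(- 1) ^ p"] False by (simp add: b_def)
    qed (simp add: b_def sform_zero)
    have c: "contr x (alt_wedge p q (u y) (w y)) = (\<lambda>v. a y v + b y v)" if "y \<in> V" for y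
      unfolding contr_def a_def b_def cu_def cw_def
      using alt_wedge_contr[OF sform_alternating[OF u that] sform_alternating[OF w that] Suc.hyps(2)[symmetric], of x]
      by (simp only: contr_def)
    have da: "dloc N a z v = (if p = 0 then 0 else alt_wedge p q (dloc (p - 1) cu z) (w z) v
        + (- 1) ^ (p - 1) * alt_wedge (p - 1) (Suc q) (cu z) (dloc q w z) v)"
    proof (cases "p = 0")
      case False
      then have e: "p - 1 + q = N" using Suc.hyps(2) by simp
      show ?thesis using Suc.hyps(1)[OF e[symmetric] cu w, of v, unfolded e] False by (simp add: a_def)
    qed (simp add: a_def dloc_zero)
    have db: "dloc N b z v = (if q = 0 then 0 else (- 1) ^ p * (alt_wedge (Suc p) (q - 1) (dloc p u z) (cw z) v
        + (- 1) ^ p * alt_wedge p q (u z) (dloc (q - 1) cw z) v))"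
    proof (cases "q = 0")
      case False
      then have e: "p + (q - 1) = N" using Suc.hyps(2) by simp
      show ?thesis using Suc.hyps(1)[OF e[symmetric] u cw, of v, unfolded e] False
          dloc_cmult[OF sform_wedge[OF V(1) u cw] V(2), of N "(- 1) ^ p" v] by (simp add: b_def)
    qed (simp add: b_def dloc_zero)
    have L: "dloc (p + q) (\<lambda>y. alt_wedge p q (u y) (w y)) z (x ## v) =
        alt_wedge p q (dirv x u z) (w z) v + alt_wedge p q (u z) (dirv x w z) v - (dloc N a z v + dloc N b z v)"
    proof -
      have "dloc N (\<lambda>y. contr x (alt_wedge p q (u y) (w y))) z v = dloc N (\<lambda>y v. a y v + b y v) z v"
        by (rule dloc_cong[OF V c])
      then show ?thesis
        unfolding Suc.hyps(2)[symmetric] dloc_Suc dirv_wedge[OF u w V(2)] by (simp only: dloc_add[OF sa sb V(2)])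
    qed
    have cdu: "contr x (dloc p u z) = (\<lambda>v. dirv x u z v - (if p = 0 then 0 else dloc (p - 1) cu z v))"
    proof (cases p)
      case 0
      then show ?thesis by (simp add: fun_eq_iff contr_apply dloc_0)
    qed (simp add: fun_eq_iff contr_apply dloc_Suc cu_def)
    have cdw: "contr x (dloc q w z) = (\<lambda>v. dirv x w z v - (if q = 0 then 0 else dloc (q - 1) cw z v))"
    proof (cases q)
      case 0
      then show ?thesis by (simp add: fun_eq_iff contr_apply dloc_0)
    qed (simp add: fun_eq_iff contr_apply dloc_Suc cw_def)
    have R1: "alt_wedge (Suc p) q (dloc p u z) (w z) (x ## v) =
        alt_wedge p q (contr x (dloc p u z)) (w z) v
        - (if q = 0 then 0 else (- 1) ^ p * alt_wedge (Suc p) (q - 1) (dloc p u z) (cw z) v)"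
      using alt_wedge_contr[OF du zw, of "p + q" x v] by (simp add: cw_def)
    have R2: "alt_wedge p (Suc q) (u z) (dloc q w z) (x ## v) =
        (if p = 0 then 0 else alt_wedge (p - 1) (Suc q) (cu z) (dloc q w z) v)
        + (- 1) ^ p * alt_wedge p q (u z) (contr x (dloc q w z)) v"
      using alt_wedge_contr[OF zu dw, of "p + q" x v] by (simp add: cu_def)
    have pw: "(- 1) ^ p * ((- 1) ^ p * t) = t" for t :: complex by (simp flip: mult.assoc power_add)
    have pp: "p \<noteq> 0 \<Longrightarrow> (- 1) ^ p = - ((- 1) ^ (p - 1) :: complex)" by (cases p) simp_all
    show ?thesis
      unfolding L R1 R2 cdu cdw alt_wedge_diff_left alt_wedge_diff_right da db
      by (cases "p = 0"; cases "q = 0")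
        (simp_all add: alt_wedge_zero_left alt_wedge_zero_right distrib_left right_diff_distrib pw, simp_all add: pp)
  qed
  from this[of "v 0" "\<lambda>i. v (Suc i)"] show ?case unfolding vcons_eta .
qed

section \<open>Holomorphic maps are smooth\<close>

text \<open>Differentiation under the integral with the derivative given direction by direction. In
  finite dimension continuity in each direction is continuity as a bounded linear map, which is what
  \<open>leibniz_rule\<close> asks for.\<close>

lemma has_derivative_integral_param:
  fixes F :: "'b::euclidean_space \<Rightarrow> 't::euclidean_space \<Rightarrow> complex"
  assumes U: "convex U" "open U" "x0 \<in> U"
    and d: "\<And>x t. x \<in> U \<Longrightarrow> t \<in> cbox a b \<Longrightarrow> ((\<lambda>x. F x t) has_derivative F' x t) (at x)"
    and c: "\<And>w. continuous_on (U \<times> cbox a b) (\<lambda>(x, t). F' x t w)"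
    and i: "\<And>x. x \<in> U \<Longrightarrow> F x integrable_on cbox a b"
  shows "((\<lambda>x. integral (cbox a b) (F x)) has_derivative (\<lambda>w. integral (cbox a b) (\<lambda>t. F' x0 t w))) (at x0)"
proof -
  define fx where "fx x t = Blinfun (F' x t)" for x t
  have ap: "blinfun_apply (fx x t) = F' x t" if "x \<in> U" "t \<in> cbox a b" for x t
    unfolding fx_def by (rule bounded_linear_Blinfun_apply[OF has_derivative_bounded_linear[OF d[OF that]]])
  have cfx: "continuous_on (U \<times> cbox a b) (\<lambda>(x, t). fx x t)"
  proof (rule continuous_on_blinfun_componentwise)
    fix w :: 'b
    show "continuous_on (U \<times> cbox a b) (\<lambda>xt. blinfun_apply (case xt of (x, t) \<Rightarrow> fx x t) w)"
      by (rule continuous_on_eq[OF c[of w]]) (auto simp: ap)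
  qed
  have "((\<lambda>x. integral (cbox a b) (F x)) has_derivative blinfun_apply (integral (cbox a b) (fx x0))) (at x0 within U)"
  proof (rule leibniz_rule[OF _ i cfx U(3,1)])
    show "((\<lambda>x. F x t) has_derivative blinfun_apply (fx x t)) (at x within U)" if "x \<in> U" "t \<in> cbox a b" for x t
      unfolding ap[OF that] by (rule has_derivative_at_withinI[OF d[OF that]])
  qed
  moreover have "blinfun_apply (integral (cbox a b) (fx x0)) = (\<lambda>w. integral (cbox a b) (\<lambda>t. F' x0 t w))"
  proof
    fix w
    have "continuous_on (cbox a b) (\<lambda>t. case (x0, t) of (x, t) \<Rightarrow> fx x t)"
      by (rule continuous_on_compose2[OF cfx]) (use U in \<open>auto intro!: continuous_intros\<close>)
    then have "fx x0 integrable_on cbox a b" by (intro integrable_continuous) simp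
    then have "blinfun_apply (integral (cbox a b) (fx x0)) w = integral (cbox a b) (\<lambda>t. blinfun_apply (fx x0 t) w)"
      by (rule blinfun_apply_integral)
    also have "\<dots> = integral (cbox a b) (\<lambda>t. F' x0 t w)"
      by (rule integral_cong) (simp add: ap[OF U(3)])
    finally show "blinfun_apply (integral (cbox a b) (fx x0)) w = integral (cbox a b) (\<lambda>t. F' x0 t w)" .
  qed
  ultimately show ?thesis using at_within_open[OF U(3,2)] by simp
qed

definition holo :: "(complex ^ 'n::finite) set \<Rightarrow> (complex ^ 'n \<Rightarrow> complex) \<Rightarrow> bool" where
  "holo V g \<longleftrightarrow> (\<forall>z\<in>V. \<exists>L. (g has_derivative L) (at z) \<and> (\<forall>a v. L (a *s v) = a * L v))"

lemma holo_frechet: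
  assumes "holo V g" "z \<in> V"
  shows "(g has_derivative frechet_derivative g (at z)) (at z)"
    "frechet_derivative g (at z) (a *s v) = a * frechet_derivative g (at z) v"
proof -
  obtain L where L: "(g has_derivative L) (at z)" "\<And>a v. L (a *s v) = a * L v"
    using assms unfolding holo_def by metis
  show "(g has_derivative frechet_derivative g (at z)) (at z)"
    "frechet_derivative g (at z) (a *s v) = a * frechet_derivative g (at z) v"
    using L by (simp_all only: frechet_derivative_eqI[OF L(1)])
qed

lemma bounded_linear_vec_scale_left: "bounded_linear (\<lambda>a. a *s (v::complex ^ 'n::finite))"
  by (rule linear_conv_bounded_linear[THEN iffD1, OF linearI]) (auto simp: vec_eq_iff algebra_simps)

text \<open>Cauchy's formula for the derivative at 0 of the function sending a to g(z + a v), on the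
  circle of radius r. With u = r exp(2 pi i t) the differential du = 2 pi i u dt cancels one of the
  two powers of u in the denominator.\<close>

lemma holo_cauchy:
  fixes g :: "complex ^ 'n::finite \<Rightarrow> complex"
  assumes V: "open V" and g: "holo V g" and r: "r > 0"
    and sub: "\<And>a. norm a \<le> r \<Longrightarrow> z + a *s v \<in> V"
  shows "frechet_derivative g (at z) v =
    integral {0..1} (\<lambda>t. g (z + (r * exp (2 * of_real pi * \<i> * of_real t)) *s v) / (r * exp (2 * of_real pi * \<i> * of_real t)))"
proof -
  define f where "f a = g (z + a *s v)" for a
  have fd: "(f has_field_derivative frechet_derivative g (at (z + a *s v)) v) (at a)" if "norm a \<le> r" for a
  proof -
    have "((\<lambda>a. z + a *s v) has_derivative (\<lambda>h. h *s v)) (at a)"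
      using has_derivative_add[OF has_derivative_const bounded_linear_imp_has_derivative[OF bounded_linear_vec_scale_left]]
      by fastforce
    from diff_chain_at[OF this holo_frechet(1)[OF g sub[OF that]]]
    show ?thesis unfolding has_field_derivative_def f_def o_def
      by (simp add: holo_frechet(2)[OF g sub[OF that]] mult.commute[of _ "frechet_derivative g (at (z + a *s v)) v"])
  qed
  have cont: "continuous_on (cball 0 r) f"
    by (rule continuous_at_imp_continuous_on) (auto intro!: DERIV_isCont[OF fd])
  have hol: "f holomorphic_on ball 0 r"
    unfolding holomorphic_on_def
  proof
    fix a :: complex assume "a \<in> ball 0 r"
    then have "norm a \<le> r" by (simp add: dist_norm)
    from fd[OF this] show "f field_differentiable at a within ball 0 r"
      using field_differentiable_at_within field_differentiable_def by blast
  qed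
  have "(f has_field_derivative (1 / (2 * of_real pi * \<i>) * contour_integral (circlepath 0 r) (\<lambda>u. f u / (u - 0)\<^sup>2))) (at 0)"
    by (rule Cauchy_derivative_integral_circlepath(2)[OF cont hol]) (use r in simp)
  from DERIV_unique[OF fd[of 0] this] r
  have "frechet_derivative g (at z) v = 1 / (2 * of_real pi * \<i>) * contour_integral (circlepath 0 r) (\<lambda>u. f u / u\<^sup>2)"
    by simp
  also have "\<dots> = 1 / (2 * of_real pi * \<i>) * integral {0..1} (\<lambda>t. (2 * of_real pi * \<i>) * (f (r * exp (2 * of_real pi * \<i> * of_real t)) / (r * exp (2 * of_real pi * \<i> * of_real t))))"
    unfolding contour_integral_integral
  proof (rule arg_cong2[where f="(*)", OF refl integral_cong])
    fix t :: real
    show "f (circlepath 0 r t) / (circlepath 0 r t)\<^sup>2 * vector_derivative (circlepath 0 r) (at t) =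
      (2 * of_real pi * \<i>) * (f (r * exp (2 * of_real pi * \<i> * of_real t)) / (r * exp (2 * of_real pi * \<i> * of_real t)))"
      unfolding vector_derivative_circlepath unfolding circlepath using r by (simp add: power2_eq_square)
  qed
  also have "\<dots> = integral {0..1} (\<lambda>t. f (r * exp (2 * of_real pi * \<i> * of_real t)) / (r * exp (2 * of_real pi * \<i> * of_real t)))"
    by (subst integral_mult_right) simp
  finally show ?thesis unfolding f_def .
qed

text \<open>Differentiating the Cauchy integral in z gives an integral that is again complex linear
  in the direction. This requires continuous first derivatives, which complex differentiability does
  not contain; \<open>contD\<close> reads their continuity off the same integral, where only g
  occurs.\<close>

lemma holo_deriv:
  fixes g :: "complex ^ 'n::finite \<Rightarrow> complex"
  assumes V: "open V" and g: "holo V g"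
  shows "holo V (\<lambda>z. frechet_derivative g (at z) v)"
proof -
  have contg: "continuous_on V g"
    by (rule continuous_at_imp_continuous_on) (use holo_frechet(1)[OF g] has_derivative_continuous in blast)
  define E where "E t = exp (2 * of_real pi * \<i> * of_real t)" for t :: real
  have contE: "continuous_on S E" for S unfolding E_def by (intro continuous_intros)
  have nE: "norm (E t) = 1" for t unfolding E_def by (simp add: norm_exp_eq_Re)
  \<comment> \<open>One radius must serve all z near z0, because the circle of integration is kept
    fixed while z varies.\<close>
  have main: "\<exists>\<rho> r. \<rho> > 0 \<and> r > 0 \<and> (\<forall>z\<in>ball z0 \<rho>. \<forall>a. norm a \<le> r \<longrightarrow> z + a *s w \<in> V)"
    if z0: "z0 \<in> V" for z0 w
  proof -
    obtain e where e: "e > 0" "ball z0 e \<subseteq> V" using V z0 openE by blast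
    have nw: "norm (a *s w) = norm a * norm w" for a :: complex
      unfolding norm_vec_def L2_set_def by (simp add: norm_mult power_mult_distrib sum_distrib_left[symmetric] real_sqrt_mult)
    define r where "r = e / 2 / (norm w + 1)"
    have "r > 0" using e(1) by (simp add: r_def add_nonneg_pos)
    moreover have "z + a *s w \<in> V" if "z \<in> ball z0 (e / 2)" "norm a \<le> r" for z a
    proof -
      have "norm (a *s w) \<le> r * norm w" unfolding nw using that(2) by (simp add: mult_right_mono)
      also have "\<dots> \<le> r * (norm w + 1)" using \<open>r > 0\<close> by simp
      also have "\<dots> = e / 2"
      proof -
        have "norm w + 1 \<noteq> 0" using norm_ge_zero[of w] by linarith
        then show ?thesis unfolding r_def using nonzero_eq_divide_eq[of "norm w + 1" "e / 2 / (norm w + 1)" "e / 2"] by blast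
      qed
      finally have "dist z0 (z + a *s w) < e"
        using that(1) norm_triangle_ineq4[of "z0 - z" "a *s w"] by (simp add: dist_norm algebra_simps)
      then show ?thesis using e(2) by auto
    qed
    ultimately show ?thesis using e(1) by (intro exI[of _ "e / 2"] exI[of _ r]) auto
  qed
  have contD: "continuous_on V (\<lambda>z. frechet_derivative g (at z) w)" for w
  proof (rule continuous_at_imp_continuous_on, rule ballI)
    fix z0 assume z0: "z0 \<in> V"
    obtain \<rho> r where r: "\<rho> > 0" "r > 0" "\<And>z a. z \<in> ball z0 \<rho> \<Longrightarrow> norm a \<le> r \<Longrightarrow> z + a *s w \<in> V"
      using main[OF z0, of w] by blast
    have "continuous_on (ball z0 \<rho>) (\<lambda>z. integral (cbox 0 1) (\<lambda>t. g (z + (r * E t) *s w) / (r * E t)))"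
    proof (rule integral_continuous_on_param)
      have "continuous_on (ball z0 \<rho> \<times> cbox 0 1) (\<lambda>(x, t). g (x + (r * E t) *s w))"
        unfolding case_prod_beta
        by (rule continuous_on_compose2[OF contg])
          (auto intro!: continuous_intros continuous_on_compose2[OF contE]
            bounded_linear.continuous_on[OF bounded_linear_vec_scale_left] r(3) simp: norm_mult nE r(2) less_imp_le)
      then show "continuous_on (ball z0 \<rho> \<times> cbox 0 1) (\<lambda>(x, t). g (x + (r * E t) *s w) / (r * E t))"
        unfolding case_prod_beta using r(2)
        by (intro continuous_on_divide) (auto intro!: continuous_intros continuous_on_compose2[OF contE] simp: E_def)
    qed
    then have "continuous_on (ball z0 \<rho>) (\<lambda>z. frechet_derivative g (at z) w)"
      by (rule continuous_on_eq) (use holo_cauchy[OF V g r(2)] r(3) in \<open>auto simp: E_def\<close>)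
    then show "isCont (\<lambda>z. frechet_derivative g (at z) w) z0"
      using r(1) by (simp add: continuous_on_eq_continuous_at)
  qed
  show ?thesis
    unfolding holo_def
  proof
    fix z0 assume z0: "z0 \<in> V"
    obtain \<rho> r where r: "\<rho> > 0" "r > 0" "\<And>z a. z \<in> ball z0 \<rho> \<Longrightarrow> norm a \<le> r \<Longrightarrow> z + a *s v \<in> V"
      using main[OF z0, of v] by blast
    define p where "p z t = z + (r * E t) *s v" for z t
    have pV: "p z t \<in> V" if "z \<in> ball z0 \<rho>" for z t
      unfolding p_def by (rule r(3)[OF that]) (simp add: norm_mult nE r(2) less_imp_le)
    have contp: "continuous_on (ball z0 \<rho> \<times> cbox 0 1) (\<lambda>xt. p (fst xt) (snd xt))"
      unfolding p_def by (auto intro!: continuous_intros continuous_on_compose2[OF contE]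
            bounded_linear.continuous_on[OF bounded_linear_vec_scale_left])
    have rE: "continuous_on S (\<lambda>t. inverse (r * E t))" for S
      using r(2) by (intro continuous_on_inverse) (auto intro!: continuous_intros contE simp: E_def)
    define D where "D w = integral (cbox 0 1) (\<lambda>t. inverse (r * E t) * frechet_derivative g (at (p z0 t)) w)" for w
    have "((\<lambda>z. integral (cbox 0 1) (\<lambda>t. inverse (r * E t) * g (p z t))) has_derivative D) (at z0)"
      unfolding D_def
    proof (rule has_derivative_integral_param[where U="ball z0 \<rho>" and F'="\<lambda>z t w. inverse (r * E t) * frechet_derivative g (at (p z t)) w"])
      show "((\<lambda>z. inverse (r * E t) * g (p z t)) has_derivative (\<lambda>w. inverse (r * E t) * frechet_derivative g (at (p z t)) w)) (at z)"
        if "z \<in> ball z0 \<rho>" for z t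
      proof -
        have "((\<lambda>z. p z t) has_derivative (\<lambda>w. w)) (at z)" unfolding p_def by (auto intro!: derivative_eq_intros)
        from diff_chain_at[OF this holo_frechet(1)[OF g pV[OF that]]] show ?thesis
          unfolding o_def by (rule has_derivative_mult_right)
      qed
      show "continuous_on (ball z0 \<rho> \<times> cbox 0 1) (\<lambda>(z, t). inverse (r * E t) * frechet_derivative g (at (p z t)) w)" for w
        unfolding case_prod_beta
        by (intro continuous_on_mult continuous_on_compose2[OF rE] continuous_on_compose2[OF contD contp])
          (auto intro!: continuous_intros pV)
      show "(\<lambda>t. inverse (r * E t) * g (p z t)) integrable_on cbox 0 1" if "z \<in> ball z0 \<rho>" for z
      proof (rule integrable_continuous)
        have "continuous_on (cbox 0 1) (\<lambda>t. p z t)"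
          unfolding p_def by (auto intro!: continuous_intros contE
            bounded_linear.continuous_on[OF bounded_linear_vec_scale_left])
        then show "continuous_on (cbox 0 1) (\<lambda>t. inverse (r * E t) * g (p z t))"
          by (intro continuous_on_mult rE continuous_on_compose2[OF contg]) (auto intro: pV[OF that])
      qed
    qed (use r(1) in auto)
    then have "((\<lambda>z. frechet_derivative g (at z) v) has_derivative D) (at z0)"
    proof (rule has_derivative_transform_within_open[where s="ball z0 \<rho>"])
      show "integral (cbox 0 1) (\<lambda>t. inverse (r * E t) * g (p z t)) = frechet_derivative g (at z) v"
        if "z \<in> ball z0 \<rho>" for z
      proof -
        have "frechet_derivative g (at z) v =
          integral {0..1} (\<lambda>t. g (z + (r * exp (2 * of_real pi * \<i> * of_real t)) *s v) / (r * exp (2 * of_real pi * \<i> * of_real t)))"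
          by (rule holo_cauchy[OF V g r(2)]) (rule r(3)[OF that])
        then show ?thesis by (simp only: E_def p_def divide_inverse cbox_interval mult.commute[of "g _"])
      qed
    qed (use r(1) in auto)
    moreover have "D (a *s w) = a * D w" for a w
      unfolding D_def by (subst integral_mult_right[symmetric])
        (intro integral_cong, use holo_frechet(2)[OF g pV] r(1) in simp)
    ultimately show "\<exists>L. ((\<lambda>z. frechet_derivative g (at z) v) has_derivative L) (at z0) \<and> (\<forall>a v. L (a *s v) = a * L v)"
      by blast
  qed
qed

lemma holo_smooth:
  fixes g :: "complex ^ 'n::finite \<Rightarrow> complex"
  assumes "open V" "holo V g"
  shows "smooth_on V g"
  unfolding smooth_on_def
proof
  fix k
  show "Ck_on k V g" using assms(2)
  proof (induction k arbitrary: g)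
    case 0
    show ?case unfolding Ck_on.simps
      by (rule continuous_at_imp_continuous_on) (intro ballI has_derivative_continuous[OF holo_frechet(1)[OF 0]])
  next
    case (Suc k)
    show ?case
      by (rule Ck_on_SucI[OF assms(1) holo_frechet(1)[OF Suc.prems] Suc.IH[OF holo_deriv[OF assms(1) Suc.prems]]])
  qed
qed



lemma holomorphic_map_smooth:
  assumes V: "open V" and f: "holomorphic_map_on V f"
  shows "smooth_on V f"
proof -
  have "holo V (\<lambda>z. f z $ i)" for i
    unfolding holo_def
  proof
    fix z assume "z \<in> V"
    then obtain L where L: "(f has_derivative L) (at z)" "\<And>a v. L (a *s v) = a *s L v"
      using f unfolding holomorphic_map_on_def by metis
    have "((\<lambda>z. f z $ i) has_derivative (\<lambda>v. L v $ i)) (at z)"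
      by (rule bounded_linear.has_derivative[OF bounded_linear_vec_nth L(1)])
    then show "\<exists>L. ((\<lambda>z. f z $ i) has_derivative L) (at z) \<and> (\<forall>a v. L (a *s v) = a * L v)"
      by (intro exI[of _ "\<lambda>v. L v $ i"]) (simp add: L(2))
  qed
  then have s: "smooth_on V (\<lambda>z. f z $ i)" for i by (rule holo_smooth[OF V])
  have "smooth_on V (\<lambda>z. \<Sum>i\<in>UNIV. f z $ i *s axis i (1::complex))"
    by (intro smooth_on_sum V smooth_on_bounded_linear[OF bounded_linear_vec_scale_left V] s)
  then show ?thesis unfolding basis_expansion .
qed

lemma holomorphic_map_derivative:
  assumes "holomorphic_map_on V f" "z \<in> V"
  shows "frechet_derivative f (at z) (a *s v) = a *s frechet_derivative f (at z) v"
proof -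
  obtain L where L: "(f has_derivative L) (at z)" "\<And>a v. L (a *s v) = a *s L v"
    using assms unfolding holomorphic_map_on_def by metis
  show ?thesis using L by (simp only: frechet_derivative_eqI[OF L(1)])
qed

section \<open>Pull-back of forms\<close>

lemma alternating_pull:
  assumes L: "linear L" and f: "alternating k f"
  shows "alternating k (\<lambda>v. f (\<lambda>i. L (v i)))"
proof (rule alternatingI)
  show "f (\<lambda>i. L (v i)) = f (\<lambda>i. L (w i))" if "\<And>i. i < k \<Longrightarrow> v i = w i" for v w
    by (rule alternating_cong[OF f]) (simp add: that)
  show "linear (\<lambda>x. f (\<lambda>j. L ((v(i := x)) j)))" if "i < k" for v i
  proof -
    have "(\<lambda>j. L ((v(i := x)) j)) = (\<lambda>j. L (v j))(i := L x)" for x by auto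
    then show ?thesis
      using linear_compose[OF L alternating_linear[OF f that, of "\<lambda>j. L (v j)"]] by (simp only: o_def)
  qed
  show "f (\<lambda>i. L (v i)) = 0" if "i < k" "j < k" "i \<noteq> j" "v i = v j" for v i j
    by (rule alternating_eq[OF f that(1-3)]) (simp add: that(4))
qed

text \<open>The real coordinate covector dx_b, with complex values.\<close>

definition cob :: "complex ^ 'n::finite \<Rightarrow> 'n altform" where
  "cob b v = complex_of_real (v 0 \<bullet> b)"

lemma alternating_cob: "alternating 1 (cob b)"
proof (rule alternatingI)
  have "linear (\<lambda>x. complex_of_real (x \<bullet> b))"
    by (rule bounded_linear.linear[OF bounded_linear_compose[OF bounded_linear_of_real bounded_linear_inner_left]])
  then show "linear (\<lambda>x. cob b (v(i := x)))" if "i < 1" for v i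
    using that by (simp add: cob_def)
qed (auto simp: cob_def)

lemma alternating_expand:
  assumes f: "alternating (Suc k) f"
  shows "f (x ## v) = (\<Sum>b\<in>Basis. of_real (x \<bullet> b) * f (b ## v))"
proof -
  have l: "linear (\<lambda>x. f (x ## v))" by (rule alternating_vcons_linear[OF f])
  have "f (x ## v) = f ((\<Sum>b\<in>Basis. (x \<bullet> b) *\<^sub>R b) ## v)" by (simp add: euclidean_representation)
  also have "\<dots> = (\<Sum>b\<in>Basis. f (((x \<bullet> b) *\<^sub>R b) ## v))" by (rule linear_sum[OF l])
  also have "\<dots> = (\<Sum>b\<in>Basis. of_real (x \<bullet> b) * f (b ## v))"
    by (intro sum.cong refl, subst linear_scale[OF l], rule scaleR_conv_of_real)
  finally show ?thesis .
qed

lemma contr_swap: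
  assumes f: "alternating (Suc (Suc k)) f"
  shows "contr x (contr y f) = (\<lambda>v. - contr y (contr x f) v)"
proof
  fix v
  have "(x ## y ## v) \<circ> swp 0 (Suc 0) = y ## x ## v"
    by (rule ext) (auto simp: vcons_def Transposition.transpose_def split: nat.split)
  then show "contr x (contr y f) v = - contr y (contr x f) v"
    using alternating_transpose[OF f, of 0 "Suc 0" "x ## y ## v"] by (simp add: contr_def)
qed

text \<open>Contracting with x, the covectors reproduce f by the basis expansion of x, and the rest
  is the identity for i_x f, one degree lower. The identity writes a form as a sum of products with
  coordinate covectors, which reduces pull-back to degree 1 and to lower degree.\<close>

lemma euler_identity:
  assumes "alternating (Suc k) f"
  shows "(\<Sum>b\<in>Basis. alt_wedge 1 k (cob b) (contr b f) v) = of_nat (Suc k) * f v"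
  using assms
proof (induction k arbitrary: f v)
  case 0
  have "(\<Sum>b\<in>Basis. alt_wedge 1 0 (cob b) (contr b f) (x ## w)) = f (x ## w)" for x w
  proof -
    have "alt_wedge 1 0 (cob b) (contr b f) (x ## w) = of_real (x \<bullet> b) * f (b ## w)" for b
    proof -
      have c: "alternating 0 (contr b f)" using alternating_contr[OF 0] .
      have "contr b f (x ## w) = contr b f w" using c unfolding alternating_0 by blast
      then show ?thesis unfolding alt_wedge_0_right[OF alternating_cob c] by (simp add: cob_def contr_apply)
    qed
    then show ?thesis by (simp only: alternating_expand[OF 0, of x w])
  qed
  from this[of "v 0" "\<lambda>i. v (Suc i)"] show ?case unfolding vcons_eta by simp
next
  case (Suc k)
  have "(\<Sum>b\<in>Basis. alt_wedge 1 (Suc k) (cob b) (contr b f) (x ## w)) = of_nat (Suc (Suc k)) * f (x ## w)" for x w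
  proof -
    have c: "alternating (Suc k) (contr b f)" for b using alternating_contr[OF Suc.prems] .
    have c0: "alternating 0 (contr x (cob b))" for b using alternating_contr[of 0 "cob b" x] alternating_cob[of b] by simp
    have "alt_wedge 1 (Suc k) (cob b) (contr b f) (x ## w)
        = of_real (x \<bullet> b) * f (b ## w) + alt_wedge 1 k (cob b) (contr b (contr x f)) w" for b
    proof -
      have "alt_wedge 1 (Suc k) (cob b) (contr b f) (x ## w) =
         alt_wedge 0 (Suc k) (contr x (cob b)) (contr b f) w - alt_wedge 1 k (cob b) (contr x (contr b f)) w"
        using alt_wedge_contr[OF alternating_cob c, of "Suc k" b b x w] by simp
      also have "alt_wedge 0 (Suc k) (contr x (cob b)) (contr b f) w = of_real (x \<bullet> b) * f (b ## w)"
        unfolding alt_wedge_0_left[OF c0 c] by (simp add: contr_apply cob_def)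
      also have "contr x (contr b f) = (\<lambda>v. (- 1) * contr b (contr x f) v)"
        unfolding contr_swap[OF Suc.prems, of x b] by simp
      finally show ?thesis unfolding alt_wedge_cmult_right by simp
    qed
    then have "(\<Sum>b\<in>Basis. alt_wedge 1 (Suc k) (cob b) (contr b f) (x ## w))
      = (\<Sum>b\<in>Basis. of_real (x \<bullet> b) * f (b ## w)) + (\<Sum>b\<in>Basis. alt_wedge 1 k (cob b) (contr b (contr x f)) w)"
      by (simp only: sum.distrib)
    also have "\<dots> = f (x ## w) + of_nat (Suc k) * contr x f w"
      unfolding Suc.IH[OF c] alternating_expand[OF Suc.prems, of x w] ..
    finally show ?thesis by (simp add: contr_apply algebra_simps)
  qed
  from this[of "v 0" "\<lambda>i. v (Suc i)"] show ?case unfolding vcons_eta .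
qed

definition pbk :: "(complex ^ 'n \<Rightarrow> complex ^ 'n) \<Rightarrow> (complex ^ 'n \<Rightarrow> 'n::finite altform) \<Rightarrow> complex ^ 'n \<Rightarrow> 'n altform" where
  "pbk \<tau> u z v = u (\<tau> z) (\<lambda>i. frechet_derivative \<tau> (at z) (v i))"

lemma pbk_wedge: "pbk \<tau> (\<lambda>y. alt_wedge p q (u y) (w y)) z = alt_wedge p q (pbk \<tau> u z) (pbk \<tau> w z)"
  by (simp add: pbk_def alt_wedge_def fun_eq_iff)

lemma euler_expand:
  assumes "alternating (Suc k) f"
  shows "f = (\<lambda>v. (1 / of_nat (Suc k)) * (\<Sum>b\<in>Basis. alt_wedge 1 k (cob b) (contr b f) v))"
  unfolding euler_identity[OF assms] by (simp del: of_nat_Suc)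

lemma pbk_expand:
  assumes "alternating (Suc k) (u (\<tau> z))"
  shows "pbk \<tau> u z = (\<lambda>v. (1 / of_nat (Suc k)) * (\<Sum>b\<in>Basis. alt_wedge 1 k (pbk \<tau> (\<lambda>_. cob b) z) (pbk \<tau> (\<lambda>y. contr b (u y)) z) v))"
proof
  fix v
  have "pbk \<tau> u z v = (1 / of_nat (Suc k)) * (\<Sum>b\<in>Basis. pbk \<tau> (\<lambda>y. alt_wedge 1 k (cob b) (contr b (u y))) z v)"
    unfolding pbk_def euler_identity[OF assms] by (simp del: of_nat_Suc)
  then show "pbk \<tau> u z v = (1 / of_nat (Suc k)) * (\<Sum>b\<in>Basis. alt_wedge 1 k (pbk \<tau> (\<lambda>_. cob b) z) (pbk \<tau> (\<lambda>y. contr b (u y)) z) v)"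
    by (simp only: pbk_wedge)
qed

context
  fixes V W :: "(complex ^ 'n::finite) set" and \<tau>
  assumes V: "open V" and W: "open W" and \<tau>: "smooth_on V \<tau>" and \<tau>W: "\<And>z. z \<in> V \<Longrightarrow> \<tau> z \<in> W"
begin

text \<open>The pull-back of dx_b is the differential of a coordinate of the map; this makes it both
  smooth and closed.\<close>

lemma pbk_cob_exact:
  assumes "z \<in> V"
  shows "pbk \<tau> (\<lambda>_. cob b) z = dloc 0 (\<lambda>y v. of_real (\<tau> y \<bullet> b)) z"
proof
  fix v
  have "frechet_derivative (\<lambda>y. complex_of_real (\<tau> y \<bullet> b)) (at z) = (\<lambda>v. complex_of_real (frechet_derivative \<tau> (at z) v \<bullet> b))"
    by (rule frechet_derivative_linear_comp[OF bounded_linear_compose[OF bounded_linear_of_real bounded_linear_inner_left]])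
      (rule smooth_on_differentiable[OF \<tau> assms])
  then show "pbk \<tau> (\<lambda>_. cob b) z v = dloc 0 (\<lambda>y v. of_real (\<tau> y \<bullet> b)) z v"
    by (simp add: pbk_def cob_def dloc_def)
qed

lemma sform_coord: "sform 0 V (\<lambda>y v. complex_of_real (\<tau> y \<bullet> b))"
  unfolding sform_def alternating_0
  by (auto intro: smooth_on_bounded_linear[OF bounded_linear_compose[OF bounded_linear_of_real bounded_linear_inner_left] V \<tau>])

lemma sform_pbk_cob: "sform 1 V (pbk \<tau> (\<lambda>_. cob b))"
  using sform_cong[OF V pbk_cob_exact[symmetric] sform_dloc[OF V sform_coord]] by simp

lemma sform_pbk:
  assumes "sform k W u"
  shows "sform k V (pbk \<tau> u)"
  using assms
proof (induction k arbitrary: u)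
  case 0
  have e: "pbk \<tau> u z v = u (\<tau> z) v" if "z \<in> V" for z v
    using sform_alternating[OF 0 \<tau>W[OF that]] unfolding alternating_0 pbk_def by blast
  have "smooth_on V (\<lambda>z. pbk \<tau> u z v)" for v
    by (rule smooth_on_cong[OF V _ smooth_on_compose[OF V W \<tau>W \<tau> sform_smooth[OF 0, of v]]]) (simp_all add: e)
  moreover have "alternating 0 (pbk \<tau> u z)" if "z \<in> V" for z
    using sform_alternating[OF 0 \<tau>W[OF that]] unfolding alternating_0 pbk_def by blast
  ultimately show ?case by (simp add: sform_def)
next
  case (Suc k)
  have "sform (Suc k) V (\<lambda>z v. (1 / of_nat (Suc k)) * (\<Sum>b\<in>Basis. alt_wedge 1 k (pbk \<tau> (\<lambda>_. cob b) z) (pbk \<tau> (\<lambda>y. contr b (u y)) z) v))"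
    by (rule sform_cmult[OF V sform_sum[OF V sform_wedge[OF V sform_pbk_cob Suc.IH[OF sform_contr[OF Suc.prems]],
      unfolded plus_1_eq_Suc]]])
  then show ?case
    by (rule sform_cong[OF V, rotated]) (rule pbk_expand[symmetric], rule sform_alternating[OF Suc.prems \<tau>W])
qed

text \<open>After expansion by \<open>euler_identity\<close> only products of some dx_b with a form
  of lower degree occur. d kills dx_b and its pull-back, so the Leibniz rule leaves one term on each
  side, and these agree by induction. In degree 0 it is the chain rule.\<close>

lemma dloc_pbk:
  assumes u: "sform k W u" and z: "z \<in> V"
  shows "dloc k (pbk \<tau> u) z v = pbk \<tau> (dloc k u) z v"
  using u
proof (induction k arbitrary: u v)
  case 0
  have k0: "u y v = u y w" if "y \<in> W" for y v w
    using sform_alternating[OF 0 that] unfolding alternating_0 by blast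
  let ?a = "\<lambda>j. v (Suc j)" and ?b = "\<lambda>j. frechet_derivative \<tau> (at z) (v (Suc j))"
  have "dloc 0 (pbk \<tau> u) z v = frechet_derivative (\<lambda>y. pbk \<tau> u y ?a) (at z) (v 0)"
    by (simp add: dloc_def)
  also have "\<dots> = frechet_derivative (\<lambda>y. u (\<tau> y) ?b) (at z) (v 0)"
    by (rule fun_cong[OF frechet_derivative_cong[OF V z]]) (simp add: pbk_def, rule k0[OF \<tau>W])
  also have "\<dots> = frechet_derivative (\<lambda>y. u y ?b) (at (\<tau> z)) (frechet_derivative \<tau> (at z) (v 0))"
    by (rule frechet_derivative_chain[OF smooth_on_differentiable[OF \<tau> z] sform_differentiable[OF 0 \<tau>W[OF z]]])
  also have "\<dots> = pbk \<tau> (dloc 0 u) z v" by (simp add: pbk_def dloc_def)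
  finally show ?case .
next
  case (Suc k)
  let ?c = "1 / of_nat (Suc k) :: complex"
  have c: "sform k W (\<lambda>y. contr b (u y))" for b by (rule sform_contr[OF Suc.prems])
  have cb: "sform 1 W (\<lambda>_. cob b)" for b by (simp add: sform_def alternating_cob[simplified])
  have pc: "sform k V (pbk \<tau> (\<lambda>y. contr b (u y)))" for b by (rule sform_pbk[OF c])
  have dz: "dloc 1 (\<lambda>_. cob b) y = (\<lambda>v. 0)" for b and y :: "complex ^ 'n"
    by (rule ext) (simp add: dloc_def frechet_derivative_const)
  have dp: "dloc 1 (pbk \<tau> (\<lambda>_. cob b)) z = (\<lambda>v. 0)" for b
  proof
    fix v
    have "dloc 1 (pbk \<tau> (\<lambda>_. cob b)) z v = dloc 1 (dloc 0 (\<lambda>y v. of_real (\<tau> y \<bullet> b))) z v"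
      by (rule dloc_cong[OF V z]) (rule pbk_cob_exact)
    then show "dloc 1 (pbk \<tau> (\<lambda>_. cob b)) z v = 0" using dloc_dloc[OF V z sform_coord] by simp
  qed
  have w1: "sform (Suc k) V (\<lambda>y. alt_wedge 1 k (pbk \<tau> (\<lambda>_. cob b) y) (pbk \<tau> (\<lambda>y. contr b (u y)) y))" for b
    using sform_wedge[OF V sform_pbk_cob pc] by simp
  have w2: "sform (Suc k) W (\<lambda>y. alt_wedge 1 k (cob b) (contr b (u y)))" for b
    using sform_wedge[OF W cb c] by simp
  have "dloc (Suc k) (pbk \<tau> u) z v = dloc (Suc k) (\<lambda>z v. ?c * (\<Sum>b\<in>Basis. alt_wedge 1 k (pbk \<tau> (\<lambda>_. cob b) z) (pbk \<tau> (\<lambda>y. contr b (u y)) z) v)) z v"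
    by (rule dloc_cong[OF V z]) (rule pbk_expand, rule sform_alternating[OF Suc.prems \<tau>W])
  also have "\<dots> = ?c * (\<Sum>b\<in>Basis. dloc (Suc k) (\<lambda>y. alt_wedge 1 k (pbk \<tau> (\<lambda>_. cob b) y) (pbk \<tau> (\<lambda>y. contr b (u y)) y)) z v)"
    unfolding dloc_cmult[OF sform_sum[OF V w1] z] dloc_sum[OF w1 z] ..
  also have "\<dots> = ?c * (\<Sum>b\<in>Basis. - alt_wedge 1 (Suc k) (pbk \<tau> (\<lambda>_. cob b) z) (dloc k (pbk \<tau> (\<lambda>y. contr b (u y))) z) v)"
    using dloc_wedge[OF V z sform_pbk_cob pc] by (simp add: dp[simplified] alt_wedge_zero_left)
  also have "\<dots> = ?c * (\<Sum>b\<in>Basis. - alt_wedge 1 (Suc k) (pbk \<tau> (\<lambda>_. cob b) z) (pbk \<tau> (dloc k (\<lambda>y. contr b (u y))) z) v)"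
  proof -
    have "dloc k (pbk \<tau> (\<lambda>y. contr b (u y))) z = pbk \<tau> (dloc k (\<lambda>y. contr b (u y))) z" for b
      by (rule ext) (rule Suc.IH[OF c])
    then show ?thesis by (simp only:)
  qed
  also have "\<dots> = pbk \<tau> (\<lambda>y v. ?c * (\<Sum>b\<in>Basis. - alt_wedge 1 (Suc k) (cob b) (dloc k (\<lambda>y. contr b (u y)) y) v)) z v"
    unfolding pbk_wedge[symmetric] by (simp only: pbk_def)
  also have "\<dots> = pbk \<tau> (dloc (Suc k) u) z v"
  proof -
    have "dloc (Suc k) u y v = ?c * (\<Sum>b\<in>Basis. - alt_wedge 1 (Suc k) (cob b) (dloc k (\<lambda>y. contr b (u y)) y) v)" if y: "y \<in> W" for y v
    proof -
      have "dloc (Suc k) u y v = dloc (Suc k) (\<lambda>y v. ?c * (\<Sum>b\<in>Basis. alt_wedge 1 k (cob b) (contr b (u y)) v)) y v"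
        by (rule dloc_cong[OF W y]) (rule euler_expand, rule sform_alternating[OF Suc.prems])
      also have "\<dots> = ?c * (\<Sum>b\<in>Basis. dloc (Suc k) (\<lambda>y. alt_wedge 1 k (cob b) (contr b (u y))) y v)"
        unfolding dloc_cmult[OF sform_sum[OF W w2] y] dloc_sum[OF w2 y] ..
      also have "\<dots> = ?c * (\<Sum>b\<in>Basis. - alt_wedge 1 (Suc k) (cob b) (dloc k (\<lambda>y. contr b (u y)) y) v)"
        using dloc_wedge[OF W y cb c] by (simp add: dz[simplified] alt_wedge_zero_left)
      finally show ?thesis .
    qed
    then show ?thesis unfolding pbk_def[of \<tau> "dloc (Suc k) u"] by (simp only: \<tau>W[OF z] pbk_def)
  qed
  finally show ?case .
qed

end

lemma pbk_compose:
  assumes "\<tau> differentiable (at z)" "\<sigma> differentiable (at (\<tau> z))"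
  shows "pbk \<tau> (pbk \<sigma> u) z v = pbk (\<lambda>y. \<sigma> (\<tau> y)) u z v"
  by (simp add: pbk_def frechet_derivative_chain[OF assms])

section \<open>Forms on a complex manifold\<close>

locale complex_mfd =
  fixes X :: "'a topology" and A :: "('a, 'n::finite) chart set"
  assumes mfd: "complex_manifold X A"
begin

lemma chart: "c \<in> A \<Longrightarrow> is_chart X c"
  using mfd by (simp add: complex_manifold_def)

lemma open_image: "c \<in> A \<Longrightarrow> open (chart_image c)"
  using chart by (simp add: is_chart_def)

lemma open_dom: "c \<in> A \<Longrightarrow> openin X (fst c)"
  using chart by (simp add: is_chart_def)

lemma homeo: "c \<in> A \<Longrightarrow> homeomorphic_map (subtopology X (fst c)) (top_of_set (chart_image c)) (snd c)"
  using chart by (simp add: is_chart_def)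

lemma dom_subset: "c \<in> A \<Longrightarrow> fst c \<subseteq> topspace X"
  using open_dom openin_subset by blast

lemma chart_inj: "c \<in> A \<Longrightarrow> inj_on (snd c) (fst c)"
  using homeomorphic_imp_injective_map[OF homeo] dom_subset by (simp add: Int_absorb1)

lemma chart_cover: "x \<in> topspace X \<Longrightarrow> \<exists>c\<in>A. x \<in> fst c"
  using mfd by (auto simp: complex_manifold_def)

definition cinv :: "('a, 'n) chart \<Rightarrow> complex ^ 'n \<Rightarrow> 'a" where
  "cinv c = the_inv_into (fst c) (snd c)"

lemma cinv: "c \<in> A \<Longrightarrow> x \<in> fst c \<Longrightarrow> cinv c (snd c x) = x"
  unfolding cinv_def by (rule the_inv_into_f_f[OF chart_inj])

lemma cinv_image: "c \<in> A \<Longrightarrow> z \<in> chart_image c \<Longrightarrow> cinv c z \<in> fst c \<and> snd c (cinv c z) = z"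
  by (auto simp: chart_image_def cinv)

lemma transition: "transition c c' z = snd c' (cinv c z)"
  by (simp add: transition_def cinv_def)

definition ovl :: "('a, 'n) chart \<Rightarrow> ('a, 'n) chart \<Rightarrow> (complex ^ 'n) set" where
  "ovl c c' = snd c ` (fst c \<inter> fst c')"

lemma open_chart_image:
  assumes "c \<in> A" "openin X U"
  shows "open (snd c ` (fst c \<inter> U))"
proof -
  have "openin (subtopology X (fst c)) (fst c \<inter> U)"
    using assms(2) by (simp add: openin_subtopology_Int2)
  then have "openin (top_of_set (chart_image c)) (snd c ` (fst c \<inter> U))"
    using homeomorphic_map_openness[OF homeo[OF assms(1)], of "fst c \<inter> U"] dom_subset[OF assms(1)] by auto
  then show ?thesis using open_image[OF assms(1)] openin_open_trans by blast
qed

lemma open_ovl: "c \<in> A \<Longrightarrow> c' \<in> A \<Longrightarrow> open (ovl c c')"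
  unfolding ovl_def by (rule open_chart_image) (auto simp: open_dom)

lemma ovl_iff: "c \<in> A \<Longrightarrow> z \<in> ovl c c' \<longleftrightarrow> z \<in> chart_image c \<and> cinv c z \<in> fst c'"
  by (auto simp: ovl_def chart_image_def cinv)

lemma ovl_subset: "ovl c c' \<subseteq> chart_image c"
  by (auto simp: ovl_def chart_image_def)

lemma transition_ovl: "c \<in> A \<Longrightarrow> c' \<in> A \<Longrightarrow> z \<in> ovl c c' \<Longrightarrow> transition c c' z \<in> ovl c' c"
  by (auto simp: ovl_def transition cinv)

lemma transition_inverse: "c \<in> A \<Longrightarrow> c' \<in> A \<Longrightarrow> z \<in> ovl c c' \<Longrightarrow> transition c' c (transition c c' z) = z"
  by (auto simp: ovl_def transition cinv)

lemma transition_holomorphic: "c \<in> A \<Longrightarrow> c' \<in> A \<Longrightarrow> holomorphic_map_on (ovl c c') (transition c c')"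
  using mfd by (simp add: complex_manifold_def ovl_def)

lemma transition_smooth: "c \<in> A \<Longrightarrow> c' \<in> A \<Longrightarrow> smooth_on (ovl c c') (transition c c')"
  by (rule holomorphic_map_smooth[OF open_ovl transition_holomorphic])

lemma transition_differentiable:
  "c \<in> A \<Longrightarrow> c' \<in> A \<Longrightarrow> z \<in> ovl c c' \<Longrightarrow> transition c c' differentiable (at z)"
  using transition_smooth smooth_on_differentiable by blast

lemma transition_linear: "c \<in> A \<Longrightarrow> c' \<in> A \<Longrightarrow> z \<in> ovl c c' \<Longrightarrow> linear (frechet_derivative (transition c c') (at z))"
  by (rule linear_frechet_derivative[OF transition_differentiable])

text \<open>Compatibility is phrased through \<open>pbk\<close> at points of the coordinate space,
  the shape in which the local results on pull-backs apply.\<close>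

lemma formsI:
  assumes "\<And>c z v. c \<notin> A \<or> z \<notin> chart_image c \<Longrightarrow> u c z v = 0"
    "\<And>c. c \<in> A \<Longrightarrow> sform k (chart_image c) (u c)"
    "\<And>c c' z v. c \<in> A \<Longrightarrow> c' \<in> A \<Longrightarrow> z \<in> ovl c c' \<Longrightarrow> u c z v = pbk (transition c c') (u c') z v"
  shows "u \<in> forms A k"
  unfolding forms_def mem_Collect_eq
proof (intro conjI)
  show "\<forall>c z v. c \<notin> A \<or> z \<notin> chart_image c \<longrightarrow> u c z v = 0" using assms(1) by blast
  show "\<forall>c\<in>A. \<forall>z\<in>chart_image c. alternating k (u c z)" using assms(2) by (simp add: sform_def)
  show "\<forall>c\<in>A. \<forall>v. smooth_on (chart_image c) (\<lambda>z. u c z v)" using assms(2) by (simp add: sform_def)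
  show "\<forall>c\<in>A. \<forall>c'\<in>A. \<forall>x\<in>fst c \<inter> fst c'. \<forall>v. u c (snd c x) v =
        u c' (snd c' x) (\<lambda>i. frechet_derivative (transition c c') (at (snd c x)) (v i))"
  proof (intro ballI allI)
    fix c c' x v assume c: "c \<in> A" "c' \<in> A" and x: "x \<in> fst c \<inter> fst c'"
    have "snd c x \<in> ovl c c'" using x by (auto simp: ovl_def)
    from assms(3)[OF c this, of v] show "u c (snd c x) v =
        u c' (snd c' x) (\<lambda>i. frechet_derivative (transition c c') (at (snd c x)) (v i))"
      using x by (simp add: pbk_def transition cinv[OF c(1)])
  qed
qed

lemma forms_outside: "u \<in> forms A k \<Longrightarrow> c \<notin> A \<or> z \<notin> chart_image c \<Longrightarrow> u c z v = 0"
  unfolding forms_def by blast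

lemma forms_sform: "u \<in> forms A k \<Longrightarrow> c \<in> A \<Longrightarrow> sform k (chart_image c) (u c)"
  by (simp add: forms_def sform_def)

lemma forms_sform_ovl: "u \<in> forms A k \<Longrightarrow> c \<in> A \<Longrightarrow> sform k (ovl c c') (u c)"
  using sform_subset[OF forms_sform ovl_subset] .

lemma forms_alternating: "u \<in> forms A k \<Longrightarrow> c \<in> A \<Longrightarrow> z \<in> chart_image c \<Longrightarrow> alternating k (u c z)"
  using forms_sform sform_alternating by blast

lemma forms_pbk:
  assumes u: "u \<in> forms A k" and c: "c \<in> A" "c' \<in> A" and z: "z \<in> ovl c c'"
  shows "u c z v = pbk (transition c c') (u c') z v"
proof -
  obtain x where x: "x \<in> fst c \<inter> fst c'" "z = snd c x" using z by (auto simp: ovl_def)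
  have "u c (snd c x) v = u c' (snd c' x) (\<lambda>i. frechet_derivative (transition c c') (at (snd c x)) (v i))"
    using u c x(1) unfolding forms_def by blast
  moreover have "snd c' x = transition c c' z" using x c by (simp add: transition cinv)
  ultimately show ?thesis unfolding pbk_def x(2) by simp
qed

lemma forms_ext:
  assumes "u \<in> forms A k" "w \<in> forms A l" "\<And>c z v. c \<in> A \<Longrightarrow> z \<in> chart_image c \<Longrightarrow> u c z v = w c z v"
  shows "u = w"
proof (intro ext)
  show "u c z v = w c z v" for c z v
    using assms(3)[of c z v] forms_outside[OF assms(1), of c z v] forms_outside[OF assms(2), of c z v]
    by (cases "c \<in> A \<and> z \<in> chart_image c") auto
qed

lemma forms_zero: "0 \<in> forms A k"
  by (rule formsI) (auto simp: zero_fun_def sform_zero pbk_def)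

lemma forms_add: "u \<in> forms A k \<Longrightarrow> w \<in> forms A k \<Longrightarrow> u + w \<in> forms A k"
proof (rule formsI)
  assume u: "u \<in> forms A k" and w: "w \<in> forms A k"
  show "(u + w) c z v = 0" if "c \<notin> A \<or> z \<notin> chart_image c" for c z v
    using forms_outside[OF u that] forms_outside[OF w that] by simp
  show "sform k (chart_image c) ((u + w) c)" if "c \<in> A" for c
    unfolding plus_fun_def by (rule sform_add[OF open_image[OF that] forms_sform[OF u that] forms_sform[OF w that]])
  show "(u + w) c z v = pbk (transition c c') ((u + w) c') z v" if "c \<in> A" "c' \<in> A" "z \<in> ovl c c'" for c c' z v
    unfolding plus_fun_apply forms_pbk[OF u that] forms_pbk[OF w that] by (simp add: pbk_def)
qed

lemma forms_scale: "u \<in> forms A k \<Longrightarrow> scale_form a u \<in> forms A k"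
proof (rule formsI)
  assume u: "u \<in> forms A k"
  show "scale_form a u c z v = 0" if "c \<notin> A \<or> z \<notin> chart_image c" for c z v
    using forms_outside[OF u that] by (simp add: scale_form_def)
  show "sform k (chart_image c) (scale_form a u c)" if "c \<in> A" for c
    unfolding scale_form_def by (rule sform_cmult[OF open_image[OF that] forms_sform[OF u that]])
  show "scale_form a u c z v = pbk (transition c c') (scale_form a u c') z v" if "c \<in> A" "c' \<in> A" "z \<in> ovl c c'" for c c' z v
    unfolding scale_form_def forms_pbk[OF u that] by (simp add: pbk_def)
qed

lemma scale_form_minus_1: "scale_form (- 1) u = - u"
  by (simp add: scale_form_def fun_eq_iff)

lemma forms_diff: "u \<in> forms A k \<Longrightarrow> w \<in> forms A k \<Longrightarrow> u - w \<in> forms A k"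
  using forms_add[OF _ forms_scale[of w k "-1"]] by (simp add: scale_form_minus_1)

lemma forms_sum: "(\<And>i. i \<in> S \<Longrightarrow> u i \<in> forms A k) \<Longrightarrow> (\<Sum>i\<in>S. u i) \<in> forms A k"
  by (induction S rule: infinite_finite_induct) (simp_all add: forms_zero forms_add)

lemma forms_wedge:
  assumes u: "u \<in> forms A p" and w: "w \<in> forms A q"
  shows "wedge p q u w \<in> forms A (p + q)"
proof (rule formsI)
  show "wedge p q u w c z v = 0" if "c \<notin> A \<or> z \<notin> chart_image c" for c z v
  proof -
    have "u c z = (\<lambda>v. 0)" using forms_outside[OF u that] by blast
    then show ?thesis by (simp add: wedge_def alt_wedge_zero_left)
  qed
  show "sform (p + q) (chart_image c) (wedge p q u w c)" if "c \<in> A" for c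
    unfolding wedge_def by (rule sform_wedge[OF open_image[OF that] forms_sform[OF u that] forms_sform[OF w that]])
  show "wedge p q u w c z v = pbk (transition c c') (wedge p q u w c') z v" if "c \<in> A" "c' \<in> A" "z \<in> ovl c c'" for c c' z v
  proof -
    have "u c z = pbk (transition c c') (u c') z" "w c z = pbk (transition c c') (w c') z"
      using forms_pbk[OF u that] forms_pbk[OF w that] by blast+
    then show ?thesis unfolding wedge_def by (simp only: pbk_wedge)
  qed
qed

lemma ext_d_dloc: "z \<in> chart_image c \<Longrightarrow> ext_d k u c z v = dloc k (u c) z v"
  by (simp add: ext_d_def ext_with_def dloc_def)

lemma ext_d_outside: "z \<notin> chart_image c \<Longrightarrow> ext_d k u c z v = 0"
  by (simp add: ext_d_def ext_with_def)

text \<open>Compatibility of the local expressions survives because d commutes with pull-back along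
  transition maps, which are smooth by Cauchy's formula.\<close>

lemma forms_ext_d:
  assumes u: "u \<in> forms A k"
  shows "ext_d k u \<in> forms A (Suc k)"
proof (rule formsI)
  show "ext_d k u c z v = 0" if "c \<notin> A \<or> z \<notin> chart_image c" for c z v
  proof (cases "z \<in> chart_image c")
    case True
    then have "u c = (\<lambda>z v. 0)" using forms_outside[OF u] that by blast
    then show ?thesis using True by (simp add: ext_d_dloc dloc_zero)
  qed (simp add: ext_d_outside)
  show "sform (Suc k) (chart_image c) (ext_d k u c)" if "c \<in> A" for c
    by (rule sform_cong[OF open_image[OF that] _ sform_dloc[OF open_image[OF that] forms_sform[OF u that]]])
      (simp add: ext_d_dloc fun_eq_iff)
  show "ext_d k u c z v = pbk (transition c c') (ext_d k u c') z v" if c: "c \<in> A" "c' \<in> A" "z \<in> ovl c c'" for c c' z v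
  proof -
    have "ext_d k u c z v = dloc k (u c) z v" using c ovl_subset by (simp add: ext_d_dloc subset_iff)
    also have "\<dots> = dloc k (pbk (transition c c') (u c')) z v"
      by (rule dloc_cong[OF open_ovl[OF c(1,2)] c(3)]) (rule ext, rule forms_pbk[OF u c(1,2)])
    also have "\<dots> = pbk (transition c c') (dloc k (u c')) z v"
      by (rule dloc_pbk[OF open_ovl[OF c(1,2)] open_ovl[OF c(2,1)] transition_smooth[OF c(1,2)]
        transition_ovl[OF c(1,2)] forms_sform_ovl[OF u c(2)] c(3)])
    also have "\<dots> = pbk (transition c c') (ext_d k u c') z v"
      unfolding pbk_def using subsetD[OF ovl_subset transition_ovl[OF c]] by (simp only: ext_d_dloc)
    finally show ?thesis .
  qed
qed

lemma ext_d_add: "u \<in> forms A k \<Longrightarrow> w \<in> forms A k \<Longrightarrow> ext_d k (u + w) = ext_d k u + ext_d k w"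
  by (rule forms_ext[OF forms_ext_d[OF forms_add] forms_add[OF forms_ext_d forms_ext_d]])
    (simp_all add: ext_d_dloc plus_fun_def dloc_add[OF forms_sform forms_sform])

lemma ext_d_scale: "u \<in> forms A k \<Longrightarrow> ext_d k (scale_form a u) = scale_form a (ext_d k u)"
  by (rule forms_ext[OF forms_ext_d[OF forms_scale] forms_scale[OF forms_ext_d]])
    (simp_all add: ext_d_dloc scale_form_def dloc_cmult[OF forms_sform])

lemma ext_d_zero: "ext_d k (0 :: ('a, 'n) form) = 0"
  by (simp add: ext_d_def ext_with_def fun_eq_iff frechet_derivative_const)

lemma ext_d_diff: "u \<in> forms A k \<Longrightarrow> w \<in> forms A k \<Longrightarrow> ext_d k (u - w) = ext_d k u - ext_d k w"
  using ext_d_add[OF _ forms_scale[of w k "-1"], of u] ext_d_scale[of w k "-1"] by (simp add: scale_form_minus_1)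

lemma ext_d_sum: "(\<And>i. i \<in> S \<Longrightarrow> u i \<in> forms A k) \<Longrightarrow> ext_d k (\<Sum>i\<in>S. u i) = (\<Sum>i\<in>S. ext_d k (u i))"
  by (induction S rule: infinite_finite_induct) (simp_all add: ext_d_zero ext_d_add forms_sum)

lemma ext_d_ext_d: "u \<in> forms A k \<Longrightarrow> ext_d (Suc k) (ext_d k u) = 0"
proof (rule forms_ext[OF forms_ext_d[OF forms_ext_d] forms_zero])
  fix c z v assume u: "u \<in> forms A k" and c: "c \<in> A" "z \<in> chart_image c"
  have "ext_d (Suc k) (ext_d k u) c z v = dloc (Suc k) (dloc k (u c)) z v"
    unfolding ext_d_dloc[OF c(2)] by (rule dloc_cong[OF open_image[OF c(1)] c(2)]) (simp add: ext_d_dloc fun_eq_iff)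
  then show "ext_d (Suc k) (ext_d k u) c z v = 0 c z v"
    by (simp add: dloc_dloc[OF open_image[OF c(1)] c(2) forms_sform[OF u c(1)]])
qed

lemma ext_d_wedge:
  assumes u: "u \<in> forms A p" and w: "w \<in> forms A q"
  shows "ext_d (p + q) (wedge p q u w) =
    wedge (Suc p) q (ext_d p u) w + scale_form ((- 1) ^ p) (wedge p (Suc q) u (ext_d q w))"
proof (rule forms_ext[OF forms_ext_d[OF forms_wedge[OF u w]]])
  show "wedge (Suc p) q (ext_d p u) w + scale_form ((- 1) ^ p) (wedge p (Suc q) u (ext_d q w)) \<in> forms A (Suc (p + q))"
    using forms_wedge[OF forms_ext_d[OF u] w] forms_wedge[OF u forms_ext_d[OF w]] by (simp add: forms_add forms_scale)
  fix c z v assume c: "c \<in> A" "z \<in> chart_image c"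
  have "ext_d p u c z = dloc p (u c) z" "ext_d q w c z = dloc q (w c) z"
    by (simp_all add: ext_d_dloc[OF c(2)] fun_eq_iff)
  then show "ext_d (p + q) (wedge p q u w) c z v =
    (wedge (Suc p) q (ext_d p u) w + scale_form ((- 1) ^ p) (wedge p (Suc q) u (ext_d q w))) c z v"
    using dloc_wedge[OF open_image[OF c(1)] c(2) forms_sform[OF u c(1)] forms_sform[OF w c(1)], of v]
    by (simp add: ext_d_dloc[OF c(2)] scale_form_def wedge_def)
qed

end

section \<open>De Rham classes and the wedge map\<close>

lemma wedge_diff_left: "wedge p q (u - u') w = wedge p q u w - wedge p q u' w"
proof (intro ext)
  fix c z v
  have "(u - u') c z = (\<lambda>v. u c z v - u' c z v)" by (simp add: fun_eq_iff)
  then show "wedge p q (u - u') w c z v = (wedge p q u w - wedge p q u' w) c z v"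
    by (simp add: wedge_def alt_wedge_diff_left)
qed

lemma wedge_diff_right: "wedge p q u (w - w') = wedge p q u w - wedge p q u w'"
proof (intro ext)
  fix c z v
  have "(w - w') c z = (\<lambda>v. w c z v - w' c z v)" by (simp add: fun_eq_iff)
  then show "wedge p q u (w - w') c z v = (wedge p q u w - wedge p q u w') c z v"
    by (simp add: wedge_def alt_wedge_diff_right)
qed

lemma wedge_add_left: "wedge p q (u + u') w = wedge p q u w + wedge p q u' w"
proof (intro ext)
  fix c z v
  have "(u + u') c z = (\<lambda>v. u c z v + u' c z v)" by (simp add: fun_eq_iff)
  then show "wedge p q (u + u') w c z v = (wedge p q u w + wedge p q u' w) c z v"
    by (simp add: wedge_def alt_wedge_add_left)
qed

lemma wedge_add_right: "wedge p q u (w + w') = wedge p q u w + wedge p q u w'"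
proof (intro ext)
  fix c z v
  have "(w + w') c z = (\<lambda>v. w c z v + w' c z v)" by (simp add: fun_eq_iff)
  then show "wedge p q u (w + w') c z v = (wedge p q u w + wedge p q u w') c z v"
    by (simp add: wedge_def alt_wedge_add_right)
qed

lemma wedge_scale_left: "wedge p q (scale_form a u) w = scale_form a (wedge p q u w)"
  by (intro ext) (simp add: wedge_def scale_form_def alt_wedge_cmult_left)

lemma wedge_scale_right: "wedge p q u (scale_form a w) = scale_form a (wedge p q u w)"
  by (intro ext) (simp add: wedge_def scale_form_def alt_wedge_cmult_right)

lemma wedge_zero_left: "wedge p q 0 w = 0"
  using wedge_diff_left[of p q 0 0 w] by simp

lemma wedge_zero_right: "wedge p q u 0 = 0"
  using wedge_diff_right[of p q u 0 0] by simp

lemma scale_form_add: "scale_form a (u + w) = scale_form a u + scale_form a w"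
  by (simp add: scale_form_def fun_eq_iff distrib_left)

lemma scale_form_diff: "scale_form a (u - w) = scale_form a u - scale_form a w"
  by (simp add: scale_form_def fun_eq_iff right_diff_distrib)

lemma scale_form_zero: "scale_form a 0 = 0"
  by (simp add: scale_form_def fun_eq_iff)

context complex_mfd
begin

lemma closed_forms_forms: "u \<in> closed_forms A k \<Longrightarrow> u \<in> forms A k"
  by (simp add: closed_forms_def)

lemma closed_forms_d: "u \<in> closed_forms A k \<Longrightarrow> ext_d k u = 0"
  by (simp add: closed_forms_def)

lemma closed_add: "u \<in> closed_forms A k \<Longrightarrow> w \<in> closed_forms A k \<Longrightarrow> u + w \<in> closed_forms A k"
  by (simp add: closed_forms_def forms_add ext_d_add)

lemma closed_scale: "u \<in> closed_forms A k \<Longrightarrow> scale_form a u \<in> closed_forms A k"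
  by (simp add: closed_forms_def forms_scale ext_d_scale scale_form_zero)

lemma closed_diff: "u \<in> closed_forms A k \<Longrightarrow> w \<in> closed_forms A k \<Longrightarrow> u - w \<in> closed_forms A k"
  by (simp add: closed_forms_def forms_diff ext_d_diff)

lemma exact_iff: "u \<in> exact_forms A (Suc k) \<longleftrightarrow> (\<exists>w\<in>forms A k. u = ext_d k w)"
  by (auto simp: exact_forms_def)

lemma exact_zero: "0 \<in> exact_forms A k"
  using ext_d_zero forms_zero by (cases k) (auto simp: exact_iff exact_forms_def intro!: image_eqI[where x=0])

lemma exact_scale: "u \<in> exact_forms A k \<Longrightarrow> scale_form a u \<in> exact_forms A k"
proof (cases k)
  case 0
  assume "u \<in> exact_forms A k"
  then show ?thesis using 0 by (simp add: exact_forms_def scale_form_zero)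
next
  case (Suc l)
  assume "u \<in> exact_forms A k"
  then obtain w where w: "w \<in> forms A l" "u = ext_d l w" using Suc exact_iff by auto
  then have "scale_form a u = ext_d l (scale_form a w)" by (simp add: ext_d_scale)
  then show ?thesis unfolding Suc exact_iff using forms_scale[OF w(1)] by blast
qed

lemma exact_add: "u \<in> exact_forms A k \<Longrightarrow> u' \<in> exact_forms A k \<Longrightarrow> u + u' \<in> exact_forms A k"
proof (cases k)
  case 0
  assume "u \<in> exact_forms A k" "u' \<in> exact_forms A k"
  then show ?thesis using 0 by (simp add: exact_forms_def)
next
  case (Suc l)
  assume "u \<in> exact_forms A k" "u' \<in> exact_forms A k"
  then obtain w w' where w: "w \<in> forms A l" "u = ext_d l w" "w' \<in> forms A l" "u' = ext_d l w'"
    using Suc exact_iff by auto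
  then have "u + u' = ext_d l (w + w')" by (simp add: ext_d_add)
  then show ?thesis unfolding Suc exact_iff using forms_add[OF w(1,3)] by blast
qed

lemma exact_minus: "u - w \<in> exact_forms A k \<Longrightarrow> w - u \<in> exact_forms A k"
  using exact_scale[of "u - w" k "-1"] by (simp add: scale_form_minus_1)

lemma dR_rel_equiv: "equiv (closed_forms A k) (dR_rel A k)"
proof (rule equivI)
  show "dR_rel A k \<subseteq> closed_forms A k \<times> closed_forms A k" by (auto simp: dR_rel_def)
  show "refl_on (closed_forms A k) (dR_rel A k)" by (rule refl_onI) (auto simp: dR_rel_def exact_zero)
  show "sym (dR_rel A k)" by (rule symI) (auto simp: dR_rel_def intro: exact_minus)
  show "trans (dR_rel A k)"
  proof (rule transI)
    fix u v w assume "(u, v) \<in> dR_rel A k" "(v, w) \<in> dR_rel A k"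
    then show "(u, w) \<in> dR_rel A k"
      using exact_add[of "u - v" k "v - w"] by (auto simp: dR_rel_def)
  qed
qed

lemma dR_class_eq: "u \<in> closed_forms A k \<Longrightarrow> w \<in> closed_forms A k \<Longrightarrow> u - w \<in> exact_forms A k \<Longrightarrow>
    dR_class A k u = dR_class A k w"
  unfolding dR_class_def by (rule equiv_class_eq[OF dR_rel_equiv]) (simp add: dR_rel_def)

lemma dR_class_eqD: "u \<in> closed_forms A k \<Longrightarrow> w \<in> closed_forms A k \<Longrightarrow>
    dR_class A k u = dR_class A k w \<Longrightarrow> u - w \<in> exact_forms A k"
  unfolding dR_class_def using eq_equiv_class_iff[OF dR_rel_equiv] by (auto simp: dR_rel_def)

lemma dR_class_in: "u \<in> closed_forms A k \<Longrightarrow> dR_class A k u \<in> dR A k"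
  unfolding dR_class_def dR_def by (rule quotientI)

lemma dR_cases: "a \<in> dR A k \<Longrightarrow> (\<And>u. u \<in> closed_forms A k \<Longrightarrow> a = dR_class A k u \<Longrightarrow> P) \<Longrightarrow> P"
  unfolding dR_class_def dR_def by (erule quotientE) blast

text \<open>The operations on classes are unions over representatives; when the operation respects
  the relation, all sets in the union are equal and one representative suffices.\<close>

lemma dR_UN:
  assumes "\<And>u w. (u, w) \<in> dR_rel A k \<Longrightarrow> f u = f w" "u \<in> closed_forms A k"
  shows "(\<Union>w\<in>dR_class A k u. f w) = f u"
proof -
  have "f w = f u" if "w \<in> dR_class A k u" for w
    using assms(1)[of u w] that by (simp add: dR_class_def)
  moreover have "u \<in> dR_class A k u" unfolding dR_class_def by (rule equiv_class_self[OF dR_rel_equiv assms(2)])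
  ultimately show ?thesis by blast
qed

lemma dR_add_class:
  assumes u: "u \<in> closed_forms A k" and w: "w \<in> closed_forms A k"
  shows "dR_add A k (dR_class A k u) (dR_class A k w) = dR_class A k (u + w)"
proof -
  have "(\<Union>w'\<in>dR_class A k w. dR_class A k (u' + w')) = dR_class A k (u' + w)" if "u' \<in> closed_forms A k" for u'
    by (rule dR_UN[OF _ w]) (rule dR_class_eq, auto simp: dR_rel_def closed_add that)
  moreover have "u' \<in> closed_forms A k" if "u' \<in> dR_class A k u" for u'
    using that by (simp add: dR_class_def dR_rel_def)
  ultimately have "dR_add A k (dR_class A k u) (dR_class A k w) = (\<Union>u'\<in>dR_class A k u. dR_class A k (u' + w))"
    unfolding dR_add_def by simp
  also have "\<dots> = dR_class A k (u + w)"
    by (rule dR_UN[OF _ u]) (rule dR_class_eq, auto simp: dR_rel_def closed_add w)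
  finally show ?thesis .
qed

lemma dR_scale_class:
  assumes u: "u \<in> closed_forms A k"
  shows "dR_scale A k r (dR_class A k u) = dR_class A k (scale_form r u)"
  unfolding dR_scale_def
  by (rule dR_UN[OF _ u]) (rule dR_class_eq, auto simp: dR_rel_def closed_scale exact_scale scale_form_diff[symmetric])

lemma wedge_closed:
  assumes t: "\<theta> \<in> closed_forms A p" and u: "u \<in> closed_forms A q"
  shows "wedge p q \<theta> u \<in> closed_forms A (p + q)"
  unfolding closed_forms_def
  using ext_d_wedge[OF closed_forms_forms[OF t] closed_forms_forms[OF u]] closed_forms_d[OF t] closed_forms_d[OF u]
    forms_wedge[OF closed_forms_forms[OF t] closed_forms_forms[OF u]]
  by (simp add: wedge_zero_left wedge_zero_right scale_form_zero)

text \<open>For closed \<theta> the form \<theta> ^ dw is (-1)^p d(\<theta> ^ w); the sign is its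
  own inverse and is absorbed into the primitive.\<close>

lemma wedge_exact_right:
  assumes t: "\<theta> \<in> closed_forms A p" and u: "u \<in> exact_forms A (Suc l)"
  shows "wedge p (Suc l) \<theta> u \<in> exact_forms A (p + Suc l)"
proof -
  obtain w where w: "w \<in> forms A l" "u = ext_d l w" using u exact_iff by auto
  have "ext_d (p + l) (wedge p l \<theta> w) = scale_form ((- 1) ^ p) (wedge p (Suc l) \<theta> u)"
    using ext_d_wedge[OF closed_forms_forms[OF t] w(1)] closed_forms_d[OF t] w(2) by (simp add: wedge_zero_left)
  then have "scale_form ((- 1) ^ p) (ext_d (p + l) (wedge p l \<theta> w)) = wedge p (Suc l) \<theta> u"
    by (simp add: scale_form_def flip: power_add)
  moreover have "scale_form ((- 1) ^ p) (ext_d (p + l) (wedge p l \<theta> w)) \<in> exact_forms A (Suc (p + l))"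
    by (rule exact_scale) (use exact_iff forms_wedge[OF closed_forms_forms[OF t] w(1)] in blast)
  ultimately show ?thesis by simp
qed

lemma wedge_exact_left:
  assumes t: "\<theta> \<in> exact_forms A (Suc l)" and u: "u \<in> closed_forms A q"
  shows "wedge (Suc l) q \<theta> u \<in> exact_forms A (Suc l + q)"
proof -
  obtain w where w: "w \<in> forms A l" "\<theta> = ext_d l w" using t exact_iff by auto
  have "ext_d (l + q) (wedge l q w u) = wedge (Suc l) q \<theta> u"
    using ext_d_wedge[OF w(1) closed_forms_forms[OF u]] closed_forms_d[OF u] w(2)
    by (simp add: wedge_zero_right scale_form_zero)
  then have "wedge (Suc l) q \<theta> u \<in> exact_forms A (Suc (l + q))"
    unfolding exact_iff by (intro bexI[of _ "wedge l q w u"] forms_wedge[OF w(1) closed_forms_forms[OF u]]) simp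
  then show ?thesis by simp
qed

context
  fixes \<theta> and p :: nat
  assumes t: "\<theta> \<in> closed_forms A p"
begin

lemma wedge_class_cong: "(u, w) \<in> dR_rel A 1 \<Longrightarrow> dR_class A (p + 1) (wedge p 1 \<theta> u) = dR_class A (p + 1) (wedge p 1 \<theta> w)"
  using wedge_exact_right[OF t, of "u - w" 0] by (intro dR_class_eq wedge_closed t) (auto simp: dR_rel_def wedge_diff_right)

lemma wedge_well_defined_1: "wedge_well_defined A p 1 \<theta>"
  unfolding wedge_well_defined_def congruent_def   by (auto simp del: One_nat_def intro!: wedge_closed[OF t] wedge_class_cong)

lemma dR_wedge_class:
  "u \<in> closed_forms A 1 \<Longrightarrow> dR_wedge A p 1 \<theta> (dR_class A 1 u) = dR_class A (p + 1) (wedge p 1 \<theta> u)"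
  unfolding dR_wedge_def by (rule dR_UN[OF wedge_class_cong])

lemma dR_wedge_linear: "dR_linear A 1 (p + 1) (dR_wedge A p 1 \<theta>)"
  unfolding dR_linear_def
proof (intro conjI ballI allI funcsetI)
  fix a assume a: "a \<in> dR A 1"
  then obtain u where u: "u \<in> closed_forms A 1" "a = dR_class A 1 u" by (rule dR_cases)
  show "dR_wedge A p 1 \<theta> a \<in> dR A (p + 1)"
    unfolding u(2) dR_wedge_class[OF u(1)] by (intro dR_class_in wedge_closed t u)
  show "dR_wedge A p 1 \<theta> (dR_scale A 1 r a) = dR_scale A (p + 1) r (dR_wedge A p 1 \<theta> a)" for r
    unfolding u(2) dR_scale_class[OF u(1)] dR_wedge_class[OF closed_scale[OF u(1)]] dR_wedge_class[OF u(1)]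
      dR_scale_class[OF wedge_closed[OF t u(1)]] wedge_scale_right ..
  fix b assume b: "b \<in> dR A 1"
  then obtain w where w: "w \<in> closed_forms A 1" "b = dR_class A 1 w" by (rule dR_cases)
  show "dR_wedge A p 1 \<theta> (dR_add A 1 a b) = dR_add A (p + 1) (dR_wedge A p 1 \<theta> a) (dR_wedge A p 1 \<theta> b)"
    unfolding u(2) w(2) dR_add_class[OF u(1) w(1)] dR_wedge_class[OF closed_add[OF u(1) w(1)]] dR_wedge_class[OF u(1)]
      dR_wedge_class[OF w(1)] dR_add_class[OF wedge_closed[OF t u(1)] wedge_closed[OF t w(1)]] wedge_add_right ..
qed

text \<open>Moves bijectivity from classes to representatives: what remains are a statement on the
  kernel and one on solvability modulo exact forms.\<close>

lemma dR_wedge_isomorphism: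
  assumes inj: "\<And>u. u \<in> closed_forms A 1 \<Longrightarrow> wedge p 1 \<theta> u \<in> exact_forms A (p + 1) \<Longrightarrow> u \<in> exact_forms A 1"
    and surj: "\<And>\<gamma>. \<gamma> \<in> closed_forms A (p + 1) \<Longrightarrow> \<exists>u\<in>closed_forms A 1. \<gamma> - wedge p 1 \<theta> u \<in> exact_forms A (p + 1)"
  shows "dR_isomorphism A 1 (p + 1) (dR_wedge A p 1 \<theta>)"
  unfolding dR_isomorphism_def bij_betw_def
proof (intro conjI)
  show "dR_linear A 1 (p + 1) (dR_wedge A p 1 \<theta>)" by (rule dR_wedge_linear)
  show "inj_on (dR_wedge A p 1 \<theta>) (dR A 1)"
  proof (rule inj_onI)
  fix a b assume "a \<in> dR A 1" "b \<in> dR A 1" and eq: "dR_wedge A p 1 \<theta> a = dR_wedge A p 1 \<theta> b"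
  then obtain u w where u: "u \<in> closed_forms A 1" "a = dR_class A 1 u" and w: "w \<in> closed_forms A 1" "b = dR_class A 1 w"
    by (metis dR_cases)
  have "wedge p 1 \<theta> u - wedge p 1 \<theta> w \<in> exact_forms A (p + 1)"
    using eq unfolding u(2) w(2) dR_wedge_class[OF u(1)] dR_wedge_class[OF w(1)]
    by (rule dR_class_eqD[OF wedge_closed[OF t u(1)] wedge_closed[OF t w(1)]])
  then show "a = b" unfolding u(2) w(2)
    by (intro dR_class_eq u w inj closed_diff) (simp add: wedge_diff_right)
  qed
  show "dR_wedge A p 1 \<theta> ` dR A 1 = dR A (p + 1)"
  proof (intro equalityI subsetI)
  fix a assume "a \<in> dR_wedge A p 1 \<theta> ` dR A 1"
  then show "a \<in> dR A (p + 1)" using dR_wedge_linear unfolding dR_linear_def by blast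
next
  fix g assume "g \<in> dR A (p + 1)"
  then obtain \<gamma> where g: "\<gamma> \<in> closed_forms A (p + 1)" "g = dR_class A (p + 1) \<gamma>" by (rule dR_cases)
  obtain u where u: "u \<in> closed_forms A 1" "\<gamma> - wedge p 1 \<theta> u \<in> exact_forms A (p + 1)" using surj[OF g(1)] by blast
  have "g = dR_wedge A p 1 \<theta> (dR_class A 1 u)"
    unfolding g(2) dR_wedge_class[OF u(1)] by (rule dR_class_eq[OF g(1) wedge_closed[OF t u(1)] u(2)])
  then show "g \<in> dR_wedge A p 1 \<theta> ` dR A 1" using dR_class_in[OF u(1)] by blast
  qed
qed

end

lemma dR_wedge_cong:
  assumes t: "\<theta> \<in> closed_forms A (Suc l)" and t': "\<theta>' \<in> closed_forms A (Suc l)"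
    and eq: "dR_class A (Suc l) \<theta>' = dR_class A (Suc l) \<theta>" and a: "a \<in> dR A 1"
  shows "dR_wedge A (Suc l) 1 \<theta>' a = dR_wedge A (Suc l) 1 \<theta> a"
proof -
  obtain u where u: "u \<in> closed_forms A 1" "a = dR_class A 1 u" using a by (rule dR_cases)
  have "wedge (Suc l) 1 \<theta>' u - wedge (Suc l) 1 \<theta> u \<in> exact_forms A (Suc l + 1)"
    unfolding wedge_diff_left[symmetric] by (rule wedge_exact_left[OF dR_class_eqD[OF t' t eq] u(1)])
  then show ?thesis
    unfolding u(2) dR_wedge_class[OF t' u(1)] dR_wedge_class[OF t u(1)]
    by (rule dR_class_eq[OF wedge_closed[OF t' u(1)] wedge_closed[OF t u(1)]])
qed

lemma forms_unit: "unit_form A \<in> forms A 0"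
proof (rule formsI)
  show "sform 0 (chart_image c) (unit_form A c)" if "c \<in> A" for c
    by (rule sform_cong[OF open_image[OF that], of "\<lambda>z v. 1"]) (auto simp: sform_def alternating_0 unit_form_def that)
  show "unit_form A c z v = pbk (transition c c') (unit_form A c') z v" if "c \<in> A" "c' \<in> A" "z \<in> ovl c c'" for c c' z v
    using subsetD[OF ovl_subset that(3)] subsetD[OF ovl_subset transition_ovl[OF that]] that
    by (simp add: unit_form_def pbk_def)
qed (auto simp: unit_form_def)

lemma forms_wedge_power2: "\<omega> \<in> forms A 2 \<Longrightarrow> wedge_power2 A \<omega> k \<in> forms A (2 * k)"
proof (induction k)
  case (Suc k)
  then show ?case using forms_wedge[of \<omega> 2 "wedge_power2 A \<omega> k" "2 * k"] by simp
qed (simp add: forms_unit)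

lemma balanced_divided_power_closed:
  assumes "balanced_metric A \<omega>"
  shows "divided_power A \<omega> (CARD('n) - 1) \<in> closed_forms A (2 * CARD('n) - 2)"
proof -
  have w: "\<omega> \<in> forms A 2" and d: "ext_d (2 * (CARD('n) - 1)) (wedge_power2 A \<omega> (CARD('n) - 1)) = 0"
    using assms by (auto simp: balanced_metric_def hermitian_metric_def)
  have "wedge_power2 A \<omega> (CARD('n) - 1) \<in> closed_forms A (2 * (CARD('n) - 1))"
    unfolding closed_forms_def using d forms_wedge_power2[OF w] by simp
  then show ?thesis unfolding divided_power_def using closed_scale by (simp add: right_diff_distrib')
qed

end

section \<open>Smooth cut-off functions\<close>

text \<open>The functions p(1/t) exp(-1/t), continued by 0. The family is closed under
  differentiation, with \<open>flat_deriv p\<close> as the new polynomial, so smoothness follows by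
  induction from a single limit at 0.\<close>

definition flat :: "real poly \<Rightarrow> real \<Rightarrow> real" where
  "flat p t = (if t > 0 then poly p (inverse t) * exp (- inverse t) else 0)"

lemma poly_exp_tendsto_0: "((\<lambda>s. s ^ k * poly p s * exp (- s)) \<longlongrightarrow> 0) (at_top :: real filter)"
proof (induction p arbitrary: k)
  case (pCons a p)
  have "((\<lambda>s. a * (s ^ k / exp s) + s ^ Suc k * poly p s * exp (- s)) \<longlongrightarrow> a * 0 + 0) (at_top :: real filter)"
    by (intro tendsto_add tendsto_mult_left tendsto_power_div_exp_0 pCons.IH)
  then show ?case by (simp add: algebra_simps exp_minus divide_inverse)
qed simp

definition flat_deriv :: "real poly \<Rightarrow> real poly" where
  "flat_deriv p = [:0, 0, 1:] * (p - pderiv p)"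

lemma DERIV_flat: "(flat p has_field_derivative flat (flat_deriv p) t) (at t)"
proof -
  consider "t > 0" | "t < 0" | "t = 0" by linarith
  then show ?thesis
  proof cases
    case 1
    have "((\<lambda>t. poly p (inverse t) * exp (- inverse t)) has_field_derivative flat (flat_deriv p) t) (at t)"
      using 1 by (auto intro!: derivative_eq_intros DERIV_chain2[OF poly_DERIV]
        simp: flat_def flat_deriv_def power2_eq_square algebra_simps)
    then show ?thesis
      by (rule DERIV_cong_ev[THEN iffD1, OF refl _ refl, rotated])
        (use eventually_nhds_in_open[of "{0<..}" t] 1 in \<open>auto simp: flat_def elim!: eventually_mono\<close>)
  next
    case 2
    have "((\<lambda>t. 0) has_field_derivative flat (flat_deriv p) t) (at t)"
      using 2 by (simp add: flat_def)
    then show ?thesis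
      by (rule DERIV_cong_ev[THEN iffD1, OF refl _ refl, rotated])
        (use eventually_nhds_in_open[of "{..<0}" t] 2 in \<open>auto simp: flat_def elim!: eventually_mono\<close>)
  next
    case 3
    have "((\<lambda>h. flat p h / h) \<longlongrightarrow> 0) (at_right 0)"
    proof -
      have "((\<lambda>h. inverse h ^ 1 * poly p (inverse h) * exp (- inverse h)) \<longlongrightarrow> 0) (at_right 0)"
        by (rule filterlim_compose[OF poly_exp_tendsto_0 filterlim_inverse_at_top_right])
      then show ?thesis
        by (rule Lim_transform_eventually)
          (use eventually_at_right_less[of "0::real"] in \<open>auto simp: flat_def divide_inverse mult_ac elim!: eventually_mono\<close>)
    qed
    moreover have "((\<lambda>h. flat p h / h) \<longlongrightarrow> 0) (at_left 0)"
      by (rule Lim_transform_eventually[OF tendsto_const])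
        (use eventually_at_left_real[of "-1" "0::real"] in \<open>auto simp: flat_def elim!: eventually_mono\<close>)
    ultimately have "((\<lambda>h. flat p h / h) \<longlongrightarrow> 0) (at 0)" by (simp add: filterlim_at_split)
    then show ?thesis by (simp add: 3 has_field_derivative_iff flat_def)
  qed
qed

lemma smooth_flat: "smooth_on UNIV (flat p)"
  unfolding smooth_on_def
proof
  fix k show "Ck_on k UNIV (flat p)"
  proof (induction k arbitrary: p)
    case 0
    show ?case unfolding Ck_on.simps
      by (rule continuous_at_imp_continuous_on) (intro ballI DERIV_isCont[OF DERIV_flat])
  next
    case (Suc k)
    show ?case
      by (rule Ck_on_SucI[where f'="\<lambda>z v. flat (flat_deriv p) z * v"])
        (use DERIV_flat[of p] Ck_on_bounded_linear[OF bounded_linear_mult_left open_UNIV Suc.IH] in \<open>auto simp: has_field_derivative_def\<close>)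
  qed
qed

text \<open>\<open>e\<close> is a normalised bump and \<open>A\<close> its antiderivative. In the
  compactly supported Poincare lemma \<open>e\<close> carries the integral along a line, and
  \<open>A\<close> removes that integral from the primitive.\<close>

lemma smooth_step_exists:
  assumes r: "r > 0"
  shows "\<exists>A e :: real \<Rightarrow> real. smooth_on UNIV A \<and> smooth_on UNIV e \<and> (\<forall>t. (A has_field_derivative e t) (at t)) \<and>
    (\<forall>t. e t \<ge> 0) \<and> e 0 > 0 \<and> (\<forall>t. \<bar>t\<bar> \<ge> r \<longrightarrow> e t = 0) \<and> (\<forall>t\<le>-r. A t = 0) \<and> (\<forall>t\<ge>r. A t = 1)"
proof -
  define f where "f t = flat 1 (r * r - t * t)" for t
  have f0: "f t \<ge> 0" for t by (simp add: f_def flat_def)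
  have fz: "f t = 0" if "\<bar>t\<bar> \<ge> r" for t
    using abs_le_square_iff[of r t] that r by (simp add: f_def flat_def power2_eq_square)
  have fp: "f 0 > 0" using r by (simp add: f_def flat_def)
  have sf: "smooth_on UNIV f"
    unfolding f_def by (rule smooth_on_compose[OF open_UNIV open_UNIV _ _ smooth_flat])
      (auto intro!: smooth_on_diff smooth_on_mult smooth_on_id)
  have cf: "continuous_on S f" for S
    using smooth_on_continuous[OF sf] continuous_on_subset by blast
  \<comment> \<open>Starting one unit to the left of -r makes every t \<ge> -r an interior point of
    an interval of integration, so the fundamental theorem gives a two-sided derivative
    there.\<close>
  define F where "F t = integral {-r-1..t} f" for t
  have F0: "F t = 0" if "t \<le> -r" for t
  proof -
    have "integral {-r-1..t} f = integral {-r-1..t} (\<lambda>_. 0)"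
      by (rule integral_cong) (use that r in \<open>auto intro!: fz\<close>)
    then show ?thesis by (simp add: F_def)
  qed
  have FD: "(F has_field_derivative f t) (at t)" for t
  proof (cases "t < -r")
    case True
    have "((\<lambda>_. 0) has_field_derivative f t) (at t)" using True fz[of t] r by simp
    then show ?thesis
      by (rule DERIV_cong_ev[THEN iffD1, OF refl _ refl, rotated])
        (use eventually_nhds_in_open[of "{..<-r}" t] True F0 in \<open>auto elim!: eventually_mono\<close>)
  next
    case False
    have "(F has_field_derivative f t) (at t within {-r-1..t+1})"
      unfolding F_def has_real_derivative_iff_has_vector_derivative
      by (rule integral_has_vector_derivative[OF cf]) (use False in auto)
    then show ?thesis using False at_within_Icc_at[of "-r-1" t "t+1"] by simp
  qed
  have Fr: "F t = F r" if "t \<ge> r" for t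
  proof -
    have "F t - F r = integral {r..t} f"
      unfolding F_def using Henstock_Kurzweil_Integration.integral_combine[of "-r-1" r t f] that r
        integrable_continuous_real[OF cf] by force
    also have "\<dots> = integral {r..t} (\<lambda>_. 0)"
      by (rule integral_cong) (use r in \<open>auto intro!: fz\<close>)
    finally show ?thesis by simp
  qed
  have mono: "F a \<le> F b" if "a \<le> b" for a b
    using that by (rule DERIV_nonneg_imp_nondecreasing) (use FD f0 in blast)
  have pos: "f x > 0" if "-r/2 \<le> x" "x \<le> r/2" for x
  proof -
    have "\<bar>x\<bar> < \<bar>r\<bar>" using r that by auto
    then have "x * x < r * r" using abs_le_square_iff[of r x] by (auto simp: power2_eq_square not_le[symmetric])
    then show ?thesis by (simp add: f_def flat_def)
  qed
  have "F (-r/2) < F (r/2)"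
    by (rule DERIV_pos_imp_increasing) (use r FD pos in \<open>simp, blast\<close>)
  moreover have "F (-r) \<le> F (-r/2)" "F (r/2) \<le> F r" using r by (auto intro!: mono)
  ultimately have Fp: "F r > 0" using F0[of "-r"] by simp
  define A where "A t = inverse (F r) * F t" for t
  define e where "e t = inverse (F r) * f t" for t
  have AD: "(A has_field_derivative e t) (at t)" for t
    unfolding A_def e_def by (rule DERIV_cmult[OF FD])
  have se: "smooth_on UNIV e" unfolding e_def by (intro smooth_on_mult sf smooth_on_const open_UNIV)
  have "smooth_on UNIV A"
    by (rule smooth_onI[OF open_UNIV, where f'="\<lambda>z v. e z * v"])
      (use AD smooth_on_mult[OF open_UNIV se smooth_on_const] in \<open>auto simp: has_field_derivative_def\<close>)
  moreover have "A t = 1" if "t \<ge> r" for t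
    unfolding A_def by (subst Fr[OF that]) (use Fp in simp)
  moreover have "A t = 0" if "t \<le> -r" for t using F0[OF that] by (simp add: A_def)
  moreover have "e t \<ge> 0" "\<bar>t\<bar> \<ge> r \<Longrightarrow> e t = 0" "e 0 > 0" for t using f0 fz fp Fp by (simp_all add: e_def)
  ultimately show ?thesis using AD se by (intro exI[of _ A] exI[of _ e] conjI allI impI)
qed

section \<open>The Poincare lemma with compact support\<close>

lemma integral_UNIV_support:
  fixes f :: "'b::euclidean_space \<Rightarrow> complex"
  shows "(\<And>x. x \<notin> S \<Longrightarrow> f x = 0) \<Longrightarrow> integral UNIV f = integral S f"
  unfolding integral_restrict_UNIV[symmetric, of S f] by (rule integral_cong) auto

lemma integrable_compact_support:
  fixes g :: "'b::euclidean_space \<Rightarrow> complex"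
  assumes "continuous_on UNIV g" "compact Q" "\<And>x. x \<notin> Q \<Longrightarrow> g x = 0"
  shows "integrable lborel g"
proof -
  have "integrable lborel (\<lambda>x. indicator Q x *\<^sub>R g x)"
    by (rule borel_integrable_compact[OF assms(2)]) (use assms(1) continuous_on_subset in blast)
  moreover have "(\<lambda>x. indicator Q x *\<^sub>R g x) = g" by (rule ext) (use assms(3) in \<open>auto simp: indicator_def\<close>)
  ultimately show ?thesis by simp
qed

lemma has_derivative_integral_translate:
  fixes g :: "'b::euclidean_space \<Rightarrow> complex"
  assumes g: "smooth_on UNIV g"
  shows "((\<lambda>x. integral {\<alpha>..\<beta>} (\<lambda>s. g (x - s *\<^sub>R b))) has_derivative
    (\<lambda>v. integral {\<alpha>..\<beta>} (\<lambda>s. frechet_derivative g (at (x - s *\<^sub>R b)) v))) (at (x :: 'b))"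
  unfolding cbox_interval[symmetric]
proof (rule has_derivative_integral_param[where U=UNIV and F'="\<lambda>x s. frechet_derivative g (at (x - s *\<^sub>R b))"])
  show "((\<lambda>x. g (x - t *\<^sub>R b)) has_derivative frechet_derivative g (at (x - t *\<^sub>R b))) (at x)" for x t
  proof -
    have "((\<lambda>x. x - t *\<^sub>R b) has_derivative (\<lambda>v. v)) (at x)" by (auto intro!: derivative_eq_intros)
    from diff_chain_at[OF this smooth_on_has_derivative[OF g UNIV_I]] show ?thesis by (simp add: o_def)
  qed
  show "continuous_on (UNIV \<times> cbox \<alpha> \<beta>) (\<lambda>(x, t). frechet_derivative g (at (x - t *\<^sub>R b)) w)" for w
    unfolding case_prod_beta
    by (rule continuous_on_compose2[OF smooth_on_continuous[OF smooth_on_deriv[OF g, of w]]])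
      (auto intro!: continuous_intros)
  show "(\<lambda>s. g (x - s *\<^sub>R b)) integrable_on cbox \<alpha> \<beta>" for x
    by (intro integrable_continuous continuous_on_compose2[OF smooth_on_continuous[OF g]]) (auto intro!: continuous_intros)
qed auto

definition avg :: "real \<Rightarrow> real \<Rightarrow> 'b \<Rightarrow> ('b::euclidean_space \<Rightarrow> complex) \<Rightarrow> 'b \<Rightarrow> complex" where
  "avg \<alpha> \<beta> b g x = integral {\<alpha>..\<beta>} (\<lambda>s. g (x - s *\<^sub>R b))"

lemma frechet_avg:
  "smooth_on UNIV g \<Longrightarrow> frechet_derivative (avg \<alpha> \<beta> b g) (at x) v = avg \<alpha> \<beta> b (\<lambda>y. frechet_derivative g (at y) v) x"
  unfolding avg_def using frechet_derivative_eqI[OF has_derivative_integral_translate[of g \<alpha> \<beta> b x]] by simp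

lemma smooth_avg:
  assumes "smooth_on UNIV g"
  shows "smooth_on UNIV (avg \<alpha> \<beta> b g)"
  unfolding smooth_on_def
proof
  fix k show "Ck_on k UNIV (avg \<alpha> \<beta> b g)" using assms
  proof (induction k arbitrary: g)
    case 0
    have "isCont (avg \<alpha> \<beta> b g) x" for x
      unfolding avg_def by (rule has_derivative_continuous[OF has_derivative_integral_translate[OF 0]])
    then show ?case unfolding Ck_on.simps by (intro continuous_at_imp_continuous_on ballI)
  next
    case (Suc k)
    have "((\<lambda>x. avg \<alpha> \<beta> b g x) has_derivative (\<lambda>v. avg \<alpha> \<beta> b (\<lambda>y. frechet_derivative g (at y) v) x)) (at x)" for x
      unfolding avg_def by (rule has_derivative_integral_translate[OF Suc.prems])
    then show ?case
      by (intro Ck_on_SucI[where f'="\<lambda>x v. avg \<alpha> \<beta> b (\<lambda>y. frechet_derivative g (at y) v) x"] Suc.IH smooth_on_deriv Suc.prems) auto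
  qed
qed

lemma avg_integrable:
  fixes g :: "'b::euclidean_space \<Rightarrow> complex"
  shows "continuous_on UNIV g \<Longrightarrow> (\<lambda>s. g (x - s *\<^sub>R b)) integrable_on {\<alpha>..\<beta>::real}"
  unfolding cbox_interval[symmetric]
  by (rule integrable_continuous, rule continuous_on_compose2[where g=g and t=UNIV]) (auto intro!: continuous_intros)

lemma avg_add: "smooth_on UNIV g \<Longrightarrow> smooth_on UNIV h \<Longrightarrow> avg \<alpha> \<beta> b (\<lambda>x. g x + h x) x = avg \<alpha> \<beta> b g x + avg \<alpha> \<beta> b h x"
  unfolding avg_def by (rule integral_add) (auto intro!: avg_integrable smooth_on_continuous)

lemma avg_cmult: "avg \<alpha> \<beta> b (\<lambda>x. c * g x) x = c * avg \<alpha> \<beta> b g x"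
  unfolding avg_def by simp

lemma avg_zero: "(\<And>s. \<alpha> \<le> s \<Longrightarrow> s \<le> \<beta> \<Longrightarrow> g (x - s *\<^sub>R b) = 0) \<Longrightarrow> avg \<alpha> \<beta> b g x = 0"
  unfolding avg_def by (subst integral_cong[where g="\<lambda>_. 0"]) auto

lemma avg_deriv:
  assumes g: "smooth_on UNIV g" and "\<alpha> \<le> \<beta>"
  shows "avg \<alpha> \<beta> b (\<lambda>y. frechet_derivative g (at y) b) x = g (x - \<alpha> *\<^sub>R b) - g (x - \<beta> *\<^sub>R b)"
proof -
  have "((\<lambda>s. frechet_derivative g (at (x - s *\<^sub>R b)) b) has_integral - g (x - \<beta> *\<^sub>R b) - (- g (x - \<alpha> *\<^sub>R b))) {\<alpha>..\<beta>}"
  proof (rule fundamental_theorem_of_calculus[OF assms(2)])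
    fix s
    have lin: "linear (frechet_derivative g (at (x - s *\<^sub>R b)))"
      using smooth_on_has_derivative[OF g UNIV_I] has_derivative_linear by blast
    have "((\<lambda>s. x - s *\<^sub>R b) has_derivative (\<lambda>k. - (k *\<^sub>R b))) (at s)"
      by (auto intro!: derivative_eq_intros)
    from has_derivative_minus[OF diff_chain_at[OF this smooth_on_has_derivative[OF g UNIV_I]]]
    have "((\<lambda>s. - g (x - s *\<^sub>R b)) has_vector_derivative frechet_derivative g (at (x - s *\<^sub>R b)) b) (at s)"
      unfolding has_vector_derivative_def o_def by (simp add: linear_neg[OF lin] linear_scale[OF lin])
    then show "((\<lambda>s. - g (x - s *\<^sub>R b)) has_vector_derivative frechet_derivative g (at (x - s *\<^sub>R b)) b) (at s within {\<alpha>..\<beta>})"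
      by (rule has_vector_derivative_at_within)
  qed
  then show ?thesis unfolding avg_def by (simp add: integral_unique)
qed

text \<open>The integral of g(x + t v) over x is independent of t by translation invariance, and its
  derivative at t = 0 can be taken under the integral. The box with corners -B and B contains the
  translated supports for all |t| \<le> 1.\<close>

lemma integral_deriv_zero:
  fixes g :: "'b::euclidean_space \<Rightarrow> complex"
  assumes g: "smooth_on UNIV g" and Q: "compact Q" "\<And>x. x \<notin> Q \<Longrightarrow> g x = 0"
  shows "(LINT x|lborel. frechet_derivative g (at x) v) = 0"
proof -
  obtain M where M: "Q \<subseteq> ball 0 M" using bounded_subset_ballD[OF compact_imp_bounded[OF Q(1)], of 0] by blast
  obtain B :: "'b" where B: "ball 0 (M + norm v) \<subseteq> cbox (-B) B" using bounded_subset_cbox_symmetric[OF bounded_ball] by blast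
  have out: "g (x + t *\<^sub>R v) = 0" if "x \<notin> cbox (-B) B" "\<bar>t\<bar> \<le> 1" for x t
  proof -
    have "norm (t *\<^sub>R v) \<le> norm v" using that(2) by (simp add: mult_left_le_one_le)
    moreover have "norm x \<ge> M + norm v" using that(1) B by (auto simp: subset_iff not_le[symmetric])
    ultimately have "norm (x + t *\<^sub>R v) \<ge> M" using norm_diff_ineq[of x "t *\<^sub>R v"] by linarith
    then have "x + t *\<^sub>R v \<notin> Q" using M by auto
    then show ?thesis by (rule Q(2))
  qed
  have cont: "continuous_on UNIV g" by (rule smooth_on_continuous[OF g])
  have LI: "integral (cbox (-B) B) (\<lambda>x. g (x + t *\<^sub>R v)) = (LINT x|lborel. g x)" if "\<bar>t\<bar> \<le> 1" for t
  proof -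
    have c: "continuous_on UNIV (\<lambda>x. g (x + t *\<^sub>R v))"
      by (rule continuous_on_compose2[OF cont]) (auto intro!: continuous_intros)
    have i: "integrable lborel (\<lambda>x. g (x + t *\<^sub>R v))"
      by (rule integrable_compact_support[OF c compact_cbox]) (rule out[OF _ that])
    have "integral (cbox (-B) B) (\<lambda>x. g (x + t *\<^sub>R v)) = integral UNIV (\<lambda>x. g (x + t *\<^sub>R v))"
      by (rule integral_UNIV_support[symmetric]) (rule out[OF _ that])
    also have "\<dots> = (LINT x|lborel. g (x + t *\<^sub>R v))" by (rule integral_lborel[OF i])
    also have "\<dots> = (LINT x|lborel. g x)"
    proof -
      have "(LINT x|lborel. g x) = (LINT x|distr lborel borel ((+) (t *\<^sub>R v)). g x)"
        by (simp only: lborel_distr_plus)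
      also have "\<dots> = (LINT x|lborel. g (t *\<^sub>R v + x))"
        by (rule integral_distr) (simp_all add: borel_measurable_continuous_onI[OF cont])
      finally show ?thesis by (simp only: add.commute)
    qed
    finally show ?thesis .
  qed
  have "((\<lambda>t. integral (cbox (-B) B) (\<lambda>x. g (x + t *\<^sub>R v))) has_derivative
     (\<lambda>w. integral (cbox (-B) B) (\<lambda>x. w *\<^sub>R frechet_derivative g (at (x + 0 *\<^sub>R v)) v))) (at 0)"
  proof (rule has_derivative_integral_param[where U="ball 0 1" and F'="\<lambda>t x w. w *\<^sub>R frechet_derivative g (at (x + t *\<^sub>R v)) v"])
    fix t :: real and x
    have lin: "linear (frechet_derivative g (at (x + t *\<^sub>R v)))"
      using smooth_on_has_derivative[OF g UNIV_I] has_derivative_linear by blast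
    have "((\<lambda>t. x + t *\<^sub>R v) has_derivative (\<lambda>k. k *\<^sub>R v)) (at t)" by (auto intro!: derivative_eq_intros)
    from diff_chain_at[OF this smooth_on_has_derivative[OF g UNIV_I]]
    show "((\<lambda>t. g (x + t *\<^sub>R v)) has_derivative (\<lambda>w. w *\<^sub>R frechet_derivative g (at (x + t *\<^sub>R v)) v)) (at t)"
      by (simp add: o_def linear_scale[OF lin])
  next
    show "continuous_on (ball 0 1 \<times> cbox (-B) B) (\<lambda>(t, x). w *\<^sub>R frechet_derivative g (at (x + t *\<^sub>R v)) v)" for w
      unfolding case_prod_beta
      by (intro continuous_on_scaleR continuous_on_const continuous_on_compose2[OF smooth_on_continuous[OF smooth_on_deriv[OF g, of v]]])
        (auto intro!: continuous_intros)
    show "(\<lambda>x. g (x + t *\<^sub>R v)) integrable_on cbox (-B) B" for t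
      by (intro integrable_continuous continuous_on_compose2[OF cont]) (auto intro!: continuous_intros)
  qed auto
  moreover have "((\<lambda>t. integral (cbox (-B) B) (\<lambda>x. g (x + t *\<^sub>R v))) has_derivative (\<lambda>w. 0)) (at 0)"
    by (rule has_derivative_transform_within_open[OF has_derivative_const[of "LINT x|lborel. g x"], of "ball 0 1"]) (auto simp: LI)
  ultimately have "(\<lambda>w. integral (cbox (-B) B) (\<lambda>x. w *\<^sub>R frechet_derivative g (at (x + 0 *\<^sub>R v)) v)) = (\<lambda>w. 0)"
    by (rule has_derivative_unique)
  from fun_cong[OF this, of 1] have 0: "integral (cbox (-B) B) (\<lambda>x. frechet_derivative g (at x) v) = 0" by simp
  have dz: "frechet_derivative g (at x) v = 0" if "x \<notin> Q" for x
    by (rule frechet_derivative_zero_on[of "-Q"]) (use Q that compact_imp_closed in auto)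
  have "ball 0 M \<subseteq> ball (0::'b) (M + norm v)" by (rule subset_ball) simp
  then have QB: "Q \<subseteq> cbox (-B) B" using M B by blast
  have "(LINT x|lborel. frechet_derivative g (at x) v) = integral UNIV (\<lambda>x. frechet_derivative g (at x) v)"
    by (rule integral_lborel[symmetric], rule integrable_compact_support[OF smooth_on_continuous[OF smooth_on_deriv[OF g]] Q(1) dz])
  also have "\<dots> = integral (cbox (-B) B) (\<lambda>x. frechet_derivative g (at x) v)"
    by (rule integral_UNIV_support) (use dz QB in blast)
  finally show ?thesis using 0 by simp
qed

lemma integral_nonneg_zero_imp:
  fixes f :: "'b::euclidean_space \<Rightarrow> real"
  assumes c: "continuous_on UNIV f" and nn: "\<And>x. f x \<ge> 0" and Q: "compact Q" "\<And>x. x \<notin> Q \<Longrightarrow> f x = 0"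
    and z: "(LINT x|lborel. f x) = 0"
  shows "f x = 0"
proof -
  obtain B :: 'b where B: "Q \<union> {x} \<subseteq> box (-B) B"
    using bounded_subset_box_symmetric[of "Q \<union> {x}"] compact_imp_bounded[OF Q(1)] by auto
  have "integrable lborel (\<lambda>x. indicator Q x *\<^sub>R f x)"
    by (rule borel_integrable_compact[OF Q(1)]) (use c continuous_on_subset in blast)
  moreover have "(\<lambda>x. indicator Q x *\<^sub>R f x) = f" by (rule ext) (use Q(2) in \<open>auto simp: indicator_def\<close>)
  ultimately have i: "integrable lborel f" by simp
  have "integral UNIV f = 0" using integral_lborel[OF i] z by simp
  moreover have "integral UNIV f = integral (cbox (-B) B) f"
    unfolding integral_restrict_UNIV[symmetric, of "cbox (-B) B" f]
    by (rule integral_cong) (use Q(2) B box_subset_cbox in fastforce)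
  moreover have cc: "continuous_on (cbox (-B) B) f" using c continuous_on_subset by blast
  ultimately have "(f has_integral 0) (cbox (-B) B)"
    using integrable_integral[OF integrable_continuous[OF cc]] by simp
  then show ?thesis
    by (rule has_integral_0_cbox_imp_0[OF cc nn]) (use B box_subset_cbox in auto)
qed

text \<open>The slots are expanded in the real basis one after the other; tuples with a repetition
  vanish by alternation, so only injective ones need checking.\<close>

lemma alternating_zero_on_basis:
  assumes "alternating k f" "\<And>v. inj_on v {..<k} \<Longrightarrow> v ` {..<k} \<subseteq> Basis \<Longrightarrow> f v = 0"
  shows "f v = 0"
  using assms
proof (induction k arbitrary: f v)
  case 0
  then show ?case by simp
next
  case (Suc k)
  have "f (b ## w) = 0" if b: "b \<in> Basis" for b w
  proof -
    have "contr b f w = 0"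
    proof (rule Suc.IH[OF alternating_contr[OF Suc.prems(1)]])
      fix v :: "nat \<Rightarrow> (complex, 'a) vec" assume v: "inj_on v {..<k}" "v ` {..<k} \<subseteq> Basis"
      show "contr b f v = 0"
      proof (cases "b \<in> v ` {..<k}")
        case True
        then obtain i where i: "i < k" "b = v i" by auto
        show ?thesis unfolding contr_def
          by (rule alternating_eq[OF Suc.prems(1), of 0 "Suc i"]) (use i in auto)
      next
        case False
        have "inj_on (b ## v) {..<Suc k}"
        proof (rule inj_onI)
          fix i j assume "i \<in> {..<Suc k}" "j \<in> {..<Suc k}" "(b ## v) i = (b ## v) j"
          then show "i = j" using False inj_onD[OF v(1)] by (cases i; cases j) auto
        qed
        moreover have "(b ## v) ` {..<Suc k} \<subseteq> Basis"
        proof (intro subsetI, elim imageE)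
          fix y i assume "y = (b ## v) i" "i \<in> {..<Suc k}"
          then show "y \<in> Basis" using b v(2) by (cases i) auto
        qed
        ultimately show ?thesis unfolding contr_def by (rule Suc.prems(2))
      qed
    qed
    then show ?thesis by (simp add: contr_apply)
  qed
  then have "f (x ## w) = 0" for x w unfolding alternating_expand[OF Suc.prems(1), of x w] by simp
  from this[of "v 0" "\<lambda>i. v (Suc i)"] show ?case unfolding vcons_eta .
qed

section \<open>Integration along coordinate lines in a cube\<close>

locale cube =
  fixes c :: "complex ^ 'n::finite" and r R :: real and A e :: "real \<Rightarrow> real"
  assumes r: "0 < r" "r < R"
    and A: "smooth_on UNIV A" "\<And>t. (A has_field_derivative e t) (at t)" "\<And>t. t \<le> -r \<Longrightarrow> A t = 0" "\<And>t. t \<ge> r \<Longrightarrow> A t = 1"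
    and e: "smooth_on UNIV e" "\<And>t. e t \<ge> 0" "e 0 > 0" "\<And>t. \<bar>t\<bar> \<ge> r \<Longrightarrow> e t = 0"
begin

definition Q :: "(complex ^ 'n) set" where "Q = {x. \<forall>b\<in>Basis. \<bar>(x - c) \<bullet> b\<bar> \<le> r}"
definition V :: "(complex ^ 'n) set" where "V = {x. \<forall>b\<in>Basis. \<bar>(x - c) \<bullet> b\<bar> < R}"

lemma Q_cbox: "Q = cbox (c - r *\<^sub>R One) (c + r *\<^sub>R One)"
proof -
  have "\<bar>(x - c) \<bullet> b\<bar> \<le> r \<longleftrightarrow> (c - r *\<^sub>R One) \<bullet> b \<le> x \<bullet> b \<and> x \<bullet> b \<le> (c + r *\<^sub>R One) \<bullet> b" if "b \<in> Basis" for x b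
    using that by (simp add: inner_diff_left inner_add_left) arith
  then show ?thesis unfolding Q_def cbox_def by blast
qed

lemma V_box: "V = box (c - R *\<^sub>R One) (c + R *\<^sub>R One)"
proof -
  have "\<bar>(x - c) \<bullet> b\<bar> < R \<longleftrightarrow> (c - R *\<^sub>R One) \<bullet> b < x \<bullet> b \<and> x \<bullet> b < (c + R *\<^sub>R One) \<bullet> b" if "b \<in> Basis" for x b
    using that by (simp add: inner_diff_left inner_add_left) arith
  then show ?thesis unfolding V_def box_def by blast
qed

lemma compact_Q: "compact Q" by (simp add: Q_cbox)
lemma open_nQ: "open (- Q)" using compact_Q compact_imp_closed by blast
lemma open_V: "open V" unfolding V_box by (rule open_box)
lemma QV: "Q \<subseteq> V" using r by (auto simp: Q_def V_def)
definition SF :: "(complex ^ 'n \<Rightarrow> complex) \<Rightarrow> bool" where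
  "SF g \<longleftrightarrow> smooth_on UNIV g \<and> (\<forall>x. x \<notin> Q \<longrightarrow> g x = 0)"

lemma SF_smooth: "SF g \<Longrightarrow> smooth_on UNIV g" by (simp add: SF_def)
lemma SF_zero: "SF g \<Longrightarrow> x \<notin> Q \<Longrightarrow> g x = 0" by (simp add: SF_def)

lemma SF_deriv: "SF g \<Longrightarrow> SF (\<lambda>x. frechet_derivative g (at x) v)"
  unfolding SF_def by (auto intro!: smooth_on_deriv frechet_derivative_zero_on[OF open_nQ])

lemma SF_cmult: "SF g \<Longrightarrow> SF (\<lambda>x. a * g x)" by (simp add: SF_def smooth_on_mult)
lemma SF_sum: "(\<And>i. i \<in> S \<Longrightarrow> SF (g i)) \<Longrightarrow> SF (\<lambda>x. \<Sum>i\<in>S. g i x)"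
  by (simp add: SF_def smooth_on_sum)

text \<open>The formulas for \<open>J\<close> and \<open>E\<close> integrate over bounded ranges and
  are meaningful in \<open>V\<close> only. That they vanish on the shell between \<open>Q\<close>
  and the boundary of \<open>V\<close> makes the cut-off by 0 smooth.\<close>

lemma SF_ext:
  assumes "smooth_on UNIV h" "\<And>x. x \<in> V \<Longrightarrow> x \<notin> Q \<Longrightarrow> h x = 0"
  shows "SF (\<lambda>x. if x \<in> V then h x else 0)"
  unfolding SF_def
proof (intro conjI allI impI)
  have "smooth_on (V \<union> -Q) (\<lambda>x. if x \<in> V then h x else 0)"
  proof (rule smooth_on_Un[OF open_V open_nQ])
    show "smooth_on V (\<lambda>x. if x \<in> V then h x else 0)"
      by (rule smooth_on_cong[OF open_V _ smooth_on_subset[OF assms(1)]]) auto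
    show "smooth_on (- Q) (\<lambda>x. if x \<in> V then h x else 0)"
      by (rule smooth_on_cong[OF open_nQ _ smooth_on_const[of _ 0]]) (use assms(2) in auto)
  qed
  moreover have "V \<union> -Q = UNIV" using QV by auto
  ultimately show "smooth_on UNIV (\<lambda>x. if x \<in> V then h x else 0)" by simp
qed (use assms(2) in auto)

text \<open>\<open>E b g\<close> is the bump \<open>e\<close> times the integral of \<open>g\<close> along the lines in direction \<open>b\<close>, and
  \<open>J b g\<close> is the antiderivative in direction \<open>b\<close> of \<open>g - E b g\<close> with support in \<open>Q\<close>.\<close>

definition T1 :: "complex ^ 'n \<Rightarrow> (complex ^ 'n \<Rightarrow> complex) \<Rightarrow> complex ^ 'n \<Rightarrow> complex" where
  "T1 b = avg 0 (2 * R) b"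
definition T2 :: "complex ^ 'n \<Rightarrow> (complex ^ 'n \<Rightarrow> complex) \<Rightarrow> complex ^ 'n \<Rightarrow> complex" where
  "T2 b = avg (- 2 * R) (2 * R) b"
definition J :: "complex ^ 'n \<Rightarrow> (complex ^ 'n \<Rightarrow> complex) \<Rightarrow> complex ^ 'n \<Rightarrow> complex" where
  "J b g x = (if x \<in> V then T1 b g x - of_real (A ((x - c) \<bullet> b)) * T2 b g x else 0)"
definition E :: "complex ^ 'n \<Rightarrow> (complex ^ 'n \<Rightarrow> complex) \<Rightarrow> complex ^ 'n \<Rightarrow> complex" where
  "E b g x = (if x \<in> V then of_real (e ((x - c) \<bullet> b)) * T2 b g x else 0)"

lemma smooth_coord: "smooth_on UNIV h \<Longrightarrow> smooth_on UNIV (\<lambda>x. complex_of_real (h ((x - c) \<bullet> b)))" for h :: "real \<Rightarrow> real" and b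
proof -
  assume h: "smooth_on UNIV h"
  have "smooth_on UNIV (\<lambda>x. (x - c) \<bullet> b)"
    by (rule smooth_on_bounded_linear[OF bounded_linear_inner_left open_UNIV
      smooth_on_diff[OF open_UNIV smooth_on_id[OF open_UNIV] smooth_on_const]])
  then show ?thesis
    by (rule smooth_on_bounded_linear[OF bounded_linear_of_real open_UNIV
      smooth_on_compose[OF open_UNIV open_UNIV UNIV_I _ h]])
qed

lemma e_out: "\<bar>t\<bar> > r \<Longrightarrow> e t = 0" using e(4)[of t] by simp

lemma avg_combine:
  assumes "smooth_on UNIV g" "\<alpha> \<le> \<beta>" "\<beta> \<le> \<gamma>"
  shows "avg \<alpha> \<beta> b g x + avg \<beta> \<gamma> b g x = avg \<alpha> \<gamma> b g x"
  unfolding avg_def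
  by (rule Henstock_Kurzweil_Integration.integral_combine[OF assms(2,3) avg_integrable[OF smooth_on_continuous[OF assms(1)]]])

lemma inner_shift: "b \<in> Basis \<Longrightarrow> a \<in> Basis \<Longrightarrow> (x - s *\<^sub>R b - c) \<bullet> a = (x - c) \<bullet> a - (if a = b then s else 0)"
  by (simp add: inner_diff_left inner_Basis)

text \<open>Some coordinate of x exceeds r in absolute value. If it is not the one along b, the
  whole line through x misses \<open>Q\<close>. If it is, then on one side \<open>T1\<close> is 0
  and \<open>A\<close> is 0, on the other \<open>T1\<close> equals the full line integral
  \<open>T2\<close> and \<open>A\<close> is 1; \<open>e\<close> is 0 on both sides.\<close>

lemma JE_vanish:
  assumes g: "SF g" and b: "b \<in> Basis" and x: "x \<notin> Q"
  shows "T1 b g x - of_real (A ((x - c) \<bullet> b)) * T2 b g x = 0" "of_real (e ((x - c) \<bullet> b)) * T2 b g x = 0"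
proof -
  obtain a where a: "a \<in> Basis" "\<bar>(x - c) \<bullet> a\<bar> > r" using x by (force simp: Q_def)
  have z: "g (x - s *\<^sub>R b) = 0" if "\<bar>(x - c) \<bullet> a - (if a = b then s else 0)\<bar> > r" for s
    by (rule SF_zero[OF g]) (use that a inner_shift[OF b a(1), of x s] in \<open>force simp: Q_def\<close>)
  have "T1 b g x - of_real (A ((x - c) \<bullet> b)) * T2 b g x = 0 \<and> of_real (e ((x - c) \<bullet> b)) * T2 b g x = 0"
  proof (cases "a = b")
    case False
    then have "T1 b g x = 0" "T2 b g x = 0" unfolding T1_def T2_def using a(2) by (auto intro!: avg_zero z)
    then show ?thesis by simp
  next
    case True
    show ?thesis
    proof (cases "(x - c) \<bullet> b > r")
      case gt: True
      have "avg (- 2 * R) 0 b g x = 0" using gt True by (auto intro!: avg_zero z)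
      then have "T1 b g x = T2 b g x"
        using avg_combine[OF SF_smooth[OF g], of "- 2 * R" 0 "2 * R" b x] r by (simp add: T1_def T2_def)
      then show ?thesis using gt A(4) e_out by simp
    next
      case False
      then have lt: "(x - c) \<bullet> b < - r" using a True by auto
      then have "T1 b g x = 0" unfolding T1_def using True by (auto intro!: avg_zero z)
      then show ?thesis using lt A(3) e_out by simp
    qed
  qed
  then show "T1 b g x - of_real (A ((x - c) \<bullet> b)) * T2 b g x = 0" "of_real (e ((x - c) \<bullet> b)) * T2 b g x = 0" by auto
qed

lemma smooth_T: "SF g \<Longrightarrow> smooth_on UNIV (T1 b g)" "SF g \<Longrightarrow> smooth_on UNIV (T2 b g)"
  by (simp_all add: T1_def T2_def smooth_avg SF_smooth)

lemma SF_J: "SF g \<Longrightarrow> b \<in> Basis \<Longrightarrow> SF (J b g)"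
  unfolding J_def
proof (rule SF_ext)
  assume g: "SF g" and b: "b \<in> Basis"
  show "smooth_on UNIV (\<lambda>x. T1 b g x - of_real (A ((x - c) \<bullet> b)) * T2 b g x)"
    by (intro smooth_on_diff smooth_on_mult smooth_T[OF g] smooth_coord A(1) open_UNIV)
qed (rule JE_vanish)

lemma SF_E: "SF g \<Longrightarrow> b \<in> Basis \<Longrightarrow> SF (E b g)"
  unfolding E_def
proof (rule SF_ext)
  assume g: "SF g" and b: "b \<in> Basis"
  show "smooth_on UNIV (\<lambda>x. of_real (e ((x - c) \<bullet> b)) * T2 b g x)"
    by (intro smooth_on_mult smooth_T[OF g] smooth_coord e(1) open_UNIV)
qed (rule JE_vanish)

lemma J_add: "SF g \<Longrightarrow> SF h \<Longrightarrow> J b (\<lambda>x. g x + h x) x = J b g x + J b h x"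
  by (simp add: J_def T1_def T2_def avg_add SF_smooth distrib_left)
lemma E_add: "SF g \<Longrightarrow> SF h \<Longrightarrow> E b (\<lambda>x. g x + h x) x = E b g x + E b h x"
  by (simp add: E_def T2_def avg_add SF_smooth distrib_left)
lemma J_cmult: "J b (\<lambda>x. a * g x) x = a * J b g x"
  by (simp add: J_def T1_def T2_def avg_cmult right_diff_distrib mult.left_commute)
lemma E_cmult: "E b (\<lambda>x. a * g x) x = a * E b g x"
  by (simp add: E_def T2_def avg_cmult mult.left_commute)
lemma J_0: "J b (\<lambda>x. 0) x = 0" using J_cmult[of b 0 "\<lambda>_. 0" x] by simp
lemma E_0: "E b (\<lambda>x. 0) x = 0" using E_cmult[of b 0 "\<lambda>_. 0" x] by simp

lemma J_sum: "(\<And>i. i \<in> S \<Longrightarrow> SF (g i)) \<Longrightarrow> J b (\<lambda>x. \<Sum>i\<in>S. g i x) x = (\<Sum>i\<in>S. J b (g i) x)"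
  by (induction S rule: infinite_finite_induct) (simp_all add: J_0 J_add SF_sum)

text \<open>Differentiation commutes with the averages; the one extra term comes from
  differentiating \<open>A\<close>, whose derivative \<open>e\<close> turns the line integral into
  \<open>E\<close>.\<close>

lemma frechet_J:
  assumes g: "SF g" and b: "b \<in> Basis"
  shows "frechet_derivative (J b g) (at x) v = J b (\<lambda>y. frechet_derivative g (at y) v) x - of_real (v \<bullet> b) * E b g x"
proof (cases "x \<in> V")
  case True
  let ?h = "\<lambda>x. T1 b g x - of_real (A ((x - c) \<bullet> b)) * T2 b g x"
  note dT = smooth_on_differentiable[OF smooth_T(1)[OF g] UNIV_I] smooth_on_differentiable[OF smooth_T(2)[OF g] UNIV_I]
  note dA = smooth_on_differentiable[OF smooth_coord[OF A(1)] UNIV_I]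
  have "((\<lambda>x. (x - c) \<bullet> b) has_derivative (\<lambda>v. v \<bullet> b)) (at x)" by (auto intro!: derivative_eq_intros)
  from diff_chain_at[OF this has_field_derivative_imp_has_derivative[OF A(2)]]
  have "((\<lambda>x. A ((x - c) \<bullet> b)) has_derivative (\<lambda>v. e ((x - c) \<bullet> b) * (v \<bullet> b))) (at x)" by (simp add: o_def)
  from frechet_derivative_eqI[OF bounded_linear.has_derivative[OF bounded_linear_of_real[where 'a=complex] this]]
  have fA: "frechet_derivative (\<lambda>x. complex_of_real (A ((x - c) \<bullet> b))) (at x) v = of_real (e ((x - c) \<bullet> b)) * of_real (v \<bullet> b)" by simp
  have "frechet_derivative (J b g) (at x) v = frechet_derivative ?h (at x) v"
    by (rule fun_cong[OF frechet_derivative_cong[OF open_V True]]) (simp add: J_def)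
  also have "\<dots> = frechet_derivative (T1 b g) (at x) v - (of_real (A ((x - c) \<bullet> b)) * frechet_derivative (T2 b g) (at x) v
      + of_real (e ((x - c) \<bullet> b)) * of_real (v \<bullet> b) * T2 b g x)"
    by (subst frechet_derivative_diff) (auto intro!: dT dA differentiable_mult simp: frechet_derivative_mult[OF dA dT(2)] fA)
  finally show ?thesis using True
    by (simp add: J_def E_def T1_def T2_def frechet_avg[OF SF_smooth[OF g]] mult_ac)
next
  case False
  then have "frechet_derivative (J b g) (at x) v = 0"
    using QV SF_zero[OF SF_J[OF g b]] by (intro frechet_derivative_zero_on[OF open_nQ]) auto
  then show ?thesis using False by (simp add: J_def E_def)
qed

text \<open>In \<open>V\<close> the b-coordinate is below R in absolute value, so a shift by 2R
  along b makes it larger than R > r. This is the origin of the bound 2R in \<open>T1\<close> and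
  \<open>T2\<close>.\<close>

lemma shift_out:
  assumes "SF g" "b \<in> Basis" "x \<in> V"
  shows "g (x - (2 * R) *\<^sub>R b) = 0" "g (x - (- 2 * R) *\<^sub>R b) = 0"
proof -
  have "\<bar>(x - c) \<bullet> b\<bar> < R" using assms by (simp add: V_def)
  then have "\<bar>(x - (2 * R) *\<^sub>R b - c) \<bullet> b\<bar> > r" "\<bar>(x - (- 2 * R) *\<^sub>R b - c) \<bullet> b\<bar> > r"
    unfolding inner_shift[OF assms(2,2)] using r by auto
  then have "x - (2 * R) *\<^sub>R b \<notin> Q" "x - (- 2 * R) *\<^sub>R b \<notin> Q"
    unfolding Q_def mem_Collect_eq using assms(2) not_le by blast+
  then show "g (x - (2 * R) *\<^sub>R b) = 0" "g (x - (- 2 * R) *\<^sub>R b) = 0"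
    using SF_zero[OF assms(1)] by blast+
qed

lemma T2_deriv: "SF g \<Longrightarrow> b \<in> Basis \<Longrightarrow> x \<in> V \<Longrightarrow> T2 b (\<lambda>y. frechet_derivative g (at y) b) x = 0"
  unfolding T2_def using r shift_out[of g b x] avg_deriv[OF SF_smooth, of g "- 2 * R" "2 * R" b x] by simp

lemma J_deriv:
  assumes "SF g" "b \<in> Basis"
  shows "J b (\<lambda>y. frechet_derivative g (at y) b) x = g x"
proof (cases "x \<in> V")
  case True
  have "T1 b (\<lambda>y. frechet_derivative g (at y) b) x = g x"
    unfolding T1_def using r avg_deriv[OF SF_smooth[OF assms(1)], of 0 "2 * R" b x] shift_out[OF assms True] by simp
  then show ?thesis using True T2_deriv[OF assms True] by (simp add: J_def)
next
  case False
  then show ?thesis using QV SF_zero[OF assms(1), of x] by (auto simp: J_def)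
qed

text \<open>For points of \<open>V\<close> the average runs over the complete part of the line that
  meets \<open>Q\<close>, so its derivative along b is 0; convexity of \<open>V\<close> keeps the
  segment inside.\<close>

lemma T2_invariant:
  assumes g: "SF g" and b: "b \<in> Basis" and V: "z \<in> V" "z + t *\<^sub>R b \<in> V"
  shows "T2 b g (z + t *\<^sub>R b) = T2 b g z"
proof -
  have seg: "z + s *\<^sub>R b \<in> V" if s: "s \<in> closed_segment 0 t" for s
  proof -
    have "z + s *\<^sub>R b \<in> closed_segment z (z + t *\<^sub>R b)"
      using s by (auto simp: in_segment algebra_simps)
    moreover have "convex V" by (simp add: V_box convex_box)
    ultimately show ?thesis using V closed_segment_subset by blast
  qed
  have "norm (T2 b g (z + t *\<^sub>R b) - T2 b g (z + 0 *\<^sub>R b)) \<le> 0 * norm (t - 0)"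
  proof (rule vector_differentiable_bound[where S="closed_segment 0 t" and g'="\<lambda>s. 0"])
    fix s assume s: "s \<in> closed_segment 0 t"
    have "((\<lambda>s. z + s *\<^sub>R b) has_derivative (\<lambda>k. k *\<^sub>R b)) (at s)" by (auto intro!: derivative_eq_intros)
    from diff_chain_at[OF this smooth_on_has_derivative[OF smooth_T(2)[OF g] UNIV_I]]
    have "((\<lambda>s. T2 b g (z + s *\<^sub>R b)) has_derivative (\<lambda>k. frechet_derivative (T2 b g) (at (z + s *\<^sub>R b)) (k *\<^sub>R b))) (at s)"
      by (simp add: o_def)
    moreover have "frechet_derivative (T2 b g) (at (z + s *\<^sub>R b)) (k *\<^sub>R b) = k *\<^sub>R 0" for k
    proof -
      have "linear (frechet_derivative (T2 b g) (at (z + s *\<^sub>R b)))"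
        by (rule linear_frechet_derivative[OF smooth_on_differentiable[OF smooth_T(2)[OF g] UNIV_I]])
      moreover have "frechet_derivative (T2 b g) (at (z + s *\<^sub>R b)) b = 0"
        using T2_deriv[OF g b seg[OF s]] by (simp add: T2_def frechet_avg[OF SF_smooth[OF g]])
      ultimately show ?thesis by (simp only: linear_scale)
    qed
    ultimately show "((\<lambda>s. T2 b g (z + s *\<^sub>R b)) has_vector_derivative 0) (at s within closed_segment 0 t)"
      unfolding has_vector_derivative_def by (simp add: has_derivative_at_withinI)
  qed auto
  then show ?thesis by simp
qed

end

section \<open>The homotopy operator and the Poincare lemma for forms supported in a cube\<close>

context cube
begin

definition cform :: "nat \<Rightarrow> (complex ^ 'n \<Rightarrow> 'n altform) \<Rightarrow> bool" where
  "cform k u \<longleftrightarrow> sform k UNIV u \<and> (\<forall>z v. z \<notin> Q \<longrightarrow> u z v = 0)"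

lemma cform_SF: "cform k u \<Longrightarrow> SF (\<lambda>y. u y v)"
  unfolding cform_def SF_def using sform_smooth by blast

lemma cform_sform: "cform k u \<Longrightarrow> sform k UNIV u"
  by (simp add: cform_def)

lemma cform_alternating: "cform k u \<Longrightarrow> alternating k (u z)"
  using cform_sform sform_alternating by blast

lemma cform_zero: "cform k u \<Longrightarrow> z \<notin> Q \<Longrightarrow> u z v = 0"
  by (simp add: cform_def)

lemma cform_contr: "cform (Suc k) u \<Longrightarrow> cform k (\<lambda>z. contr x (u z))"
  unfolding cform_def using sform_contr by (auto simp: contr_apply)

lemma cform_diff: "cform k u \<Longrightarrow> cform k w \<Longrightarrow> cform k (\<lambda>z v. u z v - w z v)"
  unfolding cform_def by (simp add: sform_diff)

lemma cform_add: "cform k u \<Longrightarrow> cform k w \<Longrightarrow> cform k (\<lambda>z v. u z v + w z v)"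
  unfolding cform_def by (simp add: sform_add)

lemma cform_dloc: "cform k u \<Longrightarrow> cform (Suc k) (dloc k u)"
  unfolding cform_def
proof (intro conjI allI impI)
  assume u: "sform k UNIV u \<and> (\<forall>z v. z \<notin> Q \<longrightarrow> u z v = 0)"
  show "sform (Suc k) UNIV (dloc k u)" using u sform_dloc[OF open_UNIV] by blast
  fix z v assume "z \<notin> Q"
  then have "dloc k u z v = dloc k (\<lambda>z v. 0) z v"
    by (intro dloc_cong[OF open_nQ]) (use u in auto)
  then show "dloc k u z v = 0" by (simp add: dloc_zero)
qed

text \<open>Multilinearity and alternation are linear relations between coefficient functions, and
  these survive any linear operator applied to each coefficient.\<close>

lemma cform_operator:
  assumes u: "cform k u"
    and SF: "\<And>g. SF g \<Longrightarrow> SF (P g)"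
    and add: "\<And>g h z. SF g \<Longrightarrow> SF h \<Longrightarrow> P (\<lambda>x. g x + h x) z = P g z + P h z"
    and cm: "\<And>a g z. P (\<lambda>x. a * g x) z = a * P g z"
  shows "cform k (\<lambda>z v. P (\<lambda>y. u y v) z)"
proof -
  have P0: "P (\<lambda>x. 0) z = 0" for z using cm[of 0 "\<lambda>_. 0" z] by simp
  note alt = cform_alternating[OF u]
  have "alternating k (\<lambda>v. P (\<lambda>y. u y v) z)" for z
  proof (rule alternatingI)
    show "P (\<lambda>y. u y v) z = P (\<lambda>y. u y w) z" if "\<And>i. i < k \<Longrightarrow> v i = w i" for v w
    proof -
      have "(\<lambda>y. u y v) = (\<lambda>y. u y w)" by (rule ext) (rule alternating_cong[OF alt that])
      then show ?thesis by simp
    qed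
    show "P (\<lambda>y. u y v) z = 0" if "i < k" "j < k" "i \<noteq> j" "v i = v j" for v i j
    proof -
      have "(\<lambda>y. u y v) = (\<lambda>y. 0)" by (rule ext) (rule alternating_eq[OF alt that])
      then show ?thesis by (simp add: P0)
    qed
    show "linear (\<lambda>x. P (\<lambda>y. u y (v(i := x))) z)" if i: "i < k" for v i
    proof (rule linearI)
      fix a b :: "complex ^ 'n" and s :: real
      have "(\<lambda>y. u y (v(i := a + b))) = (\<lambda>y. u y (v(i := a)) + u y (v(i := b)))"
        by (rule ext) (rule linear_add[OF alternating_linear[OF alt i]])
      then show "P (\<lambda>y. u y (v(i := a + b))) z = P (\<lambda>y. u y (v(i := a))) z + P (\<lambda>y. u y (v(i := b))) z"
        by (simp add: add cform_SF[OF u])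
      have "(\<lambda>y. u y (v(i := s *\<^sub>R a))) = (\<lambda>y. of_real s * u y (v(i := a)))"
        by (rule ext, subst linear_scale[OF alternating_linear[OF alt i]], rule scaleR_conv_of_real)
      then show "P (\<lambda>y. u y (v(i := s *\<^sub>R a))) z = s *\<^sub>R P (\<lambda>y. u y (v(i := a))) z"
        by (simp add: cm scaleR_conv_of_real[where x="P _ _"])
    qed
  qed
  then show ?thesis
    using SF[OF cform_SF[OF u]] by (simp add: cform_def sform_def SF_def)
qed

abbreviation Jf :: "complex ^ 'n \<Rightarrow> (complex ^ 'n \<Rightarrow> 'n altform) \<Rightarrow> complex ^ 'n \<Rightarrow> 'n altform" where
  "Jf b u \<equiv> (\<lambda>z v. J b (\<lambda>y. u y v) z)"

abbreviation Ef :: "complex ^ 'n \<Rightarrow> (complex ^ 'n \<Rightarrow> 'n altform) \<Rightarrow> complex ^ 'n \<Rightarrow> 'n altform" where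
  "Ef b u \<equiv> (\<lambda>z v. E b (\<lambda>y. u y v) z)"

lemma cform_Jf: "cform k u \<Longrightarrow> b \<in> Basis \<Longrightarrow> cform k (Jf b u)"
  by (rule cform_operator[of k u "J b"]) (auto intro: SF_J J_add J_cmult)

lemma cform_Ef: "cform k u \<Longrightarrow> b \<in> Basis \<Longrightarrow> cform k (Ef b u)"
  by (rule cform_operator[of k u "E b"]) (auto intro: SF_E E_add E_cmult)

text \<open>Cartan's formula gives d(i_b Ju) = L_b Ju - i_b d(Ju). By \<open>J_deriv\<close> the
  first term is u - Eu, and since du = 0, \<open>frechet_J\<close> shows d(Ju) = -dx_b ^ Eu.
  Altogether u - dx_b ^ i_b(Eu) remains, whose last term is the displayed sum.\<close>

lemma homotopy:
  assumes u: "cform (Suc k) u" and b: "b \<in> Basis" and closed: "\<And>z v. dloc (Suc k) u z v = 0"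
  shows "dloc k (\<lambda>z. contr b (Jf b u z)) z v =
    u z v - (\<Sum>i\<le>k. (- 1) ^ i * of_real (v i \<bullet> b) * Ef b u z (b ## (\<lambda>j. if j < i then v j else v (Suc j))))"
proof -
  have 1: "dloc (Suc k) (Jf b u) z w = - (\<Sum>i\<le>Suc k. (- 1) ^ i * (of_real (w i \<bullet> b) * Ef b u z (\<lambda>j. if j < i then w j else w (Suc j))))" for w
  proof -
    let ?D = "\<lambda>i y. (- 1) ^ i * frechet_derivative (\<lambda>y. u y (\<lambda>j. if j < i then w j else w (Suc j))) (at y) (w i)"
    have "J b (\<lambda>y. \<Sum>i\<le>Suc k. ?D i y) z = (\<Sum>i\<le>Suc k. J b (?D i) z)"
      by (rule J_sum) (intro SF_cmult SF_deriv cform_SF[OF u])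
    moreover have "(\<lambda>y. \<Sum>i\<le>Suc k. ?D i y) = (\<lambda>y. 0)" using closed[of _ w] unfolding dloc_def by (rule ext)
    ultimately have s0: "(\<Sum>i\<le>Suc k. J b (?D i) z) = 0" by (simp only: J_0)
    have "dloc (Suc k) (Jf b u) z w = (\<Sum>i\<le>Suc k. J b (?D i) z - (- 1) ^ i * (of_real (w i \<bullet> b) * Ef b u z (\<lambda>j. if j < i then w j else w (Suc j))))"
      unfolding dloc_def frechet_J[OF cform_SF[OF u] b] right_diff_distrib J_cmult ..
    then show ?thesis by (simp only: sum_subtractf s0) simp
  qed
  have om: "(\<lambda>j. if j < Suc i then (b ## v) j else (b ## v) (Suc j)) = b ## (\<lambda>j. if j < i then v j else v (Suc j))" for i
    by (rule ext) (auto simp: vcons_def split: nat.split)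
  have bb: "b \<bullet> b = 1" using b by (simp add: inner_Basis)
  have "dirv b (Jf b u) z v = u z v - Ef b u z v"
    unfolding dirv_def frechet_J[OF cform_SF[OF u] b] J_deriv[OF cform_SF[OF u] b] bb by simp
  moreover have "dloc (Suc k) (Jf b u) z (b ## v) = - Ef b u z v
    + (\<Sum>i\<le>k. (- 1) ^ i * of_real (v i \<bullet> b) * Ef b u z (b ## (\<lambda>j. if j < i then v j else v (Suc j))))"
    unfolding 1 sum.atMost_Suc_shift om by (simp add: bb sum_negf[symmetric] mult.assoc)
  moreover have "dloc k (\<lambda>z. contr b (Jf b u z)) z v = dirv b (Jf b u) z v - dloc (Suc k) (Jf b u) z (b ## v)"
    unfolding dloc_Suc by simp
  ultimately show ?thesis by (simp only:) simp
qed

text \<open>\<open>g\<close> is the product of \<open>e ((z - c) \<bullet> a)\<close> and a function that does not depend on the coordinate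
  \<open>z \<bullet> a\<close>; the equation avoids division by \<open>e\<close>.\<close>

definition Inv :: "complex ^ 'n \<Rightarrow> (complex ^ 'n \<Rightarrow> complex) \<Rightarrow> bool" where
  "Inv a g \<longleftrightarrow> (\<forall>z t. g (z + t *\<^sub>R a) * of_real (e ((z - c) \<bullet> a)) = g z * of_real (e ((z - c) \<bullet> a + t)))"

lemma Inv_zero: "Inv a (\<lambda>z. 0)" by (simp add: Inv_def)

lemma coord_shift: "a \<in> Basis \<Longrightarrow> b \<in> Basis \<Longrightarrow> (z + t *\<^sub>R a - c) \<bullet> b = (z - c) \<bullet> b + (if a = b then t else 0)"
  by (simp add: inner_diff_left inner_add_left inner_Basis)

lemma V_shift: "a \<in> Basis \<Longrightarrow> z \<in> V \<Longrightarrow> z + t *\<^sub>R a \<in> V \<longleftrightarrow> \<bar>(z - c) \<bullet> a + t\<bar> < R"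
  unfolding V_def using coord_shift[of a _ z t] by fastforce

lemma V_shift': "a \<in> Basis \<Longrightarrow> z + t *\<^sub>R a \<in> V \<Longrightarrow> z \<in> V \<longleftrightarrow> \<bar>(z - c) \<bullet> a\<bar> < R"
  using V_shift[of a "z + t *\<^sub>R a" "- t"] coord_shift[of a a z t] by simp

text \<open>\<open>E b g\<close> is \<open>e\<close> times a function that is constant along b
  inside \<open>V\<close>. If exactly one of the two points lies outside \<open>V\<close>, then
  \<open>e\<close> vanishes at its coordinate and both sides are 0.\<close>

lemma Inv_E_same:
  assumes g: "SF g" and b: "b \<in> Basis"
  shows "Inv b (E b g)"
  unfolding Inv_def
proof (intro allI)
  fix z t
  show "E b g (z + t *\<^sub>R b) * of_real (e ((z - c) \<bullet> b)) = E b g z * of_real (e ((z - c) \<bullet> b + t))"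
  proof (cases "z \<in> V")
    case z: True
    show ?thesis
    proof (cases "z + t *\<^sub>R b \<in> V")
      case True
      then show ?thesis using z T2_invariant[OF g b z True] coord_shift[OF b b] by (simp add: E_def)
    next
      case False
      then have "e ((z - c) \<bullet> b + t) = 0" using V_shift[OF b z, of t] r by (intro e(4)) auto
      then show ?thesis using False by (simp add: E_def)
    qed
  next
    case z: False
    show ?thesis
    proof (cases "z + t *\<^sub>R b \<in> V")
      case True
      then have "e ((z - c) \<bullet> b) = 0" using V_shift'[OF b True] z r by (intro e(4)) auto
      then show ?thesis using z by (simp add: E_def)
    qed (use z in \<open>simp add: E_def\<close>)
  qed
qed

text \<open>The average runs along b and leaves the coordinate along a unchanged, so the relation
  passes under the integral.\<close>

lemma Inv_E_other:
  assumes g: "SF g" and a: "a \<in> Basis" and b: "b \<in> Basis" and ab: "a \<noteq> b" and I: "Inv a g"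
  shows "Inv a (E b g)"
  unfolding Inv_def
proof (intro allI)
  fix z t
  have T: "T2 b g (z + t *\<^sub>R a) * of_real (e ((z - c) \<bullet> a)) = T2 b g z * of_real (e ((z - c) \<bullet> a + t))"
  proof -
    have "g (z + t *\<^sub>R a - s *\<^sub>R b) * of_real (e ((z - c) \<bullet> a)) = g (z - s *\<^sub>R b) * of_real (e ((z - c) \<bullet> a + t))" for s
    proof -
      have "z - s *\<^sub>R b + t *\<^sub>R a = z + t *\<^sub>R a - s *\<^sub>R b" by simp
      moreover have "(z - s *\<^sub>R b - c) \<bullet> a = (z - c) \<bullet> a" using inner_shift[OF b a, of z s] ab by simp
      ultimately show ?thesis using I[unfolded Inv_def, rule_format, of "z - s *\<^sub>R b" t] by (simp only:)
    qed
    then have "integral {- 2 * R..2 * R} (\<lambda>s. g (z + t *\<^sub>R a - s *\<^sub>R b) * of_real (e ((z - c) \<bullet> a)))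
       = integral {- 2 * R..2 * R} (\<lambda>s. g (z - s *\<^sub>R b) * of_real (e ((z - c) \<bullet> a + t)))"
      by (simp only:)
    then show ?thesis unfolding T2_def avg_def by (simp only: integral_mult_left)
  qed
  have cb: "(z + t *\<^sub>R a - c) \<bullet> b = (z - c) \<bullet> b" using coord_shift[OF a b] ab by simp
  show "E b g (z + t *\<^sub>R a) * of_real (e ((z - c) \<bullet> a)) = E b g z * of_real (e ((z - c) \<bullet> a + t))"
  proof (cases "z \<in> V")
    case z: True
    show ?thesis
    proof (cases "z + t *\<^sub>R a \<in> V")
      case True
      then show ?thesis using z T by (simp add: E_def cb mult.assoc)
    next
      case False
      then have "e ((z - c) \<bullet> a + t) = 0" using V_shift[OF a z, of t] r by (intro e(4)) auto
      then show ?thesis using False by (simp add: E_def)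
    qed
  next
    case z: False
    show ?thesis
    proof (cases "z + t *\<^sub>R a \<in> V")
      case True
      then have "e ((z - c) \<bullet> a) = 0" using V_shift'[OF a True] z r by (intro e(4)) auto
      then show ?thesis using z by (simp add: E_def)
    qed (use z in \<open>simp add: E_def\<close>)
  qed
qed

definition bt :: "nat \<Rightarrow> (nat \<Rightarrow> complex ^ 'n) \<Rightarrow> bool" where
  "bt k v \<longleftrightarrow> inj_on v {..<k} \<and> v ` {..<k} \<subseteq> Basis"

text \<open>The operator dx_b ^ i_b is the projection to the components that contain dx_b.\<close>

lemma homotopy_bt:
  assumes u: "cform (Suc k) u" and b: "b \<in> Basis" and v: "bt (Suc k) v"
  shows "(\<Sum>i\<le>k. (- 1) ^ i * of_real (v i \<bullet> b) * Ef b u z (b ## (\<lambda>j. if j < i then v j else v (Suc j)))) =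
    (if b \<in> v ` {..<Suc k} then Ef b u z v else 0)"
proof -
  have vB: "v i \<in> Basis" if "i \<le> k" for i using v that by (auto simp: bt_def)
  show ?thesis
  proof (cases "b \<in> v ` {..<Suc k}")
    case True
    then obtain i0 where "b = v i0" "i0 \<in> {..<Suc k}" by (rule imageE)
    then have i0: "i0 \<le> k" "v i0 = b" by auto
    have "v i \<bullet> b = (if i = i0 then 1 else 0)" if "i \<le> k" for i
      using v i0 that b vB[OF that] by (auto simp: inner_Basis bt_def inj_on_def)
    then have "(\<Sum>i\<le>k. (- 1) ^ i * of_real (v i \<bullet> b) * Ef b u z (b ## (\<lambda>j. if j < i then v j else v (Suc j)))) =
       (\<Sum>i\<le>k. if i = i0 then (- 1) ^ i * Ef b u z (b ## (\<lambda>j. if j < i then v j else v (Suc j))) else 0)"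
      by (intro sum.cong refl) auto
    also have "\<dots> = (- 1) ^ i0 * Ef b u z (b ## (\<lambda>j. if j < i0 then v j else v (Suc j)))"
      using i0 by (simp add: sum.delta)
    also have "\<dots> = Ef b u z (vinsert i0 b (\<lambda>j. if j < i0 then v j else v (Suc j)))"
      by (rule alternating_vinsert[symmetric, OF cform_alternating[OF cform_Ef[OF u b]] i0(1)])
    also have "vinsert i0 b (\<lambda>j. if j < i0 then v j else v (Suc j)) = v"
      by (rule ext) (auto simp: vinsert_def i0(2))
    finally show ?thesis using True by simp
  next
    case False
    then have "v i \<bullet> b = 0" if "i \<le> k" for i
      using vB[OF that] b that by (auto simp: inner_Basis)
    then show ?thesis using False by simp
  qed
qed

text \<open>The coordinates are integrated out one at a time. Each step subtracts an exact form,
  keeps only components containing the new dx_b, and gives them the profile \<open>e\<close> along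
  b, while \<open>Inv_E_other\<close> preserves the profiles already obtained.\<close>

lemma poincare_step:
  assumes u: "cform (Suc k) u" and closed: "\<And>z v. dloc (Suc k) u z v = 0" and S: "finite S" "S \<subseteq> Basis"
  shows "\<exists>\<eta> w. cform k \<eta> \<and> cform (Suc k) w \<and> (\<forall>z v. dloc (Suc k) w z v = 0) \<and>
    (\<forall>z v. u z v - w z v = dloc k \<eta> z v) \<and>
    (\<forall>v. bt (Suc k) v \<longrightarrow> (\<not> S \<subseteq> v ` {..<Suc k} \<longrightarrow> (\<forall>z. w z v = 0)) \<and> (\<forall>a\<in>S. Inv a (\<lambda>z. w z v)))"
  using S
proof (induction S rule: finite_induct)
  case empty
  have "cform k (\<lambda>z v. 0)" by (simp add: cform_def sform_zero)
  then show ?case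
    by (rule_tac exI[of _ "\<lambda>z v. 0"], rule_tac exI[of _ u]) (use u closed in \<open>simp add: dloc_zero\<close>)
next
  case (insert b S)
  then have b: "b \<in> Basis" and SB: "S \<subseteq> Basis" by auto
  from insert.IH[OF SB] obtain \<eta> w where w: "cform k \<eta>" "cform (Suc k) w" "\<And>z v. dloc (Suc k) w z v = 0"
    "\<And>z v. u z v - w z v = dloc k \<eta> z v"
    "\<And>v. bt (Suc k) v \<Longrightarrow> \<not> S \<subseteq> v ` {..<Suc k} \<Longrightarrow> \<forall>z. w z v = 0"
    "\<And>v a. bt (Suc k) v \<Longrightarrow> a \<in> S \<Longrightarrow> Inv a (\<lambda>z. w z v)"
    by blast
  define \<xi> where "\<xi> = (\<lambda>z. contr b (Jf b w z))"
  define w' where "w' = (\<lambda>z v. w z v - dloc k \<xi> z v)"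
  have \<xi>: "cform k \<xi>" unfolding \<xi>_def by (rule cform_contr[OF cform_Jf[OF w(2) b]])
  have w': "cform (Suc k) w'" unfolding w'_def by (rule cform_diff[OF w(2) cform_dloc[OF \<xi>]])
  have cl: "dloc (Suc k) w' z v = 0" for z v
    unfolding w'_def using dloc_diff[OF cform_sform[OF w(2)] cform_sform[OF cform_dloc[OF \<xi>]] UNIV_I]
      dloc_dloc[OF open_UNIV UNIV_I cform_sform[OF \<xi>]] w(3) by simp
  have ev: "w' z v = (if b \<in> v ` {..<Suc k} then Ef b w z v else 0)" if "bt (Suc k) v" for z v
    unfolding w'_def \<xi>_def homotopy[OF w(2) b w(3)] using homotopy_bt[OF w(2) b that, of z] by simp
  have diff: "u z v - w' z v = dloc k (\<lambda>z v. \<eta> z v + \<xi> z v) z v" for z v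
    using dloc_add[OF cform_sform[OF w(1)] cform_sform[OF \<xi>] UNIV_I, of k z v] w(4)[of z v] by (simp add: w'_def)
  show ?case
  proof (rule exI[of _ "\<lambda>z v. \<eta> z v + \<xi> z v"], rule exI[of _ w'], intro conjI allI impI ballI)
    fix v assume v: "bt (Suc k) v"
    show "w' z v = 0" if "\<not> insert b S \<subseteq> v ` {..<Suc k}" for z
    proof (cases "b \<in> v ` {..<Suc k}")
      case True
      then have "\<forall>y. w y v = 0" using w(5)[OF v] that by blast
      then show ?thesis unfolding ev[OF v] by (simp add: E_0)
    next
      case False
      then show ?thesis unfolding ev[OF v] by simp
    qed
    fix a assume a: "a \<in> insert b S"
    show "Inv a (\<lambda>z. w' z v)"
    proof (cases "b \<in> v ` {..<Suc k}")
      case True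
      have "(\<lambda>z. w' z v) = E b (\<lambda>y. w y v)" using True by (auto simp: ev[OF v])
      then show ?thesis
        using Inv_E_same[OF cform_SF[OF w(2)] b] Inv_E_other[OF cform_SF[OF w(2)] _ b _ w(6)[OF v]] a SB
        by (cases "a = b") auto
    next
      case False
      then show ?thesis by (simp add: ev[OF v] Inv_zero)
    qed
  qed (use w(1) \<xi> w' cl diff in \<open>auto intro: cform_add\<close>)
qed

text \<open>Moving from the centre c along one coordinate after the other, each move costing a
  factor \<open>e 0\<close> on the left, shows that g is a multiple of the product p of the bumps.
  The integral of p is positive, so the multiple is 0.\<close>

lemma Inv_integral_zero:
  assumes g: "SF g" and I: "\<And>a. a \<in> Basis \<Longrightarrow> Inv a g" and z: "(LINT x|lborel. g x) = 0"
  shows "g x = 0"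
proof -
  define p where "p z = (\<Prod>a\<in>Basis. e ((z - c) \<bullet> a))" for z
  define K where "K = complex_of_real (e 0)"
  have K: "K \<noteq> 0" using e(3) by (simp add: K_def)
  have step: "g (c + (\<Sum>a\<in>S. t a *\<^sub>R a)) * K ^ card S = g c * (\<Prod>a\<in>S. of_real (e (t a)))"
    if "finite S" "S \<subseteq> Basis" for S t
    using that
  proof (induction S rule: finite_induct)
    case (insert b S)
    then have b: "b \<in> Basis" and S: "S \<subseteq> Basis" by auto
    let ?y = "c + (\<Sum>a\<in>S. t a *\<^sub>R a)"
    have "(?y - c) \<bullet> b = (\<Sum>a\<in>S. t a * (a \<bullet> b))" by (simp add: inner_sum_left)
    also have "\<dots> = 0"
    proof (rule sum.neutral, rule ballI)
      fix a assume "a \<in> S"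
      then have "a \<in> Basis" "a \<noteq> b" using insert(2) S by auto
      then show "t a * (a \<bullet> b) = 0" using b by (simp add: inner_Basis)
    qed
    finally have "(?y - c) \<bullet> b = 0" .
    then have st: "g (?y + t b *\<^sub>R b) * K = g ?y * of_real (e (t b))"
      using I[OF b, unfolded Inv_def, rule_format, of ?y "t b"] by (simp only: K_def add_0)
    have "c + (\<Sum>a\<in>insert b S. t a *\<^sub>R a) = ?y + t b *\<^sub>R b"
      unfolding sum.insert[OF insert(1,2)] by (simp only: ac_simps)
    then have "g (c + (\<Sum>a\<in>insert b S. t a *\<^sub>R a)) * K ^ card (insert b S) = (g (?y + t b *\<^sub>R b) * K) * K ^ card S"
      by (simp only: card_insert_disjoint[OF insert(1,2)] power_Suc mult.assoc)
    also have "\<dots> = (g ?y * K ^ card S) * of_real (e (t b))" unfolding st by (simp only: mult_ac)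
    also have "\<dots> = g c * (\<Prod>a\<in>insert b S. of_real (e (t a)))"
      unfolding insert.IH[OF S] prod.insert[OF insert(1,2)] by (simp only: mult_ac)
    finally show ?case .
  qed simp
  define D where "D = card (Basis :: (complex ^ 'n) set)"
  have gp: "g z * K ^ D = g c * of_real (p z)" for z
  proof -
    have "c + (\<Sum>a\<in>Basis. ((z - c) \<bullet> a) *\<^sub>R a) = z" unfolding euclidean_representation by simp
    then show ?thesis using step[OF finite_Basis subset_refl, of "\<lambda>a. (z - c) \<bullet> a"] unfolding p_def D_def by (simp only: of_real_prod)
  qed
  have "g c = 0"
  proof (rule ccontr)
    assume gc: "g c \<noteq> 0"
    have pc: "continuous_on UNIV p"
    proof -
      have "continuous_on UNIV e" by (rule smooth_on_continuous[OF e(1)])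
      then have "continuous_on UNIV (\<lambda>z. e ((z - c) \<bullet> a))" for a
        by (rule continuous_on_compose2) (auto intro!: continuous_intros)
      then show ?thesis unfolding p_def by (rule continuous_on_prod)
    qed
    have "of_real (p z) = K ^ D / g c * g z" for z
    proof -
      have "K ^ D / g c * g z = g z * K ^ D / g c" by simp
      then show ?thesis using gc by (simp add: gp[of z])
    qed
    then have "(LINT x|lborel. complex_of_real (p x)) = K ^ D / g c * (LINT x|lborel. g x)"
      by (simp only: integral_mult_right_zero)
    then have "complex_of_real (LINT x|lborel. p x) = 0" using z by simp
    then have "(LINT x|lborel. p x) = 0" by simp
    moreover have p0: "p z = 0" if z: "z \<notin> Q" for z
    proof -
      have "\<exists>a\<in>Basis. \<bar>(z - c) \<bullet> a\<bar> > r" using z unfolding Q_def mem_Collect_eq by (meson not_le)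
      then have "\<exists>a\<in>Basis. e ((z - c) \<bullet> a) = 0" using e_out by blast
      then show ?thesis unfolding p_def by (simp add: prod_zero_iff)
    qed
    moreover have "p z \<ge> 0" for z unfolding p_def using e(2) by (intro prod_nonneg) auto
    ultimately have "p c = 0" using integral_nonneg_zero_imp[OF pc _ compact_Q p0] by blast
    then show False using e(3) by (simp add: p_def)
  qed
  then show ?thesis using gp[of x] K by simp
qed

lemma integral_dloc_zero:
  assumes "cform k \<eta>"
  shows "(LINT z|lborel. dloc k \<eta> z v) = 0"
proof -
  let ?f = "\<lambda>i z. frechet_derivative (\<lambda>y. \<eta> y (\<lambda>j. if j < i then v j else v (Suc j))) (at z) (v i)"
  have SFi: "SF (?f i)" for i by (rule SF_deriv[OF cform_SF[OF assms]])
  have "integrable lborel (?f i)" for i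
    by (rule integrable_compact_support[OF smooth_on_continuous[OF SF_smooth[OF SFi]] compact_Q SF_zero[OF SFi]])
  moreover have "(LINT z|lborel. ?f i z) = 0" for i
    by (rule integral_deriv_zero[OF SF_smooth[OF cform_SF[OF assms]] compact_Q SF_zero[OF cform_SF[OF assms]]])
  ultimately show ?thesis unfolding dloc_def by (simp add: Bochner_Integration.integral_sum)
qed

text \<open>Once all coordinates are integrated out, only components containing every dx_b can
  remain. Below the top degree there are none; in the top degree they have the same integral as u,
  which is 0.\<close>

theorem poincare_cpt:
  assumes u: "cform (Suc k) u" and closed: "\<And>z v. dloc (Suc k) u z v = 0"
    and top: "Suc k < DIM(complex ^ 'n) \<or> (\<forall>v. (LINT z|lborel. u z v) = 0)"
  shows "\<exists>\<eta>. cform k \<eta> \<and> (\<forall>z v. u z v = dloc k \<eta> z v)"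
proof -
  obtain \<eta> w where w: "cform k \<eta>" "cform (Suc k) w"
    "\<And>z v. u z v - w z v = dloc k \<eta> z v"
    "\<And>v. bt (Suc k) v \<Longrightarrow> \<not> Basis \<subseteq> v ` {..<Suc k} \<Longrightarrow> \<forall>z. w z v = 0"
    "\<And>v a. bt (Suc k) v \<Longrightarrow> a \<in> Basis \<Longrightarrow> Inv a (\<lambda>z. w z v)"
    using poincare_step[OF u closed finite_Basis subset_refl] by blast
  have "w z v = 0" if v: "bt (Suc k) v" for z v
  proof (cases "\<not> Basis \<subseteq> v ` {..<Suc k}")
    case True
    then show ?thesis using w(4)[OF v] by blast
  next
    case False
    have "card (Basis :: (complex ^ 'n) set) \<le> card (v ` {..<Suc k})"
      using False by (intro card_mono) auto
    also have "\<dots> \<le> Suc k" using card_image_le[of "{..<Suc k}" v] by simp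
    finally have "(LINT z|lborel. u z v) = 0" using top by auto
    moreover have "(LINT z|lborel. w z v) = (LINT z|lborel. u z v) - (LINT z|lborel. dloc k \<eta> z v)"
    proof -
      have "(\<lambda>z. w z v) = (\<lambda>z. u z v - dloc k \<eta> z v)"
        by (rule ext) (use w(3)[of _ v] in \<open>simp add: algebra_simps\<close>)
      moreover have "integrable lborel (\<lambda>z. u z v)" "integrable lborel (\<lambda>z. dloc k \<eta> z v)"
        using cform_SF[OF u] cform_SF[OF cform_dloc[OF w(1)]]
        by (auto intro!: integrable_compact_support[OF smooth_on_continuous compact_Q] simp: SF_def)
      ultimately show ?thesis by simp
    qed
    ultimately have "(LINT z|lborel. w z v) = 0" using integral_dloc_zero[OF w(1)] by simp
    from Inv_integral_zero[OF cform_SF[OF w(2)] w(5)[OF v] this] show ?thesis .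
  qed
  then have "w z v = 0" for z v
    using alternating_zero_on_basis[OF cform_alternating[OF w(2)], of z v] by (simp add: bt_def)
  then show ?thesis using w(1,3) by (intro exI[of _ \<eta>]) simp
qed

end

section \<open>Extension by zero and partitions of unity\<close>

definition ocube :: "complex ^ 'n::finite \<Rightarrow> real \<Rightarrow> (complex ^ 'n) set" where
  "ocube p s = {z. \<forall>b\<in>Basis. \<bar>(z - p) \<bullet> b\<bar> < s}"

definition ccube :: "complex ^ 'n::finite \<Rightarrow> real \<Rightarrow> (complex ^ 'n) set" where
  "ccube p s = {z. \<forall>b\<in>Basis. \<bar>(z - p) \<bullet> b\<bar> \<le> s}"

lemma ccube_cbox: "ccube p s = cbox (p - s *\<^sub>R One) (p + s *\<^sub>R One)"
proof -
  have "\<bar>(x - p) \<bullet> b\<bar> \<le> s \<longleftrightarrow> (p - s *\<^sub>R One) \<bullet> b \<le> x \<bullet> b \<and> x \<bullet> b \<le> (p + s *\<^sub>R One) \<bullet> b" if "b \<in> Basis" for x b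
    using that by (simp add: inner_diff_left inner_add_left) arith
  then show ?thesis unfolding ccube_def cbox_def by blast
qed

lemma ocube_box: "ocube p s = box (p - s *\<^sub>R One) (p + s *\<^sub>R One)"
proof -
  have "\<bar>(x - p) \<bullet> b\<bar> < s \<longleftrightarrow> (p - s *\<^sub>R One) \<bullet> b < x \<bullet> b \<and> x \<bullet> b < (p + s *\<^sub>R One) \<bullet> b" if "b \<in> Basis" for x b
    using that by (simp add: inner_diff_left inner_add_left) arith
  then show ?thesis unfolding ocube_def box_def by blast
qed

lemma compact_ccube: "compact (ccube p s)" unfolding ccube_cbox by (rule compact_cbox)
lemma open_ocube: "open (ocube p s)" unfolding ocube_box by (rule open_box)

lemma cube_mono: "s < t \<Longrightarrow> ccube p s \<subseteq> ocube p t" "s \<le> t \<Longrightarrow> ocube p s \<subseteq> ocube p t" "s \<le> t \<Longrightarrow> ccube p s \<subseteq> ccube p t"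
  "ocube p s \<subseteq> ccube p s"
  by (force simp: ccube_def ocube_def)+

lemma ocube_center: "0 < s \<Longrightarrow> p \<in> ocube p s"
  by (simp add: ocube_def)

lemma ocube_in_open:
  assumes "open U" "p \<in> U"
  shows "\<exists>s>0. ocube p s \<subseteq> U"
proof -
  obtain d where d: "d > 0" "ball p d \<subseteq> U" using assms openE by blast
  \<comment> \<open>The Euclidean norm is at most the sum of the absolute coordinates, so the
    half-width d is divided by more than their number.\<close>
  define N where "N = real (card (Basis :: (complex ^ 'a) set)) + 1"
  have N: "N > 0" by (simp add: N_def add_nonneg_pos)
  have "ocube p (d / N) \<subseteq> ball p d"
  proof
    fix z assume z: "z \<in> ocube p (d / N)"
    have "norm (z - p) \<le> (\<Sum>b\<in>Basis. \<bar>(z - p) \<bullet> b\<bar>)" by (rule norm_le_l1)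
    also have "\<dots> \<le> (\<Sum>b\<in>(Basis :: (complex ^ 'a) set). d / N)"
      by (rule sum_mono) (use z in \<open>force simp: ocube_def\<close>)
    also have "\<dots> = real (card (Basis :: (complex ^ 'a) set)) * (d / N)" by (rule sum_constant)
    also have "\<dots> < N * (d / N)"
      by (rule mult_strict_right_mono) (use d N in \<open>simp_all add: N_def\<close>)
    also have "\<dots> = d" using N by simp
    finally show "z \<in> ball p d" by (simp add: dist_norm norm_minus_commute)
  qed
  then show ?thesis using d N by (intro exI[of _ "d / N"]) auto
qed

lemma bump_exists:
  assumes r: "r > 0"
  shows "\<exists>\<beta> :: complex ^ 'n::finite \<Rightarrow> real. smooth_on UNIV \<beta> \<and> (\<forall>z. 0 \<le> \<beta> z \<and> \<beta> z \<le> 1) \<and>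
    (\<forall>z\<in>ocube p (r / 2). \<beta> z = 1) \<and> (\<forall>z. z \<notin> ccube p r \<longrightarrow> \<beta> z = 0)"
proof -
  obtain A e :: "real \<Rightarrow> real" where A: "smooth_on UNIV A" "\<And>t. (A has_field_derivative e t) (at t)" "\<And>t. e t \<ge> 0"
    "\<And>t. t \<le> - (3 * (r * r) / 8) \<Longrightarrow> A t = 0" "\<And>t. t \<ge> 3 * (r * r) / 8 \<Longrightarrow> A t = 1"
    using smooth_step_exists[of "3 * (r * r) / 8"] r by auto
  have mono: "A a \<le> A b" if "a \<le> b" for a b
    using that by (rule DERIV_nonneg_imp_nondecreasing) (use A(2,3) in blast)
  have A01: "0 \<le> A t" "A t \<le> 1" for t
  proof -
    show "0 \<le> A t" using mono[of "min t (- (3 * (r * r) / 8))" t] A(4)[of "min t (- (3 * (r * r) / 8))"] by auto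
    show "A t \<le> 1" using mono[of t "max t (3 * (r * r) / 8)"] A(5)[of "max t (3 * (r * r) / 8)"] by auto
  qed
  \<comment> \<open>Squares keep the dependence on the coordinate smooth. The step is centred at 5/8
    r^2 with half-width 3/8 r^2, so it takes place between r^2/4 and r^2, the squares of r/2 and
    r.\<close>
  define h :: "complex ^ 'n \<Rightarrow> complex ^ 'n \<Rightarrow> real"
    where "h b z = 1 - A (((z - p) \<bullet> b) * ((z - p) \<bullet> b) - 5 * (r * r) / 8)" for b z
  have sq: "smooth_on UNIV (\<lambda>z. ((z - p) \<bullet> b) * ((z - p) \<bullet> b) - 5 * (r * r) / 8)" for b
  proof -
    have "smooth_on UNIV (\<lambda>z. (z - p) \<bullet> b)"
      by (rule smooth_on_bounded_linear[OF bounded_linear_inner_left open_UNIV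
        smooth_on_diff[OF open_UNIV smooth_on_id[OF open_UNIV] smooth_on_const]])
    then show ?thesis by (intro smooth_on_diff smooth_on_mult open_UNIV smooth_on_const)
  qed
  have sh: "smooth_on UNIV (h b)" for b
    unfolding h_def
    by (rule smooth_on_diff[OF open_UNIV smooth_on_const smooth_on_compose[OF open_UNIV open_UNIV UNIV_I sq A(1)]])
  have h01: "0 \<le> h b z" "h b z \<le> 1" for b z using A01 by (simp_all add: h_def)
  define \<beta> where "\<beta> z = (\<Prod>b\<in>Basis. h b z)" for z
  have "smooth_on UNIV \<beta>" unfolding \<beta>_def by (rule smooth_on_prod[OF open_UNIV sh])
  moreover have "0 \<le> \<beta> z \<and> \<beta> z \<le> 1" for z
    unfolding \<beta>_def by (intro conjI prod_nonneg prod_le_1) (simp_all add: h01)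
  moreover have "\<beta> z = 1" if z: "z \<in> ocube p (r / 2)" for z
    unfolding \<beta>_def
  proof (rule prod.neutral, rule ballI)
    fix b :: "complex ^ 'n" assume "b \<in> Basis"
    then have "\<bar>(z - p) \<bullet> b\<bar> \<le> \<bar>r / 2\<bar>" using z r by (force simp: ocube_def)
    then have "((z - p) \<bullet> b) * ((z - p) \<bullet> b) \<le> (r / 2) * (r / 2)"
      unfolding abs_le_square_iff by (simp add: power2_eq_square)
    then show "h b z = 1" unfolding h_def by (subst A(4)) auto
  qed
  moreover have "\<beta> z = 0" if z: "z \<notin> ccube p r" for z
  proof -
    obtain b where b: "b \<in> Basis" "\<bar>(z - p) \<bullet> b\<bar> > r" using z unfolding ccube_def mem_Collect_eq by (meson not_le)
    then have "\<bar>r\<bar> \<le> \<bar>(z - p) \<bullet> b\<bar>" using r by simp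
    then have "r * r \<le> ((z - p) \<bullet> b) * ((z - p) \<bullet> b)"
      unfolding abs_le_square_iff by (simp add: power2_eq_square)
    then have "h b z = 0" unfolding h_def by (subst A(5)) auto
    then show ?thesis unfolding \<beta>_def using b(1) by (auto simp: prod_zero_iff)
  qed
  ultimately show ?thesis by blast
qed

section \<open>Extension of local forms by zero\<close>

definition smul :: "('a, 'n::finite) form \<Rightarrow> ('a, 'n) form \<Rightarrow> ('a, 'n) form" where
  "smul f u = (\<lambda>c z v. f c z v * u c z v)"

context complex_mfd
begin

lemma smul_wedge:
  assumes "f \<in> forms A 0" "u \<in> forms A k"
  shows "smul f u = wedge 0 k f u"
proof (intro ext)
  fix c z v
  show "smul f u c z v = wedge 0 k f u c z v"
  proof (cases "c \<in> A \<and> z \<in> chart_image c")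
    case True
    then show ?thesis
      using alt_wedge_0_left[OF forms_alternating[OF assms(1)] forms_alternating[OF assms(2)]] by (simp add: smul_def wedge_def)
  next
    case False
    then have "f c z = (\<lambda>v. 0)" using forms_outside[OF assms(1)] by blast
    then show ?thesis by (simp add: smul_def wedge_def alt_wedge_zero_left)
  qed
qed

lemma forms_smul: "f \<in> forms A 0 \<Longrightarrow> u \<in> forms A k \<Longrightarrow> smul f u \<in> forms A k"
  using forms_wedge[of f 0 u k] by (simp add: smul_wedge)

definition ext0 :: "('a, 'n) chart \<Rightarrow> (complex ^ 'n \<Rightarrow> 'n altform) \<Rightarrow> ('a, 'n) form" where
  "ext0 c \<phi> = (\<lambda>c' z v. if c' \<in> A \<and> z \<in> ovl c' c then pbk (transition c' c) \<phi> z v else 0)"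

lemma transition_self:
  assumes "c \<in> A" "z \<in> chart_image c"
  shows "transition c c z = z" "frechet_derivative (transition c c) (at z) = (\<lambda>v. v)" "z \<in> ovl c c"
proof -
  have t: "transition c c y = y" if "y \<in> chart_image c" for y
    using cinv_image[OF assms(1) that] by (simp add: transition)
  show "transition c c z = z" by (rule t[OF assms(2)])
  show "frechet_derivative (transition c c) (at z) = (\<lambda>v. v)"
    using frechet_derivative_cong[OF open_image[OF assms(1)] assms(2), of "transition c c" "\<lambda>y. y"] t
      frechet_derivative_eqI[OF has_derivative_ident, of z] by simp
  show "z \<in> ovl c c" using assms cinv_image by (simp add: ovl_iff)
qed

lemma ext0_self: "c \<in> A \<Longrightarrow> z \<in> chart_image c \<Longrightarrow> ext0 c \<phi> c z v = \<phi> z v"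
  by (simp add: ext0_def pbk_def transition_self)

lemma chart_homeomorphic_maps:
  assumes c: "c \<in> A"
  shows "\<exists>g. homeomorphic_maps (subtopology X (fst c)) (top_of_set (chart_image c)) (snd c) g \<and>
    (\<forall>z\<in>chart_image c. g z = cinv c z)"
proof -
  obtain g where g: "homeomorphic_maps (subtopology X (fst c)) (top_of_set (chart_image c)) (snd c) g"
    using homeo[OF c] homeomorphic_map_maps by blast
  have gc: "g z = cinv c z" if "z \<in> chart_image c" for z
  proof -
    have x: "cinv c z \<in> fst c" "snd c (cinv c z) = z" using cinv_image[OF c that] by auto
    then have "cinv c z \<in> topspace (subtopology X (fst c))" using dom_subset[OF c] by auto
    then have "g (snd c (cinv c z)) = cinv c z" using g unfolding homeomorphic_maps_def by blast
    then show ?thesis unfolding x(2) .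
  qed
  then show ?thesis using g by blast
qed

lemma openin_cinv_image:
  assumes c: "c \<in> A" and W: "open W" "W \<subseteq> chart_image c"
  shows "openin X (cinv c ` W)"
proof -
  obtain g where g: "homeomorphic_maps (subtopology X (fst c)) (top_of_set (chart_image c)) (snd c) g"
    and gc: "\<And>z. z \<in> chart_image c \<Longrightarrow> g z = cinv c z"
    using chart_homeomorphic_maps[OF c] by blast
  have "homeomorphic_map (top_of_set (chart_image c)) (subtopology X (fst c)) g"
    using g homeomorphic_maps_map by blast
  moreover have "openin (top_of_set (chart_image c)) W"
    unfolding openin_open_eq[OF open_image[OF c]] using W by blast
  ultimately have "openin (subtopology X (fst c)) (g ` W)"
    using homeomorphic_map_openness_eq by blast
  moreover have "g ` W = cinv c ` W" using gc W(2) by (intro image_cong) auto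
  ultimately have "openin (subtopology X (fst c)) (cinv c ` W)" by (simp only:)
  then show ?thesis by (rule openin_trans_full[OF _ open_dom[OF c]])
qed

lemma compactin_chart:
  assumes c: "c \<in> A" and K: "compact K" "K \<subseteq> chart_image c"
  shows "compactin X (cinv c ` K)"
proof -
  obtain g where g: "homeomorphic_maps (subtopology X (fst c)) (top_of_set (chart_image c)) (snd c) g"
    and gc: "\<And>z. z \<in> chart_image c \<Longrightarrow> g z = cinv c z"
    using chart_homeomorphic_maps[OF c] by blast
  have "compactin (top_of_set (chart_image c)) K" using K by (simp add: compactin_subtopology)
  then have "compactin (subtopology X (fst c)) (g ` K)"
    using g image_compactin unfolding homeomorphic_maps_def by blast
  moreover have "g ` K = cinv c ` K" using gc K(2) by (intro image_cong) auto
  ultimately show ?thesis by (simp add: compactin_subtopology)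
qed

lemma ext0_support:
  assumes c: "c \<in> A" and z: "\<And>z v. z \<in> chart_image c \<Longrightarrow> z \<notin> K \<Longrightarrow> \<phi> z v = 0"
    and c': "c' \<in> A" "y \<in> chart_image c'" "cinv c' y \<notin> cinv c ` K"
  shows "ext0 c \<phi> c' y v = 0"
proof (cases "y \<in> ovl c' c")
  case True
  have t: "transition c' c y \<in> chart_image c" by (rule subsetD[OF ovl_subset transition_ovl[OF c'(1) c True]])
  have "transition c' c y \<notin> K"
  proof
    assume "transition c' c y \<in> K"
    moreover have "cinv c (transition c' c y) = cinv c' y"
      using True ovl_iff[OF c'(1)] cinv[OF c] by (simp add: transition)
    ultimately show False using c'(3) by (metis imageI)
  qed
  then show ?thesis using z[OF t] by (simp add: ext0_def pbk_def)
qed (simp add: ext0_def)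

text \<open>The image of any chart is covered by its overlap with c, where the form is a pull-back,
  and by the points outside the image of K, where it is 0. The latter form an open set because
  compact sets are closed in the Hausdorff space X.\<close>

lemma forms_ext0:
  assumes c: "c \<in> A" and \<phi>: "sform k (chart_image c) \<phi>" and K: "compact K" "K \<subseteq> chart_image c"
    and z: "\<And>z v. z \<in> chart_image c \<Longrightarrow> z \<notin> K \<Longrightarrow> \<phi> z v = 0"
  shows "ext0 c \<phi> \<in> forms A k"
proof (rule formsI)
  have cl: "closedin X (cinv c ` K)"
    using compactin_imp_closedin[OF _ compactin_chart[OF c K]] mfd by (simp add: complex_manifold_def)
  fix c' assume c': "c' \<in> A"
  let ?U = "snd c' ` (fst c' \<inter> (topspace X - cinv c ` K))"
  have oU: "open ?U" by (rule open_chart_image[OF c']) (use cl in blast)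
  have pb: "sform k (ovl c' c) (pbk (transition c' c) \<phi>)"
    by (rule sform_pbk[OF open_ovl[OF c' c] open_image[OF c] transition_smooth[OF c' c] _ \<phi>])
      (use transition_ovl[OF c' c] ovl_subset in blast)
  have U: "y \<in> ?U \<longleftrightarrow> y \<in> chart_image c' \<and> cinv c' y \<notin> cinv c ` K" for y
    using dom_subset[OF c'] by (force simp: chart_image_def cinv[OF c'])
  have a: "sform k (ovl c' c) (ext0 c \<phi> c')"
    by (rule sform_cong[OF open_ovl[OF c' c] _ pb]) (simp add: ext0_def c')
  have b: "sform k ?U (ext0 c \<phi> c')"
    by (rule sform_cong[OF oU _ sform_zero]) (rule ext, rule ext0_support[OF c z c', symmetric], use U in auto)
  have un: "ovl c' c \<union> ?U = chart_image c'"
  proof -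
    have "y \<in> chart_image c' \<Longrightarrow> y \<notin> ?U \<Longrightarrow> y \<in> ovl c' c" for y
      using U[of y] ovl_iff[OF c'] K(2) cinv_image[OF c] by auto
    then show ?thesis using U ovl_subset by blast
  qed
  show "sform k (chart_image c') (ext0 c \<phi> c')"
    unfolding un[symmetric] sform_def
  proof (intro conjI ballI allI)
    show "alternating k (ext0 c \<phi> c' y)" if "y \<in> ovl c' c \<union> ?U" for y
      using that sform_alternating[OF a] sform_alternating[OF b] by blast
    show "smooth_on (ovl c' c \<union> ?U) (\<lambda>z. ext0 c \<phi> c' z v)" for v
      by (rule smooth_on_Un[OF open_ovl[OF c' c] oU sform_smooth[OF a] sform_smooth[OF b]])
  qed
next
  fix c' c'' y v assume c': "c' \<in> A" "c'' \<in> A" and y: "y \<in> ovl c' c''"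
  have iff: "transition c' c'' y \<in> ovl c'' c \<longleftrightarrow> y \<in> ovl c' c"
    using y cinv[OF c'(2)] ovl_iff[OF c'(1)] ovl_iff[OF c'(2)] by (auto simp: transition chart_image_def)
  show "ext0 c \<phi> c' y v = pbk (transition c' c'') (ext0 c \<phi> c'') y v"
  proof (cases "y \<in> ovl c' c")
    case True
    let ?N = "ovl c' c \<inter> ovl c' c''"
    have N: "open ?N" "y \<in> ?N" using open_ovl[OF c'(1) c] open_ovl[OF c'] True y by blast+
    have eq: "transition c' c w = transition c'' c (transition c' c'' w)" if "w \<in> ?N" for w
      using that c' by (auto simp: transition ovl_iff cinv)
    have fr: "frechet_derivative (transition c' c) (at y) = frechet_derivative (\<lambda>w. transition c'' c (transition c' c'' w)) (at y)"
      by (rule frechet_derivative_cong[OF N]) (rule eq)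
    have "pbk (transition c' c) \<phi> y v = pbk (\<lambda>w. transition c'' c (transition c' c'' w)) \<phi> y v"
      unfolding pbk_def fr eq[OF N(2)] ..
    also have "\<dots> = pbk (transition c' c'') (pbk (transition c'' c) \<phi>) y v"
      using True iff
      by (intro pbk_compose[symmetric] transition_differentiable c' c y) auto
    finally show ?thesis using True iff c' by (simp add: ext0_def pbk_def)
  next
    case False
    then show ?thesis using iff by (simp add: ext0_def pbk_def)
  qed
next
  fix c' y v assume "c' \<notin> A \<or> y \<notin> chart_image c'"
  then have "\<not> (c' \<in> A \<and> y \<in> ovl c' c)" using ovl_subset[of c' c] by blast
  then show "ext0 c \<phi> c' y v = 0" unfolding ext0_def by (rule if_not_P)
qed

end

section \<open>Partitions of unity on a compact manifold\<close>

locale compact_mfd = complex_mfd X A for X :: "'a topology" and A :: "('a, 'n::finite) chart set" +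
  assumes compact: "compact_space X"
begin

text \<open>Several sizes share one cube: a bump is 1 on half-width r/2 and supported in half-width
  r, later primitives live in 2r, and the prescribed neighbourhood contains 4r.\<close>

definition fits :: "('a, 'n) chart \<Rightarrow> complex ^ 'n \<Rightarrow> real \<Rightarrow> bool" where
  "fits c p r \<longleftrightarrow> c \<in> A \<and> r > 0 \<and> ocube p (4 * r) \<subseteq> chart_image c"

lemma fitsD: "fits c p r \<Longrightarrow> c \<in> A" "fits c p r \<Longrightarrow> r > 0" "fits c p r \<Longrightarrow> ccube p r \<subseteq> chart_image c"
  "fits c p r \<Longrightarrow> ccube p (2 * r) \<subseteq> chart_image c" "fits c p r \<Longrightarrow> ocube p (3 * r) \<subseteq> chart_image c"
proof -
  show "fits c p r \<Longrightarrow> c \<in> A" "fits c p r \<Longrightarrow> r > 0" by (auto simp: fits_def)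
  assume f: "fits c p r"
  then have r: "r > 0" and s: "ocube p (4 * r) \<subseteq> chart_image c" by (auto simp: fits_def)
  show "ccube p r \<subseteq> chart_image c" using cube_mono(1)[of r "4 * r" p] r s by auto
  show "ccube p (2 * r) \<subseteq> chart_image c" using cube_mono(1)[of "2 * r" "4 * r" p] r s by auto
  show "ocube p (3 * r) \<subseteq> chart_image c" using cube_mono(2)[of "3 * r" "4 * r" p] r s by auto
qed

definition nnf :: "('a, 'n) form \<Rightarrow> bool" where
  "nnf f \<longleftrightarrow> (\<forall>c z v. \<exists>t. 0 \<le> t \<and> t \<le> 1 \<and> f c z v = complex_of_real t)"

lemma nnf_smul: "nnf f \<Longrightarrow> nnf g \<Longrightarrow> nnf (smul f g)"
  unfolding nnf_def
proof (intro allI)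
  fix c z v
  assume f: "\<forall>c z v. \<exists>t. 0 \<le> t \<and> t \<le> 1 \<and> f c z v = complex_of_real t"
    and g: "\<forall>c z v. \<exists>t. 0 \<le> t \<and> t \<le> 1 \<and> g c z v = complex_of_real t"
  obtain s t where "0 \<le> s \<and> s \<le> 1 \<and> f c z v = complex_of_real s" "0 \<le> t \<and> t \<le> 1 \<and> g c z v = complex_of_real t"
    using f g by metis
  then show "\<exists>t. 0 \<le> t \<and> t \<le> 1 \<and> smul f g c z v = complex_of_real t"
    by (intro exI[of _ "s * t"]) (auto simp: smul_def mult_le_one)
qed

lemma nnf_unit_minus:
  assumes "f \<in> forms A 0" "nnf f"
  shows "nnf (unit_form A - f)"
  unfolding nnf_def
proof (intro allI)
  fix c z v
  obtain t where t: "0 \<le> t" "t \<le> 1" "f c z v = complex_of_real t" using assms(2) unfolding nnf_def by metis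
  show "\<exists>t. 0 \<le> t \<and> t \<le> 1 \<and> (unit_form A - f) c z v = complex_of_real t"
  proof (cases "c \<in> A \<and> z \<in> chart_image c")
    case True
    then show ?thesis using t by (intro exI[of _ "1 - t"]) (simp add: unit_form_def)
  next
    case False
    then show ?thesis using forms_outside[OF assms(1), of c z v] by (intro exI[of _ 0]) (auto simp: unit_form_def)
  qed
qed

lemma bump_form:
  assumes f: "fits c p r"
  shows "\<exists>b\<in>forms A 0. nnf b \<and>
    (\<forall>c'\<in>A. \<forall>z\<in>chart_image c'. \<forall>v. cinv c' z \<notin> cinv c ` ccube p r \<longrightarrow> b c' z v = 0) \<and>
    (\<forall>c'\<in>A. \<forall>z\<in>chart_image c'. \<forall>v. cinv c' z \<in> cinv c ` ocube p (r / 2) \<longrightarrow> b c' z v = 1)"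
proof -
  note c = fitsD(1)[OF f] and r = fitsD(2)[OF f] and sub = fitsD(3)[OF f]
  obtain \<beta> :: "complex ^ 'n \<Rightarrow> real" where b: "smooth_on UNIV \<beta>" "\<And>z. 0 \<le> \<beta> z \<and> \<beta> z \<le> 1"
    "\<And>z. z \<in> ocube p (r / 2) \<Longrightarrow> \<beta> z = 1" "\<And>z. z \<notin> ccube p r \<Longrightarrow> \<beta> z = 0"
    using bump_exists[OF r, of p] by blast
  define \<phi> :: "complex ^ 'n \<Rightarrow> 'n altform" where "\<phi> = (\<lambda>z v. complex_of_real (\<beta> z))"
  have "smooth_on UNIV (\<lambda>z. complex_of_real (\<beta> z))"
    by (rule smooth_on_bounded_linear[OF bounded_linear_of_real open_UNIV b(1)])
  then have s: "sform 0 (chart_image c) \<phi>"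
    unfolding sform_def \<phi>_def alternating_0 using smooth_on_subset by blast
  have z: "\<And>z v. z \<in> chart_image c \<Longrightarrow> z \<notin> ccube p r \<Longrightarrow> \<phi> z v = 0" using b(4) by (simp add: \<phi>_def)
  show ?thesis
  proof (intro bexI[of _ "ext0 c \<phi>"] conjI ballI allI impI)
    show "ext0 c \<phi> \<in> forms A 0" by (rule forms_ext0[OF c s compact_ccube sub z])
    show "nnf (ext0 c \<phi>)" unfolding nnf_def
    proof (intro allI)
      fix c' z v
      show "\<exists>t. 0 \<le> t \<and> t \<le> 1 \<and> ext0 c \<phi> c' z v = complex_of_real t"
        using b(2)[of "transition c' c z"]
        by (cases "c' \<in> A \<and> z \<in> ovl c' c") (auto simp: ext0_def pbk_def \<phi>_def intro: exI[of _ "0::real"])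
    qed
    fix c' z v assume c': "c' \<in> A" "z \<in> chart_image c'"
    show "ext0 c \<phi> c' z v = 0" if "cinv c' z \<notin> cinv c ` ccube p r" by (rule ext0_support[OF c z c' that])
    show "ext0 c \<phi> c' z v = 1" if x: "cinv c' z \<in> cinv c ` ocube p (r / 2)"
    proof -
      obtain y where y: "y \<in> ocube p (r / 2)" "cinv c' z = cinv c y" using x by blast
      have yc: "y \<in> chart_image c" using y(1) cube_mono(2)[of "r / 2" "r" p] cube_mono(4) sub r by fastforce
      have "z \<in> ovl c' c" using ovl_iff[OF c'(1)] c'(2) y(2) cinv_image[OF c yc] by simp
      moreover have "transition c' c z = y" using cinv_image[OF c yc] y(2) by (simp add: transition)
      ultimately show ?thesis using c'(1) b(3)[OF y(1)] by (simp add: ext0_def pbk_def \<phi>_def)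
    qed
  qed
qed

lemma fits_exists:
  assumes U: "openin X U" "x \<in> U"
  shows "\<exists>c p r. fits c p r \<and> x \<in> cinv c ` ocube p (r / 2) \<and> cinv c ` ocube p (4 * r) \<subseteq> U"
proof -
  obtain c where c: "c \<in> A" "x \<in> fst c" using chart_cover U openin_subset by blast
  let ?W = "snd c ` (fst c \<inter> U)"
  have "open ?W" "snd c x \<in> ?W" using open_chart_image[OF c(1) U(1)] c(2) U(2) by auto
  then obtain s where s: "s > 0" "ocube (snd c x) s \<subseteq> ?W" using ocube_in_open by blast
  have "fits c (snd c x) (s / 4)" using c(1) s by (auto simp: fits_def chart_image_def)
  moreover have "x \<in> cinv c ` ocube (snd c x) (s / 4 / 2)"
    using cinv[OF c] ocube_center[of "s / 4 / 2" "snd c x"] s(1) by (metis divide_pos_pos imageI zero_less_numeral)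
  moreover have "cinv c ` ocube (snd c x) (4 * (s / 4)) \<subseteq> U" using s(2) cinv[OF c(1)] by force
  ultimately show ?thesis by blast
qed

lemma unit_form_apply: "c \<in> A \<Longrightarrow> z \<in> chart_image c \<Longrightarrow> unit_form A c z v = 1"
  by (simp add: unit_form_def)

lemma smul_unit: "u \<in> forms A k \<Longrightarrow> smul (unit_form A) u = u"
  by (intro ext) (auto simp: smul_def unit_form_def forms_outside)

definition splits :: "'i set \<Rightarrow> ('i \<Rightarrow> ('a, 'n) form) \<Rightarrow> ('i \<Rightarrow> ('a, 'n) form) \<Rightarrow> ('a, 'n) form \<Rightarrow> bool" where
  "splits I b \<rho> P \<longleftrightarrow> (\<forall>i\<in>I. \<rho> i \<in> forms A 0 \<and> nnf (\<rho> i) \<and> (\<forall>c z v. b i c z v = 0 \<longrightarrow> \<rho> i c z v = 0)) \<and>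
    P \<in> forms A 0 \<and> nnf P \<and> (\<forall>c z v. (\<exists>i\<in>I. b i c z v = 1) \<longrightarrow> P c z v = 0) \<and>
    (\<Sum>i\<in>I. \<rho> i) = unit_form A - P"

text \<open>The new function is b_j times the remainder P, and then P is multiplied by 1 - b_j. Thus
  P is the product of all 1 - b_i, which vanishes as soon as one b_i is 1.\<close>

lemma partition_product:
  assumes "finite I" "\<And>i. i \<in> I \<Longrightarrow> b i \<in> forms A 0 \<and> nnf (b i)"
  shows "\<exists>\<rho> P. splits I b \<rho> P"
  using assms
proof (induction I rule: finite_induct)
  case empty
  have "nnf (unit_form A)" unfolding nnf_def unit_form_def
  proof (intro allI)
    fix c z v
    show "\<exists>t. 0 \<le> t \<and> t \<le> 1 \<and> (if c \<in> A \<and> z \<in> chart_image c then 1 else 0) = complex_of_real t"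
      by (rule exI[of _ "if c \<in> A \<and> z \<in> chart_image c then 1 else 0"]) simp
  qed
  then have "splits {} b (\<lambda>_. 0) (unit_form A)" unfolding splits_def using forms_unit by simp
  then show ?case by blast
next
  case (insert j I)
  have "\<exists>\<rho> P. splits I b \<rho> P" by (rule insert.IH) (rule insert.prems, simp)
  then obtain \<rho> P where s: "splits I b \<rho> P" by blast
  have IH: "\<And>i. i \<in> I \<Longrightarrow> \<rho> i \<in> forms A 0 \<and> nnf (\<rho> i) \<and> (\<forall>c z v. b i c z v = 0 \<longrightarrow> \<rho> i c z v = 0)"
    "P \<in> forms A 0" "nnf P" "\<And>c z v. \<exists>i\<in>I. b i c z v = 1 \<Longrightarrow> P c z v = 0" "(\<Sum>i\<in>I. \<rho> i) = unit_form A - P"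
    using s unfolding splits_def by blast+
  have b: "b j \<in> forms A 0" "nnf (b j)" using insert.prems by auto
  define \<rho>' where "\<rho>' = \<rho>(j := smul (b j) P)"
  define P' where "P' = smul (unit_form A - b j) P"
  have "smul (unit_form A - b j) P = smul (unit_form A) P - smul (b j) P"
    by (intro ext) (simp add: smul_def left_diff_distrib)
  then have P': "P' = P - smul (b j) P" unfolding P'_def smul_unit[OF IH(2)] .
  have "(\<Sum>i\<in>I. \<rho>' i) = (\<Sum>i\<in>I. \<rho> i)"
    by (rule sum.cong[OF refl]) (use insert(2) in \<open>auto simp: \<rho>'_def\<close>)
  then have "(\<Sum>i\<in>insert j I. \<rho>' i) = smul (b j) P + (unit_form A - P)"
    unfolding sum.insert[OF insert(1,2)] IH(5) by (simp add: \<rho>'_def)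
  then have "(\<Sum>i\<in>insert j I. \<rho>' i) = unit_form A - P'" unfolding P' by simp
  moreover have "\<rho>' i \<in> forms A 0 \<and> nnf (\<rho>' i) \<and> (\<forall>c z v. b i c z v = 0 \<longrightarrow> \<rho>' i c z v = 0)" if i: "i \<in> insert j I" for i
  proof (cases "i = j")
    case True
    have "\<forall>c z v. b j c z v = 0 \<longrightarrow> smul (b j) P c z v = 0" by (simp add: smul_def)
    then show ?thesis using True forms_smul[OF b(1) IH(2)] nnf_smul[OF b(2) IH(3)] by (simp add: \<rho>'_def)
  next
    case False
    then have e: "\<rho>' i = \<rho> i" and iI: "i \<in> I" using i by (auto simp: \<rho>'_def)
    show ?thesis unfolding e by (rule IH(1)[OF iI])
  qed
  moreover have "P' \<in> forms A 0" "nnf P'"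
    unfolding P'_def
    by (rule forms_smul[OF forms_diff[OF forms_unit b(1)] IH(2)], rule nnf_smul[OF nnf_unit_minus[OF b] IH(3)])
  moreover have "P' c z v = 0" if "\<exists>i\<in>insert j I. b i c z v = 1" for c z v
  proof -
    have "P c z v = 0 \<or> b j c z v = 1" using that IH(4)[of c z v] by blast
    then show ?thesis
    proof
      assume b1: "b j c z v = 1"
      then have "c \<in> A" "z \<in> chart_image c" using forms_outside[OF b(1), of c z v] by fastforce+
      then have "unit_form A c z v = 1" by (rule unit_form_apply)
      then show ?thesis using b1 by (simp add: P'_def smul_def)
    qed (simp add: P'_def smul_def)
  qed
  ultimately have "splits (insert j I) b \<rho>' P'" unfolding splits_def by blast
  then show ?case by blast
qed

text \<open>By compactness finitely many of the inner cubes on which the bumps are 1 cover X, so the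
  remainder P of \<open>partition_product\<close> is 0. The index set consists of the centres, which
  lets U be a function of the index.\<close>

theorem partition_of_unity:
  assumes U: "\<And>x. x \<in> topspace X \<Longrightarrow> openin X (U x) \<and> x \<in> U x"
  shows "\<exists>I c p r \<rho>. finite I \<and> I \<subseteq> topspace X \<and>
    (\<forall>i\<in>I. fits (c i) (p i) (r i) \<and> cinv (c i) ` ocube (p i) (4 * r i) \<subseteq> U i \<and> \<rho> i \<in> forms A 0 \<and> nnf (\<rho> i) \<and>
      (\<forall>c'\<in>A. \<forall>z\<in>chart_image c'. \<forall>v. cinv c' z \<notin> cinv (c i) ` ccube (p i) (r i) \<longrightarrow> \<rho> i c' z v = 0)) \<and>
    (\<Sum>i\<in>I. \<rho> i) = unit_form A"
proof -
  have "\<forall>x. \<exists>c p r. x \<in> topspace X \<longrightarrow> fits c p r \<and> x \<in> cinv c ` ocube p (r / 2) \<and> cinv c ` ocube p (4 * r) \<subseteq> U x"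
    using fits_exists U by meson
  then obtain c p r where cpr: "\<And>x. x \<in> topspace X \<Longrightarrow> fits (c x) (p x) (r x) \<and> x \<in> cinv (c x) ` ocube (p x) (r x / 2) \<and>
      cinv (c x) ` ocube (p x) (4 * r x) \<subseteq> U x" by metis
  have "\<forall>x. \<exists>b. x \<in> topspace X \<longrightarrow> b \<in> forms A 0 \<and> nnf b \<and>
    (\<forall>c'\<in>A. \<forall>z\<in>chart_image c'. \<forall>v. cinv c' z \<notin> cinv (c x) ` ccube (p x) (r x) \<longrightarrow> b c' z v = 0) \<and>
    (\<forall>c'\<in>A. \<forall>z\<in>chart_image c'. \<forall>v. cinv c' z \<in> cinv (c x) ` ocube (p x) (r x / 2) \<longrightarrow> b c' z v = 1)"
    using bump_form cpr by meson
  then obtain b where b: "\<And>x. x \<in> topspace X \<Longrightarrow> b x \<in> forms A 0 \<and> nnf (b x) \<and>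
    (\<forall>c'\<in>A. \<forall>z\<in>chart_image c'. \<forall>v. cinv c' z \<notin> cinv (c x) ` ccube (p x) (r x) \<longrightarrow> b x c' z v = 0) \<and>
    (\<forall>c'\<in>A. \<forall>z\<in>chart_image c'. \<forall>v. cinv c' z \<in> cinv (c x) ` ocube (p x) (r x / 2) \<longrightarrow> b x c' z v = 1)"
    by metis
  define Nb where "Nb x = cinv (c x) ` ocube (p x) (r x / 2)" for x
  have oO: "openin X (Nb x)" if x: "x \<in> topspace X" for x
  proof -
    note f = cpr[OF x, THEN conjunct1]
    have "ocube (p x) (r x / 2) \<subseteq> chart_image (c x)"
      using cube_mono(2)[of "r x / 2" "3 * r x" "p x"] fitsD(2,5)[OF f] by auto
    then show ?thesis unfolding Nb_def by (rule openin_cinv_image[OF fitsD(1)[OF f] open_ocube])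
  qed
  have "\<exists>\<F>. finite \<F> \<and> \<F> \<subseteq> Nb ` topspace X \<and> topspace X \<subseteq> \<Union>\<F>"
  proof -
    have "topspace X \<subseteq> \<Union>(Nb ` topspace X)" using cpr by (auto simp: Nb_def)
    moreover have "\<And>U. U \<in> Nb ` topspace X \<Longrightarrow> openin X U" using oO by blast
    ultimately show ?thesis using compact unfolding compact_space_def compactin_def by meson
  qed
  then obtain I where I: "I \<subseteq> topspace X" "finite I" "topspace X \<subseteq> \<Union>(Nb ` I)"
    by (metis finite_subset_image)
  have "\<exists>\<rho> P. splits I b \<rho> P" by (rule partition_product[OF I(2)]) (use b I(1) in blast)
  then obtain \<rho> P where s: "splits I b \<rho> P" by blast
  have \<rho>: "\<And>i. i \<in> I \<Longrightarrow> \<rho> i \<in> forms A 0 \<and> nnf (\<rho> i) \<and> (\<forall>c z v. b i c z v = 0 \<longrightarrow> \<rho> i c z v = 0)"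
    "P \<in> forms A 0" "\<And>c z v. \<exists>i\<in>I. b i c z v = 1 \<Longrightarrow> P c z v = 0" "(\<Sum>i\<in>I. \<rho> i) = unit_form A - P"
    using s unfolding splits_def by blast+
  have "P = 0"
  proof (rule forms_ext[OF \<rho>(2) forms_zero])
    fix c' z v assume c': "c' \<in> A" "z \<in> chart_image c'"
    then have "cinv c' z \<in> topspace X" using cinv_image dom_subset by blast
    then obtain i where i: "i \<in> I" "cinv c' z \<in> Nb i" using I(3) by blast
    then have "b i c' z v = 1" using b[of i] I(1) c' unfolding Nb_def by blast
    then have "P c' z v = 0" using \<rho>(3) i(1) by blast
    then show "P c' z v = 0 c' z v" by simp
  qed
  then have "(\<Sum>i\<in>I. \<rho> i) = unit_form A" using \<rho>(4) by simp
  moreover have all: "fits (c i) (p i) (r i) \<and> cinv (c i) ` ocube (p i) (4 * r i) \<subseteq> U i \<and> \<rho> i \<in> forms A 0 \<and> nnf (\<rho> i) \<and>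
      (\<forall>c'\<in>A. \<forall>z\<in>chart_image c'. \<forall>v. cinv c' z \<notin> cinv (c i) ` ccube (p i) (r i) \<longrightarrow> \<rho> i c' z v = 0)" if "i \<in> I" for i
  proof -
    have "i \<in> topspace X" using that I(1) by blast
    then show ?thesis using cpr[of i] \<rho>(1)[OF that] b[of i] by blast
  qed
  ultimately show ?thesis using I(1,2)
    by (rule_tac exI[of _ I], rule_tac exI[of _ c], rule_tac exI[of _ p], rule_tac exI[of _ r], rule_tac exI[of _ \<rho>])
      (intro conjI ballI; assumption?; (erule all[THEN conjunct1] | drule all; blast))
qed

end

section \<open>Orientation\<close>

definition en :: "nat \<Rightarrow> 'n::finite" where
  "en = (SOME f. bij_betw f {..<CARD('n)} UNIV)"

lemma bij_en: "bij_betw (en :: nat \<Rightarrow> 'n::finite) {..<CARD('n)} UNIV"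
proof -
  obtain f :: "nat \<Rightarrow> 'n" where "bij_betw f {0..<CARD('n)} UNIV"
    using ex_bij_betw_nat_finite[of "UNIV :: 'n set"] by auto
  then have "bij_betw f {..<CARD('n)} UNIV" by (simp add: atLeast0LessThan)
  then have "\<exists>f. bij_betw f {..<CARD('n)} (UNIV :: 'n set)" by blast
  then show ?thesis unfolding en_def by (rule someI_ex)
qed

text \<open>The real basis e_1, i e_1, e_2, i e_2, ... of C^n; its order fixes the complex
  orientation.\<close>

definition std :: "nat \<Rightarrow> complex ^ 'n::finite" where
  "std i = axis (en (i div 2)) (if even i then 1 else \<i>)"

lemma bij_std: "bij_betw (std :: nat \<Rightarrow> complex ^ 'n::finite) {..<2 * CARD('n)} Basis"
proof (rule bij_betw_imageI)
  show "inj_on (std :: nat \<Rightarrow> complex ^ 'n) {..<2 * CARD('n)}"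
  proof (rule inj_onI)
    fix i j assume i: "i \<in> {..<2 * CARD('n)}" and j: "j \<in> {..<2 * CARD('n)}" and eq: "(std i :: complex ^ 'n) = std j"
    have e: "(en (i div 2) :: 'n) = en (j div 2)" "even i \<longleftrightarrow> even j"
      using eq by (auto simp: std_def axis_eq_axis complex_eq_iff split: if_splits)
    have "i div 2 = j div 2"
      by (rule inj_onD[OF bij_betw_imp_inj_on[OF bij_en] e(1)]) (use i j in auto)
    with e(2) show "i = j" by (metis dvd_mult_div_cancel odd_two_times_div_two_succ)
  qed
  show "std ` {..<2 * CARD('n)} = (Basis :: (complex ^ 'n) set)"
  proof (intro equalityI subsetI)
    fix x :: "complex ^ 'n" assume "x \<in> std ` {..<2 * CARD('n)}"
    then obtain i where "x = std i" by blast
    then show "x \<in> Basis" by (auto simp: std_def axis_in_Basis_iff Basis_complex_def)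
  next
    fix x :: "complex ^ 'n" assume "x \<in> Basis"
    then obtain k u where x: "x = axis k u" "u \<in> Basis" by (auto simp: Basis_vec_def)
    obtain l where l: "l < CARD('n)" "k = en l" using bij_betw_imp_surj_on[OF bij_en] by (metis UNIV_I imageE lessThan_iff)
    from x(2) consider "u = 1" | "u = \<i>" by (auto simp: Basis_complex_def)
    then show "x \<in> std ` {..<2 * CARD('n)}"
    proof cases
      case 1
      then show ?thesis using x l by (intro image_eqI[of _ _ "2 * l"]) (auto simp: std_def)
    next
      case 2
      then show ?thesis using x l by (intro image_eqI[of _ _ "2 * l + 1"]) (auto simp: std_def)
    qed
  qed
qed

text \<open>The type \<open>'n bit0\<close> has \<open>2 * CARD('n)\<close> elements and a well-order, as the change of variables
  formula of the library requires of index types.\<close>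

definition ix :: "'n::finite bit0 \<Rightarrow> nat" where
  "ix = (SOME f. bij_betw f UNIV {..<2 * CARD('n)})"

lemma bij_ix: "bij_betw (ix :: 'n::finite bit0 \<Rightarrow> nat) UNIV {..<2 * CARD('n)}"
proof -
  have "\<exists>f. bij_betw f (UNIV :: 'n bit0 set) {..<2 * CARD('n)}"
    by (rule finite_same_card_bij) simp_all
  then show ?thesis unfolding ix_def by (rule someI_ex)
qed

definition cor :: "complex ^ 'n::finite \<Rightarrow> real ^ 'n bit0" where
  "cor x = (\<chi> j. x \<bullet> std (ix j))"

definition roc :: "real ^ 'n::finite bit0 \<Rightarrow> complex ^ 'n" where
  "roc y = (\<Sum>j\<in>UNIV. (y $ j) *\<^sub>R std (ix j))"

lemma bij_std_ix: "bij_betw (\<lambda>j. std (ix j)) (UNIV :: 'n::finite bit0 set) (Basis :: (complex ^ 'n) set)"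
  using bij_betw_trans[OF bij_ix bij_std] by (simp add: o_def)

lemma std_ix_basis: "(std (ix (j :: 'n::finite bit0)) :: complex ^ 'n) \<in> Basis"
  by (rule bij_betwE[OF bij_std_ix, rule_format, OF UNIV_I])

lemma std_ix_inner: "(std (ix (i :: 'n bit0)) :: complex ^ 'n::finite) \<bullet> std (ix (j :: 'n bit0)) = (if i = j then 1 else 0)"
proof -
  have "(std (ix i) :: complex ^ 'n) = std (ix j) \<longleftrightarrow> i = j"
    by (rule inj_on_eq_iff[OF bij_betw_imp_inj_on[OF bij_std_ix] UNIV_I UNIV_I])
  then show ?thesis unfolding inner_Basis[OF std_ix_basis[of i] std_ix_basis[of j]] by (simp only:)
qed

lemma roc_cor: "roc (cor x) = x"
proof -
  have "roc (cor x) = (\<Sum>b\<in>Basis. (x \<bullet> b) *\<^sub>R b)"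
    unfolding roc_def cor_def using sum.reindex_bij_betw[OF bij_std_ix, of "\<lambda>b. (x \<bullet> b) *\<^sub>R b"] by simp
  then show ?thesis by (simp add: euclidean_representation)
qed

lemma cor_roc: "cor (roc y) = y"
  unfolding cor_def roc_def vec_eq_iff
  by (simp add: inner_sum_left std_ix_inner sum.delta if_distrib cong: if_cong)

lemma linear_cor: "linear (cor :: complex ^ 'n::finite \<Rightarrow> real ^ 'n bit0)"
  by (rule linearI) (simp_all add: cor_def vec_eq_iff inner_add_left)

lemma linear_roc: "linear (roc :: real ^ 'n bit0 \<Rightarrow> complex ^ 'n::finite)"
  by (rule linearI) (simp_all add: roc_def scaleR_add_left sum.distrib scaleR_sum_right)

definition rd :: "(nat \<Rightarrow> complex ^ 'n::finite) \<Rightarrow> real" where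
  "rd v = det ((\<chi> j. cor (v (ix j))) :: real ^ 'n bit0 ^ 'n bit0)"

lemma ix_cases: "i < 2 * CARD('n) \<Longrightarrow> \<exists>j :: 'n::finite bit0. ix j = i"
  using bij_betw_imp_surj_on[OF bij_ix] by (metis imageE lessThan_iff)

lemma rd_std: "rd (std :: nat \<Rightarrow> complex ^ 'n::finite) = 1"
proof -
  have "((\<chi> j. cor (std (ix j))) :: real ^ 'n bit0 ^ 'n bit0) = mat 1"
    by (simp add: vec_eq_iff cor_def mat_def std_ix_inner)
  then show ?thesis by (simp add: rd_def)
qed

lemma alternating_rd: "alternating (2 * CARD('n)) (\<lambda>v. complex_of_real (rd (v :: nat \<Rightarrow> complex ^ 'n::finite)))"
proof (rule alternatingI)
  have ixl: "ix j < 2 * CARD('n)" for j :: "'n bit0" using bij_betw_imp_surj_on[OF bij_ix] by blast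
  show "complex_of_real (rd v) = complex_of_real (rd w)" if "\<And>i. i < 2 * CARD('n) \<Longrightarrow> v i = w i" for v w :: "nat \<Rightarrow> complex ^ 'n"
    unfolding rd_def using that[OF ixl] by simp
  show "linear (\<lambda>x. complex_of_real (rd (v(i := x))))" if i: "i < 2 * CARD('n)" for v :: "nat \<Rightarrow> complex ^ 'n" and i
  proof -
    obtain k :: "'n bit0" where k: "ix k = i" using ix_cases[OF i] by blast
    have "ix j = i \<longleftrightarrow> j = k" for j using bij_betw_imp_inj_on[OF bij_ix] k by (auto simp: inj_on_def)
    then have e: "rd (v(i := x)) = det (\<chi> j. if j = k then cor x else cor (v (ix j)))" for x
      unfolding rd_def by (intro arg_cong[of _ _ det]) (simp add: vec_eq_iff)
    have "linear (\<lambda>x. rd (v(i := x)))"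
      unfolding e
      using det_row_add[of k "\<lambda>_. cor _" "\<lambda>_. cor _" "\<lambda>j. cor (v (ix j))"]
        det_row_mul[of k _ "\<lambda>_. cor _" "\<lambda>j. cor (v (ix j))"]
      by (intro linearI) (simp_all only: linear_add[OF linear_cor] linear_scale[OF linear_cor] scalar_mult_eq_scaleR
          real_scaleR_def)
    then show ?thesis using linear_compose[OF _ bounded_linear.linear[OF bounded_linear_of_real]] by (simp add: o_def)
  qed
  show "complex_of_real (rd v) = 0" if ij: "i < 2 * CARD('n)" "j < 2 * CARD('n)" "i \<noteq> j" "v i = v j" for v :: "nat \<Rightarrow> complex ^ 'n" and i j
  proof -
    obtain k l :: "'n bit0" where kl: "ix k = i" "ix l = j" using ix_cases ij(1,2) by metis
    then have "k \<noteq> l" using ij by auto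
    then have "rd v = 0" unfolding rd_def by (rule det_identical_rows) (simp add: row_def vec_eq_iff kl ij(4))
    then show ?thesis by simp
  qed
qed

text \<open>A full tuple of distinct basis vectors is a permutation of \<open>std\<close>, and f and
  \<open>rd\<close> change by the same sign under it. So f minus \<open>f std\<close> times
  \<open>rd\<close> vanishes on basis tuples.\<close>

lemma top_form_rd:
  assumes f: "alternating (2 * CARD('n)) (f :: 'n::finite altform)"
  shows "f v = of_real (rd v) * f std"
proof -
  let ?m = "2 * CARD('n)"
  have "alternating ?m (\<lambda>v. f v - f std * of_real (rd v))"
    by (intro alternating_diff f alternating_cmult alternating_rd)
  then have "f v - f std * of_real (rd v) = 0"
  proof (rule alternating_zero_on_basis)
    fix v :: "nat \<Rightarrow> complex ^ 'n" assume v: "inj_on v {..<?m}" "v ` {..<?m} \<subseteq> Basis"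
    define \<pi> where "\<pi> i = (if i < ?m then inv_into {..<?m} std (v i) else i)" for i
    have vs: "v i \<in> std ` {..<?m}" if "i < ?m" for i
      using v(2) that bij_betw_imp_surj_on[OF bij_std] by auto
    have sp: "std (\<pi> i) = v i" "\<pi> i < ?m" if "i < ?m" for i
      using f_inv_into_f[OF vs[OF that]] inv_into_into[OF vs[OF that]] that by (auto simp: \<pi>_def)
    have "inj_on \<pi> {..<?m}"
    proof (rule inj_onI)
      fix i j assume ij: "i \<in> {..<?m}" "j \<in> {..<?m}" "\<pi> i = \<pi> j"
      then have "v i = v j" using sp(1)[of i] sp(1)[of j] by simp
      then show "i = j" using v(1) ij by (auto dest: inj_onD)
    qed
    moreover have "\<pi> ` {..<?m} \<subseteq> {..<?m}" using sp(2) by auto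
    ultimately have "bij_betw \<pi> {..<?m} {..<?m}"
      by (simp add: bij_betw_def endo_inj_surj)
    then have p: "\<pi> permutes {..<?m}" by (rule bij_imp_permutes) (simp add: \<pi>_def)
    have g: "g v = of_int (sign \<pi>) * g std" if "alternating ?m g" for g :: "'n altform"
    proof -
      have "g v = g (std \<circ> \<pi>)" by (rule alternating_cong[OF that]) (simp add: sp)
      then show ?thesis using alternating_permutes[OF that p] by simp
    qed
    show "f v - f std * of_real (rd v) = 0"
      using g[OF f] g[OF alternating_rd] by (simp add: rd_std)
  qed
  then show ?thesis by (simp add: mult.commute)
qed

definition rdet :: "(complex ^ 'n::finite \<Rightarrow> complex ^ 'n) \<Rightarrow> real" where
  "rdet L = rd (\<lambda>i. L (std i))"

lemma top_form_rdet:
  assumes f: "alternating (2 * CARD('n)) (f :: 'n::finite altform)" and L: "linear L"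
  shows "f (\<lambda>i. L (v i)) = of_real (rdet L) * f v"
proof -
  note a = alternating_pull[OF L f]
  have "f (\<lambda>i. L (v i)) = of_real (rd v) * f (\<lambda>i. L (std i))" using top_form_rd[OF a] .
  also have "f (\<lambda>i. L (std i)) = of_real (rdet L) * f std" unfolding rdet_def by (rule top_form_rd[OF f])
  finally show ?thesis using top_form_rd[OF f, of v] by simp
qed

lemma rdet_compose: "linear L \<Longrightarrow> linear (M :: complex ^ 'n::finite \<Rightarrow> complex ^ 'n) \<Longrightarrow> rdet (\<lambda>x. M (L x)) = rdet M * rdet L"
  using top_form_rdet[OF alternating_rd, of M "\<lambda>i. L (std i)"] by (simp add: rdet_def flip: of_real_mult)

lemma rdet_det: "rdet L = det (matrix (\<lambda>y. cor (L (roc y))))"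
proof -
  have r: "roc (axis j 1) = std (ix j)" for j :: "'a bit0"
    unfolding roc_def by (simp add: axis_def if_distrib[of "\<lambda>x. x *\<^sub>R _"] sum.delta cong: if_cong)
  have "(\<chi> j. cor (L (std (ix j)))) = Finite_Cartesian_Product.transpose (matrix (\<lambda>y. cor (L (roc y))))"
    by (simp add: matrix_def Finite_Cartesian_Product.transpose_def r vec_eq_iff)
  then show ?thesis by (simp add: rdet_def rd_def det_transpose)
qed

lemma continuous_rd:
  fixes w :: "nat \<Rightarrow> complex \<Rightarrow> complex ^ 'n::finite"
  assumes "\<And>i. continuous_on S (w i)"
  shows "continuous_on S (\<lambda>t. rd (\<lambda>i. w i t))"
  unfolding rd_def det_def cor_def using assms
  by (intro continuous_intros) simp_all

text \<open>\<open>rdet\<close> does not vanish on the complex line \<open>t \<mapsto> 1 + t (L - 1)\<close> outside the countable zero set of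
  a holomorphic determinant, and the complement of that set is connected.\<close>

lemma rdet_pos:
  assumes L: "linear L" "\<And>a v. L (a *s v) = a *s L v" and M: "linear M" and LM: "\<And>x. M (L x) = x" "\<And>x. L (M x) = x"
  shows "rdet (L :: complex ^ 'n::finite \<Rightarrow> complex ^ 'n) > 0"
proof -
  define B :: "complex ^ 'n ^ 'n" where "B = matrix L"
  have "Vector_Spaces.linear (*s) (*s) L"
    unfolding Vector_Spaces.linear_iff using vec.vector_space_axioms by (simp add: linear_add[OF L(1)] L(2))
  then have B: "B *v x = L x" for x unfolding B_def by (rule matrix_works)
  define N where "N t = (\<lambda>x. x + t *s (L x - x))" for t
  define C :: "complex \<Rightarrow> complex ^ 'n ^ 'n" where "C t = (\<chi> i j. mat 1 $ i $ j + t * (B $ i $ j - mat 1 $ i $ j))" for t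
  have NC: "C t *v x = N t x" for t x
  proof -
    have "C t = mat 1 + (\<chi> i j. t * (B - mat 1) $ i $ j)" by (simp add: C_def vec_eq_iff)
    moreover have "(\<chi> i j. t * (B - mat 1) $ i $ j) *v x = t *s ((B - mat 1) *v x)"
      by (simp add: matrix_vector_mult_def vec_eq_iff sum_distrib_left mult.assoc)
    ultimately show ?thesis
      by (simp add: N_def matrix_vector_mult_add_rdistrib matrix_vector_mult_diff_rdistrib B)
  qed
  have lin: "linear (\<lambda>x. D *v x)" for D :: "complex ^ 'n ^ 'n"
    by (rule linearI) (simp_all add: matrix_vector_mult_def vec_eq_iff scaleR_sum_right distrib_left sum.distrib)
  have nz: "rdet (N t) \<noteq> 0" if "det (C t) \<noteq> 0" for t
  proof -
    have "invertible (C t)" unfolding invertible_det_nz using that .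
    then obtain D where "D ** C t = mat 1" unfolding invertible_def by blast
    then have "rdet (\<lambda>x. D *v (C t *v x)) = 1"
      by (simp add: matrix_vector_mul_assoc rdet_def rd_std)
    then have "rdet (\<lambda>x. D *v x) * rdet (N t) = 1"
      using rdet_compose[OF lin lin, of D "C t"] by (simp add: NC)
    then show ?thesis by auto
  qed
  have C0: "C 0 = mat 1" and C1: "C 1 = B" by (simp_all add: C_def vec_eq_iff)
  have "inj (\<lambda>x. B *v x)" unfolding B by (rule inj_on_inverseI[of _ M]) (rule LM(1))
  then obtain D where "D ** B = mat 1" using matrix_left_invertible_injective[of B] by blast
  then have "det D * det B = 1" by (metis det_mul det_I)
  then have B0: "det B \<noteq> 0" by auto
  have hol: "(\<lambda>t. det (C t)) holomorphic_on UNIV"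
    unfolding det_def C_def by (simp, intro holomorphic_intros)
  have "countable {t. det (C t) = 0}"
  proof (cases "(\<lambda>t. det (C t)) constant_on UNIV")
    case True
    then have "det (C t) = det (C 0)" for t unfolding constant_on_def by force
    then show ?thesis by (simp add: C0)
  next
    case False
    then show ?thesis using holomorphic_countable_zeros[OF hol] connected_UNIV by simp
  qed
  then have "path_connected (- {t. det (C t) = 0})"
    by (intro path_connected_complement_countable) simp_all
  moreover have "continuous_on S (\<lambda>t. rdet (N t))" for S
    unfolding rdet_def N_def by (intro continuous_rd continuous_on_add continuous_on_const) (auto intro!: continuous_intros simp: vector_scalar_mult_def)
  ultimately have "connected ((\<lambda>t. rdet (N t)) ` (- {t. det (C t) = 0}))"
    by (intro connected_continuous_image path_connected_imp_connected)
  moreover have "1 \<in> (\<lambda>t. rdet (N t)) ` (- {t. det (C t) = 0})"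
    by (rule image_eqI[of _ _ 0]) (simp_all add: N_def C0 rdet_def rd_std)
  moreover have "rdet L \<in> (\<lambda>t. rdet (N t)) ` (- {t. det (C t) = 0})"
    by (rule image_eqI[of _ _ 1]) (simp_all add: N_def C1 B0)
  moreover have "0 \<notin> (\<lambda>t. rdet (N t)) ` (- {t. det (C t) = 0})"
    using nz by force
  ultimately show ?thesis by (meson connectedD_interval not_less zero_le_one)
qed

section \<open>Lebesgue measure and change of variables on C^n\<close>

lemmas bounded_linear_cor = linear_conv_bounded_linear[THEN iffD1, OF linear_cor]
lemmas bounded_linear_roc = linear_conv_bounded_linear[THEN iffD1, OF linear_roc]

text \<open>Boxes correspond to boxes with the same side lengths, and these values determine
  \<open>lborel\<close>.\<close>

lemma lborel_cor: "distr lborel borel (cor :: complex ^ 'n::finite \<Rightarrow> real ^ 'n bit0) = lborel"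
proof (rule lborel_eqI[symmetric])
  have cm: "(cor :: complex ^ 'n \<Rightarrow> real ^ 'n bit0) \<in> lborel \<rightarrow>\<^sub>M borel"
    using borel_measurable_continuous_onI[OF linear_continuous_on[OF bounded_linear_cor]] by simp
  fix l u :: "real ^ 'n bit0" assume lu: "\<And>b. b \<in> Basis \<Longrightarrow> l \<bullet> b \<le> u \<bullet> b"
  have cr: "roc y \<bullet> std (ix j) = y $ j" for y :: "real ^ 'n bit0" and j
    by (metis cor_def cor_roc vec_lambda_beta)
  have ex: "\<exists>j :: 'n bit0. b = std (ix j)" if "b \<in> Basis" for b :: "complex ^ 'n"
    using that bij_betw_imp_surj_on[OF bij_std_ix] by blast
  have lui: "l $ j \<le> u $ j" for j using lu[of "axis j 1"] by (simp add: inner_axis axis_in_Basis_iff)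
  have "cor -` box l u = (box (roc l) (roc u) :: (complex ^ 'n) set)"
  proof (intro set_eqI)
    fix x :: "complex ^ 'n"
    have "x \<in> box (roc l) (roc u) \<longleftrightarrow> (\<forall>j :: 'n bit0. roc l \<bullet> std (ix j) < x \<bullet> std (ix j) \<and> x \<bullet> std (ix j) < roc u \<bullet> std (ix j))"
      unfolding mem_box using ex std_ix_basis by blast
    then show "x \<in> cor -` box l u \<longleftrightarrow> x \<in> box (roc l) (roc u)"
      by (simp add: cr mem_box_cart cor_def)
  qed
  then have "emeasure (distr lborel borel (cor :: complex ^ 'n \<Rightarrow> _)) (box l u) = emeasure lborel (box (roc l) (roc u) :: (complex ^ 'n) set)"
    by (simp add: emeasure_distr[OF cm])
  also have "\<dots> = (\<Prod>b\<in>Basis. (roc u - roc l) \<bullet> (b :: complex ^ 'n))"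
    by (rule emeasure_lborel_box) (use ex cr lui in metis)
  also have "(\<Prod>b\<in>Basis. (roc u - roc l) \<bullet> (b :: complex ^ 'n)) = (\<Prod>j\<in>UNIV. (u - l) $ j)"
    by (subst prod.reindex_bij_betw[OF bij_std_ix, symmetric]) (simp add: inner_diff_left cr)
  also have "\<dots> = (\<Prod>b\<in>Basis. (u - l) \<bullet> b)"
    by (subst prod.reindex_bij_betw[of "\<lambda>j. axis j 1" UNIV Basis, symmetric])
       (auto simp: inner_axis bij_betw_def inj_on_def axis_eq_axis Basis_vec_def)
  finally show "emeasure (distr lborel borel (cor :: complex ^ 'n \<Rightarrow> _)) (box l u) = ennreal (\<Prod>b\<in>Basis. (u - l) \<bullet> b)" .
qed simp

lemma integral_cor:
  fixes f :: "complex ^ 'n::finite \<Rightarrow> real"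
  assumes f: "integrable lborel f"
  shows "integrable lborel (\<lambda>y. f (roc y))" "(LINT x|lborel. f x) = integral UNIV (\<lambda>y. f (roc y))"
proof -
  have rm: "(\<lambda>y. f (roc y)) \<in> borel_measurable borel"
    using measurable_compose[OF borel_measurable_continuous_onI[OF linear_continuous_on[OF bounded_linear_roc]],
      of f borel] borel_measurable_integrable[OF f] by simp
  have cm: "(cor :: complex ^ 'n \<Rightarrow> real ^ 'n bit0) \<in> lborel \<rightarrow>\<^sub>M borel"
    using borel_measurable_continuous_onI[OF linear_continuous_on[OF bounded_linear_cor]] by simp
  show i: "integrable lborel (\<lambda>y. f (roc y))"
    using integrable_distr_eq[OF cm rm] f by (simp add: lborel_cor roc_cor)
  show "(LINT x|lborel. f x) = integral UNIV (\<lambda>y. f (roc y))"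
    using integral_distr[OF cm rm] by (simp add: lborel_cor roc_cor integral_lborel[OF i])
qed

text \<open>The statement is carried by \<open>cor\<close> to real vectors, where the change of
  variables formula applies. f and h are 0 outside the image and the domain of g, so integrals over
  the whole space can be compared.\<close>

lemma integral_transform_real:
  fixes f h :: "complex ^ 'n::finite \<Rightarrow> real"
  assumes S: "open S" and g: "\<And>x. x \<in> S \<Longrightarrow> (g has_derivative g' x) (at x)" "inj_on g S"
    and f: "integrable lborel f" "\<And>y. y \<notin> g ` S \<Longrightarrow> f y = 0"
    and h: "integrable lborel h" "\<And>x. x \<in> S \<Longrightarrow> h x = \<bar>rdet (g' x)\<bar> * f (g x)" "\<And>x. x \<notin> S \<Longrightarrow> h x = 0"
  shows "(LINT x|lborel. h x) = (LINT y|lborel. f y)"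
proof -
  let ?T = "cor ` S" and ?g = "\<lambda>y. cor (g (roc y))" and ?g' = "\<lambda>y v. cor (g' (roc y) (roc v))"
  let ?f = "\<lambda>y. f (roc y)" and ?h = "\<lambda>y. h (roc y)"
  have T: "?T = roc -` S" by (rule set_eqI) (metis cor_roc roc_cor image_iff vimage_eq)
  have oT: "open ?T" unfolding T
    using open_vimage[OF S] linear_continuous_on[OF bounded_linear_roc] by blast
  have gT: "?g ` ?T = cor ` g ` S" by (auto simp: roc_cor image_iff)
  have der: "(?g has_derivative ?g' y) (at y within ?T)" if "y \<in> ?T" for y
  proof -
    have "roc y \<in> S" using that by (auto simp: T)
    have r: "(roc has_derivative roc) (at y within ?T)" "(cor has_derivative cor) (at a within B)" for a :: "complex ^ 'n" and B
      by (simp_all add: bounded_linear_imp_has_derivative bounded_linear_roc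
         bounded_linear_cor)
    have "(g has_derivative g' (roc y)) (at (roc y) within roc ` ?T)"
      using g(1)[OF \<open>roc y \<in> S\<close>] has_derivative_at_withinI by blast
    from diff_chain_within[OF diff_chain_within[OF r(1) this] r(2)] show ?thesis by (simp add: o_def)
  qed
  have inj: "inj_on ?g ?T"
    using g(2) by (auto simp: inj_on_def roc_cor dest!: arg_cong[of "cor _" _ roc])
  have det: "\<bar>det (matrix (?g' y))\<bar> = \<bar>rdet (g' (roc y))\<bar>" for y by (simp add: rdet_det)
  have ff: "?f y = (if y \<in> ?g ` ?T then ?f y else 0)" for y
    using f(2)[of "roc y"] cor_roc[of y] unfolding gT by (metis imageI)
  have hh: "?h y = (if y \<in> ?T then \<bar>det (matrix (?g' y))\<bar> * ?f (?g y) else 0)" for y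
    using h(2,3)[of "roc y"] by (simp add: T roc_cor det)
  have "?f absolutely_integrable_on UNIV" "?h absolutely_integrable_on UNIV"
    using integral_cor(1)[OF f(1)] integral_cor(1)[OF h(1)]
    by (simp_all add: set_integrable_def integrable_completion borel_measurable_integrable)
  then have af: "?f absolutely_integrable_on ?g ` ?T"
    by (subst (asm) ff) (simp only: absolutely_integrable_restrict_UNIV)
  \<comment> \<open>The formula is about vector-valued integrands, hence the detour through
    \<open>real ^ 1\<close>.\<close>
  have cv: "(\<lambda>x. \<bar>det (matrix (?g' x))\<bar> *\<^sub>R vec (?f (?g x)) :: real ^ 1) absolutely_integrable_on ?T \<and>
           integral ?T (\<lambda>x. \<bar>det (matrix (?g' x))\<bar> *\<^sub>R vec (?f (?g x))) = (vec b :: real ^ 1)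
         \<longleftrightarrow> (\<lambda>x. vec (?f x) :: real ^ 1) absolutely_integrable_on (?g ` ?T) \<and>
           integral (?g ` ?T) (\<lambda>x. vec (?f x)) = (vec b :: real ^ 1)" for b
    using oT by (intro has_absolute_integral_change_of_variables der inj) auto
  have "integral ?T (\<lambda>x. \<bar>det (matrix (?g' x))\<bar> * ?f (?g x)) = integral (?g ` ?T) ?f"
    using af cv[of "integral (?g ` ?T) ?f"] by (simp add: absolutely_integrable_on_1_iff integral_on_1_eq)
  then have "integral UNIV ?h = integral UNIV ?f"
    by (subst hh, subst ff) (simp only: Henstock_Kurzweil_Integration.integral_restrict_UNIV)
  then show ?thesis using integral_cor(2)[OF f(1)] integral_cor(2)[OF h(1)] by simp
qed

lemma integral_transform:
  fixes f h :: "complex ^ 'n::finite \<Rightarrow> complex"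
  assumes S: "open S" and g: "\<And>x. x \<in> S \<Longrightarrow> (g has_derivative g' x) (at x)" "inj_on g S"
    and f: "integrable lborel f" "\<And>y. y \<notin> g ` S \<Longrightarrow> f y = 0"
    and h: "integrable lborel h" "\<And>x. x \<in> S \<Longrightarrow> h x = of_real \<bar>rdet (g' x)\<bar> * f (g x)" "\<And>x. x \<notin> S \<Longrightarrow> h x = 0"
  shows "(LINT x|lborel. h x) = (LINT y|lborel. f y)"
proof -
  have "(LINT x|lborel. Re (h x)) = (LINT y|lborel. Re (f y))"
    by (rule integral_transform_real[OF S g]) (use f h in simp_all)
  moreover have "(LINT x|lborel. Im (h x)) = (LINT y|lborel. Im (f y))"
    by (rule integral_transform_real[OF S g]) (use f h in simp_all)
  ultimately show ?thesis using f(1) h(1) by (simp add: complex_eq_iff integral_Re integral_Im)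
qed

section \<open>Integration of top-degree forms\<close>

context complex_mfd
begin

text \<open>Supports are recorded as subsets of X and not of a coordinate space, so that they make
  sense in all charts at once.\<close>

definition supported :: "'a set \<Rightarrow> ('a, 'n) form \<Rightarrow> bool" where
  "supported K u \<longleftrightarrow> (\<forall>c\<in>A. \<forall>z\<in>chart_image c. cinv c z \<notin> K \<longrightarrow> (\<forall>v. u c z v = 0))"

lemma supportedD: "supported K u \<Longrightarrow> c \<in> A \<Longrightarrow> z \<in> chart_image c \<Longrightarrow> cinv c z \<notin> K \<Longrightarrow> u c z v = 0"
  by (simp add: supported_def)

lemma supported_mono: "supported K u \<Longrightarrow> K \<subseteq> L \<Longrightarrow> supported L u"
  unfolding supported_def by blast

lemma supported_zero: "supported K 0"
  by (simp add: supported_def)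

lemma supported_add: "supported K u \<Longrightarrow> supported K w \<Longrightarrow> supported K (u + w)"
  by (simp add: supported_def)

lemma supported_diff: "supported K u \<Longrightarrow> supported K w \<Longrightarrow> supported K (u - w)"
  by (simp add: supported_def)

lemma supported_scale: "supported K u \<Longrightarrow> supported K (scale_form a u)"
  by (simp add: supported_def scale_form_def)

lemma supported_sum: "(\<And>i. i \<in> S \<Longrightarrow> supported K (u i)) \<Longrightarrow> supported K (\<Sum>i\<in>S. u i)"
  by (induction S rule: infinite_finite_induct) (simp_all add: supported_zero supported_add)

lemma supported_smul_left: "supported K f \<Longrightarrow> supported K (smul f u)"
  by (simp add: supported_def smul_def)

lemma supported_smul_right: "supported K u \<Longrightarrow> supported K (smul f u)"
  by (simp add: supported_def smul_def)

lemma supported_wedge_left: "supported K u \<Longrightarrow> supported K (wedge p q u w)"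
  by (simp add: supported_def wedge_def alt_wedge_def)

lemma supported_wedge_right: "supported K w \<Longrightarrow> supported K (wedge p q u w)"
  by (simp add: supported_def wedge_def alt_wedge_def)

lemma dloc_off_support:
  assumes K: "closedin X K" and u: "supported K u" and c: "c \<in> A" and z: "z \<in> chart_image c" "cinv c z \<notin> K"
  shows "dloc k (u c) z v = 0"
proof -
  let ?U = "snd c ` (fst c \<inter> (topspace X - K))"
  have "open ?U" by (rule open_chart_image[OF c]) (use K in blast)
  moreover have U: "y \<in> ?U \<longleftrightarrow> y \<in> chart_image c \<and> cinv c y \<notin> K" for y
    using dom_subset[OF c] by (force simp: chart_image_def cinv[OF c])
  moreover have "u c y = (\<lambda>v. 0)" if "y \<in> ?U" for y
    using u c that unfolding supported_def U by blast
  ultimately have "dloc k (u c) z v = dloc k (\<lambda>y v. 0) z v" using z by (intro dloc_cong[of ?U]) auto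
  then show ?thesis by (simp add: dloc_zero)
qed

lemma supported_ext_d: "closedin X K \<Longrightarrow> supported K u \<Longrightarrow> supported K (ext_d k u)"
  using dloc_off_support[of K u] unfolding supported_def by (simp add: ext_d_dloc)

lemma closedin_chart: "c \<in> A \<Longrightarrow> compact K \<Longrightarrow> K \<subseteq> chart_image c \<Longrightarrow> closedin X (cinv c ` K)"
  using compactin_imp_closedin[OF _ compactin_chart] mfd by (simp add: complex_manifold_def)

lemma cinv_image_iff: "c \<in> A \<Longrightarrow> K \<subseteq> chart_image c \<Longrightarrow> z \<in> chart_image c \<Longrightarrow> cinv c z \<in> cinv c ` K \<longleftrightarrow> z \<in> K"
  using inj_on_image_mem_iff[of "cinv c" "chart_image c" z K] inj_on_inverseI[of "chart_image c" "snd c" "cinv c"] cinv_image[of c]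
  by simp

lemma supported_local: "u \<in> forms A k \<Longrightarrow> supported (cinv c ` K) u \<Longrightarrow> c \<in> A \<Longrightarrow> K \<subseteq> chart_image c \<Longrightarrow> z \<notin> K \<Longrightarrow> u c z v = 0"
  by (cases "z \<in> chart_image c") (auto simp: forms_outside supported_def cinv_image_iff)

definition csupp :: "('a, 'n) chart \<Rightarrow> ('a, 'n) form \<Rightarrow> bool" where
  "csupp c u \<longleftrightarrow> c \<in> A \<and> (\<exists>K. compact K \<and> K \<subseteq> chart_image c \<and> supported (cinv c ` K) u)"

lemma csuppI: "c \<in> A \<Longrightarrow> compact K \<Longrightarrow> K \<subseteq> chart_image c \<Longrightarrow> supported (cinv c ` K) u \<Longrightarrow> csupp c u"
  unfolding csupp_def by blast

lemma csupp_cong: "csupp c u \<Longrightarrow> (\<And>K. closedin X K \<Longrightarrow> supported K u \<Longrightarrow> supported K w) \<Longrightarrow> csupp c w"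
  unfolding csupp_def using closedin_chart by blast

text \<open>The chart image and the complement of K cover the coordinate space, so the local
  expression, which is 0 outside the chart, is smooth everywhere.\<close>

lemma csupp_sform:
  assumes u: "u \<in> forms A k" and s: "csupp c u"
  shows "sform k UNIV (u c)" "\<exists>K. compact K \<and> (\<forall>z v. z \<notin> K \<longrightarrow> u c z v = 0)"
proof -
  obtain K where c: "c \<in> A" and K: "compact K" "K \<subseteq> chart_image c" "supported (cinv c ` K) u" using s csupp_def by blast
  have z: "u c z v = 0" if "z \<notin> K" for z v by (rule supported_local[OF u K(3) c K(2) that])
  then show "\<exists>K. compact K \<and> (\<forall>z v. z \<notin> K \<longrightarrow> u c z v = 0)" using K(1) by auto
  have un: "UNIV = chart_image c \<union> - K" using K(2) by blast
  have oK: "open (- K)" using compact_imp_closed[OF K(1)] by blast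
  have "smooth_on (- K) (\<lambda>z. u c z v)" for v
    by (rule smooth_on_cong[OF oK _ smooth_on_const[of _ 0]]) (simp add: z)
  then have "smooth_on UNIV (\<lambda>z. u c z v)" for v
    unfolding un by (intro smooth_on_Un open_image[OF c] oK sform_smooth[OF forms_sform[OF u c]])
  moreover have "alternating k (u c z)" for z
  proof (cases "z \<in> chart_image c")
    case True
    then show ?thesis by (rule forms_alternating[OF u c])
  next
    case False
    then have "u c z = (\<lambda>v. 0)" using z K(2) by (intro ext) blast
    then show ?thesis by (simp add: alternating_zero)
  qed
  ultimately show "sform k UNIV (u c)" by (simp add: sform_def)
qed

lemma csupp_integrable:
  assumes u: "u \<in> forms A k" and s: "csupp c u"
  shows "integrable lborel (\<lambda>z. u c z v)"
  using csupp_sform[OF assms] integrable_compact_support[OF smooth_on_continuous[OF sform_smooth]] by metis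

lemma csupp_dloc:
  assumes u: "u \<in> forms A k" and s: "csupp c u"
  shows "ext_d k u c z v = dloc k (u c) z v"
proof (cases "z \<in> chart_image c")
  case False
  obtain K where c: "c \<in> A" and K: "compact K" "K \<subseteq> chart_image c" "supported (cinv c ` K) u" using s csupp_def by blast
  have "dloc k (u c) z v = dloc k (\<lambda>y v. 0) z v"
  proof (rule dloc_cong[of "- K"])
    show "open (- K)" using compact_imp_closed[OF K(1)] by blast
    show "z \<in> - K" using False K(2) by blast
    show "u c y = (\<lambda>v. 0)" if "y \<in> - K" for y
      using supported_local[OF u K(3) c K(2)] that by (intro ext) simp
  qed
  then show ?thesis using False by (simp add: ext_d_outside dloc_zero)
qed (simp add: ext_d_dloc)

text \<open>Every summand of the exterior derivative is a directional derivative of a compactly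
  supported function and integrates to 0.\<close>

lemma csupp_stokes:
  assumes u: "u \<in> forms A k" and s: "csupp c u"
  shows "(LINT z|lborel. ext_d k u c z v) = 0"
proof -
  obtain K where c: "c \<in> A" and K: "compact K" "K \<subseteq> chart_image c" "supported (cinv c ` K) u" using s csupp_def by blast
  have z: "u c z v = 0" if "z \<notin> K" for z v by (rule supported_local[OF u K(3) c K(2) that])
  have oK: "open (- K)" using compact_imp_closed[OF K(1)] by blast
  let ?g = "\<lambda>i y. u c y (\<lambda>j. if j < i then v j else v (Suc j))"
  have sm: "smooth_on UNIV (?g i)" for i by (rule sform_smooth[OF csupp_sform(1)[OF u s]])
  have "frechet_derivative (?g i) (at z) x = 0" if "z \<notin> K" for i z x
    using frechet_derivative_cong[OF oK, of z "?g i" "\<lambda>_. 0"] that z by (simp add: frechet_derivative_const)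
  then have "integrable lborel (\<lambda>z. (- 1) ^ i * frechet_derivative (?g i) (at z) (v i))" for i
    by (intro integrable_mult_right integrable_compact_support[OF smooth_on_continuous[OF smooth_on_deriv[OF sm]] K(1)])
  moreover have "(LINT z|lborel. frechet_derivative (?g i) (at z) (v i)) = 0" for i
    by (rule integral_deriv_zero[OF sm K(1)]) (rule z)
  ultimately show ?thesis unfolding csupp_dloc[OF u s] dloc_def by (simp add: Bochner_Integration.integral_sum)
qed

lemma transition_complex_linear:
  "c \<in> A \<Longrightarrow> c' \<in> A \<Longrightarrow> z \<in> ovl c c' \<Longrightarrow>
    frechet_derivative (transition c c') (at z) (a *s x) = a *s frechet_derivative (transition c c') (at z) x"
  by (rule holomorphic_map_derivative[OF transition_holomorphic])

text \<open>Change of variables involves the absolute value of the Jacobian, the transformation law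
  of top forms the Jacobian itself. They agree because the derivative of a transition map is complex
  linear and invertible, so \<open>rdet_pos\<close> applies.\<close>

lemma csupp_change_chart:
  assumes u: "u \<in> forms A (2 * CARD('n))" and s: "csupp c u" "csupp c' u"
  shows "(LINT z|lborel. u c z std) = (LINT z|lborel. u c' z std)"
proof (rule integral_transform[where S = "ovl c c'" and g = "transition c c'" and g' = "\<lambda>z. frechet_derivative (transition c c') (at z)"])
  have c: "c \<in> A" "c' \<in> A" using s csupp_def by blast+
  show "open (ovl c c')" by (rule open_ovl[OF c])
  show "(transition c c' has_derivative frechet_derivative (transition c c') (at z)) (at z)" if "z \<in> ovl c c'" for z
    using transition_differentiable[OF c that] frechet_derivative_works by blast
  show "inj_on (transition c c') (ovl c c')"
    using transition_inverse[OF c] by (rule inj_on_inverseI)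
  show "integrable lborel (\<lambda>z. u c z std)" "integrable lborel (\<lambda>z. u c' z std)"
    by (rule csupp_integrable[OF u s(1)], rule csupp_integrable[OF u s(2)])
  have off: "u a z v = 0" if a: "csupp b u" "a \<in> A" "z \<notin> ovl a b" for a b z v
  proof (cases "z \<in> chart_image a")
    case True
    obtain K where b: "b \<in> A" and K: "compact K" "K \<subseteq> chart_image b" "supported (cinv b ` K) u" using a csupp_def by blast
    have "cinv a z \<notin> fst b" using a(3) True ovl_iff[OF a(2)] by simp
    moreover have "cinv b ` K \<subseteq> fst b" using K(2) cinv_image[OF b] by auto
    ultimately have "cinv a z \<notin> cinv b ` K" by (rule contra_subsetD[rotated])
    then show ?thesis using K(3) a(2) True by (simp add: supported_def)
  qed (simp add: forms_outside[OF u])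
  show "u c z std = 0" if "z \<notin> ovl c c'" for z by (rule off[OF s(2) c(1) that])
  show "u c' z std = 0" if "z \<notin> transition c c' ` ovl c c'" for z
  proof (rule off[OF s(1) c(2)])
    show "z \<notin> ovl c' c"
      using that transition_ovl[OF c(2) c(1)] transition_inverse[OF c(2) c(1)] by (metis imageI)
  qed
  show "u c z std = of_real \<bar>rdet (frechet_derivative (transition c c') (at z))\<bar> * u c' (transition c c' z) std" if z: "z \<in> ovl c c'" for z
  proof -
    let ?D = "frechet_derivative (transition c c') (at z)"
    have tz: "transition c c' z \<in> ovl c' c" by (rule transition_ovl[OF c z])
    have df: "transition c c' differentiable at z" "transition c' c differentiable at (transition c c' z)"
      using transition_differentiable[OF c z] transition_differentiable[OF c(2) c(1) tz] .
    let ?E = "frechet_derivative (transition c' c) (at (transition c c' z))"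
    \<comment> \<open>Differentiating the identity between the two transition maps shows that their
      derivatives are inverse to each other; it is used in both orders.\<close>
    have id: "F (G x) = x" if *: "a \<in> A" "b \<in> A" "y \<in> ovl a b" "G = frechet_derivative (transition a b) (at y)"
        "F = frechet_derivative (transition b a) (at (transition a b y))" for F G a b y x
    proof -
      have "((\<lambda>w. transition b a (transition a b w)) has_derivative (\<lambda>x. F (G x))) (at y)"
        using has_derivative_compose[of "transition a b" G y UNIV "transition b a" F] *
          transition_differentiable[OF *(1,2,3)] transition_differentiable[OF *(2,1) transition_ovl[OF *(1,2,3)]]
          frechet_derivative_works by blast
      moreover have "((\<lambda>w. w) has_derivative (\<lambda>x. x)) (at y)" by (rule has_derivative_ident)
      then have "((\<lambda>w. transition b a (transition a b w)) has_derivative (\<lambda>x. x)) (at y)"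
        by (rule has_derivative_transform_within_open[OF _ open_ovl[OF *(1,2)] *(3)])
          (simp add: transition_inverse[OF *(1,2)])
      ultimately show ?thesis using has_derivative_unique by metis
    qed
    have "?D (a *s v) = a *s ?D v" for a v by (rule transition_complex_linear[OF c z])
    moreover have "?E (?D x) = x" for x using id[OF c z] by simp
    moreover have "?D (?E x) = x" for x
      using id[OF c(2) c(1) tz refl refl] transition_inverse[OF c z] by simp
    ultimately have "rdet ?D > 0"
      using transition_linear[OF c z] transition_linear[OF c(2) c(1) tz] by (intro rdet_pos[of ?D ?E])
    moreover have "u c z std = of_real (rdet ?D) * u c' (transition c c' z) std"
      using forms_pbk[OF u c z] transition_linear[OF c z] tz ovl_subset
      by (simp add: pbk_def top_form_rdet[OF forms_alternating[OF u c(2)]] subset_iff)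
    ultimately show ?thesis by simp
  qed
qed

end

lemma smul_add: "smul f (u + w) = smul f u + smul f w"
  by (intro ext) (simp add: smul_def distrib_left)

lemma smul_scale: "smul f (scale_form a u) = scale_form a (smul f u)"
  by (intro ext) (simp add: smul_def scale_form_def mult.left_commute)

lemma sum_form_apply: "(\<Sum>i\<in>S. f i) c z v = (\<Sum>i\<in>S. f i c z v)" for f :: "_ \<Rightarrow> ('a, 'n::finite) form"
  by (induction S rule: infinite_finite_induct) simp_all

lemma smul_sum: "smul (\<Sum>i\<in>S. f i) u = (\<Sum>i\<in>S. smul (f i) u)"
  by (intro ext) (simp add: smul_def sum_form_apply sum_distrib_right)

section \<open>The integral over a compact manifold\<close>

context compact_mfd
begin

text \<open>An axiomatic description. Everything after the construction argues from these five
  properties, so the partition of unity behind the integral never reappears.\<close>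

definition is_integral :: "(('a, 'n) form \<Rightarrow> complex) \<Rightarrow> bool" where
  "is_integral F \<longleftrightarrow>
     (\<forall>u\<in>forms A (2 * CARD('n)). \<forall>w\<in>forms A (2 * CARD('n)). F (u + w) = F u + F w) \<and>
     (\<forall>a. \<forall>u\<in>forms A (2 * CARD('n)). F (scale_form a u) = a * F u) \<and>
     (\<forall>c. \<forall>u\<in>forms A (2 * CARD('n)). csupp c u \<longrightarrow> F u = (LINT z|lborel. u c z std)) \<and>
     (\<forall>k. \<forall>\<eta>\<in>forms A k. Suc k = 2 * CARD('n) \<longrightarrow> F (ext_d k \<eta>) = 0) \<and>
     (\<forall>u\<in>forms A (2 * CARD('n)). (\<forall>c\<in>A. \<forall>z\<in>chart_image c. \<exists>t\<ge>0. u c z std = complex_of_real t) \<longrightarrow> F u = 0 \<longrightarrow> u = 0)"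

definition pou :: "('a \<Rightarrow> 'a set) \<Rightarrow> 'a set \<Rightarrow> ('a \<Rightarrow> ('a, 'n) chart) \<Rightarrow> ('a \<Rightarrow> complex ^ 'n) \<Rightarrow> ('a \<Rightarrow> real) \<Rightarrow>
    ('a \<Rightarrow> ('a, 'n) form) \<Rightarrow> bool" where
  "pou U I c p r \<rho> \<longleftrightarrow> finite I \<and> I \<subseteq> topspace X \<and>
    (\<forall>i\<in>I. fits (c i) (p i) (r i) \<and> cinv (c i) ` ocube (p i) (4 * r i) \<subseteq> U i \<and> \<rho> i \<in> forms A 0 \<and> nnf (\<rho> i) \<and>
      supported (cinv (c i) ` ccube (p i) (r i)) (\<rho> i)) \<and> (\<Sum>i\<in>I. \<rho> i) = unit_form A"

lemma pou_exists:
  assumes U: "\<And>x. x \<in> topspace X \<Longrightarrow> openin X (U x) \<and> x \<in> U x"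
  shows "\<exists>I c p r \<rho>. pou U I c p r \<rho>"
proof -
  have sup: "(\<forall>c\<in>A. \<forall>z\<in>chart_image c. \<forall>v. cinv c z \<notin> K \<longrightarrow> u c z v = 0) \<longleftrightarrow> supported K u" for K u
    by (auto simp: supported_def)
  show ?thesis unfolding pou_def by (rule partition_of_unity[of U, unfolded sup]) (rule U)
qed

lemma pouD:
  assumes "pou U I c p r \<rho>"
  shows "finite I" "I \<subseteq> topspace X" "\<And>i. i \<in> I \<Longrightarrow> fits (c i) (p i) (r i)"
    "\<And>i. i \<in> I \<Longrightarrow> cinv (c i) ` ocube (p i) (4 * r i) \<subseteq> U i"
    "\<And>i. i \<in> I \<Longrightarrow> \<rho> i \<in> forms A 0" "\<And>i. i \<in> I \<Longrightarrow> nnf (\<rho> i)"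
    "\<And>i. i \<in> I \<Longrightarrow> supported (cinv (c i) ` ccube (p i) (r i)) (\<rho> i)" "(\<Sum>i\<in>I. \<rho> i) = unit_form A"
  using assms by (simp_all add: pou_def)

text \<open>A partition of unity reduces each property to one chart:
  \<open>csupp_change_chart\<close> makes the value on a form supported in a chart independent of
  the partition, and Stokes holds for each product \<open>smul (\<rho> i) \<eta>\<close>
  separately.\<close>

theorem integral_exists: "\<exists>F. is_integral F"
proof -
  let ?m = "2 * CARD('n)"
  obtain I c p r \<rho> where P: "pou (\<lambda>x. topspace X) I c p r \<rho>"
    using pou_exists[of "\<lambda>x. topspace X"] by auto
  note fin = pouD(1)[OF P] and f = pouD(3)[OF P] and \<rho> = pouD(5-7)[OF P] and one = pouD(8)[OF P]
  define F where "F u = (\<Sum>i\<in>I. LINT z|lborel. smul (\<rho> i) u (c i) z std)" for u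
  have fo: "smul (\<rho> i) u \<in> forms A k" if "i \<in> I" "u \<in> forms A k" for i u k
    by (rule forms_smul[OF \<rho>(1)[OF that(1)] that(2)])
  have cs: "csupp (c i) (smul (\<rho> i) u)" if "i \<in> I" for i u
    by (rule csuppI[OF fitsD(1)[OF f[OF that]] compact_ccube fitsD(3)[OF f[OF that]]]) (rule supported_smul_left[OF \<rho>(3)[OF that]])
  have int: "integrable lborel (\<lambda>z. smul (\<rho> i) u (c i) z v)" if "i \<in> I" "u \<in> forms A k" for i u k v
    by (rule csupp_integrable[OF fo[OF that] cs[OF that(1)]])
  have sp: "u = (\<Sum>i\<in>I. smul (\<rho> i) u)" if "u \<in> forms A k" for u k
    using smul_unit[OF that] by (simp add: one flip: smul_sum)
  have add: "F (u + w) = F u + F w" if "u \<in> forms A ?m" "w \<in> forms A ?m" for u w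
    unfolding F_def smul_add using int[OF _ that(1)] int[OF _ that(2)] by (simp add: sum.distrib)
  have scale: "F (scale_form a u) = a * F u" for a u
    unfolding F_def smul_scale by (simp add: scale_form_def sum_distrib_left)
  have loc: "F u = (LINT z|lborel. u b z std)" if u: "u \<in> forms A ?m" and b: "csupp b u" for u b
  proof -
    have csb: "csupp b (smul (\<rho> i) u)" for i by (rule csupp_cong[OF b supported_smul_right])
    have "F u = (\<Sum>i\<in>I. LINT z|lborel. smul (\<rho> i) u b z std)"
      unfolding F_def by (intro sum.cong refl csupp_change_chart fo u cs csb)
    also have "\<dots> = (LINT z|lborel. (\<Sum>i\<in>I. smul (\<rho> i) u) b z std)"
      unfolding sum_form_apply by (rule Bochner_Integration.integral_sum[symmetric]) (rule csupp_integrable[OF fo[OF _ u] csb])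
    finally show ?thesis using sp[OF u] by simp
  qed
  have stokes: "F (ext_d k \<eta>) = 0" if \<eta>: "\<eta> \<in> forms A k" and k: "Suc k = ?m" for k \<eta>
  proof -
    have d: "ext_d k (smul (\<rho> i) \<eta>) \<in> forms A ?m" if "i \<in> I" for i
      using forms_ext_d[OF fo[OF that \<eta>]] k by simp
    have "F (ext_d k (smul (\<rho> i) \<eta>)) = 0" if "i \<in> I" for i
      using loc[OF d[OF that] csupp_cong[OF cs[OF that] supported_ext_d]] csupp_stokes[OF fo[OF that \<eta>] cs[OF that]] by simp
    moreover have "J \<subseteq> I \<Longrightarrow> F (\<Sum>i\<in>J. ext_d k (smul (\<rho> i) \<eta>)) = (\<Sum>i\<in>J. F (ext_d k (smul (\<rho> i) \<eta>)))" for J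
    proof (induction J rule: infinite_finite_induct)
      case (insert j J)
      have "(\<Sum>i\<in>J. ext_d k (smul (\<rho> i) \<eta>)) \<in> forms A ?m" by (rule forms_sum, rule d) (use insert in blast)
      moreover have "j \<in> I" "J \<subseteq> I" using insert.prems by auto
      ultimately have "F (ext_d k (smul (\<rho> j) \<eta>) + (\<Sum>i\<in>J. ext_d k (smul (\<rho> i) \<eta>))) =
          F (ext_d k (smul (\<rho> j) \<eta>)) + (\<Sum>i\<in>J. F (ext_d k (smul (\<rho> i) \<eta>)))"
        using add[OF d] insert.IH by simp
      then show ?case unfolding sum.insert[OF insert.hyps] .
    qed (use scale[of 0 0] in \<open>simp_all add: scale_form_zero\<close>)
    ultimately have "F (\<Sum>i\<in>I. ext_d k (smul (\<rho> i) \<eta>)) = 0" by simp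
    then show ?thesis using ext_d_sum[of I "\<lambda>i. smul (\<rho> i) \<eta>" k] fo[OF _ \<eta>] sp[OF \<eta>] by simp
  qed
  \<comment> \<open>A nonnegative form is cut into nonnegative continuous pieces whose integrals add
    up to 0, so each integral and hence each piece is 0.\<close>
  have pos: "u = 0" if u: "u \<in> forms A ?m" and nn: "\<And>c z. c \<in> A \<Longrightarrow> z \<in> chart_image c \<Longrightarrow> \<exists>t\<ge>0. u c z std = complex_of_real t"
    and z: "F u = 0" for u
  proof -
    have re: "Re (smul (\<rho> i) u (c i) z std) \<ge> 0 \<and> Im (smul (\<rho> i) u (c i) z std) = 0" if i: "i \<in> I" for i z
    proof (cases "z \<in> chart_image (c i)")
      case True
      obtain t where "t \<ge> 0" "u (c i) z std = complex_of_real t" using nn[OF fitsD(1)[OF f[OF i]] True] by blast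
      moreover obtain s where "s \<ge> 0" "\<rho> i (c i) z std = complex_of_real s" using \<rho>(2)[OF i] unfolding nnf_def by blast
      ultimately show ?thesis by (simp add: smul_def)
    qed (simp add: forms_outside[OF fo[OF that u]])
    let ?R = "\<lambda>i z. Re (smul (\<rho> i) u (c i) z std)"
    have nnR: "(LINT z|lborel. ?R i z) \<ge> 0" if "i \<in> I" for i
      using re[OF that] by (simp add: integral_nonneg_AE)
    have "(\<Sum>i\<in>I. LINT z|lborel. ?R i z) = Re (F u)"
      unfolding F_def by (simp add: int[OF _ u] integral_Re)
    then have "(LINT z|lborel. ?R i z) = 0" if "i \<in> I" for i
      using sum_nonneg_eq_0_iff[OF fin nnR] that z by simp
    then have "?R i z = 0" if i: "i \<in> I" for i z
    proof -
      obtain K where K: "compact K" "\<And>z v. z \<notin> K \<Longrightarrow> smul (\<rho> i) u (c i) z v = 0"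
        using csupp_sform(2)[OF fo[OF i u] cs[OF i]] by blast
      show ?thesis
      proof (rule integral_nonneg_zero_imp[where f = "?R i", OF _ _ K(1) _ \<open>\<And>i. i \<in> I \<Longrightarrow> (LINT z|lborel. ?R i z) = 0\<close>[OF i]])
        show "continuous_on UNIV (?R i)"
          by (rule continuous_on_Re[OF smooth_on_continuous[OF sform_smooth[OF csupp_sform(1)[OF fo[OF i u] cs[OF i]]]]])
        show "0 \<le> ?R i x" for x using re[OF i] by blast
        show "?R i x = 0" if "x \<notin> K" for x using K(2)[OF that] by simp
      qed
    qed
    then have std0: "smul (\<rho> i) u (c i) z std = 0" if "i \<in> I" for i z
      using re[OF that] that by (simp add: complex_eq_iff)
    have loc0: "smul (\<rho> i) u (c i) z v = 0" if i: "i \<in> I" for i z v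
    proof (cases "z \<in> chart_image (c i)")
      case True
      show ?thesis using top_form_rd[OF forms_alternating[OF fo[OF i u] fitsD(1)[OF f[OF i]] True]] std0[OF i] by simp
    qed (simp add: forms_outside[OF fo[OF that u]])
    have "smul (\<rho> i) u = 0" if i: "i \<in> I" for i
    proof (rule forms_ext[OF fo[OF i u] forms_zero])
      fix b z v assume b: "b \<in> A" "z \<in> chart_image b"
      show "smul (\<rho> i) u b z v = 0 b z v"
      proof (cases "z \<in> ovl b (c i)")
        case True
        show ?thesis using forms_pbk[OF fo[OF i u] b(1) fitsD(1)[OF f[OF i]] True] loc0[OF i] by (simp add: pbk_def)
      next
        case False
        then have "cinv b z \<notin> fst (c i)" using ovl_iff[OF b(1)] b(2) by simp
        moreover have "cinv (c i) ` ccube (p i) (r i) \<subseteq> fst (c i)"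
          using fitsD(3)[OF f[OF i]] cinv_image[OF fitsD(1)[OF f[OF i]]] by auto
        ultimately have "\<rho> i b z v = 0" using supportedD[OF \<rho>(3)[OF i] b] by blast
        then show ?thesis by (simp add: smul_def)
      qed
    qed
    then show "u = 0" using sp[OF u] by simp
  qed
  have "is_integral F" unfolding is_integral_def
    using add scale loc stokes pos by auto
  then show ?thesis by (rule exI[of is_integral F])
qed

definition integ :: "('a, 'n) form \<Rightarrow> complex" where
  "integ = (SOME F. is_integral F)"

lemma is_integral_integ: "is_integral integ"
  unfolding integ_def by (rule someI_ex[OF integral_exists])

lemma integ_add: "u \<in> forms A (2 * CARD('n)) \<Longrightarrow> w \<in> forms A (2 * CARD('n)) \<Longrightarrow> integ (u + w) = integ u + integ w"
  by (rule is_integral_integ[unfolded is_integral_def, THEN conjunct1, rule_format])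

lemma integ_scale: "u \<in> forms A (2 * CARD('n)) \<Longrightarrow> integ (scale_form a u) = a * integ u"
  by (rule is_integral_integ[unfolded is_integral_def, THEN conjunct2, THEN conjunct1, rule_format])

lemma integ_local: "u \<in> forms A (2 * CARD('n)) \<Longrightarrow> csupp c u \<Longrightarrow> integ u = (LINT z|lborel. u c z std)"
  by (rule is_integral_integ[unfolded is_integral_def, THEN conjunct2, THEN conjunct2, THEN conjunct1, rule_format])

lemma integ_ext_d: "\<eta> \<in> forms A k \<Longrightarrow> Suc k = 2 * CARD('n) \<Longrightarrow> integ (ext_d k \<eta>) = 0"
  by (rule is_integral_integ[unfolded is_integral_def, THEN conjunct2, THEN conjunct2, THEN conjunct2, THEN conjunct1, rule_format])

lemma integ_pos: "u \<in> forms A (2 * CARD('n)) \<Longrightarrow>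
    (\<And>c z. c \<in> A \<Longrightarrow> z \<in> chart_image c \<Longrightarrow> \<exists>t\<ge>0. u c z std = complex_of_real t) \<Longrightarrow> integ u = 0 \<Longrightarrow> u = 0"
  using is_integral_integ[unfolded is_integral_def, THEN conjunct2, THEN conjunct2, THEN conjunct2, THEN conjunct2, rule_format, of u] by simp

lemma integ_zero: "integ 0 = 0"
  using integ_scale[OF forms_zero, of 0] by (simp add: scale_form_zero)

lemma integ_sum: "(\<And>i. i \<in> S \<Longrightarrow> u i \<in> forms A (2 * CARD('n))) \<Longrightarrow> integ (\<Sum>i\<in>S. u i) = (\<Sum>i\<in>S. integ (u i))"
proof (induction S rule: infinite_finite_induct)
  case (insert i S)
  have "integ (u i + sum u S) = integ (u i) + integ (sum u S)" by (rule integ_add[OF _ forms_sum]) (use insert in blast)+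
  then show ?case using insert by (simp only: sum.insert[OF insert.hyps] insertI2)
qed (simp_all add: integ_zero)

end

section \<open>Detecting exactness by finitely many test forms\<close>

lemma alternating_above_top:
  assumes "alternating k (f :: 'n::finite altform)" "2 * CARD('n) < k"
  shows "f v = 0"
proof (rule alternating_zero_on_basis[OF assms(1)])
  fix v :: "nat \<Rightarrow> complex ^ 'n" assume v: "inj_on v {..<k}" "v ` {..<k} \<subseteq> Basis"
  have "card (v ` {..<k}) \<le> DIM(complex ^ 'n)" by (rule card_mono[OF finite_Basis v(2)])
  then show "f v = 0" using card_image[OF v(1)] assms(2) by simp
qed

lemma wedge_sum_right: "wedge p q u (\<Sum>i\<in>S. w i) = (\<Sum>i\<in>S. wedge p q u (w i))"
proof (induction S rule: infinite_finite_induct)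
  case (insert i S)
  then show ?case unfolding sum.insert[OF insert.hyps] by (simp only: wedge_add_right)
qed (simp_all only: sum.infinite sum.empty wedge_zero_right not_False_eq_True)

context complex_mfd
begin

lemma supported_Int: "supported K u \<Longrightarrow> supported L u \<Longrightarrow> supported (K \<inter> L) u"
  unfolding supported_def by blast

lemma forms_eq_local:
  assumes u: "u \<in> forms A k" "w \<in> forms A k" and c: "c \<in> A" and K: "K \<subseteq> chart_image c"
    and s: "supported (cinv c ` K) u" "supported (cinv c ` K) w"
    and eq: "\<And>z v. z \<in> chart_image c \<Longrightarrow> u c z v = w c z v"
  shows "u = w"
proof (rule forms_ext[OF u])
  fix b z v assume b: "b \<in> A" "z \<in> chart_image b"
  show "u b z v = w b z v"
  proof (cases "z \<in> ovl b c")
    case True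
    have "transition b c z \<in> chart_image c" using transition_ovl[OF b(1) c True] ovl_subset by blast
    then show ?thesis using forms_pbk[OF u(1) b(1) c True] forms_pbk[OF u(2) b(1) c True] eq by (simp add: pbk_def)
  next
    case False
    then have "cinv b z \<notin> fst c" using ovl_iff[OF b(1)] b(2) by simp
    moreover have "cinv c ` K \<subseteq> fst c" using K cinv_image[OF c] by auto
    ultimately have "cinv b z \<notin> cinv c ` K" by (rule contra_subsetD[rotated])
    then show ?thesis using supportedD[OF s(1) b] supportedD[OF s(2) b] by simp
  qed
qed

lemma forms_above_top: "u \<in> forms A k \<Longrightarrow> 2 * CARD('n) < k \<Longrightarrow> u = 0"
  by (rule forms_ext[OF _ forms_zero]) (auto simp: alternating_above_top[OF forms_alternating])

lemma ext_d_unit: "ext_d 0 (unit_form A) = 0"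
proof (intro ext)
  fix c z v
  show "ext_d 0 (unit_form A) c z v = 0 c z v"
  proof (cases "c \<in> A \<and> z \<in> chart_image c")
    case True
    then have "frechet_derivative (\<lambda>y. unit_form A c y (\<lambda>j. v (Suc j))) (at z) = frechet_derivative (\<lambda>y. 1) (at z)"
      using open_image by (intro frechet_derivative_cong[of "chart_image c"]) (auto simp: unit_form_def)
    then show ?thesis using True by (simp add: ext_d_dloc dloc_def frechet_derivative_const)
  next
    case False
    then have "unit_form A c = (\<lambda>z v. 0)" if "z \<in> chart_image c" using that by (auto simp: unit_form_def)
    then show ?thesis by (cases "z \<in> chart_image c") (simp_all add: ext_d_outside ext_d_dloc dloc_zero)
  qed
qed

end

context compact_mfd
begin

text \<open>The primitive found on the coordinate space is supported in the same cube and therefore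
  extends by zero to X. In the top degree all components are multiples of the one on
  \<open>std\<close>, so the vanishing of one integral covers them all.\<close>

lemma poincare_form:
  assumes u: "u \<in> forms A (Suc k)" and cl: "ext_d (Suc k) u = 0"
    and c: "c \<in> A" and s: "s > 0" and sub: "ccube p s \<subseteq> chart_image c" and su: "supported (cinv c ` ccube p s) u"
    and top: "Suc k < 2 * CARD('n) \<or> Suc k = 2 * CARD('n) \<and> integ u = 0"
  shows "\<exists>\<eta>\<in>forms A k. supported (cinv c ` ccube p s) \<eta> \<and> u = ext_d k \<eta>"
proof -
  obtain E e :: "real \<Rightarrow> real" where E: "smooth_on UNIV E" "smooth_on UNIV e" "\<And>t. (E has_field_derivative e t) (at t)"
    "\<And>t. e t \<ge> 0" "e 0 > 0" "\<And>t. \<bar>t\<bar> \<ge> s \<Longrightarrow> e t = 0" "\<And>t. t \<le> -s \<Longrightarrow> E t = 0" "\<And>t. t \<ge> s \<Longrightarrow> E t = 1"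
    using smooth_step_exists[OF s] by blast
  \<comment> \<open>The outer cube of half-width s + 1 may leave the chart. This does no harm:
    \<open>u c\<close> is 0 outside the chart and is treated as a form on the whole coordinate
    space.\<close>
  interpret cube p s "s + 1" E e by unfold_locales (use E s in auto)
  have Q: "Q = ccube p s" by (simp add: Q_def ccube_def)
  have cs: "csupp c u" by (rule csuppI[OF c compact_ccube sub su])
  have z: "u c z v = 0" if "z \<notin> ccube p s" for z v by (rule supported_local[OF u su c sub that])
  have cf: "cform (Suc k) (u c)"
    unfolding cform_def Q using csupp_sform(1)[OF u cs] z by auto
  have dz: "dloc (Suc k) (u c) z v = 0" for z v
    using csupp_dloc[OF u cs, of z v] cl by simp
  have tp: "Suc k < DIM(complex ^ 'n) \<or> (\<forall>v. (LINT z|lborel. u c z v) = 0)"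
  proof (cases "Suc k < 2 * CARD('n)")
    case True
    then show ?thesis by simp
  next
    case False
    then have t: "Suc k = 2 * CARD('n) \<and> integ u = 0" using top by blast
    have e: "(\<lambda>z. u c z v) = (\<lambda>z. of_real (rd v) * u c z std)" for v
      by (rule ext, rule top_form_rd) (rule sform_alternating[OF csupp_sform(1)[OF u cs] UNIV_I, unfolded t[THEN conjunct1]])
    have "integ u = (LINT z|lborel. u c z std)" using u cs unfolding t[THEN conjunct1] by (rule integ_local)
    then have "(LINT z|lborel. u c z std) = 0" using t by simp
    then have "(LINT z|lborel. u c z v) = 0" for v unfolding e[of v] by simp
    then show ?thesis by blast
  qed
  obtain \<eta> where \<eta>: "cform k \<eta>" "\<And>z v. u c z v = dloc k \<eta> z v" using poincare_cpt[OF cf dz tp] by blast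
  have \<eta>z: "\<eta> z v = 0" if "z \<notin> ccube p s" for z v by (rule cform_zero[OF \<eta>(1)]) (simp add: Q that)
  have f: "ext0 c \<eta> \<in> forms A k"
    by (rule forms_ext0[OF c sform_subset[OF cform_sform[OF \<eta>(1)] subset_UNIV] compact_ccube sub \<eta>z])
  have sup: "supported (cinv c ` ccube p s) (ext0 c \<eta>)"
    unfolding supported_def using ext0_support[OF c \<eta>z] by simp
  have "u = ext_d k (ext0 c \<eta>)"
  proof (rule forms_eq_local[OF u forms_ext_d[OF f] c sub su supported_ext_d[OF closedin_chart[OF c compact_ccube sub] sup]])
    fix z v assume z: "z \<in> chart_image c"
    have "dloc k (ext0 c \<eta> c) z v = dloc k \<eta> z v"
      by (rule dloc_cong[OF open_image[OF c] z]) (rule ext, rule ext0_self[OF c])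
    then show "u c z v = ext_d k (ext0 c \<eta>) c z v" using \<eta>(2) z by (simp add: ext_d_dloc)
  qed
  then show ?thesis using f sup by blast
qed

end

lemma smul_minus: "smul f (- u) = - smul f u"
  by (intro ext) (simp add: smul_def)

lemma smul_zero: "smul f 0 = 0"
  by (intro ext) (simp add: smul_def)

lemma smul_sum_right: "smul f (\<Sum>i\<in>S. u i) = (\<Sum>i\<in>S. smul f (u i))"
  by (intro ext) (simp add: smul_def sum_form_apply sum_distrib_left)

context complex_mfd
begin

lemma smul_wedge_right:
  assumes "f \<in> forms A 0" "u \<in> forms A k"
  shows "smul f u = wedge k 0 u f"
proof (intro ext)
  fix c z v
  show "smul f u c z v = wedge k 0 u f c z v"
  proof (cases "c \<in> A \<and> z \<in> chart_image c")
    case True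
    then show ?thesis
      using alt_wedge_0_right[OF forms_alternating[OF assms(2)] forms_alternating[OF assms(1)]] by (simp add: smul_def wedge_def)
  next
    case False
    then have "f c z = (\<lambda>v. 0)" using forms_outside[OF assms(1)] by blast
    then show ?thesis by (simp add: smul_def wedge_def alt_wedge_zero_right)
  qed
qed

lemma ext_d_smul_closed:
  assumes f: "f \<in> forms A 0" and u: "u \<in> closed_forms A k"
  shows "ext_d k (smul f u) = scale_form ((- 1) ^ k) (wedge k 1 u (ext_d 0 f))"
  using ext_d_wedge[OF closed_forms_forms[OF u] f] closed_forms_d[OF u] wedge_zero_left[of "Suc k" 0 f]
  unfolding smul_wedge_right[OF f closed_forms_forms[OF u]] by simp

end

context compact_mfd
begin

text \<open>The \<rho> b add up to 1, so their differentials add up to 0: the first terms give d of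
  \<rho> a and the second ones vanish. Multiplying by the \<phi> k, which also add up to 1, changes
  nothing.\<close>

lemma pou_sum_exchange:
  assumes P: "pou U I c p r \<rho>" and Q: "pou V J d q s \<phi>" and a: "a \<in> I"
  shows "(\<Sum>k\<in>J. \<Sum>b\<in>I. smul (\<phi> k) (smul (\<rho> b) (ext_d 0 (\<rho> a)) - smul (\<rho> a) (ext_d 0 (\<rho> b)))) = ext_d 0 (\<rho> a)"
proof -
  have d: "ext_d 0 (\<rho> a) \<in> forms A 1" using forms_ext_d[OF pouD(5)[OF P a]] by simp
  have "(\<Sum>b\<in>I. smul (\<rho> b) (ext_d 0 (\<rho> a)) - smul (\<rho> a) (ext_d 0 (\<rho> b))) =
      smul (\<Sum>b\<in>I. \<rho> b) (ext_d 0 (\<rho> a)) - smul (\<rho> a) (\<Sum>b\<in>I. ext_d 0 (\<rho> b))"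
    by (simp only: sum_subtractf smul_sum smul_sum_right)
  also have "(\<Sum>b\<in>I. ext_d 0 (\<rho> b)) = ext_d 0 (unit_form A)"
    using ext_d_sum[of I \<rho> 0] pouD(5)[OF P] pouD(8)[OF P] by simp
  also have "smul (\<Sum>b\<in>I. \<rho> b) (ext_d 0 (\<rho> a)) = ext_d 0 (\<rho> a)"
    unfolding pouD(8)[OF P] by (rule smul_unit[OF d])
  finally have "(\<Sum>b\<in>I. smul (\<rho> b) (ext_d 0 (\<rho> a)) - smul (\<rho> a) (ext_d 0 (\<rho> b))) = ext_d 0 (\<rho> a)"
    by (simp only: ext_d_unit smul_zero diff_zero)
  then have "(\<Sum>k\<in>J. \<Sum>b\<in>I. smul (\<phi> k) (smul (\<rho> b) (ext_d 0 (\<rho> a)) - smul (\<rho> a) (ext_d 0 (\<rho> b)))) =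
      smul (\<Sum>k\<in>J. \<phi> k) (ext_d 0 (\<rho> a))"
    by (simp only: smul_sum_right[symmetric] smul_sum)
  then show ?thesis unfolding pouD(8)[OF Q] smul_unit[OF d] .
qed

text \<open>The test forms are \<open>\<phi> k (\<rho> b d\<rho> a - \<rho> a d\<rho> b)\<close> for two partitions of unity. If all of them annihilate
  \<open>\<gamma>\<close>, their products with \<open>\<gamma>\<close> have primitives \<open>\<zeta> k a b\<close> in small cubes, antisymmetric in \<open>a\<close> and \<open>b\<close>.
  Then each \<open>\<rho> a \<gamma> + \<Sum>k b. \<zeta> k a b\<close> is closed with support in a cube, hence exact, and these forms add up
  to \<open>\<gamma>\<close>.\<close>

theorem exactness_test_forms:
  assumes l: "Suc (Suc l) = 2 * CARD('n)"
  shows "\<exists>(S :: ('a \<times> 'a \<times> 'a) set) \<xi>. finite S \<and> (\<forall>s\<in>S. \<xi> s \<in> forms A 1) \<and>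
    (\<forall>\<gamma>\<in>closed_forms A (Suc l). (\<forall>s\<in>S. integ (wedge (Suc l) 1 \<gamma> (\<xi> s)) = 0) \<longrightarrow> \<gamma> \<in> exact_forms A (Suc l))"
proof -
  obtain I c p r \<rho> where P: "pou (\<lambda>x. topspace X) I c p r \<rho>"
    using pou_exists[of "\<lambda>x. topspace X"] by auto
  define K W where "K a = cinv (c a) ` ccube (p a) (r a)" and "W a = cinv (c a) ` ocube (p a) (2 * r a)" for a
  note fin = pouD(1)[OF P] and f = pouD(3)[OF P] and \<rho> = pouD(5)[OF P] and one = pouD(8)[OF P]
  have sK: "supported (K a) (\<rho> a)" if "a \<in> I" for a using pouD(7)[OF P that] by (simp add: K_def)
  have clK: "closedin X (K a)" if "a \<in> I" for a
    unfolding K_def by (rule closedin_chart[OF fitsD(1)[OF f[OF that]] compact_ccube fitsD(3)[OF f[OF that]]])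
  have sub2: "ccube (p a) (2 * r a) \<subseteq> chart_image (c a)" if "a \<in> I" for a by (rule fitsD(4)[OF f[OF that]])
  have opW: "openin X (W a)" if "a \<in> I" for a
    unfolding W_def by (rule openin_cinv_image[OF fitsD(1)[OF f[OF that]] open_ocube]) (use sub2[OF that] cube_mono(4) in blast)
  have KW: "K a \<subseteq> W a" if "a \<in> I" for a
    unfolding K_def W_def using cube_mono(1)[of "r a" "2 * r a" "p a"] fitsD(2)[OF f[OF that]] by (intro image_mono) simp
  \<comment> \<open>The second partition is made so fine that each \<open>L k\<close> either lies in
    \<open>W a\<close> or misses \<open>K a\<close>, depending on whether its index point k lies in
    \<open>W a\<close>. In the second case the test form with indices k, a, b is 0.\<close>
  define U where "U x = (\<Inter>a\<in>I. (if x \<in> W a then W a else topspace X) \<inter> (if x \<in> K a then topspace X else topspace X - K a)) \<inter> topspace X" for x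
  have "openin X (U x) \<and> x \<in> U x" if "x \<in> topspace X" for x
  proof
    show "openin X (U x)" unfolding U_def
      by (intro openin_INT[OF fin] openin_Int) (simp_all add: opW openin_diff[OF openin_topspace clK])
    show "x \<in> U x" unfolding U_def using that by simp
  qed
  then obtain J d q s \<phi> where Q: "pou U J d q s \<phi>" using pou_exists[of U] by blast
  note fd = pouD(3)[OF Q]
  define L where "L k = cinv (d k) ` ccube (q k) (s k)" for k
  have LU: "L k \<subseteq> U k" if "k \<in> J" for k
    using pouD(4)[OF Q that] cube_mono(1)[of "s k" "4 * s k" "q k"] fitsD(2)[OF fd[OF that]] unfolding L_def by auto
  define \<xi> where "\<xi> k a b = smul (\<phi> k) (smul (\<rho> b) (ext_d 0 (\<rho> a)) - smul (\<rho> a) (ext_d 0 (\<rho> b)))" for k a b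
  have d1: "ext_d 0 (\<rho> a) \<in> forms A 1" if "a \<in> I" for a using forms_ext_d[OF \<rho>[OF that]] by simp
  have \<xi>f: "\<xi> k a b \<in> forms A 1" if "k \<in> J" "a \<in> I" "b \<in> I" for k a b
    unfolding \<xi>_def by (intro forms_smul[OF pouD(5)[OF Q that(1)]] forms_diff forms_smul \<rho> d1 that)
  have anti: "\<xi> k b a = - \<xi> k a b" for k a b
    unfolding \<xi>_def smul_minus[symmetric] by (simp only: minus_diff_eq)
  have \<xi>L: "supported (L k) (\<xi> k a b)" if "k \<in> J" for k a b
    unfolding \<xi>_def L_def by (rule supported_smul_left[OF pouD(7)[OF Q that]])
  have dich: "L k \<subseteq> W a \<or> \<xi> k a b = 0" if "k \<in> J" "a \<in> I" "b \<in> I" for k a b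
  proof (cases "k \<in> W a")
    case True
    have "U k \<subseteq> W a"
    proof
      fix x assume "x \<in> U k"
      then have "x \<in> (if k \<in> W a then W a else topspace X)" unfolding U_def using that(2) by blast
      then show "x \<in> W a" using True by simp
    qed
    then show ?thesis using LU[OF that(1)] by blast
  next
    case False
    then have "k \<notin> K a" using KW[OF that(2)] by blast
    have "x \<notin> K a" if x: "x \<in> U k" for x
    proof -
      have "x \<in> (if k \<in> K a then topspace X else topspace X - K a)" using x \<open>a \<in> I\<close> unfolding U_def by blast
      then show ?thesis using \<open>k \<notin> K a\<close> by simp
    qed
    then have "U k \<inter> K a = {}" by blast
    then have e: "L k \<inter> K a = {}" using LU[OF that(1)] by blast
    have "supported (K a) (\<xi> k a b)"
      unfolding \<xi>_def by (intro supported_smul_right supported_diff supported_smul_left[OF sK[OF that(2)]] supported_ext_d clK sK that(2))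
    then have "supported {} (\<xi> k a b)" using supported_Int[OF \<xi>L[OF that(1)], of "K a" a b] unfolding e by blast
    then have "\<xi> k a b = 0"
      by (intro forms_ext[OF \<xi>f[OF that] forms_zero]) (simp add: supported_def)
    then show ?thesis by blast
  qed
  have test: "\<gamma> \<in> exact_forms A (Suc l)" if \<gamma>: "\<gamma> \<in> closed_forms A (Suc l)"
    and t: "\<And>k a b. k \<in> J \<Longrightarrow> a \<in> I \<Longrightarrow> b \<in> I \<Longrightarrow> integ (wedge (Suc l) 1 \<gamma> (\<xi> k a b)) = 0" for \<gamma>
  proof -
    note \<gamma>f = closed_forms_forms[OF \<gamma>]
    define g where "g k a b = wedge (Suc l) 1 \<gamma> (\<xi> k a b)" for k a b
    have gf: "g k a b \<in> forms A (Suc (Suc l))" if "k \<in> J" "a \<in> I" "b \<in> I" for k a b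
      using forms_wedge[OF \<gamma>f \<xi>f[OF that]] by (simp add: g_def)
    have ex: "\<exists>\<eta>. \<eta> \<in> forms A (Suc l) \<and> supported (L k) \<eta> \<and> (\<xi> k a b = 0 \<longrightarrow> \<eta> = 0) \<and> g k a b = ext_d (Suc l) \<eta>"
      if kab: "k \<in> J" "a \<in> I" "b \<in> I" for k a b
    proof (cases "\<xi> k a b = 0")
      case True
      then have "g k a b = ext_d (Suc l) 0" unfolding g_def by (simp only: wedge_zero_right ext_d_zero)
      then show ?thesis using forms_zero supported_zero by blast
    next
      case False
      have "ext_d (Suc (Suc l)) (g k a b) = 0"
        by (rule forms_above_top[OF forms_ext_d[OF gf[OF kab]]]) (simp add: l)
      moreover have "supported (cinv (d k) ` ccube (q k) (s k)) (g k a b)"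
        using supported_wedge_right[OF \<xi>L[OF kab(1)]] by (simp only: g_def L_def)
      moreover have "integ (g k a b) = 0" using t[OF kab] by (simp only: g_def)
      ultimately have "\<exists>\<eta>\<in>forms A (Suc l). supported (L k) \<eta> \<and> g k a b = ext_d (Suc l) \<eta>"
        unfolding L_def using l fitsD[OF fd[OF kab(1)]] by (intro poincare_form[OF gf[OF kab]]) auto
      then show ?thesis using False by blast
    qed
    define \<eta> where "\<eta> k a b = (SOME \<eta>. \<eta> \<in> forms A (Suc l) \<and> supported (L k) \<eta> \<and> (\<xi> k a b = 0 \<longrightarrow> \<eta> = 0) \<and> g k a b = ext_d (Suc l) \<eta>)" for k a b
    have \<eta>: "\<eta> k a b \<in> forms A (Suc l)" "supported (L k) (\<eta> k a b)" "\<xi> k a b = 0 \<Longrightarrow> \<eta> k a b = 0" "g k a b = ext_d (Suc l) (\<eta> k a b)"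
      if "k \<in> J" "a \<in> I" "b \<in> I" for k a b
      using someI_ex[OF ex[OF that]] unfolding \<eta>_def[symmetric] by blast+
    \<comment> \<open>The chosen primitives need not be antisymmetric in a and b. Antisymmetrising
      keeps the equation because \<open>g\<close> is antisymmetric, and the condition that \<eta> is
      0 whenever \<xi> is 0 keeps the supports under control.\<close>
    define \<zeta> where "\<zeta> k a b = scale_form (1 / 2) (\<eta> k a b - \<eta> k b a)" for k a b
    have \<zeta>f: "\<zeta> k a b \<in> forms A (Suc l)" if "k \<in> J" "a \<in> I" "b \<in> I" for k a b
      unfolding \<zeta>_def by (intro forms_scale forms_diff \<eta>(1) that)
    have \<zeta>anti: "\<zeta> k b a = - \<zeta> k a b" for k a b
      unfolding \<zeta>_def scale_form_def by (intro ext) (simp add: field_simps)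
    have \<zeta>d: "ext_d (Suc l) (\<zeta> k a b) = g k a b" if "k \<in> J" "a \<in> I" "b \<in> I" for k a b
    proof -
      have "g k b a = - g k a b"
        unfolding g_def anti[of k b a] using wedge_scale_right[of "Suc l" 1 \<gamma> "- 1" "\<xi> k a b"] by (simp only: scale_form_minus_1)
      moreover have "ext_d (Suc l) (\<zeta> k a b) = scale_form (1 / 2) (g k a b - g k b a)"
        unfolding \<zeta>_def \<eta>(4)[OF that] \<eta>(4)[OF that(1,3,2)]
        by (simp only: ext_d_scale[OF forms_diff[OF \<eta>(1)[OF that] \<eta>(1)[OF that(1,3,2)]]] ext_d_diff[OF \<eta>(1)[OF that] \<eta>(1)[OF that(1,3,2)]])
      ultimately show ?thesis by (simp add: scale_form_def fun_eq_iff)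
    qed
    have \<zeta>s: "supported (cinv (c a) ` ccube (p a) (2 * r a)) (\<zeta> k a b)" if "k \<in> J" "a \<in> I" "b \<in> I" for k a b
    proof (cases "\<xi> k a b = 0")
      case True
      then have "\<xi> k b a = 0" using anti[of k b a] by simp
      then have "\<zeta> k a b = 0" unfolding \<zeta>_def \<eta>(3)[OF that True] \<eta>(3)[OF that(1,3,2) \<open>\<xi> k b a = 0\<close>] by (simp add: scale_form_zero)
      then show ?thesis using supported_zero by simp
    next
      case False
      then have "L k \<subseteq> cinv (c a) ` ccube (p a) (2 * r a)"
        using dich[OF that] cube_mono(4)[of "p a" "2 * r a"] unfolding W_def by blast
      then show ?thesis unfolding \<zeta>_def
        by (intro supported_scale supported_diff supported_mono[OF \<eta>(2)] that)
    qed
    define D where "D a = smul (\<rho> a) \<gamma> + (\<Sum>k\<in>J. \<Sum>b\<in>I. \<zeta> k a b)" for a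
    have Df: "D a \<in> forms A (Suc l)" and Dex: "\<exists>\<epsilon>\<in>forms A l. D a = ext_d l \<epsilon>" if a: "a \<in> I" for a
    proof -
      have S: "(\<Sum>b\<in>I. \<zeta> k a b) \<in> forms A (Suc l)" if "k \<in> J" for k by (intro forms_sum \<zeta>f that a)
      have SS: "(\<Sum>k\<in>J. \<Sum>b\<in>I. \<zeta> k a b) \<in> forms A (Suc l)" by (intro forms_sum S)
      show Df: "D a \<in> forms A (Suc l)" unfolding D_def by (intro forms_add forms_smul \<rho>[OF a] \<gamma>f SS)
      \<comment> \<open>The odd degree gives the sign -1 by which d of the product with \<rho> a
        cancels the sum of the \<open>g k a b\<close>.\<close>
      have "odd (Suc l)" using l by (metis even_Suc even_mult_iff even_numeral)
      then have "ext_d (Suc l) (smul (\<rho> a) \<gamma>) = - wedge (Suc l) 1 \<gamma> (ext_d 0 (\<rho> a))"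
        using ext_d_smul_closed[OF \<rho>[OF a] \<gamma>] scale_form_minus_1 by simp
      moreover have "ext_d (Suc l) (\<Sum>k\<in>J. \<Sum>b\<in>I. \<zeta> k a b) = (\<Sum>k\<in>J. \<Sum>b\<in>I. g k a b)"
        using S a by (simp only: ext_d_sum[OF S] ext_d_sum[OF \<zeta>f[OF _ a]] \<zeta>d cong: sum.cong)
      moreover have "(\<Sum>k\<in>J. \<Sum>b\<in>I. g k a b) = wedge (Suc l) 1 \<gamma> (ext_d 0 (\<rho> a))"
        unfolding g_def wedge_sum_right[symmetric] \<xi>_def pou_sum_exchange[OF P Q a] ..
      ultimately have cl: "ext_d (Suc l) (D a) = 0"
        unfolding D_def ext_d_add[OF forms_smul[OF \<rho>[OF a] \<gamma>f] SS] by simp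
      have sup: "supported (cinv (c a) ` ccube (p a) (2 * r a)) (D a)"
        unfolding D_def
      proof (intro supported_add supported_sum \<zeta>s a)
        have "K a \<subseteq> cinv (c a) ` ccube (p a) (2 * r a)" using KW[OF a] cube_mono(4)[of "p a" "2 * r a"] unfolding W_def by blast
        then show "supported (cinv (c a) ` ccube (p a) (2 * r a)) (smul (\<rho> a) \<gamma>)"
          by (rule supported_mono[OF supported_smul_left[OF sK[OF a]]])
      qed
      show "\<exists>\<epsilon>\<in>forms A l. D a = ext_d l \<epsilon>"
        using poincare_form[OF Df cl fitsD(1)[OF f[OF a]] _ sub2[OF a] sup] fitsD(2)[OF f[OF a]] l by auto
    qed
    have "(\<Sum>a\<in>I. \<Sum>k\<in>J. \<Sum>b\<in>I. \<zeta> k a b) = - (\<Sum>a\<in>I. \<Sum>k\<in>J. \<Sum>b\<in>I. \<zeta> k a b)"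
    proof -
      have "(\<Sum>a\<in>I. \<Sum>k\<in>J. \<Sum>b\<in>I. \<zeta> k a b) = (\<Sum>k\<in>J. \<Sum>a\<in>I. \<Sum>b\<in>I. \<zeta> k a b)" by (rule sum.swap)
      also have "\<dots> = (\<Sum>k\<in>J. \<Sum>b\<in>I. \<Sum>a\<in>I. \<zeta> k a b)" by (intro sum.cong refl sum.swap)
      also have "\<dots> = (\<Sum>k\<in>J. \<Sum>b\<in>I. \<Sum>a\<in>I. - \<zeta> k b a)" by (intro sum.cong refl \<zeta>anti)
      also have "\<dots> = - (\<Sum>k\<in>J. \<Sum>b\<in>I. \<Sum>a\<in>I. \<zeta> k b a)" by (simp only: sum_negf)
      also have "(\<Sum>k\<in>J. \<Sum>b\<in>I. \<Sum>a\<in>I. \<zeta> k b a) = (\<Sum>a\<in>I. \<Sum>k\<in>J. \<Sum>b\<in>I. \<zeta> k a b)" by (rule sum.swap)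
      finally show ?thesis .
    qed
    then have z: "(\<Sum>a\<in>I. \<Sum>k\<in>J. \<Sum>b\<in>I. \<zeta> k a b) = 0"
      by (simp add: fun_eq_iff)
    have "\<gamma> = (\<Sum>a\<in>I. D a)"
      unfolding D_def sum.distrib z by (simp only: smul_sum[symmetric] one smul_unit[OF \<gamma>f] add_0_right)
    moreover obtain \<epsilon> where \<epsilon>: "\<And>a. a \<in> I \<Longrightarrow> \<epsilon> a \<in> forms A l \<and> D a = ext_d l (\<epsilon> a)" using Dex by metis
    ultimately have "\<gamma> = ext_d l (\<Sum>a\<in>I. \<epsilon> a)" using ext_d_sum[of I \<epsilon> l] by simp
    moreover have "(\<Sum>a\<in>I. \<epsilon> a) \<in> forms A l" using \<epsilon> by (intro forms_sum) blast
    ultimately show ?thesis unfolding exact_iff by blast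
  qed
  show ?thesis
  proof (rule exI[of _ "J \<times> I \<times> I"], rule exI[of _ "\<lambda>(k, a, b). \<xi> k a b"], intro conjI ballI impI)
    show "finite (J \<times> I \<times> I)" using fin pouD(1)[OF Q] by simp
    show "(case s of (k, a, b) \<Rightarrow> \<xi> k a b) \<in> forms A 1" if "s \<in> J \<times> I \<times> I" for s using that \<xi>f by auto
    fix \<gamma> assume g: "\<gamma> \<in> closed_forms A (Suc l)" and t: "\<forall>s\<in>J \<times> I \<times> I. integ (wedge (Suc l) 1 \<gamma> (case s of (k, a, b) \<Rightarrow> \<xi> k a b)) = 0"
    show "\<gamma> \<in> exact_forms A (Suc l)"
      by (rule test[OF g]) (use t in fastforce)
  qed
qed

end

text \<open>D ^ i_x w and i_y D ^ w exceed the top degree and vanish. Contracting the first with y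
  and the second with x moves both vectors from D over to w.\<close>

lemma alt_wedge_contr_duality:
  assumes l: "Suc (Suc l) = 2 * CARD('n)" and D: "alternating (Suc (Suc l)) (D :: 'n::finite altform)" and w: "alternating 2 w"
  shows "alt_wedge l 2 (contr x (contr y D)) w v = - (D v * w (x ## y ## v))"
proof -
  have w': "alternating (Suc 1) w" using w by (simp add: numeral_2_eq_2)
  have wx: "alternating 1 (contr x w)" by (rule alternating_contr[OF w'])
  have wyx: "alternating 0 (contr y (contr x w))" using alternating_contr[of 0] wx by simp
  have Dy: "alternating (Suc l) (contr y D)" by (rule alternating_contr[OF D])
  have ev: "even l" using l by (metis even_Suc even_mult_iff even_numeral)
  have "alt_wedge (Suc (Suc l)) 1 D (contr x w) (y ## v) = 0"
    by (rule alternating_above_top[OF alternating_alt_wedge[OF D wx]]) (simp add: l[symmetric])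
  then have "alt_wedge (Suc l) 1 (contr y D) (contr x w) v = - (D v * w (x ## y ## v))"
    using alt_wedge_contr[OF D wx, of "Suc (Suc l)" y v] alt_wedge_0_right[OF D wyx, of v] ev
    by (simp add: contr_apply add_eq_0_iff2)
  moreover have "alt_wedge (Suc l) 2 (contr y D) w (x ## v) = 0"
    by (rule alternating_above_top[OF alternating_alt_wedge[OF Dy w]]) (simp add: l[symmetric])
  ultimately show ?thesis
    using alt_wedge_contr[OF Dy w, of "Suc (Suc l)" x v] ev by (simp add: eq_neg_iff_add_eq_0)
qed

context compact_mfd
begin

text \<open>Near a given point the test form is a bump times conj(w(x, y)) times i_x i_y of the
  volume form. By \<open>alt_wedge_contr_duality\<close> the integrand becomes minus the bump times
  |w(x, y)|^2, which forces w(x, y) = 0 at the point.\<close>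

lemma integ_nondegenerate:
  assumes l: "Suc (Suc l) = 2 * CARD('n)" and w: "w \<in> forms A 2"
    and z: "\<And>\<eta>. \<eta> \<in> forms A l \<Longrightarrow> integ (wedge l 2 \<eta> w) = 0"
  shows "w = 0"
proof (rule forms_ext[OF w forms_zero])
  fix c z0 and v0 :: "nat \<Rightarrow> complex ^ 'n" assume c: "c \<in> A" and z0: "z0 \<in> chart_image c"
  obtain s where s: "s > 0" "ocube z0 s \<subseteq> chart_image c" using ocube_in_open[OF open_image[OF c] z0] by blast
  have f: "fits c z0 (s / 4)" using c s by (simp add: fits_def)
  note r = fitsD(2)[OF f] and sub = fitsD(3)[OF f]
  obtain \<beta> :: "complex ^ 'n \<Rightarrow> real" where b: "smooth_on UNIV \<beta>" "\<And>z. 0 \<le> \<beta> z"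
    "\<And>z. z \<in> ocube z0 (s / 4 / 2) \<Longrightarrow> \<beta> z = 1" "\<And>z. z \<notin> ccube z0 (s / 4) \<Longrightarrow> \<beta> z = 0"
    using bump_exists[OF r, of z0] by blast
  define x y where "x = v0 0" and "y = v0 1"
  define h where "h z = w c z (x ## y ## std)" for z
  define D :: "'n altform" where "D v = of_real (rd v)" for v
  have D: "alternating (Suc (Suc l)) D" unfolding D_def l by (rule alternating_rd)
  define B where "B = contr x (contr y D)"
  have B: "alternating l B" unfolding B_def by (intro alternating_contr D)
  define \<phi> where "\<phi> z v = of_real (\<beta> z) * (cnj (h z) * B v)" for z v
  have o: "open (chart_image c)" by (rule open_image[OF c])
  have "smooth_on (chart_image c) (\<lambda>z. cnj (h z))" unfolding h_def
    by (rule smooth_on_bounded_linear[OF bounded_linear_cnj o sform_smooth[OF forms_sform[OF w c]]])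
  moreover have "smooth_on (chart_image c) (\<lambda>z. complex_of_real (\<beta> z))"
    by (rule smooth_on_bounded_linear[OF bounded_linear_of_real o smooth_on_subset[OF b(1) subset_UNIV]])
  moreover have "sform l (chart_image c) (\<lambda>z. B)" using B by (simp add: sform_def)
  ultimately have \<phi>: "sform l (chart_image c) \<phi>" unfolding \<phi>_def by (intro sform_mult o)
  have \<phi>z: "\<phi> z v = 0" if "z \<notin> ccube z0 (s / 4)" for z v by (simp add: \<phi>_def b(4)[OF that])
  have \<eta>: "ext0 c \<phi> \<in> forms A l" by (rule forms_ext0[OF c \<phi> compact_ccube sub \<phi>z])
  have sup: "supported (cinv c ` ccube z0 (s / 4)) (ext0 c \<phi>)"
    unfolding supported_def using ext0_support[OF c \<phi>z] by simp
  let ?u = "wedge l 2 (ext0 c \<phi>) w"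
  have cs: "csupp c ?u" by (rule csuppI[OF c compact_ccube sub supported_wedge_left[OF sup]])
  have u: "?u \<in> forms A (2 * CARD('n))" using forms_wedge[OF \<eta> w] by (simp add: l[symmetric])
  define g where "g z = - Re (?u c z std)" for z
  have g: "g z = \<beta> z * (cmod (h z))\<^sup>2" for z
  proof (cases "z \<in> chart_image c")
    case True
    then have "ext0 c \<phi> c z = (\<lambda>v. of_real (\<beta> z) * cnj (h z) * B v)"
      using ext0_self[OF c] by (intro ext) (simp add: \<phi>_def)
    then have "?u c z std = of_real (\<beta> z) * cnj (h z) * - (D std * h z)"
      using alt_wedge_contr_duality[OF l D forms_alternating[OF w c True], of x y std]
      by (simp add: wedge_def alt_wedge_cmult_left B_def h_def)
    then have "?u c z std = - of_real (\<beta> z * (cmod (h z))\<^sup>2)"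
      using complex_norm_square[of "h z"] by (simp add: D_def rd_std mult_ac)
    then show ?thesis by (simp add: g_def)
  next
    case False
    then show ?thesis using forms_outside[OF u] forms_outside[OF w] by (simp add: g_def h_def)
  qed
  have "(LINT z|lborel. ?u c z std) = 0" using integ_local[OF u cs] z[OF \<eta>] by simp
  then have "(LINT z|lborel. g z) = 0"
    unfolding g_def using csupp_integrable[OF u cs, of std] by (simp add: integral_Re)
  moreover have "continuous_on UNIV g" unfolding g_def
    by (intro continuous_on_minus continuous_on_Re smooth_on_continuous sform_smooth[OF csupp_sform(1)[OF u cs]])
  moreover have "g z \<ge> 0" for z unfolding g using b(2)[of z] by simp
  moreover have "g z = 0" if "z \<notin> ccube z0 (s / 4)" for z unfolding g using b(4)[OF that] by simp
  ultimately have "g z0 = 0" using integral_nonneg_zero_imp[of g "ccube z0 (s / 4)" z0] compact_ccube by blast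
  then have "h z0 = 0" using b(3)[OF ocube_center] r by (simp add: g)
  moreover have "h z0 = w c z0 v0" unfolding h_def x_def y_def
    by (rule alternating_cong[OF forms_alternating[OF w c z0]]) (auto simp: less_2_cases_iff)
  ultimately show "w c z0 v0 = 0 c z0 v0" by simp
qed

end

section \<open>Powers of a Hermitian form\<close>

text \<open>Permuting a tuple keeps its entries in S, so only values of the factors on such tuples
  enter. S is later the set of vectors orthogonal to one basis vector.\<close>

lemma alt_wedge_cong_on:
  assumes "\<And>v. range v \<subseteq> S \<Longrightarrow> f v = f' v" "\<And>v. range v \<subseteq> S \<Longrightarrow> g v = g' v" "range v \<subseteq> S"
  shows "alt_wedge p q f g v = alt_wedge p q f' g' v"
proof -
  have "range (\<lambda>i. v (\<sigma> i)) \<subseteq> S" "range (\<lambda>i. v (\<sigma> (p + i))) \<subseteq> S" for \<sigma> using assms(3) by auto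
  then show ?thesis unfolding alt_wedge_def using assms(1,2) by simp
qed

lemma alt_wedge_zero_on_left:
  assumes "\<And>v. range v \<subseteq> S \<Longrightarrow> f v = 0" "range v \<subseteq> S"
  shows "alt_wedge p q f g v = 0"
  using alt_wedge_cong_on[of S f "\<lambda>_. 0" g g v p q] assms by (simp add: alt_wedge_zero_left)

text \<open>\<open>wedge_power2\<close> at a single point; \<open>wedge_power2_pwr\<close> connects
  the two.\<close>

primrec pwr :: "'n::finite altform \<Rightarrow> nat \<Rightarrow> 'n altform" where
  "pwr w 0 = (\<lambda>v. 1)"
| "pwr w (Suc k) = alt_wedge 2 (2 * k) w (pwr w k)"

lemma alternating_pwr: "alternating 2 w \<Longrightarrow> alternating (2 * k) (pwr w k)"
proof (induction k)
  case (Suc k)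
  then show ?case using alternating_alt_wedge[of 2 w "2 * k" "pwr w k"] by simp
qed (simp add: alternating_0)

lemma pwr_contr:
  assumes w: "alternating 2 w"
  shows "pwr w (Suc k) (x ## v) = alt_wedge 1 (2 * k) (contr x w) (pwr w k) v +
    (if k = 0 then 0 else alt_wedge 2 (2 * k - 1) w (contr x (pwr w k)) v)"
  using alt_wedge_contr[OF w alternating_pwr[OF w, of k], of "Suc (2 * k)" x v] by simp

context
  fixes w :: "'n::finite altform" and e e' :: "complex ^ 'n" and S
  assumes w: "alternating 2 w" and S: "\<And>v. range v \<subseteq> S \<Longrightarrow> w (e ## v) = 0" "\<And>v. range v \<subseteq> S \<Longrightarrow> w (e' ## v) = 0"
begin

text \<open>The vectors e and e' must enter the same factor w, because w vanishes on either of them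
  together with a vector of S; there are k + 1 factors to choose from.\<close>

lemma pwr_pair: "range v \<subseteq> S \<Longrightarrow> pwr w (Suc k) (e ## e' ## v) = of_nat (Suc k) * w (e ## e' ## v) * pwr w k v"
proof (induction k arbitrary: v)
  case 0
  have w': "alternating (Suc 1) w" using w by (simp add: numeral_2_eq_2)
  have "alternating 0 (\<lambda>v. 1 :: complex)" by (simp add: alternating_0)
  from alt_wedge_0_right[OF alternating_contr[OF w'] this] show ?case
    using pwr_contr[OF w, of 0 e "e' ## v"] by (simp add: contr_apply)
next
  case (Suc k)
  have w': "alternating (Suc 1) w" using w by (simp add: numeral_2_eq_2)
  have we: "alternating 1 (contr x w)" for x by (rule alternating_contr[OF w'])
  have wee: "alternating 0 (contr y (contr x w))" for x y by (rule alternating_contr[of 0]) (use we[of x] in simp)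
  have we0: "contr e w u = 0" "contr e' w u = 0" if "range u \<subseteq> S" for u using S[OF that] by (simp_all add: contr_apply)
  have P: "alternating (2 * Suc k) (pwr w (Suc k))" by (rule alternating_pwr[OF w])
  then have P': "alternating (Suc (Suc (2 * k))) (pwr w (Suc k))" by simp
  have Pe: "alternating (Suc (2 * k)) (contr e (pwr w (Suc k)))" by (rule alternating_contr[OF P'])
  have "pwr w (Suc (Suc k)) (e ## e' ## v) = alt_wedge 1 (2 * Suc k) (contr e w) (pwr w (Suc k)) (e' ## v) +
      alt_wedge 2 (Suc (2 * k)) w (contr e (pwr w (Suc k))) (e' ## v)"
    using pwr_contr[OF w, of "Suc k" e "e' ## v"] by (simp del: pwr.simps)
  also have "alt_wedge 1 (2 * Suc k) (contr e w) (pwr w (Suc k)) (e' ## v) = w (e ## e' ## v) * pwr w (Suc k) v"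
    using alt_wedge_contr[OF we P, of "Suc (Suc (2 * k))" e e' v] alt_wedge_0_left[OF wee P, of e' e v]
      alt_wedge_zero_on_left[where S = S and f = "contr e w" and v = v and p = 1 and q = "Suc (2 * k)" and g = "contr e' (pwr w (Suc k))", OF we0(1) Suc.prems]
    by (simp add: contr_apply del: pwr.simps)
  also have "alt_wedge 2 (Suc (2 * k)) w (contr e (pwr w (Suc k))) (e' ## v) =
      alt_wedge 2 (2 * k) w (contr e' (contr e (pwr w (Suc k)))) v"
    using alt_wedge_contr[OF w Pe, of "Suc (Suc (2 * k))" e' v]
      alt_wedge_zero_on_left[where S = S and f = "contr e' w" and v = v and p = 1 and q = "Suc (2 * k)" and g = "contr e (pwr w (Suc k))", OF we0(2) Suc.prems]
    by (simp del: pwr.simps)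
  also have "\<dots> = alt_wedge 2 (2 * k) w (\<lambda>u. of_nat (Suc k) * w (e ## e' ## v) * pwr w k u) v"
  proof (rule alt_wedge_cong_on[OF refl _ Suc.prems])
    fix u :: "nat \<Rightarrow> complex ^ 'n" assume u: "range u \<subseteq> S"
    have "w (e ## e' ## u) = w (e ## e' ## v)"
      by (rule alternating_cong[OF w]) (auto simp: less_2_cases_iff)
    then show "contr e' (contr e (pwr w (Suc k))) u = of_nat (Suc k) * w (e ## e' ## v) * pwr w k u"
      using Suc.IH[OF u] by (simp add: contr_apply del: pwr.simps)
  qed
  also have "\<dots> = of_nat (Suc k) * w (e ## e' ## v) * pwr w (Suc k) v"
    by (simp add: alt_wedge_cmult_left alt_wedge_cmult_right)
  finally show ?case by (simp add: distrib_right distrib_left del: pwr.simps)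
qed

text \<open>The same count in the presence of a and b: these vanish on e and e', so both vectors
  still go into the power of w.\<close>

lemma pwr_wedge_pair:
  assumes a: "alternating 1 a" "\<And>v. a (e ## v) = 0" "\<And>v. a (e' ## v) = 0"
    and b: "alternating 1 b" "\<And>v. b (e ## v) = 0" "\<And>v. b (e' ## v) = 0" and v: "range v \<subseteq> S"
  shows "alt_wedge (Suc (2 * Suc k)) 1 (alt_wedge (2 * Suc k) 1 (pwr w (Suc k)) a) b (e ## e' ## v) =
    of_nat (Suc k) * w (e ## e' ## v) * alt_wedge (Suc (2 * k)) 1 (alt_wedge (2 * k) 1 (pwr w k) a) b v"
proof -
  have c0: "alt_wedge p 0 f (contr x g) u = 0" if "\<And>v. g (x ## v) = 0" for p f u x and g :: "'n altform"
    using that alt_wedge_zero_right[of p 0 f u] by (simp add: contr_def)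
  have C: "contr y (contr x (alt_wedge (Suc (Suc p)) 1 f g)) = alt_wedge p 1 (contr y (contr x f)) g"
    if f: "alternating (Suc (Suc p)) f" and g: "alternating 1 g" "\<And>v. g (x ## v) = 0" "\<And>v. g (y ## v) = 0" for p x y and f g :: "'n altform"
  proof
    fix u
    show "contr y (contr x (alt_wedge (Suc (Suc p)) 1 f g)) u = alt_wedge p 1 (contr y (contr x f)) g u"
      using alt_wedge_contr[OF f g(1), of "Suc (Suc p)" x "y ## u"] alt_wedge_contr[OF alternating_contr[OF f, of x] g(1), of "Suc p" y u]
        c0[where g = g and x = x, OF g(2)] c0[where g = g and x = y, OF g(3)] by (simp add: contr_apply)
  qed
  have P: "alternating (Suc (Suc (2 * k))) (pwr w (Suc k))" using alternating_pwr[OF w, of "Suc k"] by simp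
  have Q: "alternating (Suc (Suc (Suc (2 * k)))) (alt_wedge (Suc (Suc (2 * k))) 1 (pwr w (Suc k)) a)"
    using alternating_alt_wedge[OF P a(1)] by simp
  have "alt_wedge (Suc (2 * Suc k)) 1 (alt_wedge (2 * Suc k) 1 (pwr w (Suc k)) a) b (e ## e' ## v) =
      alt_wedge (Suc (2 * k)) 1 (alt_wedge (2 * k) 1 (contr e' (contr e (pwr w (Suc k)))) a) b v"
    using fun_cong[OF C[OF Q b(1), of e e'], of v] b(2,3) C[OF P a(1), of e e'] a(2,3)
    by (simp add: contr_apply del: pwr.simps)
  also have "\<dots> = alt_wedge (Suc (2 * k)) 1 (alt_wedge (2 * k) 1 (\<lambda>u. of_nat (Suc k) * w (e ## e' ## v) * pwr w k u) a) b v"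
  proof (rule alt_wedge_cong_on[OF alt_wedge_cong_on[OF _ refl] refl v])
    fix u :: "nat \<Rightarrow> complex ^ 'n" assume u: "range u \<subseteq> S"
    have "w (e ## e' ## u) = w (e ## e' ## v)"
      by (rule alternating_cong[OF w]) (auto simp: less_2_cases_iff)
    then show "contr e' (contr e (pwr w (Suc k))) u = of_nat (Suc k) * w (e ## e' ## v) * pwr w k u"
      using pwr_pair[OF u, of k] by (simp add: contr_apply del: pwr.simps)
  qed
  also have "alt_wedge (2 * k) 1 (\<lambda>u. of_nat (Suc k) * w (e ## e' ## v) * pwr w k u) a =
      (\<lambda>u. of_nat (Suc k) * w (e ## e' ## v) * alt_wedge (2 * k) 1 (pwr w k) a u)"
    by (rule ext) (rule alt_wedge_cmult_left)
  finally show ?thesis by (simp only: alt_wedge_cmult_left)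
qed

end

section \<open>Positivity of a power of the metric against a (1,0)-form and its conjugate\<close>

lemma alternating_cnj:
  assumes "alternating k f"
  shows "alternating k (\<lambda>v. cnj (f v))"
proof (rule alternatingI)
  show "linear (\<lambda>x. cnj (f (v(i := x))))" if "i < k" for v i
    using linear_compose[OF alternating_linear[OF assms that] bounded_linear.linear[OF bounded_linear_cnj]] by (simp add: o_def)
  show "cnj (f v) = cnj (f w)" if "\<And>i. i < k \<Longrightarrow> v i = w i" for v w
    using alternating_cong[OF assms that] by simp
  show "cnj (f v) = 0" if "i < k" "j < k" "i \<noteq> j" "v i = v j" for v i j
    using alternating_eq[OF assms that] by simp
qed

lemma alternating_dz: "alternating 1 (dz j)"
  unfolding dz_def by (rule alternatingI) (auto intro!: linearI)

lemma alternating_dzbar: "alternating 1 (dzbar j)"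
  unfolding dzbar_def by (rule alternatingI) (auto intro!: linearI simp: complex_eq_iff)

text \<open>Fewer than n equations, padded with zero rows, form a singular square matrix.\<close>

lemma common_kernel_vector:
  fixes g :: "nat \<Rightarrow> complex ^ 'n::finite"
  assumes k: "k < CARD('n)"
  shows "\<exists>x. x \<noteq> 0 \<and> (\<forall>i<k. (\<Sum>j\<in>UNIV. g i $ j * x $ j) = 0)"
proof -
  define idx :: "'n \<Rightarrow> nat" where "idx = inv_into {..<CARD('n)} en"
  have idx: "idx (en i) = i" if "i < CARD('n)" for i
    unfolding idx_def using that inv_into_f_f[OF bij_betw_imp_inj_on[OF bij_en]] by simp
  define B :: "complex ^ 'n ^ 'n" where "B = (\<chi> i. if idx i < k then g (idx i) else 0)"
  have "row (en k) B = 0" by (simp add: row_def B_def vec_eq_iff idx[OF k])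
  then have "det B = 0" by (rule det_zero_row)
  then have "\<not> invertible B" by (simp add: invertible_det_nz)
  then have "\<not> (\<exists>C. C ** B = mat 1)" by (simp add: invertible_left_inverse)
  then obtain x where x: "x \<noteq> 0" "B *v x = 0" unfolding matrix_left_invertible_ker by blast
  have "(\<Sum>j\<in>UNIV. g i $ j * x $ j) = 0" if "i < k" for i
    using arg_cong[OF x(2), of "\<lambda>y. y $ en i"] that k by (simp add: matrix_vector_mult_def B_def idx)
  then show ?thesis using x(1) by blast
qed

text \<open>The tuple e_0, i e_0, e_1, i e_1, ...: what \<open>std\<close> becomes under the complex
  linear map that sends the standard basis to e.\<close>

definition hermitian_pairs :: "(nat \<Rightarrow> complex ^ 'n) \<Rightarrow> nat \<Rightarrow> complex ^ 'n" where
  "hermitian_pairs e = (\<lambda>i. if even i then e (i div 2) else \<i> *s e (i div 2))"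

lemma hermitian_pairs_Suc: "hermitian_pairs e = e 0 ## (\<i> *s e 0) ## hermitian_pairs (\<lambda>i. e (Suc i))"
proof
  fix i
  show "hermitian_pairs e i = (e 0 ## (\<i> *s e 0) ## hermitian_pairs (\<lambda>i. e (Suc i))) i"
  proof (cases i)
    case (Suc j)
    then show ?thesis by (cases j) (simp_all add: hermitian_pairs_def)
  qed (simp add: hermitian_pairs_def)
qed

context
  fixes h :: "'n::finite \<Rightarrow> 'n \<Rightarrow> complex" and w :: "'n altform"
  assumes w: "\<And>v. w v = \<i> * (\<Sum>j\<in>UNIV. \<Sum>k\<in>UNIV. h j k * alt_wedge 1 1 (dz j) (dzbar k) v)"
    and herm: "\<And>j k. h k j = cnj (h j k)"
    and pos: "\<And>x. x \<noteq> 0 \<Longrightarrow> 0 < Re (\<Sum>j\<in>UNIV. \<Sum>k\<in>UNIV. h j k * x $ j * cnj (x $ k))"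
begin

definition hf :: "complex ^ 'n \<Rightarrow> complex ^ 'n \<Rightarrow> complex" where
  "hf x y = (\<Sum>j\<in>UNIV. \<Sum>k\<in>UNIV. h j k * x $ j * cnj (y $ k))"

lemma hf_cnj: "hf y x = cnj (hf x y)"
proof -
  have e: "h j k * y $ j * cnj (x $ k) = cnj (h k j * x $ k * cnj (y $ j))" for j k
    using herm[of k j] by simp
  have "hf y x = (\<Sum>k\<in>UNIV. \<Sum>j\<in>UNIV. h j k * y $ j * cnj (x $ k))" unfolding hf_def by (rule sum.swap)
  also have "\<dots> = cnj (hf x y)" unfolding hf_def cnj_sum e ..
  finally show ?thesis .
qed

lemma hf_scale: "hf (a *s x) y = a * hf x y"
  unfolding hf_def by (simp add: sum_distrib_left mult_ac)

lemma hf_scale_right: "hf x (a *s y) = cnj a * hf x y"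
  unfolding hf_def by (simp add: sum_distrib_left mult_ac)

lemma hf_sum_scale: "hf (\<Sum>i\<in>S. a i *s x i) y = (\<Sum>i\<in>S. a i * hf (x i) y)"
proof (induction S rule: infinite_finite_induct)
  case (insert i S)
  have "hf (u + v) y = hf u y + hf v y" for u v by (simp add: hf_def distrib_left distrib_right sum.distrib)
  then show ?case using insert by (simp add: hf_scale)
qed (simp_all add: hf_def)

lemma hf_pos: "x \<noteq> 0 \<Longrightarrow> 0 < Re (hf x x)"
  unfolding hf_def by (rule pos)

lemma hf_real: "hf x x = of_real (Re (hf x x))"
  using hf_cnj[of x x] by (simp add: complex_eq_iff)

lemma w_alternating: "alternating 2 w"
proof -
  have "alternating 2 (alt_wedge 1 1 (dz j) (dzbar k))" for j k :: 'n
    using alternating_alt_wedge[OF alternating_dz[of j] alternating_dzbar[of k]] by (simp add: numeral_2_eq_2)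
  then have "alternating 2 (\<lambda>v. \<i> * (\<Sum>j\<in>UNIV. \<Sum>k\<in>UNIV. h j k * alt_wedge 1 1 (dz j) (dzbar k) v))"
    by (intro alternating_cmult alternating_sum)
  moreover have "w = (\<lambda>v. \<i> * (\<Sum>j\<in>UNIV. \<Sum>k\<in>UNIV. h j k * alt_wedge 1 1 (dz j) (dzbar k) v))"
    by (rule ext) (rule w)
  ultimately show ?thesis by simp
qed

lemma w_hf: "w (x ## y ## v) = \<i> * (hf x y - hf y x)"
proof -
  have "w (x ## y ## v) = \<i> * (\<Sum>j\<in>UNIV. \<Sum>k\<in>UNIV. h j k * x $ j * cnj (y $ k) - h j k * y $ j * cnj (x $ k))"
    unfolding w by (simp add: alt_wedge_1_1[OF alternating_dz alternating_dzbar, simplified] dz_def dzbar_def algebra_simps)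
  then show ?thesis by (simp only: hf_def sum_subtractf)
qed

lemma w_orth: "hf x y = 0 \<Longrightarrow> w (x ## y ## v) = 0"
  using hf_cnj[of y x] by (simp add: w_hf)

lemma w_pair: "w (x ## (\<i> *s x) ## v) = of_real (2 * Re (hf x x))"
proof -
  have "w (x ## (\<i> *s x) ## v) = 2 * hf x x" unfolding w_hf hf_scale hf_scale_right by (simp add: algebra_simps)
  also have "\<dots> = 2 * of_real (Re (hf x x))" by (rule arg_cong[OF hf_real])
  finally show ?thesis by simp
qed

text \<open>The next vector solves the equations of orthogonality to the previous ones and, unless
  it is the last, the equation given by a. These are at most n - 1 equations, so a nonzero solution
  exists. The value 0 beyond m lets orthogonality be used for all later indices.\<close>

lemma hermitian_basis:
  fixes a :: "complex ^ 'n"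
  assumes "m \<le> CARD('n)"
  shows "\<exists>e. (\<forall>i<m. e i \<noteq> 0) \<and> (\<forall>i<m. \<forall>j<m. i \<noteq> j \<longrightarrow> hf (e i) (e j) = 0) \<and>
    (\<forall>i<m. i < CARD('n) - 1 \<longrightarrow> (\<Sum>j\<in>UNIV. a $ j * e i $ j) = 0) \<and> (\<forall>i\<ge>m. e i = 0)"
  using assms
proof (induction m)
  case 0
  show ?case by (rule exI[of _ "\<lambda>_. 0"]) simp
next
  case (Suc m)
  then obtain e where e: "\<And>i. i < m \<Longrightarrow> e i \<noteq> 0" "\<And>i j. i < m \<Longrightarrow> j < m \<Longrightarrow> i \<noteq> j \<Longrightarrow> hf (e i) (e j) = 0"
    "\<And>i. i < m \<Longrightarrow> i < CARD('n) - 1 \<Longrightarrow> (\<Sum>j\<in>UNIV. a $ j * e i $ j) = 0" "\<And>i. i \<ge> m \<Longrightarrow> e i = 0" by auto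
  define g where "g i = (if i < m then (\<chi> j. \<Sum>k\<in>UNIV. h j k * cnj (e i $ k)) else a)" for i
  have "(if m < CARD('n) - 1 then Suc m else m) < CARD('n)" using Suc.prems by auto
  then obtain x where x: "x \<noteq> 0" "\<And>i. i < (if m < CARD('n) - 1 then Suc m else m) \<Longrightarrow> (\<Sum>j\<in>UNIV. g i $ j * x $ j) = 0"
    using common_kernel_vector[of _ g] by blast
  have hx: "hf x (e i) = 0" if "i < m" for i
  proof -
    have "hf x (e i) = (\<Sum>j\<in>UNIV. g i $ j * x $ j)" using that
      unfolding hf_def g_def by (simp add: sum_distrib_left sum_distrib_right mult_ac)
    then show ?thesis using x(2)[of i] that by (simp split: if_splits)
  qed
  then have hx': "hf (e i) x = 0" if "i < m" for i using hf_cnj[of "e i" x] that by simp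
  show ?case
  proof (rule exI[of _ "e(m := x)"], intro conjI allI impI)
    show "(e(m := x)) i \<noteq> 0" if "i < Suc m" for i using that e(1) x(1) by (auto simp: less_Suc_eq)
    show "hf ((e(m := x)) i) ((e(m := x)) j) = 0" if "i < Suc m" "j < Suc m" "i \<noteq> j" for i j
      using that e(2) hx hx' by (auto simp: less_Suc_eq)
    show "(\<Sum>j\<in>UNIV. a $ j * (e(m := x)) i $ j) = 0" if "i < Suc m" "i < CARD('n) - 1" for i
      using that e(3) x(2)[of m] by (auto simp: less_Suc_eq g_def)
    show "(e(m := x)) i = 0" if "Suc m \<le> i" for i using that e(4) by simp
  qed
qed

text \<open>The pairs are peeled off one at a time by \<open>pwr_wedge_pair\<close>. Each
  contributes w(e_i, i e_i) = 2 hf(e_i, e_i), and the numbers of choices multiply to the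
  factorial.\<close>

lemma pwr_wedge_hermitian_pairs:
  assumes "alternating 1 a" "alternating 1 b" "\<And>i j. i < k \<Longrightarrow> i < j \<Longrightarrow> hf (e i) (e j) = 0"
    "\<And>i v. i < k \<Longrightarrow> a (e i ## v) = 0 \<and> a ((\<i> *s e i) ## v) = 0 \<and> b (e i ## v) = 0 \<and> b ((\<i> *s e i) ## v) = 0"
  shows "alt_wedge (Suc (2 * k)) 1 (alt_wedge (2 * k) 1 (pwr w k) a) b (hermitian_pairs e) =
    of_real (fact k * (\<Prod>i<k. 2 * Re (hf (e i) (e i)))) *
      alt_wedge 1 1 a b (hermitian_pairs (\<lambda>i. e (k + i)))"
  using assms(3,4)
proof (induction k arbitrary: e)
  case 0
  have "alternating 0 (\<lambda>v. 1 :: complex)" by (simp add: alternating_0)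
  from alt_wedge_0_left[OF this assms(1)] have "alt_wedge 0 1 (\<lambda>v. 1) a = a" by (intro ext) simp
  then show ?case by simp
next
  case (Suc k)
  let ?v = "hermitian_pairs (\<lambda>i. e (Suc i))"
  have S: "range ?v \<subseteq> {y. hf (e 0) y = 0}"
    using Suc.prems(1)[of 0] by (auto simp: hermitian_pairs_def hf_scale_right)
  have wS: "w (e 0 ## v) = 0" "w ((\<i> *s e 0) ## v) = 0" if "range v \<subseteq> {y. hf (e 0) y = 0}" for v
  proof -
    have "hf (e 0) (v 0) = 0" using that by auto
    then show "w (e 0 ## v) = 0" "w ((\<i> *s e 0) ## v) = 0"
      using w_orth[of "e 0" "v 0" "\<lambda>i. v (Suc i)"] w_orth[of "\<i> *s e 0" "v 0" "\<lambda>i. v (Suc i)"]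
      unfolding vcons_eta by (simp_all add: hf_scale)
  qed
  have "alt_wedge (Suc (2 * Suc k)) 1 (alt_wedge (2 * Suc k) 1 (pwr w (Suc k)) a) b (hermitian_pairs e) =
    of_nat (Suc k) * w (e 0 ## (\<i> *s e 0) ## ?v) * alt_wedge (Suc (2 * k)) 1 (alt_wedge (2 * k) 1 (pwr w k) a) b ?v"
    unfolding hermitian_pairs_Suc[of e]
    by (rule pwr_wedge_pair[OF w_alternating wS assms(1) _ _ assms(2) _ _ S]) (use Suc.prems(2)[of 0] in simp_all)
  also have "alt_wedge (Suc (2 * k)) 1 (alt_wedge (2 * k) 1 (pwr w k) a) b ?v =
    of_real (fact k * (\<Prod>i<k. 2 * Re (hf (e (Suc i)) (e (Suc i))))) *
      alt_wedge 1 1 a b (hermitian_pairs (\<lambda>i. e (Suc (k + i))))"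
    by (rule Suc.IH) (use Suc.prems in auto)
  finally show ?case unfolding w_pair prod.lessThan_Suc_shift by (simp add: algebra_simps)
qed

text \<open>On a basis orthogonal for the metric whose first n - 1 vectors are killed by a, the form
  is a positive multiple of a ^ conj a on the last pair f, i f, which is -2i |a(f)|^2. The change
  from this basis to \<open>std\<close> is complex linear, so \<open>rdet_pos\<close> preserves the
  sign. If t = 0, then a kills the whole basis.\<close>

lemma hermitian_wedge_positive:
  assumes a: "alternating 1 a" "\<And>c x v. a ((c *s x) ## v) = c * a (x ## v)"
  shows "\<exists>t\<ge>0. alt_wedge (Suc (2 * (CARD('n) - 1))) 1 (alt_wedge (2 * (CARD('n) - 1)) 1 (pwr w (CARD('n) - 1)) a)
      (\<lambda>v. cnj (a v)) std = - \<i> * complex_of_real t \<and> (t = 0 \<longrightarrow> (\<forall>v. a v = 0))"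
proof -
  let ?n = "CARD('n)" and ?b = "\<lambda>v. cnj (a v)"
  have n0: "?n > 0" by simp
  define A where "A x = a (x ## std)" for x
  have aA: "a (x ## v) = A x" for x v unfolding A_def by (rule alternating_cong[OF a(1)]) simp
  have lA: "linear A" unfolding A_def using alternating_vcons_linear[of 0] a(1) by simp
  have As: "A (c *s x) = c * A x" for c x unfolding A_def by (rule a(2))
  have Asum: "A (\<Sum>i\<in>S. c i *s y i) = (\<Sum>i\<in>S. c i * A (y i))" for S and c :: "'b \<Rightarrow> complex" and y
    by (simp add: linear_sum[OF lA] As)
  have b: "alternating 1 ?b" by (rule alternating_cnj[OF a(1)])
  define c where "c = (\<chi> j. A (axis j 1))"
  have Ac: "A x = (\<Sum>j\<in>UNIV. c $ j * x $ j)" for x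
    using Asum[of "\<lambda>j. x $ j" "\<lambda>j. axis j 1" UNIV] by (simp add: basis_expansion c_def mult.commute)
  obtain e where H: "(\<forall>i<?n. e i \<noteq> 0) \<and> (\<forall>i<?n. \<forall>j<?n. i \<noteq> j \<longrightarrow> hf (e i) (e j) = 0) \<and>
    (\<forall>i<?n. i < ?n - 1 \<longrightarrow> (\<Sum>j\<in>UNIV. c $ j * e i $ j) = 0) \<and> (\<forall>i\<ge>?n. e i = 0)"
    using hermitian_basis[OF order_refl, of c] by (elim exE)
  have e: "\<And>i. i < ?n \<Longrightarrow> e i \<noteq> 0" "\<And>i j. i < ?n \<Longrightarrow> j < ?n \<Longrightarrow> i \<noteq> j \<Longrightarrow> hf (e i) (e j) = 0"
    "\<And>i. i < ?n - 1 \<Longrightarrow> A (e i) = 0" "\<And>i. i \<ge> ?n \<Longrightarrow> e i = 0"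
    using H unfolding Ac by simp_all
  have h0: "hf 0 y = 0" for y by (simp add: hf_def)
  have hz: "hf x 0 = 0" for x by (simp add: hf_def)
  define L where "L x = (\<Sum>i<?n. (x $ en i) *s e i)" for x :: "complex ^ 'n"
  have linL: "linear L" unfolding L_def
    by (rule linearI) (simp_all add: vec_eq_iff sum_component distrib_right sum.distrib scaleR_sum_right)
  have Ls: "L (d *s x) = d *s L x" for d x unfolding L_def by (simp add: vec_eq_iff sum_component sum_distrib_left mult.assoc)
  have hL: "hf (L x) (e j) = x $ en j * hf (e j) (e j)" if "j < ?n" for x j
    unfolding L_def hf_sum_scale using that e(2)
    by (subst sum.remove[of _ j]) (auto intro!: sum.neutral)
  have "inj L"
  proof (subst linear_injective_0[OF linL], intro allI impI)
    fix x assume "L x = 0"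
    then have "x $ en j = 0" if "j < ?n" for j
      using hL[OF that, of x] hf_pos[OF e(1)[OF that]] by (auto simp: h0)
    then show "x = 0" using bij_betw_imp_surj_on[OF bij_en] unfolding vec_eq_iff zero_index by (metis UNIV_I imageE lessThan_iff)
  qed
  then obtain M where M: "linear M" "\<And>x. M (L x) = x" "\<And>x. L (M x) = x"
    using linear_injective_isomorphism[OF linL] by blast
  have rL: "rdet L > 0" by (rule rdet_pos[OF linL Ls M])
  have Lstd: "L (std i) = hermitian_pairs e i" if i: "i < 2 * ?n" for i
  proof -
    have j: "i div 2 < ?n" using i by simp
    have "(std i :: complex ^ 'n) $ en l = 0" if "l < ?n" "l \<noteq> i div 2" for l
      using inj_onD[OF bij_betw_imp_inj_on[OF bij_en[where 'n = 'n]], of l "i div 2"] j that by (auto simp: std_def axis_def)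
    then have "L (std i) = (\<Sum>l<?n. if l = i div 2 then ((std i :: complex ^ 'n) $ en (i div 2)) *s e (i div 2) else 0)"
      unfolding L_def by (intro sum.cong refl) auto
    then show ?thesis using j by (simp add: std_def axis_def hermitian_pairs_def sum.delta)
  qed
  let ?T = "alt_wedge (Suc (2 * (?n - 1))) 1 (alt_wedge (2 * (?n - 1)) 1 (pwr w (?n - 1)) a) ?b"
  have "alternating (Suc (2 * (?n - 1)) + 1) ?T"
    using alternating_alt_wedge[OF _ b] alternating_alt_wedge[OF alternating_pwr[OF w_alternating] a(1)] by simp
  moreover have "Suc (2 * (?n - 1)) + 1 = 2 * ?n" using n0 by arith
  ultimately have T: "alternating (2 * ?n) ?T" by metis
  have "?T (hermitian_pairs e) = ?T (\<lambda>i. L (std i))"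
    by (rule alternating_cong[OF T]) (simp add: Lstd)
  also have "\<dots> = of_real (rdet L) * ?T std" by (rule top_form_rdet[OF T linL])
  finally have T1: "?T (hermitian_pairs e) = of_real (rdet L) * ?T std" .
  define f where "f = e (?n - 1)"
  define C :: real where "C = fact (?n - 1) * (\<Prod>i<?n - 1. 2 * Re (hf (e i) (e i)))"
  have C: "C > 0" unfolding C_def using hf_pos e(1) by (intro mult_pos_pos prod_pos) simp_all
  have "?T (hermitian_pairs e) = of_real C * alt_wedge 1 1 a ?b (hermitian_pairs (\<lambda>i. e (?n - 1 + i)))"
    unfolding C_def
  proof (rule pwr_wedge_hermitian_pairs[OF a(1) b])
    show "hf (e i) (e j) = 0" if "i < ?n - 1" "i < j" for i j
      using e(2)[of i j] e(4)[of j] that hz by (cases "j < ?n") auto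
    show "a (e i ## v) = 0 \<and> a ((\<i> *s e i) ## v) = 0 \<and> cnj (a (e i ## v)) = 0 \<and> cnj (a ((\<i> *s e i) ## v)) = 0" if "i < ?n - 1" for i v
      using e(3)[OF that] by (simp add: aA As)
  qed
  also have "alt_wedge 1 1 a ?b (hermitian_pairs (\<lambda>i. e (?n - 1 + i))) = - 2 * \<i> * of_real ((cmod (A f))\<^sup>2)"
    unfolding hermitian_pairs_Suc[of "\<lambda>i. e (?n - 1 + i)"] alt_wedge_1_1[OF a(1) b] using complex_norm_square[of "A f"]
    by (simp add: aA As f_def algebra_simps)
  finally have "?T std = - \<i> * of_real (2 * C * (cmod (A f))\<^sup>2 / rdet L)"
    using T1 rL by (simp add: field_simps)
  moreover have "2 * C * (cmod (A f))\<^sup>2 / rdet L \<ge> 0" using C rL by simp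
  moreover have "a v = 0" if "2 * C * (cmod (A f))\<^sup>2 / rdet L = 0" for v
  proof -
    have Af: "A f = 0" using that C rL by simp
    have "A (e i) = 0" if "i < ?n" for i
      using e(3)[of i] Af that unfolding f_def by (cases "i = ?n - 1") auto
    then have "A (L x) = 0" for x unfolding L_def Asum by (simp add: sum.neutral)
    then have "A x = 0" for x using M(3)[of x] by metis
    then show "a v = 0" using aA[of "v 0" "\<lambda>i. v (Suc i)"] unfolding vcons_eta by simp
  qed
  ultimately show ?thesis by blast
qed

end

section \<open>Types of differential forms\<close>

lemma complex_linear_from_i:
  assumes "linear (L :: complex ^ 'n::finite \<Rightarrow> complex)" "\<And>x. L (\<i> *s x) = \<sigma> * L x" "\<sigma> = \<i> \<or> \<sigma> = - \<i>"
  shows "L (s *s x) = (if \<sigma> = \<i> then s else cnj s) * L x"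
proof -
  have "s *s x = Re s *\<^sub>R x + Im s *\<^sub>R (\<i> *s x)"
    by (simp add: vec_eq_iff complex_eq_iff)
  then have "L (s *s x) = of_real (Re s) * L x + of_real (Im s) * (\<sigma> * L x)"
    by (simp only: linear_add[OF assms(1)] linear_scale[OF assms(1)] assms(2)) (simp only: scaleR_conv_of_real)
  also have "\<dots> = (of_real (Re s) + \<sigma> * of_real (Im s)) * L x" by (simp add: algebra_simps)
  also have "of_real (Re s) + \<sigma> * of_real (Im s) = (if \<sigma> = \<i> then s else cnj s)"
    using assms(3) by (auto simp: complex_eq_iff)
  finally show ?thesis .
qed

lemma linear_times_i: "linear (\<lambda>x. \<i> *s x :: complex ^ 'n::finite)"
  by (rule linearI) (simp_all add: vec_eq_iff distrib_left)

text \<open>The sesquilinear form K(x, y) = (B(x, y) - i B(i x, y)) / 2 supplies the coefficients,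
  and invariance under i makes B equal to K(x, y) - K(y, x).\<close>

lemma bilinear_type_1_1:
  fixes B :: "complex ^ 'n::finite \<Rightarrow> complex ^ 'n \<Rightarrow> complex"
  assumes lin: "\<And>y. linear (\<lambda>x. B x y)" and anti: "\<And>x y. B y x = - B x y" and J: "\<And>x y. B (\<i> *s x) (\<i> *s y) = B x y"
  shows "\<exists>a. \<forall>v. B (v 0) (v 1) = (\<Sum>j\<in>UNIV. \<Sum>k\<in>UNIV. a j k * alt_wedge 1 1 (dz j) (dzbar k) v)"
proof -
  define K where "K x y = (1 / 2) * B x y + (- \<i> / 2) * B (\<i> *s x) y" for x y
  have Jm: "\<i> *s (\<i> *s x) = - x" for x :: "complex ^ 'n" by (simp add: vec_eq_iff)
  have neg: "B (- x) y = - B x y" for x y using linear_neg[OF lin] .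
  have lin': "linear (B x)" for x
    using linear_compose_neg[OF lin[of x]] anti[of _ x] by simp
  have BJ: "B x (\<i> *s y) = - B (\<i> *s x) y" for x y
  proof -
    have "- B x (\<i> *s y) = B (\<i> *s x) y" using J[of "\<i> *s x" y] by (simp only: Jm neg)
    then show ?thesis by (metis minus_minus)
  qed
  have Jl: "linear (\<lambda>x. B (\<i> *s x) y)" for y
    using linear_compose[OF linear_times_i lin[of y]] by (simp add: o_def)
  have Kl: "linear (\<lambda>x. K x y)" "linear (K x)" for x y
    unfolding K_def by (intro linear_compose_add linear_cmult lin lin' Jl)+
  have Ki: "K (\<i> *s x) y = \<i> * K x y" "K x (\<i> *s y) = - \<i> * K x y" for x y
    by (simp_all add: K_def Jm neg BJ algebra_simps)
  have Kc: "K (s *s x) y = s * K x y" "K x (s *s y) = cnj s * K x y" for s x y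
    using complex_linear_from_i[OF Kl(1) Ki(1), of x s for x s] complex_linear_from_i[OF Kl(2) Ki(2), of y s for y s] by simp_all
  have Ksum: "K x y = (\<Sum>j\<in>UNIV. \<Sum>k\<in>UNIV. K (axis j 1) (axis k 1) * (x $ j * cnj (y $ k)))" for x y
  proof -
    have "K x y = K (\<Sum>j\<in>UNIV. x $ j *s axis j 1) (\<Sum>k\<in>UNIV. y $ k *s axis k 1)" by (simp only: basis_expansion)
    also have "\<dots> = (\<Sum>j\<in>UNIV. \<Sum>k\<in>UNIV. K (axis j 1) (axis k 1) * (x $ j * cnj (y $ k)))"
      unfolding linear_sum[OF Kl(1)] unfolding linear_sum[OF Kl(2)] unfolding Kc by (simp only: mult_ac)
    finally show ?thesis .
  qed
  have B: "B x y = K x y - K y x" for x y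
    using BJ[of x y] anti[of "\<i> *s y" x] by (simp add: K_def anti[of x y] algebra_simps)
  have wd: "alt_wedge 1 1 (dz j) (dzbar k) v = v 0 $ j * cnj (v 1 $ k) - cnj (v 0 $ k) * v 1 $ j" for j k :: 'n and v
  proof -
    have "v = v 0 ## v 1 ## (\<lambda>i. v (Suc (Suc i)))" using vcons_eta[of v] vcons_eta[of "\<lambda>i. v (Suc i)"] by simp
    then have "alt_wedge 1 1 (dz j) (dzbar k) v = alt_wedge 1 1 (dz j) (dzbar k) (v 0 ## v 1 ## (\<lambda>i. v (Suc (Suc i))))"
      by (rule arg_cong)
    also have "\<dots> = v 0 $ j * cnj (v 1 $ k) - cnj (v 0 $ k) * v 1 $ j"
      unfolding alt_wedge_1_1[OF alternating_dz alternating_dzbar] by (simp add: dz_def dzbar_def)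
    finally show ?thesis .
  qed
  show ?thesis
  proof (rule exI[of _ "\<lambda>j k. K (axis j 1) (axis k 1)"], rule allI)
    fix v :: "nat \<Rightarrow> complex ^ 'n"
    show "B (v 0) (v 1) = (\<Sum>j\<in>UNIV. \<Sum>k\<in>UNIV. K (axis j 1) (axis k 1) * alt_wedge 1 1 (dz j) (dzbar k) v)"
      unfolding B Ksum[of "v 0" "v 1"] Ksum[of "v 1" "v 0"] wd
      by (simp add: right_diff_distrib sum_subtractf mult_ac)
  qed
qed

context complex_mfd
begin

text \<open>On 1-forms, the projection to type (0,1): for a complex linear u the two terms
  cancel.\<close>

definition p01 :: "('a, 'n) form \<Rightarrow> ('a, 'n) form" where
  "p01 u = (\<lambda>c z v. (1 / 2) * u c z v + (\<i> / 2) * u c z (\<lambda>i. \<i> *s v i))"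

lemma p01_diff: "p01 (u - w) = p01 u - p01 w"
  by (intro ext) (simp add: p01_def algebra_simps)

lemma forms_p01:
  assumes u: "u \<in> forms A k"
  shows "p01 u \<in> forms A k"
proof (rule formsI)
  show "p01 u c z v = 0" if "c \<notin> A \<or> z \<notin> chart_image c" for c z v
    using forms_outside[OF u that] by (simp add: p01_def)
  show "sform k (chart_image c) (p01 u c)" if c: "c \<in> A" for c
  proof -
    have "sform k (chart_image c) (\<lambda>z v. u c z (\<lambda>i. \<i> *s v i))"
      unfolding sform_def using alternating_pull[OF linear_times_i forms_alternating[OF u c]] sform_smooth[OF forms_sform[OF u c]] by blast
    then show ?thesis unfolding p01_def
      by (intro sform_add sform_cmult open_image[OF c] forms_sform[OF u c])
  qed
  show "p01 u c z v = pbk (transition c c') (p01 u c') z v" if "c \<in> A" "c' \<in> A" "z \<in> ovl c c'" for c c' z v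
    using forms_pbk[OF u that] transition_complex_linear[OF that] by (simp add: p01_def pbk_def)
qed

definition cnj_form :: "('a, 'n) form \<Rightarrow> ('a, 'n) form" where
  "cnj_form u = (\<lambda>c z v. cnj (u c z v))"

lemma forms_cnj:
  assumes u: "u \<in> forms A k"
  shows "cnj_form u \<in> forms A k"
proof (rule formsI)
  show "cnj_form u c z v = 0" if "c \<notin> A \<or> z \<notin> chart_image c" for c z v
    using forms_outside[OF u that] by (simp add: cnj_form_def)
  show "sform k (chart_image c) (cnj_form u c)" if c: "c \<in> A" for c
    unfolding sform_def cnj_form_def
    using alternating_cnj[OF forms_alternating[OF u c]]
      smooth_on_bounded_linear[OF bounded_linear_cnj open_image[OF c] sform_smooth[OF forms_sform[OF u c]]] by blast
  show "cnj_form u c z v = pbk (transition c c') (cnj_form u c') z v" if "c \<in> A" "c' \<in> A" "z \<in> ovl c c'" for c c' z v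
    using forms_pbk[OF u that] by (simp add: cnj_form_def pbk_def)
qed

lemma closed_cnj:
  assumes u: "u \<in> closed_forms A k"
  shows "cnj_form u \<in> closed_forms A k"
proof -
  note uf = closed_forms_forms[OF u]
  have "ext_d k (cnj_form u) c z v = 0" if c: "c \<in> A" "z \<in> chart_image c" for c z v
  proof -
    have "frechet_derivative (\<lambda>y. cnj (u c y w)) (at z) x = cnj (frechet_derivative (\<lambda>y. u c y w) (at z) x)" for w x
    proof -
      have "((\<lambda>y. u c y w) has_derivative frechet_derivative (\<lambda>y. u c y w) (at z)) (at z)"
        using sform_differentiable[OF forms_sform[OF uf c(1)] c(2)] frechet_derivative_works by blast
      from bounded_linear.has_derivative[OF bounded_linear_cnj this] show ?thesis
        using frechet_derivative_eqI by (simp add: frechet_derivative_eqI)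
    qed
    then have "dloc k (cnj_form u c) z v = cnj (dloc k (u c) z v)"
      unfolding dloc_def cnj_form_def by simp
    moreover have "dloc k (u c) z v = 0" using ext_d_dloc[OF c(2), of k u v] closed_forms_d[OF u] by simp
    ultimately show ?thesis by (simp add: ext_d_dloc[OF c(2)])
  qed
  then have "ext_d k (cnj_form u) = 0"
    by (intro forms_ext[OF forms_ext_d[OF forms_cnj[OF uf]] forms_zero]) simp
  then show ?thesis using forms_cnj[OF uf] by (simp add: closed_forms_def)
qed

text \<open>Let D(x, y) be the derivative of u(y) in direction x; du = 0 says that D is symmetric.
  Symmetry cancels the antilinear parts in d of the (0,1)-part, so that only del remains, and the
  resulting bilinear form is invariant under i, hence of type (1,1).\<close>

lemma closed_1_form_p01:
  assumes u: "u \<in> closed_forms A 1"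
  shows "ext_d 1 (p01 u) = del 1 (p01 u)" "ext_d 1 (p01 u) \<in> forms_1_1 A"
proof -
  note uf = closed_forms_forms[OF u]
  define U where "U c y x = u c x (\<lambda>_. y)" for c y x
  define D where "D c z x y = frechet_derivative (U c y) (at z) x" for c z x y
  define G where "G c z y x = (1 / 2) * D c z x y + (\<i> / 2) * D c z x (\<i> *s y)" for c z y x
  have uU: "u c x v = U c (v 0) x" for c x v
  proof (cases "c \<in> A \<and> x \<in> chart_image c")
    case True
    then show ?thesis unfolding U_def by (intro alternating_cong[OF forms_alternating[OF uf]]) auto
  next
    case False
    then show ?thesis unfolding U_def using forms_outside[OF uf] by simp
  qed
  have dU: "U c y differentiable at z" if "c \<in> A" "z \<in> chart_image c" for c z y
    unfolding U_def by (rule sform_differentiable[OF forms_sform[OF uf that(1)] that(2)])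
  have e: "ext_with P 1 (p01 u) c z v = P (G c z (v 1)) (v 0) - P (G c z (v 0)) (v 1)"
    if c: "c \<in> A" "z \<in> chart_image c" for P c z v
  proof -
    have "frechet_derivative (\<lambda>x. p01 u c x w) (at z) = G c z (w 0)" for w
    proof
      fix x
      have d: "(U c y has_derivative (\<lambda>x. D c z x y)) (at z)" for y
        unfolding D_def using dU[OF c, of y] frechet_derivative_works by blast
      have "((\<lambda>x. (1 / 2) * U c (w 0) x + (\<i> / 2) * U c (\<i> *s w 0) x) has_derivative G c z (w 0)) (at z)"
        unfolding G_def by (intro has_derivative_add has_derivative_mult_right d)
      then show "frechet_derivative (\<lambda>x. p01 u c x w) (at z) x = G c z (w 0) x"
        unfolding p01_def uU[of c _ w] uU[of c _ "\<lambda>i. \<i> *s w i"] by (simp only: frechet_derivative_eqI)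
    qed
    then show ?thesis using c(2) by (simp add: ext_with_def)
  qed
  have sym: "D c z x y = D c z y x" if c: "c \<in> A" "z \<in> chart_image c" for c z x y
  proof -
    have "frechet_derivative (\<lambda>x. u c x w) (at z) = (\<lambda>x. D c z x (w 0))" for w
      unfolding uU[of c _ w] D_def ..
    then have "ext_d 1 u c z (x ## y ## v) = D c z x y - D c z y x" for v
      using c(2) by (simp add: ext_d_def ext_with_def)
    then show ?thesis using closed_forms_d[OF u] by simp
  qed
  have lin: "linear (\<lambda>x. D c z x y)" if c: "c \<in> A" "z \<in> chart_image c" for c z y
    unfolding D_def using dU[OF c] frechet_derivative_works has_derivative_linear by blast
  have Jm: "\<i> *s (\<i> *s x) = - x" for x :: "complex ^ 'n" by (simp add: vec_eq_iff)
  have neg: "D c z (- x) y = - D c z x y" "D c z x (- y) = - D c z x y" if "c \<in> A" "z \<in> chart_image c" for c z x y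
    using linear_neg[OF lin[OF that]] sym[OF that] by metis+
  have db: "antilinear_part (G c z y) x = antilinear_part (G c z x) y" if c: "c \<in> A" "z \<in> chart_image c" for c z x y
    unfolding antilinear_part_def G_def
    using sym[OF c, of y x] sym[OF c, of y "\<i> *s x"] sym[OF c, of "\<i> *s y" x] sym[OF c, of "\<i> *s y" "\<i> *s x"]
    by (simp add: algebra_simps)
  have dd: "ext_d 1 (p01 u) c z v = del 1 (p01 u) c z v" for c z v
  proof (cases "c \<in> A \<and> z \<in> chart_image c")
    case True
    then have c: "c \<in> A" "z \<in> chart_image c" by auto
    have "f x = linear_part f x + antilinear_part f x" for f :: "complex ^ 'n \<Rightarrow> complex" and x
      by (simp add: linear_part_def antilinear_part_def field_simps)
    then have "ext_with (\<lambda>L. L) 1 (p01 u) c z v = linear_part (G c z (v 1)) (v 0) + antilinear_part (G c z (v 1)) (v 0) -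
        (linear_part (G c z (v 0)) (v 1) + antilinear_part (G c z (v 0)) (v 1))"
      unfolding e[OF c] by presburger
    then show ?thesis unfolding ext_d_def del_def e[OF c] db[OF c, of "v 1" "v 0"] by simp
  next
    case False
    then show ?thesis
    proof (cases "z \<in> chart_image c")
      case True
      then have "c \<notin> A" using False by blast
      then have "p01 u c = (\<lambda>z v. 0)" using forms_outside[OF forms_p01[OF uf]] by (intro ext) blast
      then show ?thesis
        by (simp add: ext_d_def del_def ext_with_def linear_part_def frechet_derivative_const)
    qed (simp add: ext_d_def del_def ext_with_def)
  qed
  then show "ext_d 1 (p01 u) = del 1 (p01 u)" by (intro ext)
  have f2: "ext_d 1 (p01 u) \<in> forms A 2"
    using forms_ext_d[OF forms_p01[OF uf]] by (simp add: numeral_2_eq_2)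
  have "\<exists>a. \<forall>v. ext_d 1 (p01 u) c z v = (\<Sum>j\<in>UNIV. \<Sum>k\<in>UNIV. a j k * alt_wedge 1 1 (dz j) (dzbar k) v)"
    if c: "c \<in> A" "z \<in> chart_image c" for c z
  proof -
    define B where "B x y = (\<i> / 2) * D c z x (\<i> *s y) + (- \<i> / 2) * D c z (\<i> *s x) y" for x y
    have e: "ext_d 1 (p01 u) c z v = B (v 0) (v 1)" for v
      unfolding ext_d_def e[OF c] G_def B_def
      using sym[OF c, of "v 0" "v 1"] sym[OF c, of "v 1" "\<i> *s v 0"] by (simp add: algebra_simps)
    have B1: "linear (\<lambda>x. B x y)" for y unfolding B_def
      using linear_compose[OF linear_times_i lin[OF c, of y]]
      by (intro linear_compose_add linear_cmult lin[OF c]) (simp add: o_def)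
    have B2: "B y x = - B x y" for x y
      unfolding B_def using sym[OF c, of y "\<i> *s x"] sym[OF c, of "\<i> *s y" x] by (simp add: algebra_simps)
    have B3: "B (\<i> *s x) (\<i> *s y) = B x y" for x y
      unfolding B_def Jm neg[OF c] by (simp add: algebra_simps)
    show ?thesis unfolding e by (rule bilinear_type_1_1[OF B1 B2 B3])
  qed
  then show "ext_d 1 (p01 u) \<in> forms_1_1 A" unfolding forms_1_1_def using f2 by blast
qed

lemma delbar_0: "delbar 0 f = p01 (ext_d 0 f)" if f: "f \<in> forms A 0"
proof (intro ext)
  fix c z v
  have "f c y w = f c y w'" for y w w'
    using forms_alternating[OF f, of c y] forms_outside[OF f, of c y] unfolding alternating_0 by metis
  then have "(\<lambda>y. f c y w) = (\<lambda>y. f c y w')" for w w' by blast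
  from this[of "\<lambda>j. v (Suc j)" "\<lambda>j. \<i> *s v (Suc j)"] show "delbar 0 f c z v = p01 (ext_d 0 f) c z v"
    by (simp add: delbar_def p01_def ext_d_def ext_with_def antilinear_part_def add_divide_distrib)
qed

text \<open>The (0,1)-parts of u and of df have the same differential, because the former equals del
  delbar f by hypothesis and the latter always does. Their difference b is closed, and so is the
  rest a of u - df.\<close>

theorem closed_1_form_splits:
  assumes u: "u \<in> closed_forms A 1"
    and H: "\<forall>v\<in>forms_1_1 A. ext_d 2 v = 0 \<longrightarrow> v \<in> im_del A 1 \<longrightarrow> v \<in> im_del_delbar A 0"
  shows "\<exists>f\<in>forms A 0. \<exists>a\<in>closed_forms A 1. \<exists>b\<in>closed_forms A 1. u = ext_d 0 f + (a + b) \<and>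
    (\<forall>c\<in>A. \<forall>z\<in>chart_image c. \<forall>s x v. a c z ((s *s x) ## v) = s * a c z (x ## v) \<and>
       b c z ((s *s x) ## v) = cnj s * b c z (x ## v))"
proof -
  note uf = closed_forms_forms[OF u]
  note w = closed_1_form_p01[OF u]
  have "ext_d 2 (ext_d 1 (p01 u)) = 0" using ext_d_ext_d[OF forms_p01[OF uf]] by (simp add: numeral_2_eq_2)
  moreover have "ext_d 1 (p01 u) \<in> im_del A 1" unfolding im_del_def w(1) using forms_p01[OF uf] by blast
  ultimately have "ext_d 1 (p01 u) \<in> im_del_delbar A 0" using H w(2) by blast
  then obtain f where f: "f \<in> forms A 0" and df: "ext_d 1 (p01 u) = del (Suc 0) (delbar 0 f)"
    unfolding im_del_delbar_def by blast
  have dc: "ext_d 0 f \<in> closed_forms A 1"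
    using forms_ext_d[OF f] ext_d_ext_d[OF f] by (simp add: closed_forms_def)
  define g where "g = u - ext_d 0 f"
  have g: "g \<in> closed_forms A 1" unfolding g_def by (rule closed_diff[OF u dc])
  note gf = closed_forms_forms[OF g]
  define b where "b = p01 g"
  have bf: "b \<in> forms A 1" unfolding b_def by (rule forms_p01[OF gf])
  have "ext_d 1 b = ext_d 1 (p01 u) - ext_d 1 (p01 (ext_d 0 f))"
    unfolding b_def g_def p01_diff by (rule ext_d_diff[OF forms_p01[OF uf] forms_p01[OF closed_forms_forms[OF dc]]])
  also have "\<dots> = 0" unfolding df delbar_0[OF f] closed_1_form_p01(1)[OF dc] by simp
  finally have b: "b \<in> closed_forms A 1" using bf by (simp add: closed_forms_def)
  define a where "a = g - b"
  have a: "a \<in> closed_forms A 1" unfolding a_def by (rule closed_diff[OF g b])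
  have "a c z ((s *s x) ## v) = s * a c z (x ## v) \<and> b c z ((s *s x) ## v) = cnj s * b c z (x ## v)"
    if c: "c \<in> A" "z \<in> chart_image c" for c z s x v
  proof -
    have al: "alternating (Suc 0) (g c z)" "alternating (Suc 0) (a c z)" "alternating (Suc 0) (b c z)"
      using forms_alternating[OF gf c] forms_alternating[OF closed_forms_forms[OF a] c] forms_alternating[OF bf c] by simp_all
    have l: "linear (\<lambda>x. g c z (x ## v))" "linear (\<lambda>x. a c z (x ## v))" "linear (\<lambda>x. b c z (x ## v))"
      by (rule alternating_vcons_linear, rule al)+
    have J: "g c z (\<lambda>i. \<i> *s (x ## v) i) = g c z ((\<i> *s x) ## v)" for x
      by (rule alternating_cong[OF al(1)]) simp
    have Jm: "\<i> *s (\<i> *s x) = - x" for x :: "complex ^ 'n" by (simp add: vec_eq_iff)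
    have bi: "b c z ((\<i> *s x) ## v) = - \<i> * b c z (x ## v)" for x
      unfolding b_def p01_def J Jm linear_neg[OF l(1)] by (simp add: algebra_simps)
    have ai: "a c z ((\<i> *s x) ## v) = \<i> * a c z (x ## v)" for x
      unfolding a_def b_def p01_def fun_diff_def J Jm linear_neg[OF l(1)] by (simp add: algebra_simps)
    show ?thesis using complex_linear_from_i[OF l(2) ai, where s = s and x = x] complex_linear_from_i[OF l(3) bi, where s = s and x = x] by simp
  qed
  moreover have "u = ext_d 0 f + (a + b)" by (simp add: a_def g_def)
  ultimately show ?thesis using f a b by blast
qed

end

section \<open>The pairing on first cohomology\<close>

lemma alt_wedge_pull:
  "alt_wedge p q f g (\<lambda>i. L (v i)) = alt_wedge p q (\<lambda>v. f (\<lambda>i. L (v i))) (\<lambda>v. g (\<lambda>i. L (v i))) v"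
  by (simp add: alt_wedge_def)

text \<open>Pulling back along multiplication by i multiplies the product by s * s = -1, and, as it
  is a top form, by the real determinant of that map, which is positive. Only 0 satisfies
  both.\<close>

lemma same_type_wedge_zero:
  assumes t: "alternating p (t :: 'n::finite altform)" "\<And>v. t (\<lambda>i. \<i> *s v i) = t v"
    and a: "alternating 1 a" "\<And>v. a (\<lambda>i. \<i> *s v i) = s * a v"
    and b: "alternating 1 b" "\<And>v. b (\<lambda>i. \<i> *s v i) = s * b v"
    and s: "s * s = -1" and p: "Suc (Suc p) = 2 * CARD('n)"
  shows "alt_wedge (Suc p) 1 (alt_wedge p 1 t a) b v = 0"
proof -
  let ?T = "alt_wedge (Suc p) 1 (alt_wedge p 1 t a) b"
  have ta: "alternating (Suc p) (alt_wedge p 1 t a)" using alternating_alt_wedge[OF t(1) a(1)] by simp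
  have T: "alternating (2 * CARD('n)) ?T" using alternating_alt_wedge[OF ta b(1)] by (simp add: p)
  have "rdet (\<lambda>x. \<i> *s x :: complex ^ 'n) > 0"
    by (rule rdet_pos[where M = "\<lambda>x. - (\<i> *s x)"])
      (simp_all add: linear_times_i linear_compose_neg vec_eq_iff)
  moreover have "of_real (rdet (\<lambda>x. \<i> *s x :: complex ^ 'n)) * ?T v = s * s * ?T v"
    using top_form_rdet[OF T linear_times_i, of v]
    by (auto simp add: alt_wedge_pull[where L = "\<lambda>x. \<i> *s x"] t(2) a(2) b(2) alt_wedge_cmult_left alt_wedge_cmult_right)
  then have "of_real (rdet (\<lambda>x. \<i> *s x :: complex ^ 'n) + 1) * ?T v = 0" by (simp add: s algebra_simps)
  ultimately show ?thesis using of_real_eq_0_iff mult_eq_0_iff by (metis add_pos_pos less_irrefl zero_less_one)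
qed

definition is_hermitian :: "'n::finite altform \<Rightarrow> ('n \<Rightarrow> 'n \<Rightarrow> complex) \<Rightarrow> bool" where
  "is_hermitian w h \<longleftrightarrow> (\<forall>v. w v = \<i> * (\<Sum>j\<in>UNIV. \<Sum>k\<in>UNIV. h j k * alt_wedge 1 1 (dz j) (dzbar k) v)) \<and>
     (\<forall>j k. h k j = cnj (h j k)) \<and>
     (\<forall>x :: complex ^ 'n. x \<noteq> 0 \<longrightarrow> 0 < Re (\<Sum>j\<in>UNIV. \<Sum>k\<in>UNIV. h j k * x $ j * cnj (x $ k)))"

lemma is_hermitianD:
  assumes "is_hermitian w h"
  shows "\<And>v. w v = \<i> * (\<Sum>j\<in>UNIV. \<Sum>k\<in>UNIV. h j k * alt_wedge 1 1 (dz j) (dzbar k) v)"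
    "\<And>j k. h k j = cnj (h j k)"
    "\<And>x :: complex ^ 'n::finite. x \<noteq> 0 \<Longrightarrow> 0 < Re (\<Sum>j\<in>UNIV. \<Sum>k\<in>UNIV. h j k * x $ j * cnj (x $ k))"
  by (rule assms[unfolded is_hermitian_def, THEN conjunct1, rule_format],
      rule assms[unfolded is_hermitian_def, THEN conjunct2, THEN conjunct1, rule_format],
      rule assms[unfolded is_hermitian_def, THEN conjunct2, THEN conjunct2, rule_format])

lemma hermitian_J_invariant:
  assumes w: "\<And>v. w v = \<i> * (\<Sum>j\<in>UNIV. \<Sum>k\<in>UNIV. h j k * alt_wedge 1 1 (dz j) (dzbar k) v)"
  shows "w (\<lambda>i. \<i> *s v i) = (w :: 'n::finite altform) v"
proof -
  have "alt_wedge 1 1 (dz j) (dzbar k) (\<lambda>i. \<i> *s v i) = alt_wedge 1 1 (dz j) (dzbar k) v" for j k :: 'n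
  proof -
    have "(\<lambda>v. dz j (\<lambda>i. \<i> *s v i)) = (\<lambda>v. \<i> * dz j v)" "(\<lambda>v. dzbar k (\<lambda>i. \<i> *s v i)) = (\<lambda>v. - \<i> * dzbar k v)"
      by (simp_all add: dz_def dzbar_def fun_eq_iff)
    then show ?thesis unfolding alt_wedge_pull[where L = "\<lambda>x. \<i> *s x"]
      by (simp only: alt_wedge_cmult_left alt_wedge_cmult_right) simp
  qed
  then show ?thesis unfolding w by simp
qed

lemma pwr_J_invariant: "(\<And>v. w (\<lambda>i. \<i> *s v i) = w v) \<Longrightarrow> pwr w k (\<lambda>i. \<i> *s v i) = pwr w k v"
  by (induction k arbitrary: v) (simp_all add: alt_wedge_pull[where L = "\<lambda>x. \<i> *s x"])

text \<open>Linear algebra in C^S, with vectors given as functions of which only the values on S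
  count. Coordinates are eliminated one by one: an element x0 of W with value 1 at a serves as
  pivot, and the coefficient at a is chosen so that x0 is annihilated.\<close>

lemma separating_functional:
  fixes W :: "('s \<Rightarrow> complex) set"
  assumes "finite S" "\<And>x y. x \<in> W \<Longrightarrow> y \<in> W \<Longrightarrow> (\<lambda>s. x s + y s) \<in> W" "\<And>a x. x \<in> W \<Longrightarrow> (\<lambda>s. a * x s) \<in> W"
    "(\<lambda>s. 0) \<in> W" "\<And>x. x \<in> W \<Longrightarrow> \<exists>s\<in>S. x s \<noteq> y s"
  shows "\<exists>c. (\<forall>x\<in>W. (\<Sum>s\<in>S. c s * x s) = 0) \<and> (\<Sum>s\<in>S. c s * y s) \<noteq> 0"
  using assms
proof (induction S arbitrary: W y rule: finite_induct)
  case empty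
  then show ?case by blast
next
  case (insert a S)
  note W = insert.prems(1-3) and ne = insert.prems(4)
  have upd: "(\<Sum>s\<in>insert a S. (c(a := d)) s * x s) = d * x a + (\<Sum>s\<in>S. c s * x s)" for c x :: "'s \<Rightarrow> complex" and d
  proof -
    have "(\<Sum>s\<in>S. (c(a := d)) s * x s) = (\<Sum>s\<in>S. c s * x s)" using insert.hyps(2) by (intro sum.cong refl) auto
    then show ?thesis unfolding sum.insert[OF insert.hyps] by simp
  qed
  show ?case
  proof (cases "\<exists>x\<in>W. x a \<noteq> 0")
    case False
    show ?thesis
    proof (cases "y a = 0")
      case True
      have "\<exists>s\<in>S. x s \<noteq> y s" if "x \<in> W" for x using ne[OF that] False True that by auto
      then obtain c where c: "\<forall>x\<in>W. (\<Sum>s\<in>S. c s * x s) = 0" "(\<Sum>s\<in>S. c s * y s) \<noteq> 0"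
        using insert.IH[of W y] W by blast
      then show ?thesis by (intro exI[of _ "c(a := 0)"]) (simp only: upd mult_zero_left add_0_left, simp)
    next
      case False': False
      show ?thesis
        using False False' by (intro exI[of _ "(\<lambda>_. 0)(a := 1)"]) (simp only: upd, simp)
    qed
  next
    case True
    then obtain x1 where x1: "x1 \<in> W" "x1 a \<noteq> 0" by blast
    define x0 where "x0 s = inverse (x1 a) * x1 s" for s
    have x0: "x0 \<in> W" "x0 a = 1" using W(2)[OF x1(1), of "inverse (x1 a)"] x1(2) by (simp_all add: x0_def[abs_def])
    let ?W = "{x \<in> W. x a = 0}" and ?y = "\<lambda>s. y s + (- y a) * x0 s"
    have sub: "(\<lambda>s. x s + (- x a) * x0 s) \<in> ?W" if "x \<in> W" for x
      using W(1)[OF that W(2)[OF x0(1)], of "- x a"] x0(2) by simp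
    have ne': "\<exists>s\<in>S. x s \<noteq> ?y s" if x: "x \<in> ?W" for x
    proof (rule ccontr)
      assume "\<not> (\<exists>s\<in>S. x s \<noteq> ?y s)"
      then have "\<forall>s\<in>insert a S. x s + y a * x0 s = y s" using x x0(2) by auto
      moreover have "(\<lambda>s. x s + y a * x0 s) \<in> W" by (rule W(1)[OF _ W(2)[OF x0(1)]]) (use x in simp)
      ultimately show False using ne by blast
    qed
    have "\<exists>c. (\<forall>x\<in>?W. (\<Sum>s\<in>S. c s * x s) = 0) \<and> (\<Sum>s\<in>S. c s * ?y s) \<noteq> 0"
    proof (rule insert.IH)
      show "(\<lambda>s. x s + y s) \<in> ?W" if "x \<in> ?W" "y \<in> ?W" for x y using that W(1) by simp
      show "(\<lambda>s. b * x s) \<in> ?W" if "x \<in> ?W" for b x using that W(2) by simp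
      show "(\<lambda>s. 0) \<in> ?W" using W(3) by simp
    qed (rule ne')
    then obtain c where c: "\<And>x. x \<in> ?W \<Longrightarrow> (\<Sum>s\<in>S. c s * x s) = 0" "(\<Sum>s\<in>S. c s * ?y s) \<noteq> 0" by blast
    have split: "(\<Sum>s\<in>S. c s * (x s + (- b) * x0 s)) = - (\<Sum>s\<in>S. c s * x0 s) * b + (\<Sum>s\<in>S. c s * x s)" for x b
      by (simp add: algebra_simps sum.distrib sum_subtractf sum_distrib_left)
    show ?thesis
    proof (intro exI[of _ "c(a := - (\<Sum>s\<in>S. c s * x0 s))"] conjI ballI)
      fix x assume "x \<in> W"
      from c(1)[OF sub[OF this]] show "(\<Sum>s\<in>insert a S. (c(a := - (\<Sum>s\<in>S. c s * x0 s))) s * x s) = 0"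
        unfolding upd split .
    next
      show "(\<Sum>s\<in>insert a S. (c(a := - (\<Sum>s\<in>S. c s * x0 s))) s * y s) \<noteq> 0"
        using c(2) unfolding upd split .
    qed
  qed
qed

context complex_mfd
begin

lemma wedge_power2_pwr: "c \<in> A \<Longrightarrow> z \<in> chart_image c \<Longrightarrow> wedge_power2 A \<omega> k c z = pwr (\<omega> c z) k"
  by (induction k) (simp_all add: unit_form_def wedge_def)

lemma forms_1_J:
  assumes "u \<in> forms A 1" "c \<in> A" "z \<in> chart_image c" "\<And>x v. u c z ((\<i> *s x) ## v) = s * u c z (x ## v)"
  shows "u c z (\<lambda>i. \<i> *s v i) = s * u c z v"
proof -
  have "u c z (\<lambda>i. \<i> *s v i) = u c z ((\<i> *s v 0) ## (\<lambda>i. v (Suc i)))"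
    by (rule alternating_cong[OF forms_alternating[OF assms(1-3)]]) simp
  then show ?thesis unfolding assms(4) vcons_eta .
qed

end

text \<open>l is the degree 2n - 2 of \<theta>, fixed by an equation so that degrees are successors
  and not differences of naturals.\<close>

locale balanced_mfd = compact_mfd X A for X :: "'a topology" and A :: "('a, 'n::finite) chart set" +
  fixes \<omega> :: "('a, 'n) form" and l :: nat
  assumes balanced: "balanced_metric A \<omega>" and l: "Suc (Suc l) = 2 * CARD('n)"
begin

abbreviation \<theta> :: "('a, 'n) form" where
  "\<theta> \<equiv> divided_power A \<omega> (CARD('n) - 1)"

lemma theta_closed: "\<theta> \<in> closed_forms A l"
  using balanced_divided_power_closed[OF balanced] l by (metis diff_Suc_1 diff_Suc_Suc diff_Suc_eq_diff_pred numeral_2_eq_2 minus_nat.diff_0)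

lemma theta_pwr: "c \<in> A \<Longrightarrow> z \<in> chart_image c \<Longrightarrow> \<theta> c z = (\<lambda>v. 1 / fact (CARD('n) - 1) * pwr (\<omega> c z) (CARD('n) - 1) v)"
  by (simp add: divided_power_def scale_form_def wedge_power2_pwr)

lemma forms_pairing: "a \<in> forms A 1 \<Longrightarrow> b \<in> forms A 1 \<Longrightarrow> wedge (Suc l) 1 (wedge l 1 \<theta> a) b \<in> forms A (2 * CARD('n))"
  using forms_wedge[OF forms_wedge[OF closed_forms_forms[OF theta_closed]], of a 1 b 1] by (simp add: l)

lemma metric_at:
  assumes "c \<in> A" "z \<in> chart_image c"
  shows "\<exists>h. is_hermitian (\<omega> c z) h"
  unfolding is_hermitian_def
  by (rule balanced[unfolded balanced_metric_def hermitian_metric_def, THEN conjunct1, THEN conjunct2, THEN bspec, THEN bspec, OF assms])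

lemma pairing_same_type:
  assumes a: "a \<in> forms A 1" "b \<in> forms A 1" and s: "s * s = - 1"
    and J: "\<And>c z x v. c \<in> A \<Longrightarrow> z \<in> chart_image c \<Longrightarrow> a c z ((\<i> *s x) ## v) = s * a c z (x ## v)"
      "\<And>c z x v. c \<in> A \<Longrightarrow> z \<in> chart_image c \<Longrightarrow> b c z ((\<i> *s x) ## v) = s * b c z (x ## v)"
  shows "wedge (Suc l) 1 (wedge l 1 \<theta> a) b = 0"
proof (rule forms_ext[OF forms_pairing[OF a] forms_zero])
  fix c z v assume c: "c \<in> A" "z \<in> chart_image c"
  obtain h where h: "is_hermitian (\<omega> c z) h" using metric_at[OF c] by blast
  have "\<theta> c z (\<lambda>i. \<i> *s v i) = \<theta> c z v" for v
    unfolding theta_pwr[OF c] using pwr_J_invariant[where w = "\<omega> c z", OF hermitian_J_invariant[OF is_hermitianD(1)[OF h]]] by simp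
  then have "alt_wedge (Suc l) 1 (alt_wedge l 1 (\<theta> c z) (a c z)) (b c z) v = 0"
    by (rule same_type_wedge_zero[OF forms_alternating[OF closed_forms_forms[OF theta_closed] c] _
      forms_alternating[OF a(1) c] forms_1_J[OF a(1) c J(1)[OF c]] forms_alternating[OF a(2) c] forms_1_J[OF a(2) c J(2)[OF c]] s l])
  then show "wedge (Suc l) 1 (wedge l 1 \<theta> a) b c z v = 0 c z v" by (simp add: wedge_def)
qed

text \<open>By \<open>hermitian_wedge_positive\<close> the integrand is -i times a nonnegative
  function at every point, so after multiplication by i the definiteness of the integral
  applies.\<close>

lemma pairing_definite:
  assumes a: "a \<in> forms A 1" and J: "\<And>c z s x v. c \<in> A \<Longrightarrow> z \<in> chart_image c \<Longrightarrow> a c z ((s *s x) ## v) = s * a c z (x ## v)"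
    and z: "integ (wedge (Suc l) 1 (wedge l 1 \<theta> a) (cnj_form a)) = 0"
  shows "a = 0"
proof -
  let ?T = "wedge (Suc l) 1 (wedge l 1 \<theta> a) (cnj_form a)"
  let ?f = "fact (CARD('n) - 1) :: real"
  have T: "?T \<in> forms A (2 * CARD('n))" by (rule forms_pairing[OF a forms_cnj[OF a]])
  have pt: "\<exists>t\<ge>0. ?T c z std = - \<i> * complex_of_real t \<and> (t = 0 \<longrightarrow> (\<forall>v. a c z v = 0))" if c: "c \<in> A" "z \<in> chart_image c" for c z
  proof -
    obtain h where h: "is_hermitian (\<omega> c z) h" using metric_at[OF c] by blast
    have l2: "2 * (CARD('n) - 1) = l" using l by simp
    obtain t where t: "t \<ge> 0" "alt_wedge (Suc l) 1 (alt_wedge l 1 (pwr (\<omega> c z) (CARD('n) - 1)) (a c z)) (\<lambda>v. cnj (a c z v)) std =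
        - \<i> * complex_of_real t" "t = 0 \<longrightarrow> (\<forall>v. a c z v = 0)"
      using hermitian_wedge_positive[OF is_hermitianD[OF h] forms_alternating[OF a c] J[OF c]] unfolding l2 by blast
    have e: "alt_wedge l 1 (\<theta> c z) (a c z) = (\<lambda>v. 1 / fact (CARD('n) - 1) * alt_wedge l 1 (pwr (\<omega> c z) (CARD('n) - 1)) (a c z) v)"
      unfolding theta_pwr[OF c] by (rule ext) (rule alt_wedge_cmult_left)
    have "?T c z std = - \<i> * complex_of_real (t / ?f)"
      unfolding wedge_def cnj_form_def e alt_wedge_cmult_left t(2) by simp
    then show ?thesis using t(1,3) by (intro exI[of _ "t / ?f"]) simp
  qed
  have "scale_form \<i> ?T = 0"
  proof (rule integ_pos[OF forms_scale[OF T]])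
    show "integ (scale_form \<i> ?T) = 0" using integ_scale[OF T] z by simp
    show "\<exists>t\<ge>0. scale_form \<i> ?T c z std = complex_of_real t" if "c \<in> A" "z \<in> chart_image c" for c z
      using pt[OF that] by (auto simp: scale_form_def)
  qed
  from arg_cong[OF this, of "\<lambda>F. F c z std" for c z] have z0: "?T c z std = 0" for c z by (simp add: scale_form_def)
  show "a = 0"
  proof (rule forms_ext[OF a forms_zero])
    fix c z v assume "c \<in> A" "z \<in> chart_image c"
    from pt[OF this] show "a c z v = 0 c z v" unfolding z0 by auto
  qed
qed

lemma integ_exact: "x \<in> exact_forms A (Suc (Suc l)) \<Longrightarrow> integ x = 0"
  unfolding exact_iff using integ_ext_d l by blast

lemma pairing_swap:
  assumes "a \<in> forms A 1" "b \<in> forms A 1"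
  shows "wedge (Suc l) 1 (wedge l 1 \<theta> a) b = scale_form (- 1) (wedge (Suc l) 1 (wedge l 1 \<theta> b) a)"
proof (rule forms_ext[OF forms_pairing[OF assms] forms_scale[OF forms_pairing[OF assms(2,1)]]])
  fix c z v assume c: "c \<in> A" "z \<in> chart_image c"
  show "wedge (Suc l) 1 (wedge l 1 \<theta> a) b c z v = scale_form (- 1) (wedge (Suc l) 1 (wedge l 1 \<theta> b) a) c z v"
    using alt_wedge_swap_1_forms[OF forms_alternating[OF closed_forms_forms[OF theta_closed] c]
      forms_alternating[OF assms(1) c] forms_alternating[OF assms(2) c]] by (simp add: wedge_def scale_form_def)
qed

lemma pairing_exact:
  assumes u: "u \<in> exact_forms A 1" and w: "w \<in> closed_forms A 1"
  shows "integ (wedge (Suc l) 1 (wedge l 1 \<theta> u) w) = 0"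
proof -
  have "wedge l 1 \<theta> u \<in> exact_forms A (Suc l)" using wedge_exact_right[OF theta_closed, of u 0] u by simp
  from wedge_exact_left[OF this w] show ?thesis by (intro integ_exact) simp
qed

theorem pairing_nondegenerate:
  assumes H: "\<forall>v\<in>forms_1_1 A. ext_d 2 v = 0 \<longrightarrow> v \<in> im_del A 1 \<longrightarrow> v \<in> im_del_delbar A 0"
    and u: "u \<in> closed_forms A 1"
    and z: "\<And>w. w \<in> closed_forms A 1 \<Longrightarrow> integ (wedge (Suc l) 1 (wedge l 1 \<theta> u) w) = 0"
  shows "u \<in> exact_forms A 1"
proof -
  obtain f a b where f: "f \<in> forms A 0" and a: "a \<in> closed_forms A 1" and b: "b \<in> closed_forms A 1"
    and uab: "u = ext_d 0 f + (a + b)"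
    and J: "\<forall>c\<in>A. \<forall>z\<in>chart_image c. \<forall>s x v. a c z ((s *s x) ## v) = s * a c z (x ## v) \<and>
       b c z ((s *s x) ## v) = cnj s * b c z (x ## v)"
    using closed_1_form_splits[OF u H] by blast
  note af = closed_forms_forms[OF a] and bf = closed_forms_forms[OF b]
  have Ja: "a c z ((s *s x) ## v) = s * a c z (x ## v)" and Jb: "b c z ((s *s x) ## v) = cnj s * b c z (x ## v)"
    if "c \<in> A" "z \<in> chart_image c" for c z s x v using J that by blast+
  have df: "ext_d 0 f \<in> exact_forms A 1" using f exact_iff[of _ 0] by auto
  have split: "integ (wedge (Suc l) 1 (wedge l 1 \<theta> a) w) + integ (wedge (Suc l) 1 (wedge l 1 \<theta> b) w) = 0"
    if w: "w \<in> closed_forms A 1" for w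
  proof -
    note wf = closed_forms_forms[OF w]
    have d: "ext_d 0 f \<in> forms A 1" using forms_ext_d[OF f] by simp
    show ?thesis
      using z[OF w] pairing_exact[OF df w] unfolding uab wedge_add_right wedge_add_left
      by (simp only: integ_add[OF forms_pairing[OF d wf] forms_add[OF forms_pairing[OF af wf] forms_pairing[OF bf wf]]]
        integ_add[OF forms_pairing[OF af wf] forms_pairing[OF bf wf]] add_0_left)
  qed
  have ca: "cnj_form a \<in> closed_forms A 1" and cb: "cnj_form b \<in> closed_forms A 1" by (rule closed_cnj[OF a], rule closed_cnj[OF b])
  \<comment> \<open>The conjugate of a has the type of b, so testing with it removes b and isolates
    the pairing of a with its conjugate.\<close>
  have "wedge (Suc l) 1 (wedge l 1 \<theta> b) (cnj_form a) = 0"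
    by (rule pairing_same_type[OF bf closed_forms_forms[OF ca], of "- \<i>"]) (simp_all add: Ja Jb cnj_form_def)
  then have "a = 0" using split[OF ca] by (intro pairing_definite[OF af Ja]) (simp_all add: integ_zero)
  have "wedge (Suc l) 1 (wedge l 1 \<theta> a) (cnj_form b) = 0"
    by (rule pairing_same_type[OF af closed_forms_forms[OF cb], of "\<i>"]) (simp_all add: Ja Jb cnj_form_def)
  then have "integ (wedge (Suc l) 1 (wedge l 1 \<theta> b) (cnj_form b)) = 0" using split[OF cb] by (simp add: integ_zero)
  \<comment> \<open>\<open>pairing_definite\<close> is about complex linear forms. For b it is
    applied to the conjugate of b, after exchanging the two arguments at the cost of a sign.\<close>
  moreover have "cnj_form (cnj_form b) = b" by (simp add: cnj_form_def)
  ultimately have "integ (wedge (Suc l) 1 (wedge l 1 \<theta> (cnj_form b)) (cnj_form (cnj_form b))) = 0"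
    using pairing_swap[OF closed_forms_forms[OF cb] bf] integ_scale[OF forms_pairing[OF bf closed_forms_forms[OF cb]]] by simp
  then have "cnj_form b = 0"
    by (intro pairing_definite[OF closed_forms_forms[OF cb]]) (simp_all add: Jb cnj_form_def)
  then have "b = 0" by (simp add: cnj_form_def fun_eq_iff)
  then show ?thesis using df \<open>a = 0\<close> by (simp add: uab)
qed

lemma theta_injective:
  assumes H: "\<forall>v\<in>forms_1_1 A. ext_d 2 v = 0 \<longrightarrow> v \<in> im_del A 1 \<longrightarrow> v \<in> im_del_delbar A 0"
    and u: "u \<in> closed_forms A 1" and ex: "wedge l 1 \<theta> u \<in> exact_forms A (Suc l)"
  shows "u \<in> exact_forms A 1"
proof (rule pairing_nondegenerate[OF H u])
  fix w assume "w \<in> closed_forms A 1"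
  from wedge_exact_left[OF ex this] show "integ (wedge (Suc l) 1 (wedge l 1 \<theta> u) w) = 0" by (intro integ_exact) simp
qed

theorem theta_surjective:
  assumes H: "\<forall>v\<in>forms_1_1 A. ext_d 2 v = 0 \<longrightarrow> v \<in> im_del A 1 \<longrightarrow> v \<in> im_del_delbar A 0"
    and g: "\<gamma> \<in> closed_forms A (Suc l)"
  shows "\<exists>u\<in>closed_forms A 1. \<gamma> - wedge l 1 \<theta> u \<in> exact_forms A (Suc l)"
proof -
  obtain S :: "('a \<times> 'a \<times> 'a) set" and \<xi> where all: "finite S \<and> (\<forall>s\<in>S. \<xi> s \<in> forms A 1) \<and>
    (\<forall>\<gamma>\<in>closed_forms A (Suc l). (\<forall>s\<in>S. integ (wedge (Suc l) 1 \<gamma> (\<xi> s)) = 0) \<longrightarrow> \<gamma> \<in> exact_forms A (Suc l))"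
    using exactness_test_forms[OF l] by (elim exE)
  have S: "finite S" and \<xi>: "\<And>s. s \<in> S \<Longrightarrow> \<xi> s \<in> forms A 1"
    and test: "\<And>\<gamma>. \<gamma> \<in> closed_forms A (Suc l) \<Longrightarrow> (\<And>s. s \<in> S \<Longrightarrow> integ (wedge (Suc l) 1 \<gamma> (\<xi> s)) = 0) \<Longrightarrow> \<gamma> \<in> exact_forms A (Suc l)"
    using all by simp_all
  define t where "t \<gamma> s = integ (wedge (Suc l) 1 \<gamma> (\<xi> s))" for \<gamma> s
  have wf: "wedge (Suc l) 1 x y \<in> forms A (2 * CARD('n))" if "x \<in> forms A (Suc l)" "y \<in> forms A 1" for x y
    using forms_wedge[OF that] by (simp add: l)
  have tadd: "t (x + y) s = t x s + t y s" if "x \<in> forms A (Suc l)" "y \<in> forms A (Suc l)" "s \<in> S" for x y s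
    unfolding t_def wedge_add_left by (rule integ_add[OF wf[OF that(1) \<xi>[OF that(3)]] wf[OF that(2) \<xi>[OF that(3)]]])
  have tscale: "t (scale_form r x) s = r * t x s" if "x \<in> forms A (Suc l)" "s \<in> S" for x s r
    unfolding t_def wedge_scale_left by (rule integ_scale[OF wf[OF that(1) \<xi>[OF that(2)]]])
  define Z where "Z = {wedge l 1 \<theta> w + ext_d l \<eta> | w \<eta>. w \<in> closed_forms A 1 \<and> \<eta> \<in> forms A l}"
  have Zf: "x \<in> closed_forms A (Suc l)" if "x \<in> Z" for x
  proof -
    obtain w \<eta> where x: "x = wedge l 1 \<theta> w + ext_d l \<eta>" "w \<in> closed_forms A 1" "\<eta> \<in> forms A l" using \<open>x \<in> Z\<close> unfolding Z_def by blast
    have "ext_d l \<eta> \<in> closed_forms A (Suc l)" using forms_ext_d[OF x(3)] ext_d_ext_d[OF x(3)] by (simp add: closed_forms_def)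
    then show ?thesis unfolding x(1) using wedge_closed[OF theta_closed x(2)] closed_add by simp
  qed
  have ZI: "wedge l 1 \<theta> w + ext_d l \<eta> \<in> Z" if "w \<in> closed_forms A 1" "\<eta> \<in> forms A l" for w \<eta>
    unfolding Z_def using that by blast
  have ZE: "\<exists>w \<eta>. x = wedge l 1 \<theta> w + ext_d l \<eta> \<and> w \<in> closed_forms A 1 \<and> \<eta> \<in> forms A l" if "x \<in> Z" for x
    using that unfolding Z_def by blast
  \<comment> \<open>Functions that agree on S with a tuple of test values; their values elsewhere
    are arbitrary, which fits \<open>separating_functional\<close>.\<close>
  define W where "W = {x. \<exists>y\<in>Z. \<forall>s\<in>S. x s = t y s}"
  have WI: "x \<in> W" if "y \<in> Z" "\<forall>s\<in>S. x s = t y s" for x y using that unfolding W_def by blast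
  have WE: "\<exists>y. y \<in> Z \<and> (\<forall>s\<in>S. x s = t y s)" if "x \<in> W" for x using that unfolding W_def by blast
  have "\<exists>x\<in>Z. \<forall>s\<in>S. t x s = t \<gamma> s"
  proof (rule ccontr)
    assume no: "\<not> (\<exists>x\<in>Z. \<forall>s\<in>S. t x s = t \<gamma> s)"
    have "\<exists>c. (\<forall>x\<in>W. (\<Sum>s\<in>S. c s * x s) = 0) \<and> (\<Sum>s\<in>S. c s * t \<gamma> s) \<noteq> 0"
    proof (rule separating_functional[OF S])
      fix x y assume "x \<in> W" "y \<in> W"
      then obtain x' y' where xy: "x' \<in> Z" "\<forall>s\<in>S. x s = t x' s" "y' \<in> Z" "\<forall>s\<in>S. y s = t y' s"
        using WE by meson
      obtain w \<eta> w' \<eta>' where e: "x' = wedge l 1 \<theta> w + ext_d l \<eta>" "w \<in> closed_forms A 1" "\<eta> \<in> forms A l"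
        "y' = wedge l 1 \<theta> w' + ext_d l \<eta>'" "w' \<in> closed_forms A 1" "\<eta>' \<in> forms A l"
        using ZE[OF xy(1)] ZE[OF xy(3)] by (elim exE conjE)
      have "x' + y' = wedge l 1 \<theta> (w + w') + ext_d l (\<eta> + \<eta>')"
        unfolding e(1,4) wedge_add_right ext_d_add[OF e(3,6)] by (simp only: add.assoc add.left_commute)
      then have Z: "x' + y' \<in> Z" using ZI[OF closed_add[OF e(2,5)] forms_add[OF e(3,6)]] by simp
      have "\<forall>s\<in>S. x s + y s = t (x' + y') s"
        using xy(2,4) tadd[OF closed_forms_forms[OF Zf[OF xy(1)]] closed_forms_forms[OF Zf[OF xy(3)]]] by simp
      with Z show "(\<lambda>s. x s + y s) \<in> W" by (rule WI)
    next
      fix r x assume "x \<in> W"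
      then obtain x' where xy: "x' \<in> Z" "\<forall>s\<in>S. x s = t x' s" using WE by meson
      obtain w \<eta> where e: "x' = wedge l 1 \<theta> w + ext_d l \<eta>" "w \<in> closed_forms A 1" "\<eta> \<in> forms A l"
        using ZE[OF xy(1)] by (elim exE conjE)
      have "scale_form r x' = wedge l 1 \<theta> (scale_form r w) + ext_d l (scale_form r \<eta>)"
        unfolding e(1) wedge_scale_right ext_d_scale[OF e(3)] scale_form_add ..
      then have Z: "scale_form r x' \<in> Z" using ZI[OF closed_scale[OF e(2)] forms_scale[OF e(3)]] by simp
      have "\<forall>s\<in>S. r * x s = t (scale_form r x') s"
        using xy(2) tscale[OF closed_forms_forms[OF Zf[OF xy(1)]]] by simp
      with Z show "(\<lambda>s. r * x s) \<in> W" by (rule WI)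
    next
      have z1: "(0 :: ('a, 'n) form) \<in> closed_forms A 1" using forms_zero ext_d_zero by (simp add: closed_forms_def)
      have Z: "wedge l 1 \<theta> 0 + ext_d l 0 \<in> Z" by (rule ZI[OF z1 forms_zero])
      have "\<forall>s\<in>S. 0 = t (wedge l 1 \<theta> 0 + ext_d l 0) s"
        unfolding t_def by (simp only: wedge_zero_right ext_d_zero add_0 wedge_zero_left integ_zero) simp
      with Z show "(\<lambda>s. 0) \<in> W" by (rule WI)
    next
      fix x assume "x \<in> W"
      then obtain y where "y \<in> Z" "\<forall>s\<in>S. x s = t y s" using WE by meson
      then show "\<exists>s\<in>S. x s \<noteq> t \<gamma> s" using no by metis
    qed
    then obtain c where c: "\<And>x. x \<in> W \<Longrightarrow> (\<Sum>s\<in>S. c s * x s) = 0" "(\<Sum>s\<in>S. c s * t \<gamma> s) \<noteq> 0" by blast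
    define u where "u = (\<Sum>s\<in>S. scale_form (c s) (\<xi> s))"
    have u: "u \<in> forms A 1" unfolding u_def by (intro forms_sum forms_scale \<xi>)
    have tu: "(\<Sum>s\<in>S. c s * t x s) = integ (wedge (Suc l) 1 x u)" if x: "x \<in> forms A (Suc l)" for x
    proof -
      have "integ (wedge (Suc l) 1 x u) = (\<Sum>s\<in>S. integ (scale_form (c s) (wedge (Suc l) 1 x (\<xi> s))))"
        unfolding u_def wedge_sum_right wedge_scale_right by (intro integ_sum forms_scale wf x \<xi>)
      also have "\<dots> = (\<Sum>s\<in>S. c s * t x s)" unfolding t_def by (intro sum.cong refl integ_scale wf x \<xi>)
      finally show ?thesis ..
    qed
    have Zu: "integ (wedge (Suc l) 1 x u) = 0" if "x \<in> Z" for x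
    proof -
      have "t x \<in> W" by (rule WI[OF that]) simp
      then show ?thesis using c(1) tu[OF closed_forms_forms[OF Zf[OF that]]] by simp
    qed
    \<comment> \<open>Taking w = 0 in \<open>Z\<close>, u annihilates every d\<eta>. Stokes for
      \<eta> ^ u, with l even, moves d onto u, and \<open>integ_nondegenerate\<close> gives du =
      0.\<close>
    have du: "ext_d 1 u = 0"
    proof (rule integ_nondegenerate[OF l])
      show d2: "ext_d 1 u \<in> forms A 2" using forms_ext_d[OF u] by (simp add: numeral_2_eq_2)
      fix \<eta> assume \<eta>: "\<eta> \<in> forms A l"
      have z1: "(0 :: ('a, 'n) form) \<in> closed_forms A 1" using forms_zero ext_d_zero by (simp add: closed_forms_def)
      have "wedge l 1 \<theta> 0 + ext_d l \<eta> \<in> Z" by (rule ZI[OF z1 \<eta>])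
      then have "integ (wedge (Suc l) 1 (ext_d l \<eta>) u) = 0" using Zu unfolding wedge_zero_right by simp
      moreover have "even l" using l by (metis even_Suc even_mult_iff even_numeral)
      then have "ext_d (Suc l) (wedge l 1 \<eta> u) = wedge (Suc l) 1 (ext_d l \<eta>) u + wedge l 2 \<eta> (ext_d 1 u)"
        using ext_d_wedge[OF \<eta> u] by (simp add: scale_form_def numeral_2_eq_2)
      moreover have "integ (ext_d (Suc l) (wedge l 1 \<eta> u)) = 0"
        using integ_ext_d[of "wedge l 1 \<eta> u" "Suc l"] forms_wedge[OF \<eta> u] l by simp
      moreover have "wedge l 2 \<eta> (ext_d 1 u) \<in> forms A (2 * CARD('n))" using forms_wedge[OF \<eta> d2] by (simp add: l[symmetric])
      ultimately show "integ (wedge l 2 \<eta> (ext_d 1 u)) = 0"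
        using integ_add[OF wf[OF forms_ext_d[OF \<eta>] u]] by simp
    qed
    then have uc: "u \<in> closed_forms A 1" using u by (simp add: closed_forms_def)
    have "u \<in> exact_forms A 1"
    proof (rule pairing_nondegenerate[OF H uc])
      fix w assume w: "w \<in> closed_forms A 1"
      have "wedge l 1 \<theta> w + ext_d l 0 \<in> Z" by (rule ZI[OF w forms_zero])
      then have "integ (wedge (Suc l) 1 (wedge l 1 \<theta> w) u) = 0" using Zu unfolding ext_d_zero by simp
      then show "integ (wedge (Suc l) 1 (wedge l 1 \<theta> u) w) = 0"
        unfolding pairing_swap[OF u closed_forms_forms[OF w]] integ_scale[OF forms_pairing[OF closed_forms_forms[OF w] u]] by simp
    qed
    then have "wedge (Suc l) 1 \<gamma> u \<in> exact_forms A (Suc (Suc l))" using wedge_exact_right[OF g, of u 0] by simp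
    then have "integ (wedge (Suc l) 1 \<gamma> u) = 0" by (rule integ_exact)
    then show False using c(2) tu[OF closed_forms_forms[OF g]] by simp
  qed
  then obtain x where x: "x \<in> Z" and eq: "\<And>s. s \<in> S \<Longrightarrow> t x s = t \<gamma> s" by meson
  obtain w \<eta> where xw: "x = wedge l 1 \<theta> w + ext_d l \<eta>" and w: "w \<in> closed_forms A 1" and \<eta>: "\<eta> \<in> forms A l"
    using ZE[OF x] by (elim exE conjE)
  \<comment> \<open>x has the same test values as \<gamma>, so the difference passes all tests for
    exactness.\<close>
  have "\<gamma> - x \<in> exact_forms A (Suc l)"
  proof (rule test)
    show "\<gamma> - x \<in> closed_forms A (Suc l)" by (rule closed_diff[OF g Zf[OF x]])
    fix s assume s: "s \<in> S"
    have "t (\<gamma> - x + x) s = t (\<gamma> - x) s + t x s"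
      by (rule tadd[OF closed_forms_forms[OF closed_diff[OF g Zf[OF x]]] closed_forms_forms[OF Zf[OF x]] s])
    then show "integ (wedge (Suc l) 1 (\<gamma> - x) (\<xi> s)) = 0" using eq[OF s] by (simp add: t_def)
  qed
  moreover have "ext_d l \<eta> \<in> exact_forms A (Suc l)" using \<eta> exact_iff by blast
  ultimately have "\<gamma> - x + ext_d l \<eta> \<in> exact_forms A (Suc l)" by (rule exact_add)
  then have "\<gamma> - wedge l 1 \<theta> w \<in> exact_forms A (Suc l)" by (simp add: xw algebra_simps)
  then show ?thesis using w by blast
qed

end

theorem theorem1p1:
  fixes X :: "'a topology"
    and A :: "('a, 'n::finite) chart set"
    and n :: nat
    and \<omega> :: "('a, 'n) form"
  assumes "complex_manifold X A"
    and "compact_space X"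
    and "CARD('n) = n"
    and "n \<ge> 2"
    and "balanced_metric A \<omega>"
  shows
    "(divided_power A \<omega> (n - 1) \<in> closed_forms A (2 * n - 2) \<and>
      wedge_well_defined A (2 * n - 2) 1 (divided_power A \<omega> (n - 1)) \<and>
      dR_linear A 1 (2 * n - 1) (dR_wedge A (2 * n - 2) 1 (divided_power A \<omega> (n - 1))) \<and>
      (\<forall>u\<in>closed_forms A 1.
         dR_wedge A (2 * n - 2) 1 (divided_power A \<omega> (n - 1)) (dR_class A 1 u) =
         dR_class A (2 * n - 1) (wedge (2 * n - 2) 1 (divided_power A \<omega> (n - 1)) u)) \<and>
      (\<forall>\<theta>\<in>closed_forms A (2 * n - 2).
         dR_class A (2 * n - 2) \<theta> = dR_class A (2 * n - 2) (divided_power A \<omega> (n - 1)) \<longrightarrow>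
         wedge_well_defined A (2 * n - 2) 1 \<theta> \<and>
         (\<forall>a\<in>dR A 1. dR_wedge A (2 * n - 2) 1 \<theta> a =
                     dR_wedge A (2 * n - 2) 1 (divided_power A \<omega> (n - 1)) a)))
     \<and>
     ((\<forall>v\<in>forms_1_1 A. ext_d 2 v = 0 \<longrightarrow> v \<in> im_del A 1 \<longrightarrow> v \<in> im_del_delbar A 0) \<longrightarrow>
      dR_isomorphism A 1 (2 * n - 1) (dR_wedge A (2 * n - 2) 1 (divided_power A \<omega> (n - 1))))"
  
proof -
  have l: "Suc (Suc (2 * n - 2)) = 2 * CARD('n)" using assms(3,4) by simp
  interpret balanced_mfd X A \<omega> "2 * n - 2"
    by unfold_locales (use assms(1,2,5) l in simp_all)
  let ?t = "divided_power A \<omega> (n - 1)"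
  have d: "2 * n - 1 = 2 * n - 2 + 1" "Suc (2 * n - 2) = 2 * n - 2 + 1" using assms(4) by simp_all
  \<comment> \<open>Exactness in degree 2n - 2 refers to a primitive of degree 2n - 3, so the degree
    must be displayed as a successor; n \<ge> 2 allows this.\<close>
  have d': "2 * n - 2 = Suc (2 * n - 3)" using assms(4) by simp
  have t: "?t \<in> closed_forms A (2 * n - 2)" using theta_closed unfolding assms(3) .
  show ?thesis unfolding d(1)
  proof (intro conjI ballI impI)
    show "?t \<in> closed_forms A (2 * n - 2)" by (rule t)
    show "wedge_well_defined A (2 * n - 2) 1 ?t" by (rule wedge_well_defined_1[OF t])
    show "dR_linear A 1 (2 * n - 2 + 1) (dR_wedge A (2 * n - 2) 1 ?t)" by (rule dR_wedge_linear[OF t])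
    show "dR_wedge A (2 * n - 2) 1 ?t (dR_class A 1 u) = dR_class A (2 * n - 2 + 1) (wedge (2 * n - 2) 1 ?t u)"
      if "u \<in> closed_forms A 1" for u by (rule dR_wedge_class[OF t that])
    show "wedge_well_defined A (2 * n - 2) 1 \<theta>'" if "\<theta>' \<in> closed_forms A (2 * n - 2)" for \<theta>'
      by (rule wedge_well_defined_1[OF that])
    show "dR_wedge A (2 * n - 2) 1 \<theta>' a = dR_wedge A (2 * n - 2) 1 ?t a"
      if "\<theta>' \<in> closed_forms A (2 * n - 2)" "dR_class A (2 * n - 2) \<theta>' = dR_class A (2 * n - 2) ?t" "a \<in> dR A 1" for \<theta>' a
      using dR_wedge_cong[of ?t "2 * n - 3" \<theta>' a] t that unfolding d' by blast
  next
    assume H: "\<forall>v\<in>forms_1_1 A. ext_d 2 v = 0 \<longrightarrow> v \<in> im_del A 1 \<longrightarrow> v \<in> im_del_delbar A 0"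
    show "dR_isomorphism A 1 (2 * n - 2 + 1) (dR_wedge A (2 * n - 2) 1 ?t)"
      by (rule dR_wedge_isomorphism[OF t])
        (use theta_injective[OF H] theta_surjective[OF H] in \<open>simp_all only: assms(3) d(2)\<close>)
  qed
qed

end
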